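(* Let $n$ be a positive integer with $n+1<10$. Let $(M,g)$ be a locally spatially homogeneous expanding vacuum spacetime of dimension $n+1$ whose symmetry is defined by an $n$-dimensional Lie group $G$ which admits no left-invariant Riemannian metric of positive scalar curvature, the spacetime being defined for all sufficiently large values of the Gaussian time $t$. Let $p_1(t),\dots,p_n(t)$ be its generalized Kasner exponents. If for some $t_0$ $$\sup_{t\ge t_0}\min_a p_a(t)-\inf_{t\ge t_0}\min_a p_a(t)\le\frac{9-n}{4n},$$ then the spacetime is future geodesically complete.
   Context: Vacuum: the Ricci tensor of the Lorentzian metric vanishes. All objects are smooth. Setting. $G$ is a connected and simply connected Lie group of dimension $n$ and $\theta^1,\dots,\theta^n$ is a basis of the left-invariant one-forms on $G$. A locally spatially homogeneous spacetime with symmetry defined by $G$ is one whose universal cover is isometric to $[t_*,\infty)\times G$, for some $t_*\in\mathbb{R}$, with the metric $$-dt^2+\sum_{a,b=1}^n g_{ab}(t)\,\theta^a\otimes\theta^b ,$$ where $(g_{ab}(t))$ is a one-parameter family of symmetric positive definite matrices (so that each $g_{ab}(t)\theta^a\otimes\theta^b$ is a left-invariant Riemannian metric on $G$). The coordinate $t$ is called Gaussian time. In the theorem $t_0\ge t_*$. The second fundamental form $k_{ab}$ of the hypersurfaces of constant $t$ is defined by $\partial_t g_{ab}=-2k_{ab}$, and $\mathrm{tr}\,k=g^{ab}k_{ab}$. The spacetime is expanding if $\mathrm{tr}\,k<0$ for all $t\ge t_*$. Let $\lambda_1(t),\dots,\lambda_n(t)$ be the eigenvalues, with multiplicity, of $k_{ab}(t)$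 with respect to $g_{ab}(t)$, i.e. the real numbers $\lambda$ for which $k_{ab}v^b=\lambda g_{ab}v^b$ has a non-zero solution $v$. The generalized Kasner exponents are $p_a=\lambda_a/\mathrm{tr}\,k$. Future geodesically complete: every future-inextendible, future-directed timelike or null geodesic is defined for arbitrarily large values of its affine parameter. *)

theory Defs
  imports "HOL-Analysis.Analysis" "HOL-Algebra.Group"
begin

section \<open>Smooth maps between subsets of Euclidean spaces\<close>

text \<open>
  All derivatives are taken within the set on which a function is considered. The sets that occur
  are relatively open subsets of a Euclidean space, of a closed half-space, or of an interval,
  where such derivatives are unique; at boundary points they are the one-sided ones.
\<close>

definition dir_deriv ::
  "'e::real_normed_vector set \<Rightarrow> ('e \<Rightarrow> 'f::real_normed_vector) \<Rightarrow> 'e \<Rightarrow> 'e \<Rightarrow> 'f" where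
  "dir_deriv S f x v = frechet_derivative f (at x within S) v"

primrec Ck_on ::
  "nat \<Rightarrow> 'e::real_normed_vector set \<Rightarrow> ('e \<Rightarrow> 'f::real_normed_vector) \<Rightarrow> bool" where
  "Ck_on 0 S f \<longleftrightarrow> continuous_on S f"
| "Ck_on (Suc k) S f \<longleftrightarrow> f differentiable_on S \<and> (\<forall>v. Ck_on k S (\<lambda>x. dir_deriv S f x v))"

definition smooth_on ::
  "'e::real_normed_vector set \<Rightarrow> ('e \<Rightarrow> 'f::real_normed_vector) \<Rightarrow> bool" where
  "smooth_on S f \<longleftrightarrow> (\<forall>k. Ck_on k S f)"


section \<open>Smooth manifolds\<close>

text \<open>A chart is its domain together with the coordinate map; the latter is junk off the domain.\<close>

type_synonym ('m, 'e) chart = "'m set \<times> ('m \<Rightarrow> 'e)"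

definition coord_inv :: "('m, 'e) chart \<Rightarrow> 'e \<Rightarrow> 'm" where
  "coord_inv c = inv_into (fst c) (snd c)"

text \<open>The coordinate expression of a map, the set on which it is defined, and its differential,
  as a linear map between the coordinate spaces of the two charts.\<close>

definition coord_map ::
  "('m, 'e) chart \<Rightarrow> ('k, 'f) chart \<Rightarrow> ('m \<Rightarrow> 'k) \<Rightarrow> 'e \<Rightarrow> 'f" where
  "coord_map c d f = snd d \<circ> f \<circ> coord_inv c"

definition coord_dom :: "('m, 'e) chart \<Rightarrow> ('k, 'f) chart \<Rightarrow> ('m \<Rightarrow> 'k) \<Rightarrow> 'e set" where
  "coord_dom c d f = snd c ` (fst c \<inter> f -` fst d)"

definition tangent_map ::
  "('m, 'e::real_normed_vector) chart \<Rightarrow> ('k, 'f::real_normed_vector) chart \<Rightarrow> ('m \<Rightarrow> 'k)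
     \<Rightarrow> 'm \<Rightarrow> 'e \<Rightarrow> 'f" where
  "tangent_map c d f p = dir_deriv (coord_dom c d f) (coord_map c d f) (snd c p)"

text \<open>Manifolds (with boundary) modelled on relatively open subsets of \<open>H\<close>: for \<open>H = UNIV\<close> these are
  the manifolds without boundary, for a closed half-space \<open>H\<close> those with (possibly empty) boundary.\<close>

definition smooth_manifold ::
  "'e::euclidean_space set \<Rightarrow> 'm::topological_space set \<Rightarrow> ('m, 'e) chart set \<Rightarrow> bool" where
  "smooth_manifold H M A \<longleftrightarrow>
     Hausdorff_space (top_of_set M) \<and> second_countable (top_of_set M) \<and>
     (\<Union>c\<in>A. fst c) = M \<and>
     (\<forall>c\<in>A. openin (top_of_set M) (fst c) \<and> openin (top_of_set H) (snd c ` fst c) \<and>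
        homeomorphism (fst c) (snd c ` fst c) (snd c) (coord_inv c)) \<and>
     (\<forall>c\<in>A. \<forall>d\<in>A. smooth_on (coord_dom c d id) (coord_map c d id))"

definition smooth_map ::
  "'m::topological_space set \<Rightarrow> ('m, 'e::euclidean_space) chart set \<Rightarrow>
   'k::topological_space set \<Rightarrow> ('k, 'f::euclidean_space) chart set \<Rightarrow> ('m \<Rightarrow> 'k) \<Rightarrow> bool" where
  "smooth_map M A N B f \<longleftrightarrow>
     continuous_on M f \<and> f ` M \<subseteq> N \<and>
     (\<forall>c\<in>A. \<forall>d\<in>B. smooth_on (coord_dom c d f) (coord_map c d f))"

definition prod_chart :: "('m, 'e) chart \<Rightarrow> ('k, 'f) chart \<Rightarrow> ('m \<times> 'k, 'e \<times> 'f) chart" where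
  "prod_chart c d = (fst c \<times> fst d, map_prod (snd c) (snd d))"

definition prod_atlas ::
  "('m, 'e) chart set \<Rightarrow> ('k, 'f) chart set \<Rightarrow> ('m \<times> 'k, 'e \<times> 'f) chart set" where
  "prod_atlas A B = {prod_chart c d | c d. c \<in> A \<and> d \<in> B}"


section \<open>Covariant tensor fields\<close>

text \<open>
  A field of covariant tensors is given by its components: it assigns to a chart and a point of its
  domain a multilinear form on the coordinate space, and these forms obey the tensorial
  transformation law. Values outside the atlas or outside the domain of the chart are irrelevant.
\<close>

type_synonym ('m, 'e) one_form = "('m, 'e) chart \<Rightarrow> 'm \<Rightarrow> 'e \<Rightarrow> real"
type_synonym ('m, 'e) bilinear_field = "('m, 'e) chart \<Rightarrow> 'm \<Rightarrow> 'e \<Rightarrow> 'e \<Rightarrow> real"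

definition smooth_one_form ::
  "('m, 'e::euclidean_space) chart set \<Rightarrow> ('m, 'e) one_form \<Rightarrow> bool" where
  "smooth_one_form A \<omega> \<longleftrightarrow>
     (\<forall>c\<in>A. (\<forall>p\<in>fst c. linear (\<omega> c p)) \<and>
        (\<forall>u. smooth_on (snd c ` fst c) (\<lambda>x. \<omega> c (coord_inv c x) u))) \<and>
     (\<forall>c\<in>A. \<forall>d\<in>A. \<forall>p\<in>fst c \<inter> fst d. \<forall>u. \<omega> c p u = \<omega> d p (tangent_map c d id p u))"

definition smooth_bilinear_field ::
  "('m, 'e::euclidean_space) chart set \<Rightarrow> ('m, 'e) bilinear_field \<Rightarrow> bool" where
  "smooth_bilinear_field A g \<longleftrightarrow>
     (\<forall>c\<in>A. (\<forall>p\<in>fst c. bilinear (g c p)) \<and>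
        (\<forall>u v. smooth_on (snd c ` fst c) (\<lambda>x. g c (coord_inv c x) u v))) \<and>
     (\<forall>c\<in>A. \<forall>d\<in>A. \<forall>p\<in>fst c \<inter> fst d. \<forall>u v.
        g c p u v = g d p (tangent_map c d id p u) (tangent_map c d id p v))"

definition riemannian_metric ::
  "('m, 'e::euclidean_space) chart set \<Rightarrow> ('m, 'e) bilinear_field \<Rightarrow> bool" where
  "riemannian_metric A g \<longleftrightarrow> smooth_bilinear_field A g \<and>
     (\<forall>c\<in>A. \<forall>p\<in>fst c. (\<forall>u v. g c p u v = g c p v u) \<and> (\<forall>u. u \<noteq> 0 \<longrightarrow> g c p u u > 0))"

text \<open>Signature \<open>(-, +, \<dots>, +)\<close>.\<close>

definition lorentzian_metric ::
  "('m, 'e::euclidean_space) chart set \<Rightarrow> ('m, 'e) bilinear_field \<Rightarrow> bool" where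
  "lorentzian_metric A g \<longleftrightarrow> smooth_bilinear_field A g \<and>
     (\<forall>c\<in>A. \<forall>p\<in>fst c. (\<forall>u v. g c p u v = g c p v u) \<and>
        (\<exists>T. g c p T T < 0 \<and> (\<forall>u. u \<noteq> 0 \<and> g c p T u = 0 \<longrightarrow> g c p u u > 0)))"


section \<open>Curvature in coordinates\<close>

text \<open>
  Here \<open>g x\<close> is the coordinate expression of a (nondegenerate, symmetric) metric at \<open>x \<in> S\<close>, and
  \<open>sharp\<close> raises an index. With \<open>u = e\<^sub>i\<close>, \<open>v = e\<^sub>j\<close> basis vectors, \<open>christoffel S g x u v\<close> is the
  vector with components
  \<open>\<Gamma>\<^sup>k\<^sub>i\<^sub>j = 1/2 \<Sum>\<^sub>l g\<^sup>k\<^sup>l (\<partial>\<^sub>i g\<^sub>j\<^sub>l + \<partial>\<^sub>j g\<^sub>i\<^sub>l - \<partial>\<^sub>l g\<^sub>i\<^sub>j)\<close>.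
  The curvature operator is \<open>R(u,v)w = \<nabla>\<^sub>u\<nabla>\<^sub>v w - \<nabla>\<^sub>v\<nabla>\<^sub>u w\<close> for constant \<open>u, v, w\<close>, and
  \<open>Ric(v,w) = tr (u \<mapsto> R(u,v)w)\<close>; round spheres have positive scalar curvature.
\<close>

definition sharp :: "('e::euclidean_space \<Rightarrow> 'e \<Rightarrow> real) \<Rightarrow> ('e \<Rightarrow> real) \<Rightarrow> 'e" where
  "sharp b \<alpha> = (THE z. \<forall>w. b z w = \<alpha> w)"

definition christoffel ::
  "'e::euclidean_space set \<Rightarrow> ('e \<Rightarrow> 'e \<Rightarrow> 'e \<Rightarrow> real) \<Rightarrow> 'e \<Rightarrow> 'e \<Rightarrow> 'e \<Rightarrow> 'e" where
  "christoffel S g x u v = sharp (g x) (\<lambda>w.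
     (dir_deriv S (\<lambda>y. g y v w) x u + dir_deriv S (\<lambda>y. g y u w) x v
        - dir_deriv S (\<lambda>y. g y u v) x w) / 2)"

definition curvature_op ::
  "'e::euclidean_space set \<Rightarrow> ('e \<Rightarrow> 'e \<Rightarrow> 'e \<Rightarrow> real) \<Rightarrow> 'e \<Rightarrow> 'e \<Rightarrow> 'e \<Rightarrow> 'e \<Rightarrow> 'e" where
  "curvature_op S g x u v w =
     dir_deriv S (\<lambda>y. christoffel S g y v w) x u - dir_deriv S (\<lambda>y. christoffel S g y u w) x v
     + christoffel S g x u (christoffel S g x v w) - christoffel S g x v (christoffel S g x u w)"

definition ricci ::
  "'e::euclidean_space set \<Rightarrow> ('e \<Rightarrow> 'e \<Rightarrow> 'e \<Rightarrow> real) \<Rightarrow> 'e \<Rightarrow> 'e \<Rightarrow> 'e \<Rightarrow> real" where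
  "ricci S g x v w = (\<Sum>b\<in>Basis. curvature_op S g x b v w \<bullet> b)"

definition scalar_curvature ::
  "'e::euclidean_space set \<Rightarrow> ('e \<Rightarrow> 'e \<Rightarrow> 'e \<Rightarrow> real) \<Rightarrow> 'e \<Rightarrow> real" where
  "scalar_curvature S g x = (\<Sum>b\<in>Basis. sharp (g x) (ricci S g x b) \<bullet> b)"

text \<open>The metric as a function of the coordinates, as required by the definitions above.\<close>

definition in_coords ::
  "('m, 'e) chart \<Rightarrow> ('m, 'e) bilinear_field \<Rightarrow> 'e \<Rightarrow> 'e \<Rightarrow> 'e \<Rightarrow> real" where
  "in_coords c g x = g c (coord_inv c x)"

definition ricci_flat ::
  "('m, 'e::euclidean_space) chart set \<Rightarrow> ('m, 'e) bilinear_field \<Rightarrow> bool" where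
  "ricci_flat A g \<longleftrightarrow>
     (\<forall>c\<in>A. \<forall>p\<in>fst c. \<forall>u v. ricci (snd c ` fst c) (in_coords c g) (snd c p) u v = 0)"

definition positive_scalar_curvature ::
  "('m, 'e::euclidean_space) chart set \<Rightarrow> ('m, 'e) bilinear_field \<Rightarrow> bool" where
  "positive_scalar_curvature A g \<longleftrightarrow>
     (\<forall>c\<in>A. \<forall>p\<in>fst c. scalar_curvature (snd c ` fst c) (in_coords c g) (snd c p) > 0)"


section \<open>Geodesics\<close>

definition velocity ::
  "('m, 'e::real_normed_vector) chart \<Rightarrow> (real \<Rightarrow> 'm) \<Rightarrow> real set \<Rightarrow> real \<Rightarrow> 'e" where
  "velocity c \<gamma> J s = vector_derivative (snd c \<circ> \<gamma>) (at s within J \<inter> \<gamma> -` fst c)"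

definition geodesic_on ::
  "'m::topological_space set \<Rightarrow> ('m, 'e::euclidean_space) chart set \<Rightarrow> ('m, 'e) bilinear_field
     \<Rightarrow> real set \<Rightarrow> (real \<Rightarrow> 'm) \<Rightarrow> bool" where
  "geodesic_on M A g J \<gamma> \<longleftrightarrow>
     is_interval J \<and> interior J \<noteq> {} \<and> continuous_on J \<gamma> \<and> \<gamma> ` J \<subseteq> M \<and>
     (\<forall>c\<in>A. \<forall>s\<in>J \<inter> \<gamma> -` fst c.
        (snd c \<circ> \<gamma> has_vector_derivative velocity c \<gamma> J s) (at s within J \<inter> \<gamma> -` fst c) \<and>
        (velocity c \<gamma> J has_vector_derivative
           - christoffel (snd c ` fst c) (in_coords c g) (snd c (\<gamma> s))
               (velocity c \<gamma> J s) (velocity c \<gamma> J s)) (at s within J \<inter> \<gamma> -` fst c))"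

definition future_inextendible_geodesic ::
  "'m::topological_space set \<Rightarrow> ('m, 'e::euclidean_space) chart set \<Rightarrow> ('m, 'e) bilinear_field
     \<Rightarrow> real set \<Rightarrow> (real \<Rightarrow> 'm) \<Rightarrow> bool" where
  "future_inextendible_geodesic M A g J \<gamma> \<longleftrightarrow> geodesic_on M A g J \<gamma> \<and>
     \<not> (\<exists>J' \<gamma>'. geodesic_on M A g J' \<gamma>' \<and> J \<subseteq> J' \<and> (\<forall>s\<in>J. \<gamma>' s = \<gamma> s) \<and>
           (\<exists>s'\<in>J'. \<forall>s\<in>J. s < s'))"

text \<open>\<open>fut c p w\<close> says that the tangent vector at \<open>p\<close> with components \<open>w\<close> in the chart \<open>c\<close> is
  future-directed.\<close>

definition future_geodesically_complete ::
  "'m::topological_space set \<Rightarrow> ('m, 'e::euclidean_space) chart set \<Rightarrow> ('m, 'e) bilinear_field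
     \<Rightarrow> (('m, 'e) chart \<Rightarrow> 'm \<Rightarrow> 'e \<Rightarrow> bool) \<Rightarrow> bool" where
  "future_geodesically_complete M A g fut \<longleftrightarrow>
     (\<forall>J \<gamma>. future_inextendible_geodesic M A g J \<gamma> \<and>
        (\<forall>c\<in>A. \<forall>s\<in>J \<inter> \<gamma> -` fst c.
           velocity c \<gamma> J s \<noteq> 0 \<and> g c (\<gamma> s) (velocity c \<gamma> J s) (velocity c \<gamma> J s) \<le> 0 \<and>
           fut c (\<gamma> s) (velocity c \<gamma> J s))
        \<longrightarrow> (\<forall>r. \<exists>s\<in>J. r < s))"


section \<open>Lie groups and left-invariant tensors\<close>

definition lie_group ::
  "('g::topological_space, 'r) monoid_scheme \<Rightarrow> ('g, 'e::euclidean_space) chart set \<Rightarrow> bool" where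
  "lie_group G A \<longleftrightarrow>
     group G \<and> smooth_manifold UNIV (carrier G) A \<and>
     smooth_map (carrier G \<times> carrier G) (prod_atlas A A) (carrier G) A (\<lambda>(x, y). x \<otimes>\<^bsub>G\<^esub> y) \<and>
     smooth_map (carrier G) A (carrier G) A (\<lambda>x. inv\<^bsub>G\<^esub> x)"

definition left_invariant_one_form ::
  "('g::topological_space, 'r) monoid_scheme \<Rightarrow> ('g, 'e::euclidean_space) chart set
     \<Rightarrow> ('g, 'e) one_form \<Rightarrow> bool" where
  "left_invariant_one_form G A \<omega> \<longleftrightarrow> smooth_one_form A \<omega> \<and>
     (\<forall>h\<in>carrier G. \<forall>c\<in>A. \<forall>d\<in>A. \<forall>p\<in>fst c. h \<otimes>\<^bsub>G\<^esub> p \<in> fst d \<longrightarrow>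
        (\<forall>u. \<omega> c p u = \<omega> d (h \<otimes>\<^bsub>G\<^esub> p) (tangent_map c d (\<lambda>x. h \<otimes>\<^bsub>G\<^esub> x) p u)))"

definition left_invariant_metric ::
  "('g::topological_space, 'r) monoid_scheme \<Rightarrow> ('g, 'e::euclidean_space) chart set
     \<Rightarrow> ('g, 'e) bilinear_field \<Rightarrow> bool" where
  "left_invariant_metric G A b \<longleftrightarrow> riemannian_metric A b \<and>
     (\<forall>h\<in>carrier G. \<forall>c\<in>A. \<forall>d\<in>A. \<forall>p\<in>fst c. h \<otimes>\<^bsub>G\<^esub> p \<in> fst d \<longrightarrow>
        (\<forall>u v. b c p u v = b d (h \<otimes>\<^bsub>G\<^esub> p) (tangent_map c d (\<lambda>x. h \<otimes>\<^bsub>G\<^esub> x) p u)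
                             (tangent_map c d (\<lambda>x. h \<otimes>\<^bsub>G\<^esub> x) p v)))"

text \<open>A basis of the vector space of left-invariant one-forms. One-forms are compared on the domains
  of the charts of \<open>A\<close> only.\<close>

definition left_invariant_one_form_basis ::
  "('g::topological_space, 'r) monoid_scheme \<Rightarrow> ('g, 'e::euclidean_space) chart set
     \<Rightarrow> ('n::finite \<Rightarrow> ('g, 'e) one_form) \<Rightarrow> bool" where
  "left_invariant_one_form_basis G A \<theta> \<longleftrightarrow>
     (\<forall>a. left_invariant_one_form G A (\<theta> a)) \<and>
     (\<forall>\<omega>. left_invariant_one_form G A \<omega> \<longrightarrow>
        (\<exists>!x::real^'n. \<forall>c\<in>A. \<forall>p\<in>fst c. \<forall>u. \<omega> c p u = (\<Sum>a\<in>UNIV. x $ a * \<theta> a c p u)))"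


section \<open>Locally spatially homogeneous spacetimes\<close>

text \<open>The charts of \<open>[T,\<infinity>) \<times> G\<close>; their images are relatively open in \<open>[T,\<infinity>) \<times> \<real>\<^sup>n\<close>.\<close>

definition time_atlas ::
  "real \<Rightarrow> ('g, 'e) chart set \<Rightarrow> (real \<times> 'g, real \<times> 'e) chart set" where
  "time_atlas T A = prod_atlas {({T..}, id)} A"

text \<open>
  \<open>(M, B, g)\<close> is a Lorentzian manifold and \<open>\<pi>\<close> exhibits \<open>[T,\<infinity>) \<times> G\<close> with the metric
  \<open>-dt\<^sup>2 + \<Sum>\<^sub>a\<^sub>b g\<^sub>a\<^sub>b(t) \<theta>\<^sup>a \<otimes> \<theta>\<^sup>b\<close> as its universal Riemannian covering: the total space is simply
  connected, and the last conjunct says that this metric is the pull-back of \<open>g\<close> by \<open>\<pi>\<close>.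
  \<open>M\<close> is a manifold with boundary; charts of its interior can be translated into the half-space.
\<close>

definition locally_spatially_homogeneous ::
  "('g::topological_space, 'r) monoid_scheme \<Rightarrow> ('g, real^'n::finite) chart set
     \<Rightarrow> ('n \<Rightarrow> ('g, real^'n) one_form) \<Rightarrow> real \<Rightarrow> (real \<Rightarrow> real^'n^'n)
     \<Rightarrow> 'm::topological_space set \<Rightarrow> ('m, real \<times> (real^'n)) chart set
     \<Rightarrow> ('m, real \<times> (real^'n)) bilinear_field \<Rightarrow> (real \<times> 'g \<Rightarrow> 'm) \<Rightarrow> bool" where
  "locally_spatially_homogeneous G A \<theta> T gm M B g \<pi> \<longleftrightarrow>
     lie_group G A \<and> connected (carrier G) \<and> simply_connected (carrier G) \<and>
     left_invariant_one_form_basis G A \<theta> \<and>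
     smooth_on {T..} gm \<and>
     (\<forall>t\<ge>T. transpose (gm t) = gm t \<and> (\<forall>v. v \<noteq> 0 \<longrightarrow> v \<bullet> (gm t *v v) > 0)) \<and>
     smooth_manifold ({T..} \<times> UNIV) M B \<and> lorentzian_metric B g \<and>
     covering_space ({T..} \<times> carrier G) \<pi> M \<and>
     smooth_map ({T..} \<times> carrier G) (time_atlas T A) M B \<pi> \<and>
     (\<forall>c\<in>A. \<forall>d\<in>B. \<forall>t\<ge>T. \<forall>x\<in>fst c. \<pi> (t, x) \<in> fst d \<longrightarrow>
        (\<forall>r u s v.
           g d (\<pi> (t, x)) (tangent_map (prod_chart ({T..}, id) c) d \<pi> (t, x) (r, u))
                          (tangent_map (prod_chart ({T..}, id) c) d \<pi> (t, x) (s, v))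
           = - r * s + (\<Sum>a\<in>UNIV. \<Sum>b\<in>UNIV. gm t $ a $ b * \<theta> a c x u * \<theta> b c x v)))"

text \<open>The time orientation of \<open>M\<close> is the one for which \<open>\<pi>\<^sub>*\<partial>\<^sub>t\<close> is future-directed; a causal vector is
  future-directed if its product with \<open>\<pi>\<^sub>*\<partial>\<^sub>t\<close> is negative. Deck transformations preserve the
  boundary \<open>t = T\<close>, hence \<open>\<partial>\<^sub>t\<close>, so the choice of the preimage of \<open>q\<close> does not matter.\<close>

definition future_directed ::
  "real \<Rightarrow> ('g, real^'n::finite) chart set \<Rightarrow> ('m, real \<times> (real^'n)) bilinear_field
     \<Rightarrow> (real \<times> 'g \<Rightarrow> 'm) \<Rightarrow> ('m, real \<times> (real^'n)) chart \<Rightarrow> 'm \<Rightarrow> real \<times> (real^'n) \<Rightarrow> bool" where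
  "future_directed T A g \<pi> d q w \<longleftrightarrow>
     (\<exists>c\<in>time_atlas T A. \<exists>z\<in>fst c. \<pi> z = q \<and> g d q w (tangent_map c d \<pi> z (1, 0)) < 0)"

definition second_fundamental_form ::
  "real \<Rightarrow> (real \<Rightarrow> real^'n^'n) \<Rightarrow> real \<Rightarrow> real^'n^'n::finite" where
  "second_fundamental_form T gm t = - (1/2) *\<^sub>R vector_derivative gm (at t within {T..})"

definition mean_curvature :: "real \<Rightarrow> (real \<Rightarrow> real^'n^'n::finite) \<Rightarrow> real \<Rightarrow> real" where
  "mean_curvature T gm t = trace (matrix_inv (gm t) ** second_fundamental_form T gm t)"

definition expanding :: "real \<Rightarrow> (real \<Rightarrow> real^'n^'n::finite) \<Rightarrow> bool" where
  "expanding T gm \<longleftrightarrow> (\<forall>t\<ge>T. mean_curvature T gm t < 0)"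

definition relative_eigenvalues :: "real^'n^'n::finite \<Rightarrow> real^'n^'n \<Rightarrow> real set" where
  "relative_eigenvalues k b = {l. \<exists>v. v \<noteq> 0 \<and> k *v v = l *\<^sub>R (b *v v)}"

text \<open>The set of the generalized Kasner exponents; multiplicities do not affect their minimum.\<close>

definition kasner_exponents :: "real \<Rightarrow> (real \<Rightarrow> real^'n^'n::finite) \<Rightarrow> real \<Rightarrow> real set" where
  "kasner_exponents T gm t =
     (\<lambda>l. l / mean_curvature T gm t) ` relative_eigenvalues (second_fundamental_form T gm t) (gm t)"

end

theory Submission
  imports Defs
begin

text \<open>
  Let \<open>H = - tr k > 0\<close> and let \<open>S\<close> be the trace of the square of \<open>k\<close> with one index raised. The vacuum
  equations give \<open>H' = - S\<close>, and \<open>S - H\<^sup>2\<close> is the scalar curvature of the slices; as this cannot be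
  positive, \<open>(1/H)' = S/H\<^sup>2 \<le> 1\<close> and \<open>1/H\<close> grows at most linearly in \<open>t\<close>.

  A causal geodesic is lifted to a curve \<open>(t, x)\<close> in the covering space. Its energy \<open>E = dt/ds\<close> obeys
  \<open>dE/ds = k(u,u)\<close>, where \<open>u\<close> is the spatial velocity and \<open>|u| \<le> E\<close>. In dimension \<open>n \<le> 9\<close> every
  self-adjoint \<open>k\<close> satisfies \<open>H k(u,u) \<le> S |u|\<^sup>2\<close>, hence \<open>E H\<close> does not increase along the geodesic and
  \<open>dt/ds \<le> C (1 + t)\<close>. So \<open>t\<close> and the components of the velocity in the left-invariant frame stay
  bounded on bounded parameter intervals; by left invariance \<open>x\<close> then converges in \<open>G\<close>, and the geodesic
  can be continued.
\<close>

section \<open>Smooth maps\<close>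

text \<open>The product \<open>E H\<close> is dictated by the evolution equations: along the
  geodesic dH/ds = - S E, while the inequality for k gives H dE/ds <= S E^2, so the two terms of (E
  H)' cancel. The dimension bound enters only through that inequality.

  The calculus is shaped by the boundary of \<open>M\<close>. The geodesic is given in charts of
  \<open>M\<close>, where derivatives may be one-sided, while the curvature is computable only in
  the product coordinates of the covering space. The two are related by the coordinate expression of
  \<open>\<pi>\<close>, of which no local inverse is ever formed: its differential is injective
  because it preserves a nondegenerate metric, and whatever has to be carried back (lifted velocity,
  second derivative of the lift) is found as the solution of a linear system whose matrix is this
  differential. Curvature and second derivatives are considered only for \<open>t > T\<close>, where
  all derivatives are two-sided.

  Convergence in \<open>G\<close> expresses the completeness of left-invariant metrics. It comes
  from homogeneity: every point has a translated copy of one compact coordinate ball, so a curve of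
  bounded speed needs at least a fixed time to escape.\<close>

lemma dir_deriv_works:
  "f differentiable (at x within S) \<Longrightarrow> (f has_derivative dir_deriv S f x) (at x within S)"
  by (drule frechet_derivative_works[THEN iffD1]) (simp add: dir_deriv_def[abs_def])

lemma dir_deriv_interior: "x \<in> interior S \<Longrightarrow> dir_deriv S f x = dir_deriv UNIV f x"
  by (rule ext) (simp only: dir_deriv_def at_within_interior)

lemma dir_deriv_open: "open U \<Longrightarrow> x \<in> U \<Longrightarrow> dir_deriv U f x = dir_deriv UNIV f x"
  by (rule dir_deriv_interior) (simp add: interior_open)

lemma dir_deriv_eqI: "(f has_derivative f') (at x) \<Longrightarrow> dir_deriv UNIV f x = f'"
  by (drule frechet_derivative_at) (simp add: dir_deriv_def[abs_def])

lemma dir_deriv_open_eqI: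
  "open U \<Longrightarrow> x \<in> U \<Longrightarrow> (f has_derivative f') (at x) \<Longrightarrow> dir_deriv U f x = f'"
  by (subst dir_deriv_open) (assumption | rule dir_deriv_eqI)+

text \<open>\<open>frechet_derivative\<close> is a choice, so the two predicates of candidate
  derivatives are shown to be equal. The result therefore also holds where no derivative exists or
  where it is not unique.\<close>

lemma dir_deriv_cong:
  assumes "x \<in> S" "\<And>y. y \<in> S \<Longrightarrow> f y = g y"
  shows "dir_deriv S f x = dir_deriv S g x"
proof -
  have "(f has_derivative D) (at x within S) \<longleftrightarrow> (g has_derivative D) (at x within S)" for D
    using has_derivative_transform[of x S f g D] has_derivative_transform[of x S g f D] assms by metis
  then have "(\<lambda>D. (f has_derivative D) (at x within S)) = (\<lambda>D. (g has_derivative D) (at x within S))"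
    by blast
  then show ?thesis
    by (intro ext) (simp only: dir_deriv_def frechet_derivative_def)
qed

lemma dir_deriv_UNIV_cong:
  assumes "open U" "x \<in> U" "\<And>y. y \<in> U \<Longrightarrow> f y = g y"
  shows "dir_deriv UNIV f x = dir_deriv UNIV g x"
  using dir_deriv_cong[of x U f g] assms by (simp add: dir_deriv_open[OF assms(1,2)])

lemma Ck_on_cong:
  assumes "\<And>x. x \<in> S \<Longrightarrow> f x = g x"
  shows "Ck_on k S f \<longleftrightarrow> Ck_on k S g"
  using assms
proof (induction k arbitrary: f g)
  case 0
  then show ?case by (simp cong: continuous_on_cong)
next
  case (Suc k)
  have d: "f differentiable_on S \<longleftrightarrow> g differentiable_on S"
    using Suc.prems unfolding differentiable_on_def differentiable_def by (metis has_derivative_transform)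
  have "Ck_on k S (\<lambda>x. dir_deriv S f x v) \<longleftrightarrow> Ck_on k S (\<lambda>x. dir_deriv S g x v)" for v
    by (rule Suc.IH) (metis Suc.prems dir_deriv_cong)
  with d show ?case by simp
qed

text \<open>On an open set the chosen derivative is the unique one, so any explicit family
  \<open>f'\<close> may stand for it. The closure properties below thus reduce to the ordinary
  differentiation rules.\<close>

lemma Ck_on_SucI:
  assumes "open U" "\<And>x. x \<in> U \<Longrightarrow> (f has_derivative f' x) (at x)" "\<And>v. Ck_on k U (\<lambda>x. f' x v)"
  shows "Ck_on (Suc k) U f"
proof -
  have "f differentiable_on U"
    using assms by (meson differentiable_on_def differentiable_at_withinI differentiable_def)
  moreover have "Ck_on k U (\<lambda>x. dir_deriv U f x v)" for v
    using assms(3)[of v] Ck_on_cong[of U "\<lambda>x. dir_deriv U f x v" "\<lambda>x. f' x v"]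
      dir_deriv_open_eqI[OF assms(1) _ assms(2)] by fastforce
  ultimately show ?thesis by simp
qed

lemma Ck_on_SucD:
  assumes "Ck_on (Suc k) U f" "open U"
  shows "\<And>x. x \<in> U \<Longrightarrow> (f has_derivative dir_deriv U f x) (at x)"
    and "\<And>v. Ck_on k U (\<lambda>x. dir_deriv U f x v)"
proof -
  show "(f has_derivative dir_deriv U f x) (at x)" if "x \<in> U" for x
    using dir_deriv_works[of f x U] assms that at_within_open[OF that assms(2)]
    by (auto simp: differentiable_on_def)
  show "Ck_on k U (\<lambda>x. dir_deriv U f x v)" for v
    using assms by simp
qed

lemma Ck_on_mono: "Ck_on (Suc k) S f \<Longrightarrow> Ck_on k S f"
proof (induction k arbitrary: f)
  case 0
  then show ?case by (simp add: differentiable_imp_continuous_on)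
next
  case (Suc k)
  then show ?case by (metis Ck_on.simps(2))
qed

text \<open>\<open>S\<close> may have boundary points. Openness of \<open>U\<close> makes every
  point of \<open>U\<close> interior to \<open>S\<close>, where the derivatives within
  \<open>U\<close> and within \<open>S\<close> agree; this brings statements about charts with
  boundary to open sets.\<close>

lemma Ck_on_open_subset: "Ck_on k S f \<Longrightarrow> open U \<Longrightarrow> U \<subseteq> S \<Longrightarrow> Ck_on k U f"
proof (induction k arbitrary: f)
  case 0
  then show ?case by (simp add: continuous_on_subset)
next
  case (Suc k)
  have "dir_deriv U f x v = dir_deriv S f x v" if "x \<in> U" for x v
    using that Suc.prems by (metis dir_deriv_interior dir_deriv_open interior_maximal subsetD)
  moreover have "Ck_on k U (\<lambda>x. dir_deriv S f x v)" for v
    using Suc by simp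
  ultimately have "Ck_on k U (\<lambda>x. dir_deriv U f x v)" for v
    using Ck_on_cong[of U "\<lambda>x. dir_deriv U f x v" "\<lambda>x. dir_deriv S f x v" k] by blast
  with Suc.prems show ?case by (auto intro: differentiable_on_subset)
qed

declare Ck_on.simps(2) [simp del]

section \<open>Closure properties of smooth functions on open sets\<close>

lemma Ck_on_const: "open U \<Longrightarrow> Ck_on k U (\<lambda>x. c)"
proof (induction k arbitrary: c)
  case (Suc k)
  show ?case
    by (rule Ck_on_SucI[where f' = "\<lambda>x v. 0"]) (use Suc in auto)
qed simp

lemma Ck_on_add:
  "open U \<Longrightarrow> Ck_on k U f \<Longrightarrow> Ck_on k U g \<Longrightarrow> Ck_on k U (\<lambda>x. f x + g x)"
proof (induction k arbitrary: f g)
  case 0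
  then show ?case by (simp add: continuous_on_add)
next
  case (Suc k)
  show ?case
    by (rule Ck_on_SucI[where f' = "\<lambda>x v. dir_deriv U f x v + dir_deriv U g x v"])
      (auto intro!: has_derivative_add Suc.IH Suc.prems Ck_on_SucD)
qed

lemma Ck_on_bilinear:
  assumes "bounded_bilinear B" and U: "open U"
  shows "Ck_on k U f \<Longrightarrow> Ck_on k U g \<Longrightarrow> Ck_on k U (\<lambda>x. B (f x) (g x))"
proof (induction k arbitrary: f g)
  case 0
  then show ?case using bounded_bilinear.continuous_on[OF assms(1)] by simp
next
  case (Suc k)
  show ?case
  proof (rule Ck_on_SucI[OF U, where f' = "\<lambda>x v. B (f x) (dir_deriv U g x v) + B (dir_deriv U f x v) (g x)"])
    fix x assume "x \<in> U"
    then show "((\<lambda>x. B (f x) (g x)) has_derivative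
        (\<lambda>v. B (f x) (dir_deriv U g x v) + B (dir_deriv U f x v) (g x))) (at x)"
      by (intro bounded_bilinear.FDERIV[OF assms(1)] Ck_on_SucD(1)[OF Suc.prems(1) U] Ck_on_SucD(1)[OF Suc.prems(2) U])
  next
    fix v
    show "Ck_on k U (\<lambda>x. B (f x) (dir_deriv U g x v) + B (dir_deriv U f x v) (g x))"
      by (intro Ck_on_add[OF U] Suc.IH Ck_on_SucD(2)[OF Suc.prems(1) U] Ck_on_SucD(2)[OF Suc.prems(2) U]
          Ck_on_mono[OF Suc.prems(1)] Ck_on_mono[OF Suc.prems(2)])
  qed
qed

lemma Ck_on_linear:
  assumes "bounded_linear L" and U: "open U"
  shows "Ck_on k U f \<Longrightarrow> Ck_on k U (\<lambda>x. L (f x))"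
proof (induction k arbitrary: f)
  case 0
  then show ?case using bounded_linear.continuous_on[OF assms(1)] by simp
next
  case (Suc k)
  show ?case
    by (rule Ck_on_SucI[OF U, where f' = "\<lambda>x v. L (dir_deriv U f x v)"])
      (intro bounded_linear.has_derivative[OF assms(1)] Ck_on_SucD[OF Suc.prems U] Suc.IH; assumption)+
qed

text \<open>The derivative of the composite in direction \<open>v\<close> is the derivative of
  \<open>f\<close> in the fixed direction \<open>L v\<close>, composed with the same affine map, so
  the induction closes without a product rule. Projections to a factor and inclusions of slices have
  this form.\<close>

lemma Ck_on_compose_affine:
  assumes L: "bounded_linear L" and U: "open U" and V: "open V" and im: "\<And>x. x \<in> V \<Longrightarrow> a + L x \<in> U"
  shows "Ck_on k U f \<Longrightarrow> Ck_on k V (\<lambda>x. f (a + L x))"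
proof (induction k arbitrary: f)
  case 0
  have "continuous_on V (\<lambda>x. a + L x)"
    by (intro continuous_intros linear_continuous_on L)
  with 0 show ?case
    using im by (auto intro!: continuous_on_compose2[of U f])
next
  case (Suc k)
  show ?case
  proof (rule Ck_on_SucI[OF V, where f' = "\<lambda>x v. dir_deriv U f (a + L x) (L v)"])
    fix x assume x: "x \<in> V"
    have "((\<lambda>x. a + L x) has_derivative L) (at x)"
      using bounded_linear_imp_has_derivative[OF L] by (auto intro!: derivative_eq_intros)
    then show "((\<lambda>x. f (a + L x)) has_derivative (\<lambda>v. dir_deriv U f (a + L x) (L v))) (at x)"
      using Ck_on_SucD(1)[OF Suc.prems U im[OF x]] by (rule has_derivative_compose)
  next
    fix v
    show "Ck_on k V (\<lambda>x. dir_deriv U f (a + L x) (L v))"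
      using Suc.IH Ck_on_SucD(2)[OF Suc.prems U] by blast
  qed
qed

lemma smooth_on_cong: "(\<And>x. x \<in> S \<Longrightarrow> f x = g x) \<Longrightarrow> smooth_on S f \<longleftrightarrow> smooth_on S g"
  unfolding smooth_on_def using Ck_on_cong by blast

lemma smooth_on_open_subset: "smooth_on S f \<Longrightarrow> open U \<Longrightarrow> U \<subseteq> S \<Longrightarrow> smooth_on U f"
  unfolding smooth_on_def using Ck_on_open_subset by blast

lemma smooth_on_imp_continuous_on: "smooth_on S f \<Longrightarrow> continuous_on S f"
  unfolding smooth_on_def by (metis Ck_on.simps(1))

lemma smooth_on_has_derivative:
  "smooth_on U f \<Longrightarrow> open U \<Longrightarrow> x \<in> U \<Longrightarrow> (f has_derivative dir_deriv UNIV f x) (at x)"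
  unfolding smooth_on_def using Ck_on_SucD(1) dir_deriv_open by metis

lemma smooth_on_has_derivative_within:
  "smooth_on S f \<Longrightarrow> x \<in> S \<Longrightarrow> (f has_derivative dir_deriv S f x) (at x within S)"
  unfolding smooth_on_def using dir_deriv_works by (metis Ck_on.simps(2) differentiable_on_def)

lemma smooth_on_dir_deriv: "smooth_on S f \<Longrightarrow> smooth_on S (\<lambda>x. dir_deriv S f x v)"
  unfolding smooth_on_def using Ck_on.simps(2) by blast

lemma smooth_on_dir_deriv_UNIV:
  assumes "smooth_on U f" "open U" shows "smooth_on U (\<lambda>x. dir_deriv UNIV f x v)"
  using smooth_on_dir_deriv[OF assms(1), of v]
    smooth_on_cong[of U "\<lambda>x. dir_deriv U f x v" "\<lambda>x. dir_deriv UNIV f x v"]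
    dir_deriv_open[OF assms(2), of _ f] by metis

lemma smooth_on_const: "open U \<Longrightarrow> smooth_on U (\<lambda>x. c)"
  by (simp add: smooth_on_def Ck_on_const)

lemma smooth_on_add: "open U \<Longrightarrow> smooth_on U f \<Longrightarrow> smooth_on U g \<Longrightarrow> smooth_on U (\<lambda>x. f x + g x)"
  by (simp add: smooth_on_def Ck_on_add)

lemma smooth_on_linear:
  "bounded_linear L \<Longrightarrow> open U \<Longrightarrow> smooth_on U f \<Longrightarrow> smooth_on U (\<lambda>x. L (f x))"
  by (simp add: smooth_on_def Ck_on_linear)

lemma smooth_on_bilinear:
  "bounded_bilinear B \<Longrightarrow> open U \<Longrightarrow> smooth_on U f \<Longrightarrow> smooth_on U g \<Longrightarrow> smooth_on U (\<lambda>x. B (f x) (g x))"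
  by (simp add: smooth_on_def Ck_on_bilinear)

lemmas smooth_on_mult = smooth_on_bilinear[OF bounded_bilinear_mult]
lemmas smooth_on_scaleR = smooth_on_bilinear[OF bounded_bilinear_scaleR]
lemmas smooth_on_inner = smooth_on_bilinear[OF bounded_bilinear_inner]

lemma smooth_on_minus: "open U \<Longrightarrow> smooth_on U f \<Longrightarrow> smooth_on U (\<lambda>x. - f x)"
  by (rule smooth_on_linear[OF bounded_linear_minus[OF bounded_linear_ident]])

lemma smooth_on_diff: "open U \<Longrightarrow> smooth_on U f \<Longrightarrow> smooth_on U g \<Longrightarrow> smooth_on U (\<lambda>x. f x - g x)"
  using smooth_on_add[of U f "\<lambda>x. - g x"] smooth_on_minus[of U g] by simp

lemma smooth_on_sum:
  "open U \<Longrightarrow> (\<And>i. i \<in> I \<Longrightarrow> smooth_on U (f i)) \<Longrightarrow> smooth_on U (\<lambda>x. \<Sum>i\<in>I. f i x)"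
  by (induction I rule: infinite_finite_induct) (auto simp: smooth_on_const intro!: smooth_on_add)

lemma smooth_on_compose_affine:
  assumes "bounded_linear L" "open U" "open V" "\<And>x. x \<in> V \<Longrightarrow> a + L x \<in> U" "smooth_on U f"
  shows "smooth_on V (\<lambda>x. f (a + L x))"
  using Ck_on_compose_affine[OF assms(1-4)] assms(5) unfolding smooth_on_def by blast

lemma smooth_on_compose_linear:
  assumes "bounded_linear L" "open U" "open V" "\<And>x. x \<in> V \<Longrightarrow> L x \<in> U" "smooth_on U f"
  shows "smooth_on V (\<lambda>x. f (L x))"
  using smooth_on_compose_affine[of L U V 0 f] assms by simp

text \<open>First half of Schwarz's theorem: the second difference is symmetric in \<open>u\<close>
  and \<open>v\<close>, while the mean value theorem, applied in direction \<open>u\<close> and then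
  in direction \<open>v\<close>, turns it into a mixed derivative at a nearby point.\<close>

lemma second_difference_mean_value:
  fixes f :: "'x::real_normed_vector \<Rightarrow> real"
  assumes f: "Ck_on (Suc (Suc k)) U f" and U: "open U" and h: "0 < h"
    and sub: "\<And>s t. \<lbrakk>0 \<le> s; s \<le> h; 0 \<le> t; t \<le> h\<rbrakk> \<Longrightarrow> x + s *\<^sub>R u + t *\<^sub>R v \<in> U"
  shows "\<exists>s t. 0 \<le> s \<and> s \<le> h \<and> 0 \<le> t \<and> t \<le> h \<and>
     f (x + h *\<^sub>R u + h *\<^sub>R v) - f (x + h *\<^sub>R u) - f (x + h *\<^sub>R v) + f x
       = h\<^sup>2 * dir_deriv U (\<lambda>y. dir_deriv U f y u) (x + s *\<^sub>R u + t *\<^sub>R v) v"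
proof -
  define Du where "Du = (\<lambda>y. dir_deriv U f y u)"
  have fs: "((\<lambda>s. f (x + s *\<^sub>R u + t *\<^sub>R v)) has_real_derivative Du (x + s *\<^sub>R u + t *\<^sub>R v)) (at s)"
    if "0 \<le> s" "s \<le> h" "0 \<le> t" "t \<le> h" for s t
  proof -
    have 1: "((\<lambda>s. x + s *\<^sub>R u + t *\<^sub>R v) has_derivative (\<lambda>r. r *\<^sub>R u)) (at s)"
      by (auto intro!: derivative_eq_intros)
    have 2: "(f has_derivative dir_deriv U f (x + s *\<^sub>R u + t *\<^sub>R v)) (at (x + s *\<^sub>R u + t *\<^sub>R v))"
      using Ck_on_SucD(1)[OF f U sub[OF that]] .
    have "linear (dir_deriv U f (x + s *\<^sub>R u + t *\<^sub>R v))"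
      using 2 has_derivative_linear by blast
    then show ?thesis
      using has_derivative_compose[OF 1 2]
      by (simp add: has_field_derivative_def Du_def linear_scale mult.commute[of _ "dir_deriv _ _ _ _"])
  qed
  have dut: "((\<lambda>t. Du (x + s *\<^sub>R u + t *\<^sub>R v)) has_real_derivative
      dir_deriv U Du (x + s *\<^sub>R u + t *\<^sub>R v) v) (at t)"
    if "0 \<le> s" "s \<le> h" "0 \<le> t" "t \<le> h" for s t
  proof -
    have 1: "((\<lambda>t. x + s *\<^sub>R u + t *\<^sub>R v) has_derivative (\<lambda>r. r *\<^sub>R v)) (at t)"
      by (auto intro!: derivative_eq_intros)
    have 2: "(Du has_derivative dir_deriv U Du (x + s *\<^sub>R u + t *\<^sub>R v)) (at (x + s *\<^sub>R u + t *\<^sub>R v))"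
      using Ck_on_SucD(1)[OF Ck_on_SucD(2)[OF f U] U sub[OF that]] by (simp add: Du_def)
    have "linear (dir_deriv U Du (x + s *\<^sub>R u + t *\<^sub>R v))"
      using 2 has_derivative_linear by blast
    then show ?thesis
      using has_derivative_compose[OF 1 2]
      by (simp add: has_field_derivative_def linear_scale mult.commute[of _ "dir_deriv _ _ _ _"])
  qed
  obtain s where s: "0 < s" "s < h" and
    eq1: "(f (x + h *\<^sub>R u + h *\<^sub>R v) - f (x + h *\<^sub>R u + 0 *\<^sub>R v)) - (f (x + 0 *\<^sub>R u + h *\<^sub>R v) - f (x + 0 *\<^sub>R u + 0 *\<^sub>R v))
      = (h - 0) * (Du (x + s *\<^sub>R u + h *\<^sub>R v) - Du (x + s *\<^sub>R u + 0 *\<^sub>R v))"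
    using MVT2[OF h, of "\<lambda>s. f (x + s *\<^sub>R u + h *\<^sub>R v) - f (x + s *\<^sub>R u + 0 *\<^sub>R v)"
        "\<lambda>s. Du (x + s *\<^sub>R u + h *\<^sub>R v) - Du (x + s *\<^sub>R u + 0 *\<^sub>R v)"] DERIV_diff[OF fs[of _ h] fs[of _ 0]] h
    by force
  obtain t where t: "0 < t" "t < h" and
    eq2: "Du (x + s *\<^sub>R u + h *\<^sub>R v) - Du (x + s *\<^sub>R u + 0 *\<^sub>R v)
      = (h - 0) * dir_deriv U Du (x + s *\<^sub>R u + t *\<^sub>R v) v"
    using MVT2[OF h, of "\<lambda>t. Du (x + s *\<^sub>R u + t *\<^sub>R v)"
        "\<lambda>t. dir_deriv U Du (x + s *\<^sub>R u + t *\<^sub>R v) v"] dut s by force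
  show ?thesis
    using s t eq1 eq2 unfolding Du_def
    by (intro exI[of _ s] exI[of _ t]) (simp add: power2_eq_square)
qed

lemma dir_deriv_commute_real:
  fixes f :: "'x::real_normed_vector \<Rightarrow> real"
  assumes f: "Ck_on (Suc (Suc 0)) U f" and U: "open U" and x: "x \<in> U"
  shows "dir_deriv U (\<lambda>y. dir_deriv U f y u) x v = dir_deriv U (\<lambda>y. dir_deriv U f y v) x u"
proof -
  let ?uv = "\<lambda>y. dir_deriv U (\<lambda>y. dir_deriv U f y u) y v"
  let ?vu = "\<lambda>y. dir_deriv U (\<lambda>y. dir_deriv U f y v) y u"
  have cont: "continuous_on U ?uv" "continuous_on U ?vu"
    using f by (simp_all add: Ck_on.simps(2))
  have "\<bar>?uv x - ?vu x\<bar> \<le> e" if e: "e > 0" for e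
  proof -
    have "\<forall>\<^sub>F y in at x. \<bar>?uv y - ?uv x\<bar> < e / 2 \<and> \<bar>?vu y - ?vu x\<bar> < e / 2"
    proof (rule eventually_conj)
      show "\<forall>\<^sub>F y in at x. \<bar>?uv y - ?uv x\<bar> < e / 2"
        using tendstoD[of ?uv "?uv x" "at x" "e/2"] cont(1) U x e
        by (auto simp: continuous_on_eq_continuous_at isCont_def dist_real_def)
      show "\<forall>\<^sub>F y in at x. \<bar>?vu y - ?vu x\<bar> < e / 2"
        using tendstoD[of ?vu "?vu x" "at x" "e/2"] cont(2) U x e
        by (auto simp: continuous_on_eq_continuous_at isCont_def dist_real_def)
    qed
    moreover have "\<forall>\<^sub>F y in at x. y \<in> U"
      using U x by (simp add: eventually_at_in_open')
    ultimately have "\<forall>\<^sub>F y in at x. y \<in> U \<and> \<bar>?uv y - ?uv x\<bar> < e / 2 \<and> \<bar>?vu y - ?vu x\<bar> < e / 2"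
      by eventually_elim auto
    then obtain d where d: "d > 0"
      and near: "\<And>y. \<lbrakk>y \<noteq> x; dist y x < d\<rbrakk> \<Longrightarrow> y \<in> U \<and> \<bar>?uv y - ?uv x\<bar> < e / 2 \<and> \<bar>?vu y - ?vu x\<bar> < e / 2"
      unfolding eventually_at by auto
    have near': "y \<in> U \<and> \<bar>?uv y - ?uv x\<bar> < e / 2 \<and> \<bar>?vu y - ?vu x\<bar> < e / 2" if "dist y x < d" for y
      using near[of y] that x e by (cases "y = x") auto
    \<comment> \<open>With this \<open>h\<close> the whole parallelogram spanned by
      \<open>h *\<^sub>R u\<close> and \<open>h *\<^sub>R v\<close> stays within \<open>d\<close> of
      \<open>x\<close>; the summand 1 covers \<open>u = v = 0\<close>.\<close>
    define h where "h = d / (2 * (norm u + norm v + 1))"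
    have n: "0 < norm u + norm v + 1" by (meson add_nonneg_pos add_nonneg_nonneg norm_ge_zero zero_less_one)
    have h: "h > 0" unfolding h_def using d n by simp
    have sm: "dist (x + s *\<^sub>R u + t *\<^sub>R v) x < d" if "0 \<le> s" "s \<le> h" "0 \<le> t" "t \<le> h" for s t
    proof -
      have "dist (x + s *\<^sub>R u + t *\<^sub>R v) x \<le> s * norm u + t * norm v"
        using norm_triangle_ineq[of "s *\<^sub>R u" "t *\<^sub>R v"] that by (simp add: dist_norm algebra_simps)
      also have "\<dots> \<le> h * norm u + h * norm v"
        using that by (intro add_mono mult_right_mono) auto
      also have "\<dots> \<le> h * (norm u + norm v + 1)"
        using h by (simp add: algebra_simps)
      also have "\<dots> = d / 2"
        unfolding h_def using n by (metis less_irrefl nonzero_eq_divide_eq divide_divide_eq_left' times_divide_eq_left mult.commute)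
      finally show ?thesis using d by linarith
    qed
    obtain s t where st: "0 \<le> s" "s \<le> h" "0 \<le> t" "t \<le> h"
      "f (x + h *\<^sub>R u + h *\<^sub>R v) - f (x + h *\<^sub>R u) - f (x + h *\<^sub>R v) + f x
       = h\<^sup>2 * ?uv (x + s *\<^sub>R u + t *\<^sub>R v)"
      using second_difference_mean_value[OF f U h, of x u v] near' sm by blast
    have sm': "x + s *\<^sub>R v + t *\<^sub>R u \<in> U" if "0 \<le> s" "s \<le> h" "0 \<le> t" "t \<le> h" for s t
      using near'[OF sm[OF that(3,4,1,2)]] by (simp add: algebra_simps)
    obtain s' t' where st': "0 \<le> s'" "s' \<le> h" "0 \<le> t'" "t' \<le> h"
      "f (x + h *\<^sub>R v + h *\<^sub>R u) - f (x + h *\<^sub>R v) - f (x + h *\<^sub>R u) + f x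
       = h\<^sup>2 * ?vu (x + s' *\<^sub>R v + t' *\<^sub>R u)"
      using second_difference_mean_value[OF f U h, of x v u] sm' by blast
    have "h\<^sup>2 * ?uv (x + s *\<^sub>R u + t *\<^sub>R v) = h\<^sup>2 * ?vu (x + t' *\<^sub>R u + s' *\<^sub>R v)"
      using st(5) st'(5) by (simp add: algebra_simps)
    then have "?uv (x + s *\<^sub>R u + t *\<^sub>R v) = ?vu (x + t' *\<^sub>R u + s' *\<^sub>R v)"
      using h by simp
    then show ?thesis
      using near'[OF sm[OF st(1-4)]] near'[OF sm[OF st'(3,4,1,2)]] by linarith
  qed
  then have "\<bar>?uv x - ?vu x\<bar> \<le> 0" by (rule field_le_epsilon[of _ 0, simplified])
  then show ?thesis by simp
qed

lemma dir_deriv_commute: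
  fixes f :: "'x::real_normed_vector \<Rightarrow> 'f::euclidean_space"
  assumes f: "smooth_on U f" and U: "open U" and x: "x \<in> U"
  shows "dir_deriv UNIV (\<lambda>y. dir_deriv UNIV f y u) x v = dir_deriv UNIV (\<lambda>y. dir_deriv UNIV f y v) x u"
proof (rule euclidean_eqI)
  fix b :: 'f assume "b \<in> Basis"
  have 1: "dir_deriv UNIV (\<lambda>y. f y \<bullet> b) y w = dir_deriv UNIV f y w \<bullet> b" if "y \<in> U" for y w
    using dir_deriv_eqI[OF bounded_linear.has_derivative[OF bounded_linear_inner_left, OF smooth_on_has_derivative[OF f U that]]] by simp
  have 2: "dir_deriv UNIV (\<lambda>y. dir_deriv UNIV (\<lambda>y. f y \<bullet> b) y w) x r
      = dir_deriv UNIV (\<lambda>y. dir_deriv UNIV f y w) x r \<bullet> b" for w r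
  proof -
    have "dir_deriv UNIV (\<lambda>y. dir_deriv UNIV (\<lambda>y. f y \<bullet> b) y w) x
       = dir_deriv UNIV (\<lambda>y. dir_deriv UNIV f y w \<bullet> b) x"
      by (rule dir_deriv_UNIV_cong[OF U x]) (rule 1)
    then show ?thesis
      using dir_deriv_eqI[OF bounded_linear.has_derivative[OF bounded_linear_inner_left, OF
            smooth_on_has_derivative[OF smooth_on_dir_deriv_UNIV[OF f U] U x]]] by simp
  qed
  have "smooth_on U (\<lambda>y. f y \<bullet> b)"
    using smooth_on_inner[OF U f smooth_on_const[OF U]] .
  then have "Ck_on (Suc (Suc 0)) U (\<lambda>y. f y \<bullet> b)"
    unfolding smooth_on_def by blast
  from dir_deriv_commute_real[OF this U x, of u v]
  have "dir_deriv UNIV (\<lambda>y. dir_deriv U (\<lambda>y. f y \<bullet> b) y u) x v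
      = dir_deriv UNIV (\<lambda>y. dir_deriv U (\<lambda>y. f y \<bullet> b) y v) x u"
    by (simp add: dir_deriv_open[OF U x])
  moreover have "dir_deriv UNIV (\<lambda>y. dir_deriv U (\<lambda>y. f y \<bullet> b) y w) x
     = dir_deriv UNIV (\<lambda>y. dir_deriv UNIV (\<lambda>y. f y \<bullet> b) y w) x" for w
    by (rule dir_deriv_UNIV_cong[OF U x]) (simp add: dir_deriv_open[OF U])
  ultimately show "dir_deriv UNIV (\<lambda>y. dir_deriv UNIV f y u) x v \<bullet> b
      = dir_deriv UNIV (\<lambda>y. dir_deriv UNIV f y v) x u \<bullet> b"
    using 2 by simp
qed

subsection \<open>Solutions of parametrized linear systems\<close>

lemma linear_sum_Basis:
  fixes A :: "'e::euclidean_space \<Rightarrow> 'f::real_vector"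
  assumes "linear A" shows "A z = (\<Sum>e\<in>Basis. (z \<bullet> e) *\<^sub>R A e)"
  by (subst euclidean_representation[symmetric, of z])
    (simp add: linear_sum[OF assms] linear_scale[OF assms])

text \<open>Continuous dependence of the solution of a linear system on matrix and right-hand side.
  A left inverse of the limit matrix gives an a priori bound on \<open>z\<close>, the perturbation
  of the matrix being absorbed, and boundedness of \<open>z\<close> then yields convergence.\<close>

lemma tendsto_linear_solve:
  fixes A :: "'x \<Rightarrow> 'e::euclidean_space \<Rightarrow> 'f::euclidean_space"
  assumes lin: "\<forall>\<^sub>F y in F. linear (A y)" and lin0: "linear A0" and inj: "inj A0"
    and A: "\<And>e. e \<in> Basis \<Longrightarrow> ((\<lambda>y. A y e) \<longlongrightarrow> A0 e) F"
    and b: "(b \<longlongrightarrow> b0) F"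
    and eq: "\<forall>\<^sub>F y in F. A y (z y) = b y" and eq0: "A0 z0 = b0"
  shows "(z \<longlongrightarrow> z0) F"
proof -
  obtain L where L: "linear L" "L \<circ> A0 = id"
    using linear_injective_left_inverse[OF lin0 inj] by auto
  have bl: "bounded_linear L" using L(1) linear_conv_bounded_linear by blast
  obtain K where K: "K > 0" "\<And>w. norm (L w) \<le> norm w * K"
    using bounded_linear.pos_bounded[OF bl] by blast
  \<comment> \<open>Dominates the operator norm of \<open>A y - A0\<close>; only the columns
    \<open>A y e\<close> are known to converge.\<close>
  define r where "r y = (\<Sum>e\<in>Basis. norm (A y e - A0 e))" for y
  have r0: "(r \<longlongrightarrow> 0) F"
  proof -
    have "((\<lambda>y. norm (A y e - A0 e)) \<longlongrightarrow> 0) F" if "e \<in> Basis" for e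
      using A[OF that] by (simp add: LIM_zero tendsto_norm_zero)
    then have "((\<lambda>y. \<Sum>e\<in>Basis. norm (A y e - A0 e)) \<longlongrightarrow> (\<Sum>e\<in>(Basis::'e set). 0)) F"
      by (rule tendsto_sum)
    then show ?thesis by (simp add: r_def[abs_def])
  qed
  have rb: "norm (A y w - A0 w) \<le> r y * norm w" if "linear (A y)" for y w
  proof -
    have "A y w - A0 w = (\<Sum>e\<in>Basis. (w \<bullet> e) *\<^sub>R (A y e - A0 e))"
      using linear_sum_Basis[OF that, of w] linear_sum_Basis[OF lin0, of w]
      by (simp add: scaleR_diff_right sum_subtractf)
    also have "norm \<dots> \<le> (\<Sum>e\<in>Basis. norm w * norm (A y e - A0 e))"
      by (rule sum_norm_le) (auto intro!: mult_right_mono simp: Basis_le_norm)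
    finally show ?thesis by (simp add: r_def sum_distrib_left mult.commute)
  qed
  \<comment> \<open>The a priori bound: as soon as \<open>r y * K < 1/2\<close>, the term
    \<open>r y * K * norm (z y)\<close> can be absorbed into half of
    \<open>norm (z y)\<close>.\<close>
  define B where "B = 2 * K * (norm b0 + 1)"
  have ev1: "\<forall>\<^sub>F y in F. r y * K < 1 / 2"
    using order_tendstoD(2)[OF tendsto_mult_right[OF r0, of K], of "1/2"] by (simp add: mult.commute)
  have ev2: "\<forall>\<^sub>F y in F. norm (b y) < norm b0 + 1"
    using order_tendstoD(2)[OF tendsto_norm[OF b], of "norm b0 + 1"] by simp
  have diff: "norm (z y - z0) \<le> (norm (b y - b0) + r y * norm (z y)) * K"
    if "linear (A y)" "A y (z y) = b y" for y
  proof -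
    have "z y - z0 = L (A0 (z y - z0))" using L(2) by (metis comp_apply id_apply)
    also have "A0 (z y - z0) = (b y - b0) - (A y (z y) - A0 (z y))"
      using that eq0 by (simp add: linear_diff[OF lin0])
    finally have "norm (z y - z0) \<le> norm ((b y - b0) - (A y (z y) - A0 (z y))) * K"
      using K(2) by metis
    also have "\<dots> \<le> (norm (b y - b0) + r y * norm (z y)) * K"
      using rb[OF that(1), of "z y"] norm_triangle_ineq4[of "b y - b0" "A y (z y) - A0 (z y)"] K(1)
      by (intro mult_right_mono) auto
    finally show ?thesis .
  qed
  have bound: "\<forall>\<^sub>F y in F. norm (z y) \<le> B"
    using lin eq ev1 ev2
  proof eventually_elim
    case (elim y)
    have "z y = L (A0 (z y))" using L(2) by (metis comp_apply id_apply)
    also have "A0 (z y) = b y - (A y (z y) - A0 (z y))"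
      using elim by simp
    finally have "norm (z y) \<le> norm (b y - (A y (z y) - A0 (z y))) * K"
      using K(2) by metis
    also have "\<dots> \<le> (norm (b y) + r y * norm (z y)) * K"
      using rb[OF elim(1), of "z y"] norm_triangle_ineq4[of "b y" "A y (z y) - A0 (z y)"] K(1)
      by (intro mult_right_mono) auto
    finally have 1: "norm (z y) \<le> norm (b y) * K + (r y * K) * norm (z y)" by (simp add: algebra_simps)
    have 2: "(r y * K) * norm (z y) \<le> 1/2 * norm (z y)"
      using elim by (intro mult_right_mono) auto
    have 3: "norm (b y) * K \<le> (norm b0 + 1) * K"
      using elim K(1) by (intro mult_right_mono) auto
    show ?case using 1 2 3 unfolding B_def by (simp add: algebra_simps)
  qed
  have "((\<lambda>y. (norm (b y - b0) + r y * B) * K) \<longlongrightarrow> (0 + 0 * B) * K) F"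
    by (intro tendsto_intros r0 tendsto_norm_zero LIM_zero b)
  then have lim: "((\<lambda>y. (norm (b y - b0) + r y * B) * K) \<longlongrightarrow> 0) F" by simp
  have "\<forall>\<^sub>F y in F. norm (z y - z0) \<le> (norm (b y - b0) + r y * B) * K"
    using lin eq bound
  proof eventually_elim
    case (elim y)
    have "0 \<le> r y" unfolding r_def by (simp add: sum_nonneg)
    then have "(norm (b y - b0) + r y * norm (z y)) * K \<le> (norm (b y - b0) + r y * B) * K"
      using elim K(1) by (intro mult_right_mono add_left_mono mult_left_mono) auto
    then show ?case using diff[OF elim(1,2)] by linarith
  qed
  then have "((\<lambda>y. z y - z0) \<longlongrightarrow> 0) F"
    by (rule Lim_null_comparison[OF _ lim])
  then show ?thesis by (rule LIM_zero_cancel)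
qed

text \<open>At its zero \<open>x\<close> the function \<open>g\<close> is of order
  \<open>norm (y - x)\<close>, so a factor tending to 0 makes the product of smaller order. Only a
  limit of \<open>f\<close> is available where this is applied.\<close>

lemma has_derivative_scaleR_vanishing:
  assumes f: "(f \<longlongrightarrow> 0) (at x within S)" and g: "(g has_derivative g') (at x within S)" and "g x = 0"
  shows "((\<lambda>y. f y *\<^sub>R g y) has_derivative (\<lambda>_. 0)) (at x within S)"
proof -
  obtain K where K: "\<And>w. norm (g' w) \<le> norm w * K"
    using bounded_linear.bounded[OF has_derivative_bounded_linear[OF g]] by blast
  have "((\<lambda>y. norm ((1 / norm (y - x)) *\<^sub>R (g y - (g x + g' (y - x))))) \<longlongrightarrow> 0) (at x within S)"
    using g unfolding has_derivative_within by (intro tendsto_norm_zero) blast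
  then have "\<forall>\<^sub>F y in at x within S. norm ((1 / norm (y - x)) *\<^sub>R (g y - (g x + g' (y - x)))) < 1"
    by (rule order_tendstoD) simp
  moreover have "\<forall>\<^sub>F y in at x within S. y \<noteq> x"
    by (simp add: eventually_at_filter)
  ultimately have ev: "\<forall>\<^sub>F y in at x within S.
      norm ((1 / norm (y - x)) *\<^sub>R (f y *\<^sub>R g y - (f x *\<^sub>R g x + 0))) \<le> norm (f y) * (1 + K)"
  proof eventually_elim
    case (elim y)
    then have p: "norm (y - x) > 0" by simp
    have "norm (g y - g' (y - x)) < norm (y - x)"
    proof -
      have "norm ((1 / norm (y - x)) *\<^sub>R (g y - (g x + g' (y - x)))) = norm (g y - g' (y - x)) / norm (y - x)"
        using \<open>g x = 0\<close> by (simp only: norm_scaleR) simp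
      with elim(1) p show ?thesis by (simp only: divide_less_eq_1_pos)
    qed
    then have "norm (g y) \<le> norm (y - x) * (1 + K)"
      using K[of "y - x"] norm_triangle_ineq2[of "g y" "g' (y - x)"] by (simp add: algebra_simps)
    then have "norm (g y) / norm (y - x) \<le> 1 + K"
      using p by (simp add: field_simps)
    then have "norm (f y) * (norm (g y) / norm (y - x)) \<le> norm (f y) * (1 + K)"
      by (rule mult_left_mono) simp
    then show ?case using \<open>g x = 0\<close> by (simp add: mult.commute)
  qed
  have "((\<lambda>y. norm (f y) * (1 + K)) \<longlongrightarrow> 0 * (1 + K)) (at x within S)"
    by (intro tendsto_intros tendsto_norm_zero f)
  then have "((\<lambda>y. (1 / norm (y - x)) *\<^sub>R (f y *\<^sub>R g y - (f x *\<^sub>R g x + 0))) \<longlongrightarrow> 0) (at x within S)"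
    by (intro Lim_null_comparison[OF ev]) simp
  then show ?thesis
    unfolding has_derivative_within by simp
qed

text \<open>Differentiability of \<open>z\<close> is a conclusion: continuity of \<open>z\<close>
  comes from \<open>tendsto_linear_solve\<close>, and this suffices to differentiate the equation at
  \<open>x\<close> and to invert \<open>A x\<close>.\<close>

lemma has_derivative_linear_solve:
  fixes A :: "'x::real_normed_vector \<Rightarrow> 'e::euclidean_space \<Rightarrow> 'e"
  assumes x: "x \<in> S" and lin: "\<And>y. y \<in> S \<Longrightarrow> linear (A y)" and inj: "inj (A x)"
    and A: "\<And>e. e \<in> Basis \<Longrightarrow> ((\<lambda>y. A y e) has_derivative A' e) (at x within S)"
    and b: "(b has_derivative b') (at x within S)"
    and eq: "\<And>y. y \<in> S \<Longrightarrow> A y (z y) = b y"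
  shows "\<exists>z'. (z has_derivative z') (at x within S) \<and>
           (\<forall>h. A x (z' h) = b' h - (\<Sum>e\<in>Basis. (z x \<bullet> e) *\<^sub>R A' e h))"
proof -
  have evS: "\<forall>\<^sub>F y in at x within S. y \<in> S"
    by (simp add: eventually_at_filter)
  have z: "(z \<longlongrightarrow> z x) (at x within S)"
  proof (rule tendsto_linear_solve[of A "at x within S" "A x" b "b x"])
    show "((\<lambda>y. A y e) \<longlongrightarrow> A x e) (at x within S)" if "e \<in> Basis" for e
      using has_derivative_continuous[OF A[OF that]] by (simp add: continuous_within)
    show "(b \<longlongrightarrow> b x) (at x within S)"
      using has_derivative_continuous[OF b] by (simp add: continuous_within)
  qed (use lin inj x eq evS in \<open>auto elim: eventually_mono\<close>)
  obtain L where L: "linear L" "L \<circ> A x = id"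
    using linear_injective_left_inverse[OF lin[OF x] inj] by auto
  have bl: "bounded_linear L" using L(1) linear_conv_bounded_linear by blast
  let ?R = "\<lambda>y. b y - (\<Sum>e\<in>Basis. (z x \<bullet> e) *\<^sub>R (A y e - A x e) + ((z y - z x) \<bullet> e) *\<^sub>R (A y e - A x e))"
  have zeq: "A x (z y) = ?R y" if "y \<in> S" for y
  proof -
    have "A y (z y) - A x (z y) = (\<Sum>e\<in>Basis. (z y \<bullet> e) *\<^sub>R (A y e - A x e))"
      using linear_sum_Basis[OF lin[OF that], of "z y"] linear_sum_Basis[OF lin[OF x], of "z y"]
      by (simp add: scaleR_diff_right sum_subtractf)
    also have "\<dots> = (\<Sum>e\<in>Basis. (z x \<bullet> e) *\<^sub>R (A y e - A x e) + ((z y - z x) \<bullet> e) *\<^sub>R (A y e - A x e))"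
      by (intro sum.cong refl) (simp add: scaleR_left_diff_distrib[symmetric] scaleR_add_left[symmetric] inner_diff_left)
    finally show ?thesis using eq[OF that] by (metis add_diff_cancel_left' diff_add_cancel)
  qed
  let ?R' = "\<lambda>h. b' h - (\<Sum>e\<in>Basis. (z x \<bullet> e) *\<^sub>R A' e h + 0)"
  have dR: "(?R has_derivative ?R') (at x within S)"
  proof (intro has_derivative_diff b has_derivative_sum has_derivative_add)
    fix e :: 'e assume e: "e \<in> Basis"
    have d: "((\<lambda>y. A y e - A x e) has_derivative A' e) (at x within S)"
      using has_derivative_diff[OF A[OF e] has_derivative_const[of "A x e"]] by simp
    then show "((\<lambda>y. (z x \<bullet> e) *\<^sub>R (A y e - A x e)) has_derivative (\<lambda>h. (z x \<bullet> e) *\<^sub>R A' e h)) (at x within S)"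
      by (rule has_derivative_scaleR_right)
    have "((\<lambda>y. (z y - z x) \<bullet> e) \<longlongrightarrow> 0 \<bullet> e) (at x within S)"
      by (intro tendsto_intros LIM_zero z)
    then show "((\<lambda>y. ((z y - z x) \<bullet> e) *\<^sub>R (A y e - A x e)) has_derivative (\<lambda>h. 0)) (at x within S)"
      by (intro has_derivative_scaleR_vanishing[OF _ d]) auto
  qed
  have "(z has_derivative (\<lambda>h. L (?R' h))) (at x within S)"
  proof (rule has_derivative_transform[OF x])
    show "((\<lambda>y. L (?R y)) has_derivative (\<lambda>h. L (?R' h))) (at x within S)"
      by (rule bounded_linear.has_derivative[OF bl dR])
    show "z y = L (?R y)" if "y \<in> S" for y
      using zeq[OF that] L(2) by (metis comp_apply id_apply)
  qed
  moreover have "A x (L (?R' h)) = ?R' h" for h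
    using L(2) linear_inverse_left[OF L(1) lin[OF x]] by (simp add: fun_eq_iff)
  ultimately show ?thesis by auto
qed

text \<open>A bootstrap: the derivative of \<open>z\<close> solves a system with the same matrix,
  whose right-hand side involves \<open>z\<close> itself but no derivative of \<open>z\<close>, so
  one order of smoothness is gained at each step.\<close>

lemma Ck_on_linear_solve:
  fixes A :: "'x::real_normed_vector \<Rightarrow> 'e::euclidean_space \<Rightarrow> 'e"
  assumes U: "open U" and lin: "\<And>y. y \<in> U \<Longrightarrow> linear (A y)" and inj: "\<And>y. y \<in> U \<Longrightarrow> inj (A y)"
  shows "(\<And>e. Ck_on k U (\<lambda>y. A y e)) \<Longrightarrow> Ck_on k U b \<Longrightarrow>
    (\<And>y. y \<in> U \<Longrightarrow> A y (z y) = b y) \<Longrightarrow> Ck_on k U z"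
proof (induction k arbitrary: z b)
  case 0
  have "(z \<longlongrightarrow> z x) (at x within U)" if x: "x \<in> U" for x
  proof (rule tendsto_linear_solve[of A "at x within U" "A x" b "b x"])
    have "\<forall>\<^sub>F y in at x within U. y \<in> U" by (simp add: eventually_at_filter)
    then show "\<forall>\<^sub>F y in at x within U. linear (A y)" "\<forall>\<^sub>F y in at x within U. A y (z y) = b y"
      using lin 0 by (auto elim: eventually_mono)
  qed (use 0 lin inj x in \<open>auto simp: continuous_on_def\<close>)
  then show ?case by (simp add: continuous_on_def)
next
  case (Suc k)
  have zk: "Ck_on k U z"
    by (rule Suc.IH[of b]) (use Suc.prems Ck_on_mono in blast)+
  define b' where "b' x h = dir_deriv U b x h - (\<Sum>e\<in>Basis. (z x \<bullet> e) *\<^sub>R dir_deriv U (\<lambda>y. A y e) x h)" for x h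
  have "\<exists>z'. (z has_derivative z') (at x) \<and> (\<forall>h. A x (z' h) = b' x h)" if x: "x \<in> U" for x
  proof -
    have "\<exists>z'. (z has_derivative z') (at x within U) \<and> (\<forall>h. A x (z' h) = b' x h)"
      unfolding b'_def
      by (rule has_derivative_linear_solve)
        (use x lin inj Suc.prems(3) Ck_on_SucD(1)[OF Suc.prems(1) U x] Ck_on_SucD(1)[OF Suc.prems(2) U x]
          in \<open>auto intro: has_derivative_at_withinI\<close>)
    then show ?thesis by (simp only: at_within_open[OF x U])
  qed
  then obtain z' where z': "\<And>x. x \<in> U \<Longrightarrow> (z has_derivative z' x) (at x)"
    "\<And>x h. x \<in> U \<Longrightarrow> A x (z' x h) = b' x h" by metis
  show ?case
  proof (rule Ck_on_SucI[OF U z'(1)])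
    fix h
    have "Ck_on k U (\<lambda>x. \<Sum>e\<in>Basis. (z x \<bullet> e) *\<^sub>R dir_deriv U (\<lambda>y. A y e) x h)"
    proof -
      have "Ck_on k U (\<lambda>x. (z x \<bullet> e) *\<^sub>R dir_deriv U (\<lambda>y. A y e) x h)" for e
        using Ck_on_SucD(2)[OF Suc.prems(1) U]
        by (intro Ck_on_bilinear[OF bounded_bilinear_scaleR U] Ck_on_bilinear[OF bounded_bilinear_inner U] zk Ck_on_const[OF U])
      then have "Ck_on k U (\<lambda>x. \<Sum>e\<in>I. (z x \<bullet> e) *\<^sub>R dir_deriv U (\<lambda>y. A y e) x h)" for I
        by (induction I rule: infinite_finite_induct) (auto simp: Ck_on_const[OF U] intro!: Ck_on_add[OF U])
      then show ?thesis .
    qed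
    from Ck_on_linear[OF bounded_linear_minus[OF bounded_linear_ident] U this]
    have "Ck_on k U (\<lambda>x. b' x h)"
      unfolding b'_def using Ck_on_add[OF U Ck_on_SucD(2)[OF Suc.prems(2) U]] by fastforce
    then show "Ck_on k U (\<lambda>x. z' x h)"
      using Suc.IH[of "\<lambda>x. b' x h" "\<lambda>x. z' x h"] Suc.prems(1) Ck_on_mono z'(2) by blast
  qed
qed

lemma smooth_on_linear_solve:
  fixes A :: "'x::real_normed_vector \<Rightarrow> 'e::euclidean_space \<Rightarrow> 'e"
  assumes "open U" "\<And>y. y \<in> U \<Longrightarrow> linear (A y)" "\<And>y. y \<in> U \<Longrightarrow> inj (A y)"
    "\<And>e. smooth_on U (\<lambda>y. A y e)" "smooth_on U b" "\<And>y. y \<in> U \<Longrightarrow> A y (z y) = b y"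
  shows "smooth_on U z"
  using Ck_on_linear_solve[of U A _ b z] assms unfolding smooth_on_def by blast

section \<open>The Levi-Civita connection and its curvature in coordinates\<close>

lemma dir_deriv_linear:
  "smooth_on U f \<Longrightarrow> open U \<Longrightarrow> x \<in> U \<Longrightarrow> linear (dir_deriv UNIV f x)"
  using smooth_on_has_derivative has_derivative_linear by blast

text \<open>Expanding \<open>a y\<close> in the standard basis leaves only the columns
  \<open>A y e\<close> to be differentiated. Families of linear maps are treated throughout as
  curried functions, and their derivatives are taken argumentwise.\<close>

lemma has_derivative_linear_field:
  fixes A :: "'x::real_normed_vector \<Rightarrow> 'e::euclidean_space \<Rightarrow> 'f::real_normed_vector"
  assumes x: "x \<in> S" and lin: "\<And>y. y \<in> S \<Longrightarrow> linear (A y)"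
    and A: "\<And>e. ((\<lambda>y. A y e) has_derivative A' e) (at x within S)"
    and lin': "\<And>h. linear (\<lambda>e. A' e h)"
    and a: "(a has_derivative a') (at x within S)"
  shows "((\<lambda>y. A y (a y)) has_derivative (\<lambda>h. A' (a x) h + A x (a' h))) (at x within S)"
proof -
  have 1: "((\<lambda>y. \<Sum>e\<in>Basis. (a y \<bullet> e) *\<^sub>R A y e) has_derivative
      (\<lambda>h. \<Sum>e\<in>Basis. (a x \<bullet> e) *\<^sub>R A' e h + (a' h \<bullet> e) *\<^sub>R A x e)) (at x within S)"
    by (intro has_derivative_sum has_derivative_scaleR A
        bounded_linear.has_derivative[OF bounded_linear_inner_left] a)
  have 2: "(\<lambda>h. \<Sum>e\<in>Basis. (a x \<bullet> e) *\<^sub>R A' e h + (a' h \<bullet> e) *\<^sub>R A x e)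
      = (\<lambda>h. A' (a x) h + A x (a' h))"
    by (simp add: sum.distrib linear_sum_Basis[OF lin', of "a x", symmetric]
        linear_sum_Basis[OF lin[OF x], symmetric])
  have "A y (a y) = (\<Sum>e\<in>Basis. (a y \<bullet> e) *\<^sub>R A y e)" if "y \<in> S" for y
    using linear_sum_Basis[OF lin[OF that]] .
  from has_derivative_transform[OF x this 1] show ?thesis unfolding 2 by blast
qed

lemma has_derivative_bilinear_field:
  fixes B :: "'x::real_normed_vector \<Rightarrow> 'e::euclidean_space \<Rightarrow> 'e \<Rightarrow> 'f::real_normed_vector"
  assumes x: "x \<in> S" and lin: "\<And>y. y \<in> S \<Longrightarrow> bilinear (B y)"
    and B: "\<And>u v. ((\<lambda>y. B y u v) has_derivative B' u v) (at x within S)"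
    and lin': "\<And>h. bilinear (\<lambda>u v. B' u v h)"
    and a: "(a has_derivative a') (at x within S)" and c: "(c has_derivative c') (at x within S)"
  shows "((\<lambda>y. B y (a y) (c y)) has_derivative
      (\<lambda>h. B' (a x) (c x) h + B x (a' h) (c x) + B x (a x) (c' h))) (at x within S)"
proof -
  have 1: "((\<lambda>y. B y e (c y)) has_derivative (\<lambda>h. B' e (c x) h + B x e (c' h))) (at x within S)" for e
    by (rule has_derivative_linear_field[OF x _ B _ c]) (use lin lin' in \<open>auto simp: bilinear_def\<close>)
  have "((\<lambda>y. B y (a y) (c y)) has_derivative
      (\<lambda>h. (B' (a x) (c x) h + B x (a x) (c' h)) + B x (a' h) (c x))) (at x within S)"
  proof (rule has_derivative_linear_field[OF x _ 1 _ a])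
    show "linear (\<lambda>e. B y e (c y))" if "y \<in> S" for y
      using lin[OF that] by (simp add: bilinear_def)
    show "linear (\<lambda>e. B' e (c x) h + B x e (c' h))" for h
      using lin[OF x] lin'[of h] by (auto simp: bilinear_def intro!: linear_compose_add)
  qed
  then show ?thesis by (simp add: algebra_simps)
qed

subsection \<open>Raising indices and traces\<close>

text \<open>No signature is imposed, so that one tensor calculus serves the Lorentzian metric and
  the metrics of the slices.\<close>

definition nondeg_form :: "('e::euclidean_space \<Rightarrow> 'e \<Rightarrow> real) \<Rightarrow> bool" where
  "nondeg_form b \<longleftrightarrow> bilinear b \<and> (\<forall>u v. b u v = b v u) \<and> (\<forall>z. (\<forall>w. b z w = 0) \<longrightarrow> z = 0)"

lemma nondeg_formD:
  assumes "nondeg_form b"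
  shows "bilinear b" "linear (b u)" "linear (\<lambda>u. b u v)" "b u v = b v u"
    "(\<And>w. b z w = b z' w) \<Longrightarrow> z = z'"
proof -
  show b: "bilinear b" "b u v = b v u" and l: "linear (b u)" "linear (\<lambda>u. b u v)"
    using assms by (auto simp: nondeg_form_def bilinear_def)
  assume *: "\<And>w. b z w = b z' w"
  have "b (z - z') w = 0" for w
    using *[of w] bilinear_lsub[OF b(1)] by simp
  then show "z = z'" using assms unfolding nondeg_form_def by fastforce
qed

lemma bilinear_sum_Basis_linear:
  assumes "bilinear b"
  shows "linear (\<lambda>z. \<Sum>e\<in>Basis. b z e *\<^sub>R (e::'e::euclidean_space))"
  by (rule linearI) (simp_all add: bilinear_ladd[OF assms] bilinear_lmul[OF assms] scaleR_add_left
      sum.distrib scaleR_sum_right)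

text \<open>Lowering an index, written as an endomorphism of the coordinate space; in this form
  \<open>sharp\<close> becomes the solution of a linear system.\<close>

lemma nondeg_form_inj:
  fixes b :: "'e::euclidean_space \<Rightarrow> 'e \<Rightarrow> real"
  assumes b: "nondeg_form b"
  shows "inj (\<lambda>z. \<Sum>e\<in>Basis. b z e *\<^sub>R e)"
proof (rule injI)
  fix z z' assume eq: "(\<Sum>e\<in>Basis. b z e *\<^sub>R e) = (\<Sum>e\<in>Basis. b z' e *\<^sub>R e)"
  have "b z e = b z' e" if "e \<in> Basis" for e
    using arg_cong[OF eq, of "\<lambda>x. x \<bullet> e"] that by simp
  then have "b z w = b z' w" for w
    using linear_sum_Basis[OF nondeg_formD(2)[OF b], of z w] linear_sum_Basis[OF nondeg_formD(2)[OF b], of z' w]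
    by simp
  then show "z = z'" by (rule nondeg_formD(5)[OF b])
qed

lemma sharp_unique:
  assumes "nondeg_form b" "\<And>w. b z w = \<alpha> w"
  shows "sharp b \<alpha> = z"
  unfolding sharp_def using assms nondeg_formD(5)[OF assms(1)] by (intro the_equality) auto

lemma sharp_works:
  fixes b :: "'e::euclidean_space \<Rightarrow> 'e \<Rightarrow> real"
  assumes b: "nondeg_form b" and \<alpha>: "linear \<alpha>"
  shows "b (sharp b \<alpha>) w = \<alpha> w"
proof -
  have "surj (\<lambda>z. \<Sum>e\<in>Basis. b z e *\<^sub>R e)"
    using linear_injective_imp_surjective[OF bilinear_sum_Basis_linear[OF nondeg_formD(1)[OF b]] nondeg_form_inj[OF b]]
    by simp
  from surjD[OF this] obtain z where z: "(\<Sum>e\<in>Basis. b z e *\<^sub>R e) = (\<Sum>e\<in>Basis. \<alpha> e *\<^sub>R e)"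
    by (metis (no_types))
  have "b z e = \<alpha> e" if "e \<in> Basis" for e
    using arg_cong[OF z, of "\<lambda>x. x \<bullet> e"] that by simp
  then have "b z w = \<alpha> w" for w
    using linear_sum_Basis[OF nondeg_formD(2)[OF b], of z w] linear_sum_Basis[OF \<alpha>, of w] by simp
  then show ?thesis using sharp_unique[OF b] by metis
qed

lemma trace_commute:
  fixes A :: "'f::euclidean_space \<Rightarrow> 'e::euclidean_space"
  assumes A: "linear A" and B: "linear B"
  shows "(\<Sum>b\<in>Basis. A (B b) \<bullet> b) = (\<Sum>c\<in>Basis. B (A c) \<bullet> c)"
proof -
  have 1: "A (B b) \<bullet> b = (\<Sum>c\<in>Basis. (B b \<bullet> c) * (A c \<bullet> b))" for b
    using arg_cong[OF linear_sum_Basis[OF A, of "B b"], of "\<lambda>x. x \<bullet> b"] by (simp add: inner_sum_left)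
  have 2: "B (A c) \<bullet> c = (\<Sum>b\<in>Basis. (A c \<bullet> b) * (B b \<bullet> c))" for c
    using arg_cong[OF linear_sum_Basis[OF B, of "A c"], of "\<lambda>x. x \<bullet> c"] by (simp add: inner_sum_left)
  show ?thesis
    unfolding 1 2 by (subst sum.swap) (simp add: mult.commute)
qed

text \<open>Invariance of the trace under a change of basis: \<open>Q\<close> is moved cyclically by
  \<open>trace_commute\<close>. It is applied to the differential of an isometry and to the passage
  from coordinates to the left-invariant frame.\<close>

lemma trace_conjugate:
  fixes P :: "'e::euclidean_space \<Rightarrow> 'f::euclidean_space"
  assumes P: "linear P" and Q: "linear Q" "\<And>x. Q (P x) = x" "\<And>y. P (Q y) = y"
    and L: "linear L" and eq: "\<And>x. L' (P x) = P (L x)"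
  shows "(\<Sum>b\<in>Basis. L' b \<bullet> b) = (\<Sum>b\<in>Basis. L b \<bullet> b)"
proof -
  have "(\<Sum>b\<in>Basis. L' b \<bullet> b) = (\<Sum>b\<in>Basis. (P \<circ> L) (Q b) \<bullet> b)"
    using eq Q(3) by (metis comp_apply)
  also have "\<dots> = (\<Sum>c\<in>Basis. Q ((P \<circ> L) c) \<bullet> c)"
    by (rule trace_commute) (intro linear_compose L P Q)+
  finally show ?thesis using Q(2) by simp
qed

subsection \<open>Christoffel symbols\<close>

definition metric_on :: "'e::euclidean_space set \<Rightarrow> ('e \<Rightarrow> 'e \<Rightarrow> 'e \<Rightarrow> real) \<Rightarrow> bool" where
  "metric_on U g \<longleftrightarrow> (\<forall>x\<in>U. nondeg_form (g x)) \<and> (\<forall>u v. smooth_on U (\<lambda>x. g x u v))"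

lemma metric_on_subset: "metric_on S g \<Longrightarrow> open U \<Longrightarrow> U \<subseteq> S \<Longrightarrow> metric_on U g"
  unfolding metric_on_def using smooth_on_open_subset by blast

lemma bilinear_dir_deriv:
  fixes B :: "'x::euclidean_space \<Rightarrow> 'e::euclidean_space \<Rightarrow> 'e \<Rightarrow> 'f::real_normed_vector"
  assumes U: "open U" and x: "x \<in> U" and bil: "\<And>y. y \<in> U \<Longrightarrow> bilinear (B y)"
    and sm: "\<And>u v. smooth_on U (\<lambda>y. B y u v)"
  shows "bilinear (\<lambda>u v. dir_deriv UNIV (\<lambda>y. B y u v) x h)"
proof -
  note d = smooth_on_has_derivative[OF sm U x]
  have add: "dir_deriv UNIV (\<lambda>y. B y (u + u') v) x = (\<lambda>h. dir_deriv UNIV (\<lambda>y. B y u v) x h + dir_deriv UNIV (\<lambda>y. B y u' v) x h)" for u u' v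
    by (subst dir_deriv_UNIV_cong[OF U x, of _ "\<lambda>y. B y u v + B y u' v"])
      (use bil bilinear_ladd in blast, rule dir_deriv_eqI[OF has_derivative_add[OF d d]])
  have add': "dir_deriv UNIV (\<lambda>y. B y u (v + v')) x = (\<lambda>h. dir_deriv UNIV (\<lambda>y. B y u v) x h + dir_deriv UNIV (\<lambda>y. B y u v') x h)" for u v v'
    by (subst dir_deriv_UNIV_cong[OF U x, of _ "\<lambda>y. B y u v + B y u v'"])
      (use bil bilinear_radd in blast, rule dir_deriv_eqI[OF has_derivative_add[OF d d]])
  have mul: "dir_deriv UNIV (\<lambda>y. B y (r *\<^sub>R u) v) x = (\<lambda>h. r *\<^sub>R dir_deriv UNIV (\<lambda>y. B y u v) x h)" for r u v
    by (subst dir_deriv_UNIV_cong[OF U x, of _ "\<lambda>y. r *\<^sub>R B y u v"])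
      (use bil bilinear_lmul in blast, rule dir_deriv_eqI[OF has_derivative_scaleR_right[OF d]])
  have mul': "dir_deriv UNIV (\<lambda>y. B y u (r *\<^sub>R v)) x = (\<lambda>h. r *\<^sub>R dir_deriv UNIV (\<lambda>y. B y u v) x h)" for r u v
    by (subst dir_deriv_UNIV_cong[OF U x, of _ "\<lambda>y. r *\<^sub>R B y u v"])
      (use bil bilinear_rmul in blast, rule dir_deriv_eqI[OF has_derivative_scaleR_right[OF d]])
  show ?thesis
    unfolding bilinear_def by (intro conjI allI linearI) (simp_all add: add add' mul mul')
qed

text \<open>At interior points the domain of the coordinate expression is irrelevant, so that from here on
  derivatives are taken within \<open>UNIV\<close>.\<close>

lemma christoffel_interior:
  assumes "x \<in> interior S" shows "christoffel S g x = christoffel UNIV g x"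
  by (intro ext) (simp only: christoffel_def dir_deriv_interior[OF assms])

lemma curvature_op_interior:
  assumes "x \<in> interior S" shows "curvature_op S g x = curvature_op UNIV g x"
proof -
  have "dir_deriv UNIV (\<lambda>y. christoffel S g y u v) x = dir_deriv UNIV (\<lambda>y. christoffel UNIV g y u v) x" for u v
    by (rule dir_deriv_UNIV_cong[OF open_interior assms]) (rule fun_cong[OF fun_cong[OF christoffel_interior]])
  then show ?thesis
    by (intro ext) (simp only: curvature_op_def dir_deriv_interior[OF assms] christoffel_interior[OF assms])
qed

lemma ricci_interior:
  assumes "x \<in> interior S" shows "ricci S g x = ricci UNIV g x"
  by (intro ext) (simp only: ricci_def curvature_op_interior[OF assms])

lemma scalar_curvature_interior:
  assumes "x \<in> interior S" shows "scalar_curvature S g x = scalar_curvature UNIV g x"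
  by (simp only: scalar_curvature_def ricci_interior[OF assms])

locale metric_domain =
  fixes U :: "'e::euclidean_space set" and g :: "'e \<Rightarrow> 'e \<Rightarrow> 'e \<Rightarrow> real"
  assumes U: "open U" and metric: "metric_on U g"
begin

abbreviation "Gam \<equiv> christoffel UNIV g"

lemma nondeg: "x \<in> U \<Longrightarrow> nondeg_form (g x)"
  using metric by (simp add: metric_on_def)

lemma g_smooth: "smooth_on U (\<lambda>x. g x u v)"
  using metric by (simp add: metric_on_def)

lemma dg_bilinear: "x \<in> U \<Longrightarrow> bilinear (\<lambda>u v. dir_deriv UNIV (\<lambda>y. g y u v) x h)"
  by (rule bilinear_dir_deriv[OF U _ _ g_smooth]) (use nondeg nondeg_formD(1) in auto)

lemma dg_sym: "x \<in> U \<Longrightarrow> dir_deriv UNIV (\<lambda>y. g y u v) x = dir_deriv UNIV (\<lambda>y. g y v u) x"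
  using nondeg nondeg_formD(4) by (intro dir_deriv_UNIV_cong[OF U]) auto

lemma dg_linear: "x \<in> U \<Longrightarrow> linear (\<lambda>h. dir_deriv UNIV (\<lambda>y. g y u v) x h)"
  using dir_deriv_linear[OF g_smooth U] by simp

lemma first_kind_linear:
  assumes "x \<in> U"
  shows "linear (\<lambda>w. (dir_deriv UNIV (\<lambda>y. g y v w) x u + dir_deriv UNIV (\<lambda>y. g y u w) x v
        - dir_deriv UNIV (\<lambda>y. g y u v) x w) / 2)"
proof -
  have "linear (\<lambda>w. dir_deriv UNIV (\<lambda>y. g y v w) x u)" for v u
    using dg_bilinear[OF assms] by (simp add: bilinear_def)
  note l = this dg_linear[OF assms]
  show ?thesis
    by (rule linearI) (simp_all add: linear_add[OF l(1)] linear_add[OF l(2)] linear_scale[OF l(1)]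
        linear_scale[OF l(2)] field_simps)
qed

lemma christoffel_eq:
  assumes "x \<in> U"
  shows "g x (Gam x u v) w = (dir_deriv UNIV (\<lambda>y. g y v w) x u + dir_deriv UNIV (\<lambda>y. g y u w) x v
        - dir_deriv UNIV (\<lambda>y. g y u v) x w) / 2"
  unfolding christoffel_def by (rule sharp_works[OF nondeg[OF assms] first_kind_linear[OF assms]])

lemma christoffel_sym:
  assumes x: "x \<in> U" shows "Gam x u v = Gam x v u"
  by (rule nondeg_formD(5)[OF nondeg[OF x]]) (simp add: christoffel_eq[OF x] dg_sym[OF x, of u v])

lemma christoffel_bilinear:
  assumes x: "x \<in> U" shows "bilinear (Gam x)"
proof -
  note b = nondeg_formD(1)[OF nondeg[OF x]]
  note d = dg_bilinear[OF x] dg_linear[OF x]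
  have add: "Gam x (u + u') v = Gam x u v + Gam x u' v" for u u' v
    by (rule nondeg_formD(5)[OF nondeg[OF x]])
      (simp add: christoffel_eq[OF x] bilinear_ladd[OF b] bilinear_ladd[OF d(1)] bilinear_radd[OF d(1)]
        linear_add[OF d(2)] field_simps)
  have mul: "Gam x (r *\<^sub>R u) v = r *\<^sub>R Gam x u v" for r u v
    by (rule nondeg_formD(5)[OF nondeg[OF x]])
      (simp add: christoffel_eq[OF x] bilinear_lmul[OF b] bilinear_lmul[OF d(1)] bilinear_rmul[OF d(1)]
        linear_scale[OF d(2)] field_simps)
  show ?thesis
    unfolding bilinear_def using add mul christoffel_sym[OF x] by (intro conjI allI linearI) metis+
qed

text \<open>A definite description cannot be differentiated directly; by
  \<open>christoffel_eq\<close> the symbols solve a linear system with the Gram matrix of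
  \<open>g x\<close>, and \<open>smooth_on_linear_solve\<close> applies.\<close>

lemma christoffel_smooth: "smooth_on U (\<lambda>x. Gam x u v)"
proof (rule smooth_on_linear_solve[OF U])
  show "linear (\<lambda>z. \<Sum>e\<in>Basis. g x z e *\<^sub>R e)" "inj (\<lambda>z. \<Sum>e\<in>Basis. g x z e *\<^sub>R e)" if "x \<in> U" for x
    using bilinear_sum_Basis_linear[OF nondeg_formD(1)[OF nondeg[OF that]]] nondeg_form_inj[OF nondeg[OF that]] by auto
  show "smooth_on U (\<lambda>x. \<Sum>e\<in>Basis. g x z e *\<^sub>R e)" for z
    by (intro smooth_on_sum smooth_on_scaleR smooth_on_const U g_smooth)
  let ?b = "\<lambda>x w. (1/2) *\<^sub>R (dir_deriv UNIV (\<lambda>y. g y v w) x u + dir_deriv UNIV (\<lambda>y. g y u w) x v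
        - dir_deriv UNIV (\<lambda>y. g y u v) x w)"
  show "smooth_on U (\<lambda>x. \<Sum>e\<in>Basis. ?b x e *\<^sub>R e)"
    by (intro smooth_on_sum smooth_on_scaleR smooth_on_const U smooth_on_add smooth_on_diff
        smooth_on_dir_deriv_UNIV g_smooth)
  show "(\<Sum>e\<in>Basis. g x (Gam x u v) e *\<^sub>R e) = (\<Sum>e\<in>Basis. ?b x e *\<^sub>R e)" if "x \<in> U" for x
    by (simp add: christoffel_eq[OF that])
qed

lemma dchristoffel_bilinear: "x \<in> U \<Longrightarrow> bilinear (\<lambda>u v. dir_deriv UNIV (\<lambda>y. Gam y u v) x h)"
  by (rule bilinear_dir_deriv[OF U _ _ christoffel_smooth]) (use christoffel_bilinear in auto)

lemma curvature_op_linear: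
  assumes x: "x \<in> U" shows "linear (\<lambda>u. curvature_op UNIV g x u v w)"
proof -
  note b = christoffel_bilinear[OF x] and d = dchristoffel_bilinear[OF x]
  have l: "linear (\<lambda>u. dir_deriv UNIV (\<lambda>y. Gam y v w) x u)"
    using dir_deriv_linear[OF christoffel_smooth U x] by simp
  show ?thesis
    unfolding curvature_op_def
    by (rule linearI)
      (simp_all add: linear_add[OF l] linear_scale[OF l] bilinear_ladd[OF b] bilinear_lmul[OF b]
        bilinear_radd[OF b] bilinear_rmul[OF b] bilinear_ladd[OF d] bilinear_lmul[OF d] algebra_simps)
qed

end

subsection \<open>Local isometries\<close>

text \<open>Both sides have the same dimension, so nondegeneracy makes the differential
  \<open>P\<close> bijective at each point and no inverse of \<open>\<phi>\<close> is required.
  \<open>Q\<close> is the second differential of \<open>\<phi>\<close>.\<close>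

locale local_isometry = dom: metric_domain U g + cod: metric_domain U' g'
  for U :: "'e::euclidean_space set" and g and U' :: "'e set" and g' +
  fixes \<phi> :: "'e \<Rightarrow> 'e"
  assumes smooth: "smooth_on U \<phi>" and image: "\<And>x. x \<in> U \<Longrightarrow> \<phi> x \<in> U'"
    and isometry: "\<And>x u v. x \<in> U \<Longrightarrow> g x u v = g' (\<phi> x) (dir_deriv UNIV \<phi> x u) (dir_deriv UNIV \<phi> x v)"
begin

abbreviation "P \<equiv> dir_deriv UNIV \<phi>"
abbreviation "Q x u v \<equiv> dir_deriv UNIV (\<lambda>y. P y v) x u"

lemma P_linear: "x \<in> U \<Longrightarrow> linear (P x)"
  by (rule dir_deriv_linear[OF smooth dom.U])

lemma P_smooth: "smooth_on U (\<lambda>x. P x v)"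
  by (rule smooth_on_dir_deriv_UNIV[OF smooth dom.U])

lemma P_inj: assumes "x \<in> U" shows "inj (P x)"
proof (rule injI)
  fix u v assume "P x u = P x v"
  then have "g x u w = g x v w" for w
    using isometry[OF assms] by simp
  then show "u = v" using nondeg_formD(5)[OF dom.nondeg[OF assms]] by blast
qed

lemma P_surj: "x \<in> U \<Longrightarrow> \<exists>w. P x w = v"
  using linear_injective_imp_surjective[OF P_linear P_inj] by (metis surjD)

lemma Q_sym: "x \<in> U \<Longrightarrow> Q x u v = Q x v u"
  by (rule dir_deriv_commute[OF smooth dom.U])

lemma Q_bilinear: assumes "x \<in> U" shows "bilinear (Q x)"
proof -
  have "linear (\<lambda>u. Q x u v)" for v
    using dir_deriv_linear[OF P_smooth dom.U assms] by simp
  then show ?thesis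
    unfolding bilinear_def using Q_sym[OF assms] by (metis (no_types, lifting) ext)
qed

lemma metric_derivative:
  assumes x: "x \<in> U"
  shows "dir_deriv UNIV (\<lambda>y. g y v w) x u = dir_deriv UNIV (\<lambda>z. g' z (P x v) (P x w)) (\<phi> x) (P x u)
    + g' (\<phi> x) (Q x u v) (P x w) + g' (\<phi> x) (P x v) (Q x u w)"
proof -
  have "((\<lambda>y. g' (\<phi> y) (P y v) (P y w)) has_derivative
     (\<lambda>h. dir_deriv UNIV (\<lambda>z. g' z (P x v) (P x w)) (\<phi> x) (P x h)
    + g' (\<phi> x) (Q x h v) (P x w) + g' (\<phi> x) (P x v) (Q x h w))) (at x within U)"
  proof (rule has_derivative_bilinear_field[OF x])
    show "bilinear (g' (\<phi> y))" if "y \<in> U" for y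
      using nondeg_formD(1)[OF cod.nondeg[OF image[OF that]]] .
    show "((\<lambda>y. g' (\<phi> y) u v) has_derivative (\<lambda>h. dir_deriv UNIV (\<lambda>z. g' z u v) (\<phi> x) (P x h))) (at x within U)" for u v
      using has_derivative_compose[OF smooth_on_has_derivative[OF smooth dom.U x, THEN has_derivative_at_withinI]
          smooth_on_has_derivative[OF cod.g_smooth cod.U image[OF x]]] .
    show "bilinear (\<lambda>u v. dir_deriv UNIV (\<lambda>z. g' z u v) (\<phi> x) (P x h))" for h
      using cod.dg_bilinear[OF image[OF x]] .
  qed (rule smooth_on_has_derivative[OF P_smooth dom.U x, THEN has_derivative_at_withinI])+
  then have 1: "((\<lambda>y. g' (\<phi> y) (P y v) (P y w)) has_derivative
     (\<lambda>h. dir_deriv UNIV (\<lambda>z. g' z (P x v) (P x w)) (\<phi> x) (P x h)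
    + g' (\<phi> x) (Q x h v) (P x w) + g' (\<phi> x) (P x v) (Q x h w))) (at x)"
    by (simp only: at_within_open[OF x dom.U])
  have "dir_deriv UNIV (\<lambda>y. g y v w) x = dir_deriv UNIV (\<lambda>y. g' (\<phi> y) (P y v) (P y w)) x"
    by (rule dir_deriv_UNIV_cong[OF dom.U x]) (rule isometry)
  then show ?thesis by (simp add: dir_deriv_eqI[OF 1])
qed

text \<open>The isometry condition is differentiated in the three cyclic combinations of the
  Christoffel formula; by symmetry of \<open>Q\<close> all second derivatives of
  \<open>\<phi>\<close> cancel except the one in the inhomogeneous term.\<close>

lemma christoffel_transform:
  assumes x: "x \<in> U"
  shows "P x (dom.Gam x u v) = cod.Gam (\<phi> x) (P x u) (P x v) + Q x u v"
proof (rule nondeg_formD(5)[OF cod.nondeg[OF image[OF x]]])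
  fix w'
  obtain w where w: "w' = P x w" using P_surj[OF x] by metis
  note s = nondeg_formD(4)[OF cod.nondeg[OF image[OF x]]]
  have "2 * g' (\<phi> x) (P x (dom.Gam x u v)) (P x w) = 2 * g x (dom.Gam x u v) w"
    using isometry[OF x] by simp
  also have "\<dots> = 2 * g' (\<phi> x) (cod.Gam (\<phi> x) (P x u) (P x v)) (P x w) + 2 * g' (\<phi> x) (Q x u v) (P x w)"
    using s[of "Q x u w" "P x v"] s[of "Q x v w" "P x u"] s[of "Q x u v" "P x w"]
    by (simp add: dom.christoffel_eq[OF x] cod.christoffel_eq[OF image[OF x]] metric_derivative[OF x]
        Q_sym[OF x, of w] Q_sym[OF x, of v u])
  finally show "g' (\<phi> x) (P x (dom.Gam x u v)) w'
      = g' (\<phi> x) (cod.Gam (\<phi> x) (P x u) (P x v) + Q x u v) w'"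
    using bilinear_ladd[OF nondeg_formD(1)[OF cod.nondeg[OF image[OF x]]]] by (simp add: w)
qed

text \<open>Both sides of \<open>christoffel_transform\<close>, with arguments \<open>v\<close> and
  \<open>w\<close>, are differentiated at \<open>x\<close> in direction \<open>u\<close>. This is
  where third derivatives of \<open>\<phi>\<close> appear.\<close>

lemma dchristoffel_transform:
  assumes x: "x \<in> U"
  shows "dir_deriv UNIV (\<lambda>z. cod.Gam z (P x v) (P x w)) (\<phi> x) (P x u)
     + cod.Gam (\<phi> x) (Q x u v) (P x w) + cod.Gam (\<phi> x) (P x v) (Q x u w)
     = Q x u (dom.Gam x v w) + P x (dir_deriv UNIV (\<lambda>y. dom.Gam y v w) x u) - dir_deriv UNIV (\<lambda>y. Q y v w) x u"
proof -
  have "((\<lambda>y. cod.Gam (\<phi> y) (P y v) (P y w)) has_derivative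
     (\<lambda>h. dir_deriv UNIV (\<lambda>z. cod.Gam z (P x v) (P x w)) (\<phi> x) (P x h)
    + cod.Gam (\<phi> x) (Q x h v) (P x w) + cod.Gam (\<phi> x) (P x v) (Q x h w))) (at x within U)"
  proof (rule has_derivative_bilinear_field[OF x])
    show "bilinear (cod.Gam (\<phi> y))" if "y \<in> U" for y
      using cod.christoffel_bilinear[OF image[OF that]] .
    show "((\<lambda>y. cod.Gam (\<phi> y) u v) has_derivative (\<lambda>h. dir_deriv UNIV (\<lambda>z. cod.Gam z u v) (\<phi> x) (P x h))) (at x within U)" for u v
      using has_derivative_compose[OF smooth_on_has_derivative[OF smooth dom.U x, THEN has_derivative_at_withinI]
          smooth_on_has_derivative[OF cod.christoffel_smooth cod.U image[OF x]]] .
    show "bilinear (\<lambda>u v. dir_deriv UNIV (\<lambda>z. cod.Gam z u v) (\<phi> x) (P x h))" for h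
      using cod.dchristoffel_bilinear[OF image[OF x]] .
  qed (rule smooth_on_has_derivative[OF P_smooth dom.U x, THEN has_derivative_at_withinI])+
  then have 1: "((\<lambda>y. cod.Gam (\<phi> y) (P y v) (P y w)) has_derivative
     (\<lambda>h. dir_deriv UNIV (\<lambda>z. cod.Gam z (P x v) (P x w)) (\<phi> x) (P x h)
    + cod.Gam (\<phi> x) (Q x h v) (P x w) + cod.Gam (\<phi> x) (P x v) (Q x h w))) (at x)"
    by (simp only: at_within_open[OF x dom.U])
  have "((\<lambda>y. P y (dom.Gam y v w)) has_derivative
      (\<lambda>h. Q x h (dom.Gam x v w) + P x (dir_deriv UNIV (\<lambda>y. dom.Gam y v w) x h))) (at x within U)"
  proof (rule has_derivative_linear_field[OF x P_linear])
    show "((\<lambda>y. P y v) has_derivative (\<lambda>h. Q x h v)) (at x within U)" for v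
      using smooth_on_has_derivative[OF P_smooth dom.U x, THEN has_derivative_at_withinI] .
    show "linear (\<lambda>e. Q x h e)" for h
      using Q_bilinear[OF x] by (simp add: bilinear_def)
    show "((\<lambda>y. dom.Gam y v w) has_derivative dir_deriv UNIV (\<lambda>y. dom.Gam y v w) x) (at x within U)"
      using smooth_on_has_derivative[OF dom.christoffel_smooth dom.U x, THEN has_derivative_at_withinI] .
  qed
  moreover have "((\<lambda>y. Q y v w) has_derivative dir_deriv UNIV (\<lambda>y. Q y v w) x) (at x within U)"
    using smooth_on_has_derivative[OF smooth_on_dir_deriv_UNIV[OF P_smooth dom.U] dom.U x, THEN has_derivative_at_withinI] .
  ultimately have "((\<lambda>y. P y (dom.Gam y v w) - Q y v w) has_derivative
      (\<lambda>h. Q x h (dom.Gam x v w) + P x (dir_deriv UNIV (\<lambda>y. dom.Gam y v w) x h)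
         - dir_deriv UNIV (\<lambda>y. Q y v w) x h)) (at x within U)"
    by (rule has_derivative_diff)
  then have 2: "((\<lambda>y. P y (dom.Gam y v w) - Q y v w) has_derivative
      (\<lambda>h. Q x h (dom.Gam x v w) + P x (dir_deriv UNIV (\<lambda>y. dom.Gam y v w) x h)
         - dir_deriv UNIV (\<lambda>y. Q y v w) x h)) (at x)"
    by (simp only: at_within_open[OF x dom.U])
  have "dir_deriv UNIV (\<lambda>y. cod.Gam (\<phi> y) (P y v) (P y w)) x = dir_deriv UNIV (\<lambda>y. P y (dom.Gam y v w) - Q y v w) x"
    by (rule dir_deriv_UNIV_cong[OF dom.U x]) (simp add: christoffel_transform)
  from fun_cong[OF this, of u] show ?thesis
    by (simp add: dir_deriv_eqI[OF 1] dir_deriv_eqI[OF 2])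
qed

text \<open>Antisymmetrization in \<open>u\<close> and \<open>v\<close> removes everything that is
  not tensorial: the third derivatives of \<open>\<phi>\<close> cancel by their symmetry (fact
  \<open>C\<close>), the remaining terms with \<open>Q\<close> cancel in pairs.\<close>

lemma curvature_transform:
  assumes x: "x \<in> U"
  shows "curvature_op UNIV g' (\<phi> x) (P x u) (P x v) (P x w) = P x (curvature_op UNIV g x u v w)"
proof -
  let ?G = "cod.Gam (\<phi> x)"
  have C: "dir_deriv UNIV (\<lambda>y. Q y v w) x u = dir_deriv UNIV (\<lambda>y. Q y u w) x v"
    by (rule dir_deriv_commute[OF P_smooth dom.U x])
  note b = cod.christoffel_bilinear[OF image[OF x]]
  have T: "?G (P x a) (P x c) = P x (dom.Gam x a c) - Q x a c" for a c
    using christoffel_transform[OF x, of a c] by simp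
  have GG: "?G (P x a) (?G (P x c) (P x w)) = P x (dom.Gam x a (dom.Gam x c w)) - Q x a (dom.Gam x c w) - ?G (P x a) (Q x c w)" for a c
    by (simp add: T[of c w] bilinear_rsub[OF b] T)
  have D: "dir_deriv UNIV (\<lambda>z. cod.Gam z (P x c) (P x w)) (\<phi> x) (P x a)
     = Q x a (dom.Gam x c w) + P x (dir_deriv UNIV (\<lambda>y. dom.Gam y c w) x a) - dir_deriv UNIV (\<lambda>y. Q y c w) x a
       - ?G (Q x a c) (P x w) - ?G (P x c) (Q x a w)" for a c
    using dchristoffel_transform[OF x, of c w a] by (simp add: algebra_simps)
  show ?thesis
    by (simp only: curvature_op_def D GG linear_add[OF P_linear[OF x]] linear_diff[OF P_linear[OF x]])
      (simp add: C Q_sym[OF x, of v u] algebra_simps)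
qed

lemma ricci_transform:
  assumes x: "x \<in> U"
  shows "ricci UNIV g' (\<phi> x) (P x v) (P x w) = ricci UNIV g x v w"
proof -
  obtain R where R: "linear R" "R \<circ> P x = id"
    using linear_injective_left_inverse[OF P_linear[OF x] P_inj[OF x]] by auto
  have "P x \<circ> R = id" using linear_inverse_left[OF R(1) P_linear[OF x]] R(2) by simp
  with R show ?thesis
    unfolding ricci_def
    by (intro trace_conjugate[OF P_linear[OF x], where Q = R] dom.curvature_op_linear[OF x] curvature_transform[OF x])
      (auto simp: fun_eq_iff)
qed

end

section \<open>Metrics in Gaussian form\<close>

lemma sum_Basis_real_times:
  "(\<Sum>b\<in>(Basis :: (real \<times> 'e::euclidean_space) set). f b) = f (1, 0) + (\<Sum>e\<in>Basis. f (0, e))"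
proof -
  have "(\<Sum>b\<in>(Basis :: (real \<times> 'e) set). f b) = (\<Sum>b\<in>(\<lambda>u. (u, 0)) ` {1}. f b) + (\<Sum>b\<in>(\<lambda>v. (0, v)) ` Basis. f b)"
    unfolding Basis_prod_def by (subst sum.union_disjoint) auto
  then show ?thesis
    by (simp add: sum.reindex inj_on_def)
qed

lemma dir_deriv_linear_comp:
  assumes "bounded_linear L" "(f has_derivative f') (at x)"
  shows "dir_deriv UNIV (\<lambda>y. L (f y)) x = (\<lambda>h. L (f' h))"
  by (rule dir_deriv_eqI[OF bounded_linear.has_derivative[OF assms]])

locale gaussian_metric =
  fixes I :: "real set" and N :: "'e::euclidean_space set" and h :: "real \<times> 'e \<Rightarrow> 'e \<Rightarrow> 'e \<Rightarrow> real"
  assumes I: "open I" and N: "open N"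
    and h_nondeg: "\<And>x. x \<in> I \<times> N \<Longrightarrow> nondeg_form (h x)"
    and h_smooth: "\<And>u v. smooth_on (I \<times> N) (\<lambda>x. h x u v)"
begin

definition gp :: "real \<times> 'e \<Rightarrow> real \<times> 'e \<Rightarrow> real \<times> 'e \<Rightarrow> real" where
  "gp x a b = - (fst a * fst b) + h x (snd a) (snd b)"

lemma IN: "open (I \<times> N)"
  using I N by (rule open_Times)

lemma h_lin:
  assumes "x \<in> I \<times> N"
  shows "h x (u + u') v = h x u v + h x u' v" "h x u (v + v') = h x u v + h x u v'"
    "h x (r *\<^sub>R u) v = r * h x u v" "h x u (r *\<^sub>R v) = r * h x u v" "h x 0 v = 0" "h x u 0 = 0"
    "h x (- u) v = - h x u v"
  using nondeg_formD(1)[OF h_nondeg[OF assms]]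
  by (simp_all add: bilinear_ladd bilinear_radd bilinear_lmul bilinear_rmul bilinear_lzero bilinear_rzero bilinear_lneg)

lemma gp_nondeg:
  assumes x: "x \<in> I \<times> N" shows "nondeg_form (gp x)"
  unfolding nondeg_form_def
proof (intro conjI allI impI)
  show "bilinear (gp x)"
    unfolding bilinear_def by (intro conjI allI linearI) (simp_all add: gp_def h_lin[OF x] algebra_simps)
  show "gp x u v = gp x v u" for u v
    using nondeg_formD(4)[OF h_nondeg[OF x]] by (simp add: gp_def)
  fix z assume z: "\<forall>w. gp x z w = 0"
  have "fst z = 0" using z[rule_format, of "(1, 0)"] by (simp add: gp_def h_lin[OF x])
  moreover have "h x (snd z) w = 0" for w using z[rule_format, of "(0, w)"] by (simp add: gp_def)
  then have "snd z = 0" using h_nondeg[OF x] by (simp add: nondeg_form_def)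
  ultimately show "z = 0" by (simp add: prod_eq_iff)
qed

lemma gp_smooth: "smooth_on (I \<times> N) (\<lambda>x. gp x a b)"
  unfolding gp_def by (intro smooth_on_add smooth_on_const IN h_smooth)

sublocale prod: metric_domain "I \<times> N" gp
  by unfold_locales (auto simp: IN metric_on_def gp_smooth gp_nondeg)

lemma slice_has_derivative:
  assumes x: "(t, y) \<in> I \<times> N" and f: "(f has_derivative f') (at (t, y))"
  shows "((\<lambda>y. f (t, y)) has_derivative (\<lambda>w. f' (0, w))) (at y)"
proof -
  have "((\<lambda>y. (t, y)) has_derivative (\<lambda>w. (0, w))) (at y)"
    by (auto intro!: derivative_eq_intros)
  from has_derivative_compose[OF this f] show ?thesis .
qed

lemma slice_smooth:
  assumes "t \<in> I" "smooth_on (I \<times> N) f" shows "smooth_on N (\<lambda>y. f (t, y))"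
proof -
  have "smooth_on N (\<lambda>y. f ((t, 0) + (0, y)))"
    by (rule smooth_on_compose_affine[OF _ IN N _ assms(2)])
      (use assms(1) in \<open>auto intro!: bounded_linear_Pair bounded_linear_zero bounded_linear_ident\<close>)
  then show ?thesis by simp
qed

lemma slice_domain: "t \<in> I \<Longrightarrow> metric_domain N (\<lambda>y. h (t, y))"
  by unfold_locales (auto simp: N metric_on_def h_nondeg slice_smooth[OF _ h_smooth])

definition ht :: "real \<times> 'e \<Rightarrow> 'e \<Rightarrow> 'e \<Rightarrow> real" where
  "ht x u v = dir_deriv UNIV (\<lambda>x. h x u v) x (1, 0)"

text \<open>By \<open>Gam_ts\<close> this is half the time derivative of \<open>h\<close> with an
  index raised, the Weingarten map of the slices (minus k). As a component of a Christoffel symbol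
  it is smooth without further argument.\<close>

definition Kop :: "real \<times> 'e \<Rightarrow> 'e \<Rightarrow> 'e" where
  "Kop x u = snd (prod.Gam x (1, 0) (0, u))"

definition dK :: "real \<times> 'e \<Rightarrow> 'e \<Rightarrow> 'e" where
  "dK x u = dir_deriv UNIV (\<lambda>x. Kop x u) x (1, 0)"

definition GH :: "real \<times> 'e \<Rightarrow> 'e \<Rightarrow> 'e \<Rightarrow> 'e" where
  "GH x u v = christoffel UNIV (\<lambda>y. h (fst x, y)) (snd x) u v"

section \<open>Christoffel symbols of a Gaussian metric\<close>

lemma dgp: "x \<in> I \<times> N \<Longrightarrow> dir_deriv UNIV (\<lambda>x. gp x a b) x = dir_deriv UNIV (\<lambda>x. h x (snd a) (snd b)) x"
  unfolding gp_def
  using dir_deriv_eqI[OF has_derivative_add[OF has_derivative_const[of "- (fst a * fst b)"] smooth_on_has_derivative[OF h_smooth IN]]]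
  by (simp only: add_0)

lemma dh_zero: "x \<in> I \<times> N \<Longrightarrow> dir_deriv UNIV (\<lambda>x. h x 0 v) x = (\<lambda>h. 0)"
  "x \<in> I \<times> N \<Longrightarrow> dir_deriv UNIV (\<lambda>x. h x v 0) x = (\<lambda>h. 0)"
  using dir_deriv_UNIV_cong[OF IN, of x "\<lambda>x. h x 0 v" "\<lambda>x. 0"] dir_deriv_UNIV_cong[OF IN, of x "\<lambda>x. h x v 0" "\<lambda>x. 0"]
  by (simp_all add: h_lin dir_deriv_eqI[OF has_derivative_const])

lemma dh_space:
  assumes "(t, y) \<in> I \<times> N"
  shows "dir_deriv UNIV (\<lambda>x. h x u v) (t, y) (0, w) = dir_deriv UNIV (\<lambda>y. h (t, y) u v) y w"
  using dir_deriv_eqI[OF slice_has_derivative[OF assms smooth_on_has_derivative[OF h_smooth IN assms]]] by simp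

lemma dh_split:
  assumes x: "x \<in> I \<times> N"
  shows "dir_deriv UNIV (\<lambda>x. h x u v) x (r, w) = r * ht x u v + dir_deriv UNIV (\<lambda>x. h x u v) x (0, w)"
proof -
  have l: "linear (dir_deriv UNIV (\<lambda>x. h x u v) x)"
    by (rule dir_deriv_linear[OF h_smooth IN x])
  have "(r, w) = r *\<^sub>R (1, 0) + (0, w)" by simp
  then show ?thesis
    unfolding ht_def using linear_add[OF l] linear_scale[OF l] by (metis real_scaleR_def)
qed

lemma ht_bilinear: "x \<in> I \<times> N \<Longrightarrow> bilinear (ht x)"
  unfolding ht_def
  using bilinear_dir_deriv[OF IN, of x h "(1, 0)"] h_smooth h_nondeg nondeg_formD(1) by blast

lemma ht_sym: "x \<in> I \<times> N \<Longrightarrow> ht x u v = ht x v u"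
  unfolding ht_def using dir_deriv_UNIV_cong[OF IN, of x "\<lambda>x. h x u v" "\<lambda>x. h x v u"]
    nondeg_formD(4)[OF h_nondeg] by metis

lemma Gam_tt: assumes x: "x \<in> I \<times> N" shows "prod.Gam x (1, 0) (1, 0) = 0"
proof (rule nondeg_formD(5)[OF gp_nondeg[OF x]])
  show "gp x (prod.Gam x (1, 0) (1, 0)) w = gp x 0 w" for w
    using bilinear_lzero[OF nondeg_formD(1)[OF gp_nondeg[OF x]]]
    by (simp add: prod.christoffel_eq[OF x] dgp[OF x] dh_zero[OF x])
qed

lemma Gam_ts: assumes x: "x \<in> I \<times> N"
  shows "prod.Gam x (1, 0) (0, u) = (0, Kop x u)" "prod.Gam x (0, u) (1, 0) = (0, Kop x u)"
    "h x (Kop x u) v = ht x u v / 2"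
proof -
  have 1: "gp x (prod.Gam x (1, 0) (0, u)) w = ht x u (snd w) / 2" for w
    by (simp add: prod.christoffel_eq[OF x] dgp[OF x] dh_zero[OF x] ht_def)
  from 1[of "(1, 0)"] have "fst (prod.Gam x (1, 0) (0, u)) = 0"
    using bilinear_rzero[OF ht_bilinear[OF x]] by (simp add: gp_def h_lin[OF x])
  then show g: "prod.Gam x (1, 0) (0, u) = (0, Kop x u)"
    by (simp add: Kop_def prod_eq_iff)
  then show "prod.Gam x (0, u) (1, 0) = (0, Kop x u)"
    using prod.christoffel_sym[OF x] by metis
  show "h x (Kop x u) v = ht x u v / 2"
    using 1[of "(0, v)"] by (simp add: g gp_def)
qed

lemma Gam_ss: assumes x: "x \<in> I \<times> N"
  shows "prod.Gam x (0, u) (0, v) = (ht x u v / 2, GH x u v)"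
proof (rule nondeg_formD(5)[OF gp_nondeg[OF x]])
  fix w :: "real \<times> 'e"
  obtain t y where ty: "x = (t, y)" by (cases x)
  interpret slice: metric_domain N "\<lambda>y. h (t, y)" using slice_domain x ty by auto
  have y: "y \<in> N" using x ty by simp
  obtain r w' where w: "w = (r, w')" by (cases w)
  show "gp x (prod.Gam x (0, u) (0, v)) w = gp x (ht x u v / 2, GH x u v) w"
  proof -
    have "gp x (prod.Gam x (0, u) (0, v)) w = (dir_deriv UNIV (\<lambda>y. h (t, y) v w') y u
        + dir_deriv UNIV (\<lambda>y. h (t, y) u w') y v - (r * ht x u v + dir_deriv UNIV (\<lambda>y. h (t, y) u v) y w')) / 2"
      unfolding prod.christoffel_eq[OF x] dgp[OF x] w snd_conv dh_split[OF x, of _ _ r w']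
      using x unfolding ty by (simp add: dh_space)
    also have "\<dots> = - (r * ht x u v / 2) + h (t, y) (GH x u v) w'"
      using slice.christoffel_eq[OF y, of u v w'] by (simp add: GH_def ty field_simps)
    also have "\<dots> = gp x (ht x u v / 2, GH x u v) w"
      by (simp add: gp_def w ty)
    finally show ?thesis .
  qed
qed

lemma Kop_linear: assumes x: "x \<in> I \<times> N" shows "linear (Kop x)"
proof -
  have "linear (\<lambda>u. prod.Gam x (1, 0) (0, u))"
    using prod.christoffel_bilinear[OF x]
    by (intro linearI) (simp_all add: bilinear_radd[of "prod.Gam x", symmetric] bilinear_rmul[of "prod.Gam x", symmetric])
  then show ?thesis
    by (intro linearI) (simp_all add: Kop_def linear_add[of "\<lambda>u. prod.Gam x (1, 0) (0, u)"]
        linear_scale[of "\<lambda>u. prod.Gam x (1, 0) (0, u)"])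
qed

lemma Gam_t: assumes x: "x \<in> I \<times> N" shows "prod.Gam x (1, 0) (r, u) = (0, Kop x u)"
proof -
  have "(r, u) = r *\<^sub>R (1, 0) + (0, u)" by simp
  then have "prod.Gam x (1, 0) (r, u) = r *\<^sub>R prod.Gam x (1, 0) (1, 0) + prod.Gam x (1, 0) (0, u)"
    using bilinear_radd[OF prod.christoffel_bilinear[OF x]] bilinear_rmul[OF prod.christoffel_bilinear[OF x]] by metis
  then show ?thesis by (simp add: Gam_tt[OF x] Gam_ts[OF x])
qed

lemma Gam_s: assumes x: "x \<in> I \<times> N"
  shows "prod.Gam x (0, v) (r, u) = (ht x v u / 2, r *\<^sub>R Kop x v + GH x v u)"
proof -
  have "(r, u) = r *\<^sub>R (1, 0) + (0, u)" by simp
  then have "prod.Gam x (0, v) (r, u) = r *\<^sub>R prod.Gam x (0, v) (1, 0) + prod.Gam x (0, v) (0, u)"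
    using bilinear_radd[OF prod.christoffel_bilinear[OF x]] bilinear_rmul[OF prod.christoffel_bilinear[OF x]] by metis
  then show ?thesis by (simp add: Gam_ss[OF x] Gam_ts[OF x])
qed

lemma fst_Gam: assumes x: "x \<in> I \<times> N" shows "fst (prod.Gam x (r, u) (r, u)) = ht x u u / 2"
proof -
  have "(r, u) = r *\<^sub>R (1, 0) + (0, u)" by simp
  then have "prod.Gam x (r, u) (r, u) = r *\<^sub>R prod.Gam x (1, 0) (r, u) + prod.Gam x (0, u) (r, u)"
    using bilinear_ladd[OF prod.christoffel_bilinear[OF x]] bilinear_lmul[OF prod.christoffel_bilinear[OF x]] by metis
  then show ?thesis by (simp add: Gam_t[OF x] Gam_s[OF x])
qed

section \<open>Ricci curvature of a Gaussian metric\<close>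

lemma Gam_derivative:
  "x \<in> I \<times> N \<Longrightarrow> ((\<lambda>x. prod.Gam x a b) has_derivative dir_deriv UNIV (\<lambda>x. prod.Gam x a b) x) (at x)"
  by (rule smooth_on_has_derivative[OF prod.christoffel_smooth IN])

lemma dGam_tt: assumes x: "x \<in> I \<times> N" shows "dir_deriv UNIV (\<lambda>x. prod.Gam x (1, 0) (1, 0)) x = (\<lambda>h. 0)"
  using dir_deriv_UNIV_cong[OF IN x, of "\<lambda>x. prod.Gam x (1, 0) (1, 0)" "\<lambda>x. 0"] Gam_tt
  by (simp add: dir_deriv_eqI[OF has_derivative_const])

lemma Kop_smooth: "smooth_on (I \<times> N) (\<lambda>x. Kop x u)"
  unfolding Kop_def by (intro smooth_on_linear[OF bounded_linear_snd IN] prod.christoffel_smooth)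

lemma dGam_ts: assumes x: "x \<in> I \<times> N"
  shows "dir_deriv UNIV (\<lambda>x. prod.Gam x (1, 0) (0, u)) x = (\<lambda>h. (0, dir_deriv UNIV (\<lambda>x. Kop x u) x h))"
    "dir_deriv UNIV (\<lambda>x. prod.Gam x (0, u) (1, 0)) x = (\<lambda>h. (0, dir_deriv UNIV (\<lambda>x. Kop x u) x h))"
proof -
  have d: "((\<lambda>x. (0::real, Kop x u)) has_derivative (\<lambda>h. (0, dir_deriv UNIV (\<lambda>x. Kop x u) x h))) (at x)"
    by (intro has_derivative_Pair has_derivative_const smooth_on_has_derivative[OF Kop_smooth IN x])
  show "dir_deriv UNIV (\<lambda>x. prod.Gam x (1, 0) (0, u)) x = (\<lambda>h. (0, dir_deriv UNIV (\<lambda>x. Kop x u) x h))"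
    "dir_deriv UNIV (\<lambda>x. prod.Gam x (0, u) (1, 0)) x = (\<lambda>h. (0, dir_deriv UNIV (\<lambda>x. Kop x u) x h))"
    using dir_deriv_UNIV_cong[OF IN x, of "\<lambda>x. prod.Gam x (1, 0) (0, u)" "\<lambda>x. (0, Kop x u)"]
      dir_deriv_UNIV_cong[OF IN x, of "\<lambda>x. prod.Gam x (0, u) (1, 0)" "\<lambda>x. (0, Kop x u)"] Gam_ts
      dir_deriv_eqI[OF d] by metis+
qed

text \<open>Differentiates \<open>ht x u v = 2 * h x (Kop x u) v\<close>, so that the second time
  derivative of the metric enters the curvature only through \<open>Kop\<close> and its time
  derivative \<open>dK\<close>.\<close>

lemma htt:
  assumes x: "x \<in> I \<times> N"
  shows "dir_deriv UNIV (\<lambda>x. ht x u v) x (1, 0) = 2 * ht x (Kop x u) v + 2 * h x (dK x u) v"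
proof -
  have "((\<lambda>x. h x (Kop x u) v) has_derivative
     (\<lambda>k. dir_deriv UNIV (\<lambda>z. h z (Kop x u) v) x k + h x (dir_deriv UNIV (\<lambda>x. Kop x u) x k) v)) (at x within I \<times> N)"
  proof (rule has_derivative_linear_field[OF x, where A = "\<lambda>y w. h y w v"])
    show "linear (\<lambda>w. h y w v)" if "y \<in> I \<times> N" for y
      by (rule nondeg_formD(3)[OF h_nondeg[OF that]])
    show "((\<lambda>y. h y e v) has_derivative dir_deriv UNIV (\<lambda>z. h z e v) x) (at x within I \<times> N)" for e
      by (rule smooth_on_has_derivative[OF h_smooth IN x, THEN has_derivative_at_withinI])
    show "linear (\<lambda>e. dir_deriv UNIV (\<lambda>z. h z e v) x k)" for k
      using bilinear_dir_deriv[OF IN x, of h k] h_smooth h_nondeg nondeg_formD(1)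
      unfolding bilinear_def by blast
    show "((\<lambda>x. Kop x u) has_derivative dir_deriv UNIV (\<lambda>x. Kop x u) x) (at x within I \<times> N)"
      by (rule smooth_on_has_derivative[OF Kop_smooth IN x, THEN has_derivative_at_withinI])
  qed
  then have "((\<lambda>x. 2 * h x (Kop x u) v) has_derivative
     (\<lambda>k. 2 * (dir_deriv UNIV (\<lambda>z. h z (Kop x u) v) x k + h x (dir_deriv UNIV (\<lambda>x. Kop x u) x k) v))) (at x)"
    by (intro has_derivative_mult_right) (simp only: at_within_open[OF x IN])
  from dir_deriv_eqI[OF this] have "dir_deriv UNIV (\<lambda>x. 2 * h x (Kop x u) v) x (1, 0)
     = 2 * (ht x (Kop x u) v + h x (dK x u) v)"
    by (simp add: ht_def dK_def)
  moreover have "dir_deriv UNIV (\<lambda>x. ht x u v) x = dir_deriv UNIV (\<lambda>x. 2 * h x (Kop x u) v) x"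
    by (rule dir_deriv_UNIV_cong[OF IN x]) (simp add: Gam_ts(3))
  ultimately show ?thesis by simp
qed

text \<open>The traced Riccati equation of the t-lines: these are geodesics by
  \<open>Gam_tt\<close>, so only \<open>dK\<close> and the square of \<open>Kop\<close> survive, and
  the basis vector (1, 0) contributes nothing to the trace.\<close>

lemma ricci_tt:
  assumes x: "x \<in> I \<times> N"
  shows "ricci UNIV gp x (1, 0) (1, 0) = - (\<Sum>e\<in>Basis. dK x e \<bullet> e) - (\<Sum>e\<in>Basis. Kop x (Kop x e) \<bullet> e)"
  using bilinear_rzero[OF prod.christoffel_bilinear[OF x]]
  by (simp add: ricci_def sum_Basis_real_times curvature_op_def dGam_tt[OF x] dGam_ts[OF x] Gam_tt[OF x]
      Gam_ts[OF x] dK_def inner_diff_left inner_add_left sum_subtractf sum_negf sum.distrib)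

lemma fst_dir_deriv_Gam:
  assumes x: "x \<in> I \<times> N"
  shows "fst (dir_deriv UNIV (\<lambda>x. prod.Gam x (0, u) (0, v)) x k) = dir_deriv UNIV (\<lambda>x. ht x u v) x k / 2"
proof -
  have 1: "dir_deriv UNIV (\<lambda>x. fst (prod.Gam x (0, u) (0, v))) x = (\<lambda>k. fst (dir_deriv UNIV (\<lambda>x. prod.Gam x (0, u) (0, v)) x k))"
    by (rule dir_deriv_linear_comp[OF bounded_linear_fst Gam_derivative[OF x]])
  have sm: "smooth_on (I \<times> N) (\<lambda>x. ht x u v)"
    unfolding ht_def by (rule smooth_on_dir_deriv_UNIV[OF h_smooth IN])
  have 2: "dir_deriv UNIV (\<lambda>x. ht x u v / 2) x = (\<lambda>k. dir_deriv UNIV (\<lambda>x. ht x u v) x k / 2)"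
    by (rule dir_deriv_linear_comp[OF bounded_linear_divide smooth_on_has_derivative[OF sm IN x]])
  have "dir_deriv UNIV (\<lambda>x. fst (prod.Gam x (0, u) (0, v))) x = dir_deriv UNIV (\<lambda>x. ht x u v / 2) x"
    by (rule dir_deriv_UNIV_cong[OF IN x]) (simp add: Gam_ss)
  then show ?thesis unfolding 1 2 by (rule fun_cong)
qed

lemma snd_dir_deriv_Gam:
  assumes x: "(t, y) \<in> I \<times> N"
  shows "snd (dir_deriv UNIV (\<lambda>x. prod.Gam x (0, u) (0, v)) (t, y) (0, w))
    = dir_deriv UNIV (\<lambda>y. christoffel UNIV (\<lambda>y. h (t, y)) y u v) y w"
proof -
  have y: "y \<in> N" and t: "t \<in> I" using x by auto
  have 1: "((\<lambda>x. snd (prod.Gam x (0, u) (0, v))) has_derivative (\<lambda>k. snd (dir_deriv UNIV (\<lambda>x. prod.Gam x (0, u) (0, v)) (t, y) k))) (at (t, y))"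
    by (rule bounded_linear.has_derivative[OF bounded_linear_snd Gam_derivative[OF x]])
  have "dir_deriv UNIV (\<lambda>y. snd (prod.Gam (t, y) (0, u) (0, v))) y = dir_deriv UNIV (\<lambda>y. christoffel UNIV (\<lambda>y. h (t, y)) y u v) y"
    by (rule dir_deriv_UNIV_cong[OF N y]) (simp add: Gam_ss t GH_def)
  then show ?thesis
    using dir_deriv_eqI[OF slice_has_derivative[OF x 1]] by metis
qed

lemma ht_Kop: assumes x: "x \<in> I \<times> N"
  shows "ht x (Kop x v) w = 2 * h x (Kop x (Kop x v)) w" "ht x v (Kop x w) = 2 * h x (Kop x (Kop x v)) w"
proof -
  show 1: "ht x (Kop x v) w = 2 * h x (Kop x (Kop x v)) w"
    by (simp add: Gam_ts(3)[OF x])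
  have "ht x v (Kop x w) = 2 * h x (Kop x v) (Kop x w)" by (simp add: Gam_ts(3)[OF x])
  also have "\<dots> = 2 * h x (Kop x w) (Kop x v)" using nondeg_formD(4)[OF h_nondeg[OF x]] by simp
  also have "\<dots> = ht x w (Kop x v)" by (simp add: Gam_ts(3)[OF x])
  finally show "ht x v (Kop x w) = 2 * h x (Kop x (Kop x v)) w"
    using 1 ht_sym[OF x] by metis
qed

text \<open>The Gauss equation accounts for the trace over spatial vectors; the basis vector (1, 0)
  adds the part with \<open>dK\<close>.\<close>

lemma ricci_ss:
  assumes x: "(t, y) \<in> I \<times> N"
  shows "ricci UNIV gp (t, y) (0, v) (0, w) = ricci UNIV (\<lambda>y. h (t, y)) y v w
     + h (t, y) (dK (t, y) v + (\<Sum>e\<in>Basis. Kop (t, y) e \<bullet> e) *\<^sub>R Kop (t, y) v) w"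
proof -
  let ?x = "(t, y)"
  have time: "fst (curvature_op UNIV gp ?x (1, 0) (0, v) (0, w)) = ht ?x (Kop ?x v) w / 2 + h ?x (dK ?x v) w"
  proof -
    have "fst (curvature_op UNIV gp ?x (1, 0) (0, v) (0, w))
        = dir_deriv UNIV (\<lambda>x. ht x v w) ?x (1, 0) / 2 - ht ?x v (Kop ?x w) / 2"
      by (simp add: curvature_op_def fst_dir_deriv_Gam[OF x] dGam_ts[OF x] Gam_ss[OF x] Gam_t[OF x] Gam_ts(1,2)[OF x])
    then show ?thesis
      using htt[OF x, of v w] ht_Kop[OF x, of v w] by linarith
  qed
  have space: "snd (curvature_op UNIV gp ?x (0, e) (0, v) (0, w)) = curvature_op UNIV (\<lambda>y. h (t, y)) y e v w
     + (ht ?x v w / 2) *\<^sub>R Kop ?x e - (ht ?x e w / 2) *\<^sub>R Kop ?x v" for e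
    by (simp add: curvature_op_def snd_dir_deriv_Gam[OF x] Gam_ss[OF x] Gam_s[OF x] GH_def algebra_simps)
  have "linear (\<lambda>e. ht ?x e w)" using ht_bilinear[OF x] by (simp add: bilinear_def)
  from linear_sum_Basis[OF this, of "Kop ?x v"]
  \<comment> \<open>This part of the spatial trace cancels the first summand of
    \<open>time\<close>.\<close>
  have tr: "ht ?x (Kop ?x v) w / 2 = (\<Sum>e\<in>Basis. (ht ?x e w / 2) * (Kop ?x v \<bullet> e))"
    by (simp add: mult.commute sum_divide_distrib)
  have "ricci UNIV gp ?x (0, v) (0, w)
     = fst (curvature_op UNIV gp ?x (1, 0) (0, v) (0, w))
       + (\<Sum>e\<in>Basis. snd (curvature_op UNIV gp ?x (0, e) (0, v) (0, w)) \<bullet> e)"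
    by (simp add: ricci_def sum_Basis_real_times inner_prod_def)
  also have "\<dots> = ricci UNIV (\<lambda>y. h (t, y)) y v w + h ?x (dK ?x v) w + (\<Sum>e\<in>Basis. Kop ?x e \<bullet> e) * (ht ?x v w / 2)"
  proof -
    have "(\<Sum>e\<in>Basis. snd (curvature_op UNIV gp ?x (0, e) (0, v) (0, w)) \<bullet> e)
      = ricci UNIV (\<lambda>y. h (t, y)) y v w + (ht ?x v w / 2) * (\<Sum>e\<in>Basis. Kop ?x e \<bullet> e) - ht ?x (Kop ?x v) w / 2"
      by (simp only: space ricci_def inner_diff_left inner_add_left sum_subtractf sum.distrib
          inner_scaleR_left sum_distrib_left tr)
    then show ?thesis by (simp only: time) simp
  qed
  finally show ?thesis
    by (simp add: h_lin[OF x] Gam_ts(3)[OF x])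
qed

text \<open>When the spatial Ricci components vanish, \<open>ricci_ss\<close> exhibits the vector
  that represents the Ricci form of the slice, so raising the index is an instance of
  \<open>sharp_unique\<close>.\<close>

lemma scalar_curvature_slice:
  assumes x: "(t, y) \<in> I \<times> N" and ricci: "\<And>v w. ricci UNIV gp (t, y) (0, v) (0, w) = 0"
  shows "scalar_curvature UNIV (\<lambda>y. h (t, y)) y
     = - (\<Sum>e\<in>Basis. dK (t, y) e \<bullet> e) - (\<Sum>e\<in>Basis. Kop (t, y) e \<bullet> e)\<^sup>2"
proof -
  let ?tr = "\<Sum>e\<in>Basis. Kop (t, y) e \<bullet> e"
  have "sharp (h (t, y)) (ricci UNIV (\<lambda>y. h (t, y)) y v) = - (dK (t, y) v + ?tr *\<^sub>R Kop (t, y) v)" for v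
  proof (rule sharp_unique[OF h_nondeg[OF x]])
    show "h (t, y) (- (dK (t, y) v + ?tr *\<^sub>R Kop (t, y) v)) w = ricci UNIV (\<lambda>y. h (t, y)) y v w" for w
      using ricci[of v w] unfolding ricci_ss[OF x] h_lin(7)[OF x] by linarith
  qed
  then show ?thesis
    by (simp add: scalar_curvature_def inner_diff_left sum_subtractf sum_negf power2_eq_square
        sum_distrib_left)
qed

end

section \<open>An inequality for self-adjoint operators\<close>

locale inner_product =
  fixes g :: "'e::euclidean_space \<Rightarrow> 'e \<Rightarrow> real"
  assumes bil: "bilinear g" and sym: "g u v = g v u" and pos: "u \<noteq> 0 \<Longrightarrow> g u u > 0"
begin

lemmas lin = bilinear_ladd[OF bil] bilinear_radd[OF bil] bilinear_lmul[OF bil] bilinear_rmul[OF bil]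
  bilinear_lsub[OF bil] bilinear_rsub[OF bil] bilinear_lzero[OF bil] bilinear_rzero[OF bil]

lemma nonneg: "g u u \<ge> 0"
  using pos[of u] lin by (cases "u = 0") auto

lemma nondeg: "nondeg_form g"
  unfolding nondeg_form_def using bil sym pos by (metis less_irrefl)

lemma sum_left: "g (\<Sum>i\<in>F. f i) v = (\<Sum>i\<in>F. g (f i) v)"
  using linear_sum[of "\<lambda>u. g u v" f F] bil by (simp add: bilinear_def)

section \<open>Orthonormal bases and traces of squares\<close>

definition orthonormal :: "'e set \<Rightarrow> bool" where
  "orthonormal F \<longleftrightarrow> finite F \<and> (\<forall>e\<in>F. g e e = 1) \<and> (\<forall>e\<in>F. \<forall>f\<in>F. e \<noteq> f \<longrightarrow> g e f = 0)"

lemma orthonormal_coeff: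
  assumes F: "orthonormal F" and f: "f \<in> F" shows "g (\<Sum>e\<in>F. c e *\<^sub>R e) f = c f"
proof -
  have "g (\<Sum>e\<in>F. c e *\<^sub>R e) f = (\<Sum>e\<in>F. if e = f then c f else 0)"
    unfolding sum_left using F f by (intro sum.cong) (auto simp: orthonormal_def lin)
  also have "\<dots> = c f" using F f by (simp add: orthonormal_def)
  finally show ?thesis .
qed

lemma orthonormal_independent: "orthonormal F \<Longrightarrow> independent F"
proof
  assume F: "orthonormal F" and "dependent F"
  then obtain c f where "f \<in> F" "c f \<noteq> 0" "(\<Sum>e\<in>F. c e *\<^sub>R e) = 0"
    using dependent_finite[of F] by (auto simp: orthonormal_def)
  with orthonormal_coeff[OF F, of f c] show False by (simp add: lin)
qed

lemma orthonormal_exists: "k \<le> DIM('e) \<Longrightarrow> \<exists>F. orthonormal F \<and> card F = k"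
proof (induction k)
  case 0
  show ?case by (intro exI[of _ "{}"]) (simp add: orthonormal_def)
next
  case (Suc k)
  then obtain F where F: "orthonormal F" "card F = k" by auto
  have "span F \<noteq> UNIV"
    using dim_le_card'[of F] F Suc.prems dim_UNIV[where 'a = 'e] by (metis dim_span not_less_eq_eq orthonormal_def)
  then obtain v where v: "v \<notin> span F" by auto
  \<comment> \<open>One Gram-Schmidt step with respect to \<open>g\<close>, for a vector outside the
    span of the system found so far.\<close>
  define w where "w = v - (\<Sum>e\<in>F. g v e *\<^sub>R e)"
  have "(\<Sum>e\<in>F. g v e *\<^sub>R e) \<in> span F" by (intro span_sum span_scale span_base)
  with v have w0: "w \<noteq> 0" unfolding w_def by auto
  have wF: "g w f = 0" if "f \<in> F" for f
    unfolding w_def using orthonormal_coeff[OF F(1) that, of "\<lambda>e. g v e"] by (simp add: lin)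
  define e where "e = (1 / sqrt (g w w)) *\<^sub>R w"
  have ee: "g e e = 1" using pos[OF w0] by (simp add: e_def lin)
  have eF: "g e f = 0" "g f e = 0" if "f \<in> F" for f
    using wF[OF that] sym[of f w] by (simp_all add: e_def lin)
  have "e \<notin> F" using ee eF by force
  moreover have "orthonormal (insert e F)"
    using F(1) ee eF unfolding orthonormal_def by auto
  ultimately show ?case using F by (intro exI[of _ "insert e F"]) (simp add: orthonormal_def)
qed

text \<open>In a \<open>g\<close>-orthonormal basis the trace is the sum of the squared
  \<open>g\<close>-lengths of \<open>B e\<close>. The trace is defined by the standard basis, which
  need not be \<open>g\<close>-orthonormal, so one argument is expanded in \<open>F\<close> and the
  sums are exchanged.\<close>

lemma trace_square_nonneg:
  assumes B: "linear B" and adj: "\<And>x y. g (B x) y = g x (B y)"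
  shows "0 \<le> (\<Sum>b\<in>Basis. B (B b) \<bullet> b)"
proof -
  obtain F where F: "orthonormal F" "card F = DIM('e)" using orthonormal_exists[OF order_refl] by auto
  have fin: "finite F" using F by (simp add: orthonormal_def)
  have span: "span F = UNIV"
    using card_eq_dim[of F UNIV] F orthonormal_independent[OF F(1)] fin by auto
  have rep: "x = (\<Sum>e\<in>F. g x e *\<^sub>R e)" for x
  proof -
    have "x \<in> span F" using span by simp
    then obtain c where c: "x = (\<Sum>e\<in>F. c e *\<^sub>R e)"
      using span_finite[OF fin] by auto
    have "g x e = c e" if "e \<in> F" for e
      unfolding c by (rule orthonormal_coeff[OF F(1) that])
    then show ?thesis by (subst c) (auto intro!: sum.cong)
  qed
  have "(\<Sum>b\<in>Basis. B (B b) \<bullet> b) = (\<Sum>b\<in>Basis. \<Sum>e\<in>F. g (B (B b)) e * (e \<bullet> b))"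
    by (intro sum.cong refl, subst rep) (simp add: inner_sum_left)
  also have "\<dots> = (\<Sum>e\<in>F. \<Sum>b\<in>Basis. (e \<bullet> b) * g (B (B b)) e)"
    by (subst sum.swap) (simp add: mult.commute)
  also have "\<dots> = (\<Sum>e\<in>F. g (B (B e)) e)"
  proof (intro sum.cong refl)
    fix e
    have "linear (\<lambda>b. g (B (B b)) e)"
      by (rule linearI) (simp_all add: linear_add[OF B] linear_scale[OF B] lin)
    from linear_sum_Basis[OF this, of e] show "(\<Sum>b\<in>Basis. (e \<bullet> b) * g (B (B b)) e) = g (B (B e)) e" by simp
  qed
  also have "\<dots> = (\<Sum>e\<in>F. g (B e) (B e))"
    using adj by simp
  also have "\<dots> \<ge> 0" by (intro sum_nonneg nonneg)
  finally show ?thesis .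
qed

text \<open>Nonnegativity of the trace of the square, for \<open>L\<close> plus a multiple of the
  identity and of the rank-one operator along \<open>u\<close>. The choice of \<open>a\<close> and
  \<open>b\<close> replaces a diagonalization of \<open>L\<close>.\<close>

lemma trace_perturbation:
  assumes L: "linear L" and adj: "\<And>x y. g (L x) y = g x (L y)"
  shows "0 \<le> (\<Sum>b\<in>Basis. L (L b) \<bullet> b) + a\<^sup>2 * real DIM('e) + b\<^sup>2 * (g u u)\<^sup>2
     + 2 * a * (\<Sum>b\<in>Basis. L b \<bullet> b) + 2 * b * g (L u) u + 2 * a * b * g u u"
proof -
  define B where "B x = L x + a *\<^sub>R x + (b * g u x) *\<^sub>R u" for x
  have B: "linear B"
    by (rule linearI) (simp_all add: B_def linear_add[OF L] linear_scale[OF L] lin algebra_simps)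
  have Badj: "g (B x) y = g x (B y)" for x y
    using adj[of x y] sym[of u x] by (simp add: B_def lin algebra_simps)
  have rank1: "(\<Sum>c\<in>Basis. \<alpha> c * (v \<bullet> c)) = \<alpha> v" if "linear \<alpha>" for \<alpha> and v :: 'e
    using linear_sum_Basis[OF that, of v] by (simp add: mult.commute)
  have l: "linear (g u)" "linear (\<lambda>x. g u (L x))"
    using bil adj by (auto simp: bilinear_def intro!: linear_compose[OF L, unfolded o_def])
  have BB: "B (B c) \<bullet> c = L (L c) \<bullet> c + (2 * a) * (L c \<bullet> c) + a\<^sup>2 * (c \<bullet> c)
     + b * (g u c * (L u \<bullet> c)) + b * (g u (L c) * (u \<bullet> c)) + (2 * a * b + b\<^sup>2 * g u u) * (g u c * (u \<bullet> c))" for c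
    by (simp add: B_def linear_add[OF L] linear_scale[OF L] lin inner_add_left algebra_simps power2_eq_square)
  have "0 \<le> (\<Sum>c\<in>Basis. B (B c) \<bullet> c)"
    by (rule trace_square_nonneg[OF B Badj])
  also have "\<dots> = (\<Sum>c\<in>Basis. L (L c) \<bullet> c) + (2 * a) * (\<Sum>c\<in>Basis. L c \<bullet> c) + a\<^sup>2 * real DIM('e)
     + b * g u (L u) + b * g u (L u) + (2 * a * b + b\<^sup>2 * g u u) * g u u"
    by (simp only: BB sum.distrib sum_distrib_left[symmetric] rank1[OF l(1)] rank1[OF l(2)]) simp
  finally show ?thesis
    using adj[of u u] by (simp add: algebra_simps power2_eq_square)
qed

text \<open>In an eigenbasis with \<open>u\<close> along the first eigenvector the claim reads
  \<open>- x s \<le> x\<^sup>2 + (s - x)\<^sup>2 / (n - 1)\<close> with \<open>s\<close> the trace, a quadratic form whose discriminant is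
  a positive multiple of \<open>(n - 1) (n - 9)\<close>. The coefficients \<open>a\<close> and \<open>b\<close> below subtract the
  optimal multiples of the identity and of the projection to \<open>u\<close>.\<close>

lemma trace_inequality:
  assumes L: "linear L" and adj: "\<And>x y. g (L x) y = g x (L y)" and dim: "DIM('e) \<le> 9"
  shows "- (\<Sum>b\<in>Basis. L b \<bullet> b) * g (L u) u \<le> (\<Sum>b\<in>Basis. L (L b) \<bullet> b) * g u u"
proof (cases "u = 0")
  case True
  then show ?thesis by (simp add: lin)
next
  case False
  define s S w q n where "s = (\<Sum>b\<in>Basis. L b \<bullet> b)" and "S = (\<Sum>b\<in>Basis. L (L b) \<bullet> b)" and "w = g u u"
    and "q = g (L u) u" and "n = real DIM('e)"
  have w: "w > 0" using pos[OF False] by (simp add: w_def)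
  have key: "0 \<le> S + a\<^sup>2 * n + b\<^sup>2 * w\<^sup>2 + 2 * a * s + 2 * b * q + 2 * a * b * w" for a b
    using trace_perturbation[OF L adj] unfolding s_def S_def w_def q_def n_def by blast
  have S0: "S \<ge> 0" using key[of 0 0] by simp
  have "- s * q \<le> S * w"
  proof (cases "DIM('e) = 1")
    case True
    \<comment> \<open>The quotient \<open>c\<close> below would divide by zero here. With this
      \<open>a\<close> the quadratic terms in \<open>b\<close> cancel; a function affine in
      \<open>b\<close> is bounded below only if its slope vanishes, which identifies
      \<open>q\<close> with \<open>w * s\<close>.\<close>
    have k: "0 \<le> S + 2 * b * (q - w * s)" for b
      using key[of "- b * w" b] True by (simp add: n_def algebra_simps power2_eq_square)
    have "q = w * s"
    proof (rule ccontr)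
      assume "q \<noteq> w * s"
      then have "d \<noteq> 0 \<Longrightarrow> 2 * (- (S + 1) / (2 * d)) * d = - (S + 1)" and "q - w * s \<noteq> 0" for d
        by simp_all
      from this(1)[OF this(2)] have "2 * (- (S + 1) / (2 * (q - w * s))) * (q - w * s) = - (S + 1)" .
      with k[of "- (S + 1) / (2 * (q - w * s))"] show False by linarith
    qed
    then have "- s * q = - (w * s\<^sup>2)" by (simp add: power2_eq_square)
    also have "\<dots> \<le> 0" using w by simp
    also have "0 \<le> S * w" using S0 w by simp
    finally show ?thesis .
  next
    case False
    then have n: "n \<ge> 2" "n \<le> 9" unfolding n_def using dim DIM_positive[where 'a = 'e] by linarith+
    define x where "x = q / w"
    have q: "q = x * w" using w by (simp add: x_def)
    \<comment> \<open>\<open>x\<close> is the Rayleigh quotient of \<open>u\<close>, and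
      \<open>c\<close> the mean of the other eigenvalues in the case that \<open>u\<close> is an
      eigenvector.\<close>
    define c where "c = (s - x) / (n - 1)"
    have c: "s = x + c * (n - 1)" using n by (simp add: c_def)
    have "0 \<le> S + (- c)\<^sup>2 * n + ((c - x) / w)\<^sup>2 * w\<^sup>2 + 2 * (- c) * s + 2 * ((c - x) / w) * q + 2 * (- c) * ((c - x) / w) * w"
      by (rule key)
    also have "\<dots> = S + c\<^sup>2 * n + (c - x)\<^sup>2 - 2 * c * s + 2 * (c - x) * x - 2 * c * (c - x)"
      using w by (simp add: q power_divide)
    also have "\<dots> = S - (x\<^sup>2 + c\<^sup>2 * (n - 1))"
      unfolding c by (simp add: algebra_simps power2_eq_square)
    finally have S: "x\<^sup>2 + c\<^sup>2 * (n - 1) \<le> S" by simp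
    have "0 \<le> (n - 1) * (9 - n)" using n by simp
    then have d: "(n - 1)\<^sup>2 \<le> 8 * (n - 1)" by (simp add: algebra_simps power2_eq_square)
    \<comment> \<open>Eight times the difference of the two sides of the next inequality, with the
      square in \<open>x\<close> completed; \<open>n \<le> 9\<close> makes the second summand
      nonnegative.\<close>
    have "0 \<le> (4 * x + c * (n - 1))\<^sup>2 + c\<^sup>2 * (8 * (n - 1) - (n - 1)\<^sup>2)"
      using d by (intro add_nonneg_nonneg mult_nonneg_nonneg) auto
    then have "- s * x \<le> x\<^sup>2 + c\<^sup>2 * (n - 1)"
      unfolding c by (simp add: algebra_simps power2_eq_square)
    with S have "- s * x \<le> S" by linarith
    then have "- s * x * w \<le> S * w" using w by (intro mult_right_mono) auto
    then show ?thesis by (simp add: q)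
  qed
  then show ?thesis by (simp add: s_def S_def w_def q_def)
qed

end

section \<open>Spatially homogeneous metrics in a left-invariant frame\<close>

lemma trace_eq_sum_Basis: "(\<Sum>b\<in>Basis. (X *v b) \<bullet> b) = trace (X :: real^'n::finite^'n)"
proof -
  have B: "(Basis :: (real^'n) set) = range (\<lambda>i. axis i 1)"
    unfolding Basis_vec_def by auto
  have "inj (\<lambda>i. axis i (1::real) :: real^'n)"
    by (rule injI) (metis axis_eq_axis zero_neq_one)
  then have "(\<Sum>b\<in>Basis. (X *v b) \<bullet> b) = (\<Sum>i\<in>UNIV. (X *v axis i 1) \<bullet> axis i 1)"
    unfolding B by (simp add: sum.reindex)
  also have "\<dots> = trace X"
    by (simp add: trace_def inner_axis matrix_vector_mult_basis column_def)
  finally show ?thesis .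
qed

text \<open>\<open>th y\<close> is the coframe in a chart, as a linear map to the frame components.
  All dependence on time sits in \<open>gm\<close>, all dependence on the point in
  \<open>th\<close>. The value \<open>t = T\<close> is left out to make the domain open.\<close>

locale homogeneous_metric =
  fixes T :: real and N :: "(real^'n::finite) set" and th :: "real^'n \<Rightarrow> real^'n \<Rightarrow> real^'n"
    and gm :: "real \<Rightarrow> real^'n^'n"
  assumes N_open: "open N"
    and th_linear: "\<And>y. y \<in> N \<Longrightarrow> linear (th y)" and th_inj: "\<And>y. y \<in> N \<Longrightarrow> inj (th y)"
    and th_smooth: "\<And>u. smooth_on N (\<lambda>y. th y u)"
    and gm_smooth: "smooth_on {T<..} gm"
    and gm_sym: "\<And>t. t > T \<Longrightarrow> transpose (gm t) = gm t"
    and gm_pos: "\<And>t v. t > T \<Longrightarrow> v \<noteq> 0 \<Longrightarrow> v \<bullet> (gm t *v v) > 0"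
begin

definition hh :: "real \<times> (real^'n) \<Rightarrow> real^'n \<Rightarrow> real^'n \<Rightarrow> real" where
  "hh x u v = th (snd x) u \<bullet> (gm (fst x) *v th (snd x) v)"

definition gm' :: "real \<Rightarrow> real^'n^'n" where
  "gm' t = vector_derivative gm (at t)"

text \<open>Since \<open>\<partial>\<^sub>t g = - 2 k\<close>, this is the matrix of \<open>- k\<close> with one index raised.\<close>

definition mat_K :: "real \<Rightarrow> real^'n^'n" where
  "mat_K t = (1/2) *\<^sub>R (matrix_inv (gm t) ** gm' t)"

lemma gm_inner_sym: "t > T \<Longrightarrow> u \<bullet> (gm t *v v) = (gm t *v u) \<bullet> v"
  using gm_sym dot_lmul_matrix[of u "gm t" v] by (metis transpose_matrix_vector)

lemma gm_form: "t > T \<Longrightarrow> inner_product (\<lambda>u v. u \<bullet> (gm t *v v))"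
proof
  assume t: "t > T"
  show "bilinear (\<lambda>u v. u \<bullet> (gm t *v v))"
    by (auto simp: bilinear_def linear_iff inner_add_left inner_add_right
      matrix_vector_right_distrib matrix_vector_mult_scaleR)
  show "u \<bullet> (gm t *v v) = v \<bullet> (gm t *v u)" for u v
    using gm_inner_sym[OF t, of u v] by (simp only: inner_commute)
  show "u \<bullet> (gm t *v u) > 0" if "u \<noteq> 0" for u
    by (rule gm_pos[OF t that])
qed

lemma th_zero: "y \<in> N \<Longrightarrow> u \<noteq> 0 \<Longrightarrow> th y u \<noteq> 0"
  using th_linear th_inj linear_injective_0 by blast

lemma th_surj: "y \<in> N \<Longrightarrow> \<exists>u. th y u = w"
  using linear_injective_imp_surjective[OF th_linear th_inj] by (metis surjD)

lemma hh_nondeg: assumes "x \<in> {T<..} \<times> N" shows "nondeg_form (hh x)"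
proof -
  obtain t y where x: "x = (t, y)" "t > T" "y \<in> N" using assms by auto
  interpret G: inner_product "\<lambda>u v. u \<bullet> (gm t *v v)" by (rule gm_form[OF x(2)])
  have l: "linear (th y)" by (rule th_linear[OF x(3)])
  interpret inner_product "hh x"
  proof
    show "bilinear (hh x)"
      unfolding bilinear_def by (intro conjI allI linearI)
        (simp_all add: hh_def x linear_add[OF l] linear_scale[OF l] inner_add_left inner_add_right
          matrix_vector_right_distrib matrix_vector_mult_scaleR)
    show "hh x u v = hh x v u" for u v unfolding hh_def x fst_conv snd_conv by (rule G.sym)
    show "hh x u u > 0" if "u \<noteq> 0" for u
      unfolding hh_def x fst_conv snd_conv using th_zero[OF x(3) that] by (rule G.pos)
  qed
  show ?thesis by (rule nondeg)
qed

lemma gm_entry_smooth: "smooth_on {T<..} (\<lambda>t. u \<bullet> (gm t *v v))"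
proof -
  have "bounded_linear (\<lambda>M::real^'n^'n. u \<bullet> (M *v v))"
    unfolding linear_conv_bounded_linear[symmetric]
    by (rule linearI) (simp_all add: matrix_vector_mult_add_rdistrib inner_add_right scaleR_matrix_vector_assoc[symmetric])
  from smooth_on_linear[OF this _ gm_smooth] show ?thesis by simp
qed

lemma fst_smooth: "smooth_on {T<..} f \<Longrightarrow> smooth_on ({T<..} \<times> N) (\<lambda>x. f (fst x))"
  by (rule smooth_on_compose_linear[OF bounded_linear_fst, of "{T<..}"]) (auto intro: open_Times N_open)

lemma snd_smooth: "smooth_on N f \<Longrightarrow> smooth_on ({T<..} \<times> N) (\<lambda>x. f (snd x))"
  by (rule smooth_on_compose_linear[OF bounded_linear_snd N_open]) (auto intro: open_Times N_open)

text \<open>Separation of variables: each summand is a product of functions of the point alone and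
  of time alone, which reduces smoothness to \<open>fst_smooth\<close> and
  \<open>snd_smooth\<close>.\<close>

lemma hh_expand:
  "hh x u v = (\<Sum>a\<in>Basis. \<Sum>b\<in>Basis. (th (snd x) u \<bullet> a) * (th (snd x) v \<bullet> b) * (a \<bullet> (gm (fst x) *v b)))"
proof -
  let ?M = "gm (fst x)"
  have b: "bilinear (\<lambda>u v. u \<bullet> (?M *v v))"
    by (auto simp: bilinear_def linear_iff inner_add_left inner_add_right
      matrix_vector_right_distrib matrix_vector_mult_scaleR)
  have "hh x u v = (\<Sum>a\<in>Basis. (th (snd x) u \<bullet> a) * (a \<bullet> (?M *v th (snd x) v)))"
    unfolding hh_def using linear_sum_Basis[of "\<lambda>u. u \<bullet> (?M *v th (snd x) v)" "th (snd x) u"] b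
    by (simp add: bilinear_def)
  also have "\<dots> = (\<Sum>a\<in>Basis. (th (snd x) u \<bullet> a) * (\<Sum>b\<in>Basis. (th (snd x) v \<bullet> b) * (a \<bullet> (?M *v b))))"
  proof (intro sum.cong refl)
    fix a :: "real^'n"
    have "linear (\<lambda>v. a \<bullet> (?M *v v))" using b by (simp add: bilinear_def)
    from linear_sum_Basis[OF this, of "th (snd x) v"]
    show "(th (snd x) u \<bullet> a) * (a \<bullet> (?M *v th (snd x) v)) =
       (th (snd x) u \<bullet> a) * (\<Sum>b\<in>Basis. (th (snd x) v \<bullet> b) * (a \<bullet> (?M *v b)))" by simp
  qed
  finally show ?thesis by (simp add: sum_distrib_left mult.assoc)
qed

lemma hh_smooth: "smooth_on ({T<..} \<times> N) (\<lambda>x. hh x u v)"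
  unfolding hh_expand
  by (intro smooth_on_sum smooth_on_mult smooth_on_inner fst_smooth[OF gm_entry_smooth]
      snd_smooth[OF th_smooth] smooth_on_const open_Times N_open open_greaterThan)

sublocale gaussian_metric "{T<..}" N hh
  by unfold_locales (auto simp: N_open intro: hh_nondeg[simplified] hh_smooth)

section \<open>Time derivative of the metric and the vacuum equations\<close>

lemma gm_derivative: "t > T \<Longrightarrow> (gm has_vector_derivative gm' t) (at t)"
  unfolding gm'_def using smooth_on_has_derivative[OF gm_smooth open_greaterThan, of t]
  by (metis differentiableI greaterThan_iff vector_derivative_works)

lemma gm'_entry:
  "t > T \<Longrightarrow> ((\<lambda>t. u \<bullet> (gm t *v v)) has_real_derivative u \<bullet> (gm' t *v v)) (at t)"
proof -
  assume t: "t > T"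
  have b: "bounded_linear (\<lambda>M::real^'n^'n. u \<bullet> (M *v v))"
    unfolding linear_conv_bounded_linear[symmetric]
    by (rule linearI) (simp_all add: matrix_vector_mult_add_rdistrib inner_add_right scaleR_matrix_vector_assoc[symmetric])
  from bounded_linear.has_vector_derivative[OF b gm_derivative[OF t]]
  show ?thesis by (simp add: has_real_derivative_iff_has_vector_derivative)
qed

lemma gm'_sym: assumes t: "t > T" shows "u \<bullet> (gm' t *v v) = v \<bullet> (gm' t *v u)"
proof -
  have "((\<lambda>t. v \<bullet> (gm t *v u)) has_real_derivative u \<bullet> (gm' t *v v)) (at t)"
    by (rule has_field_derivative_transform_within_open[OF gm'_entry[OF t, of u v] open_greaterThan])
      (use t inner_product.sym[OF gm_form] in auto)
  then show ?thesis using DERIV_unique[OF _ gm'_entry[OF t, of v u]] by blast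
qed

lemma ht_eq:
  assumes "t > T" "y \<in> N" shows "ht (t, y) u v = th y u \<bullet> (gm' t *v th y v)"
proof -
  have x: "(t, y) \<in> {T<..} \<times> N" using assms by auto
  have "((\<lambda>t. (t, y)) has_derivative (\<lambda>r. (r, 0))) (at t)"
    by (auto intro!: derivative_eq_intros)
  from has_derivative_compose[OF this smooth_on_has_derivative[OF hh_smooth IN x]]
  have "((\<lambda>t. hh (t, y) u v) has_derivative (\<lambda>r. dir_deriv UNIV (\<lambda>x. hh x u v) (t, y) (r, 0))) (at t)" .
  moreover have "((\<lambda>t. hh (t, y) u v) has_derivative (\<lambda>r. (th y u \<bullet> (gm' t *v th y v)) * r)) (at t)"
    using gm'_entry[OF assms(1), of "th y u" "th y v"] by (simp add: hh_def has_field_derivative_def)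
  ultimately have "dir_deriv UNIV (\<lambda>x. hh x u v) (t, y) (1, 0) = (th y u \<bullet> (gm' t *v th y v)) * 1"
    by (metis has_derivative_unique)
  then show ?thesis by (simp add: ht_def)
qed

lemma gm_inverse: assumes t: "t > T" shows "gm t ** matrix_inv (gm t) = mat 1"
proof -
  have "invertible (gm t)"
    unfolding invertible_left_inverse matrix_left_invertible_ker
    using gm_pos[OF t] by (metis inner_zero_right less_irrefl)
  then show ?thesis
    unfolding invertible_def matrix_inv_def by (rule someI2_ex) simp
qed

lemma gm_mat_K: "t > T \<Longrightarrow> gm t *v (mat_K t *v w) = (1/2) *\<^sub>R (gm' t *v w)"
  using gm_inverse[of t]
  by (simp add: mat_K_def scaleR_matrix_vector_assoc[symmetric] matrix_vector_mult_scaleR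
      matrix_vector_mul_assoc matrix_mul_assoc)

text \<open>In the left-invariant frame the Weingarten map is a matrix that does not depend on the
  point; its traces are therefore functions of time alone.\<close>

lemma th_Kop:
  assumes "t > T" "y \<in> N" shows "th y (Kop (t, y) u) = mat_K t *v th y u"
proof -
  have x: "(t, y) \<in> {T<..} \<times> N" using assms by auto
  interpret G: inner_product "\<lambda>u v. u \<bullet> (gm t *v v)" by (rule gm_form[OF assms(1)])
  show ?thesis
  proof (rule nondeg_formD(5)[OF G.nondeg])
    fix w
    obtain v where v: "w = th y v" using th_surj[OF assms(2)] by metis
    have "th y (Kop (t, y) u) \<bullet> (gm t *v w) = hh (t, y) (Kop (t, y) u) v"
      by (simp add: hh_def v)
    also have "\<dots> = (th y v \<bullet> (gm' t *v th y u)) / 2"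
      using Gam_ts(3)[OF x] ht_eq[OF assms] gm'_sym[OF assms(1)] by metis
    also have "\<dots> = th y v \<bullet> (gm t *v (mat_K t *v th y u))"
      by (simp add: gm_mat_K[OF assms(1)])
    finally show "th y (Kop (t, y) u) \<bullet> (gm t *v w) = (mat_K t *v th y u) \<bullet> (gm t *v w)"
      using G.sym[of w "mat_K t *v th y u"] by (simp add: v)
  qed
qed

lemma trace_Kop:
  assumes "t > T" "y \<in> N"
  shows "(\<Sum>e\<in>Basis. Kop (t, y) e \<bullet> e) = trace (mat_K t)"
    "(\<Sum>e\<in>Basis. Kop (t, y) (Kop (t, y) e) \<bullet> e) = trace (mat_K t ** mat_K t)"
proof -
  have x: "(t, y) \<in> {T<..} \<times> N" using assms by auto
  obtain R where R: "linear R" "R \<circ> th y = id"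
    using linear_injective_left_inverse[OF th_linear[OF assms(2)] th_inj[OF assms(2)]] by auto
  have R': "th y \<circ> R = id" using linear_inverse_left[OF R(1) th_linear[OF assms(2)]] R(2) by simp
  note K = Kop_linear[OF x]
  show "(\<Sum>e\<in>Basis. Kop (t, y) e \<bullet> e) = trace (mat_K t)"
    unfolding trace_eq_sum_Basis[symmetric]
    by (rule trace_conjugate[OF th_linear[OF assms(2)] R(1) _ _ K, symmetric])
      (use R R' th_Kop[OF assms] in \<open>auto simp: fun_eq_iff\<close>)
  have "linear (\<lambda>e. Kop (t, y) (Kop (t, y) e))"
    using linear_compose[OF K K] by (simp add: o_def)
  then show "(\<Sum>e\<in>Basis. Kop (t, y) (Kop (t, y) e) \<bullet> e) = trace (mat_K t ** mat_K t)"
    unfolding trace_eq_sum_Basis[symmetric]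
    by (intro trace_conjugate[OF th_linear[OF assms(2)] R(1), symmetric])
      (use R R' th_Kop[OF assms] in \<open>auto simp: fun_eq_iff matrix_vector_mul_assoc[symmetric]\<close>)
qed

text \<open>The derivative is taken through \<open>Kop\<close> at a fixed point \<open>y\<close>,
  whose smoothness is known; this avoids differentiating the inverse matrix in
  \<open>mat_K\<close>.\<close>

lemma trace_mat_K_derivative:
  assumes "t > T" "y \<in> N"
  shows "((\<lambda>t. trace (mat_K t)) has_real_derivative (\<Sum>e\<in>Basis. dK (t, y) e \<bullet> e)) (at t)"
proof (rule has_field_derivative_transform_within_open[OF _ open_greaterThan])
  have x: "(t, y) \<in> {T<..} \<times> N" using assms by auto
  have "((\<lambda>t. Kop (t, y) e) has_vector_derivative dK (t, y) e) (at t)" for e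
  proof -
    have d: "((\<lambda>t. (t, y)) has_derivative (\<lambda>r. (r, 0))) (at t)"
      by (auto intro!: derivative_eq_intros)
    note k = smooth_on_has_derivative[OF Kop_smooth IN x, of e]
    have "(r, 0) = r *\<^sub>R (1, 0 :: real^'n)" for r :: real by simp
    then have "dir_deriv UNIV (\<lambda>x. Kop x e) (t, y) (r, 0) = r *\<^sub>R dK (t, y) e" for r
      unfolding dK_def using linear_scale[OF has_derivative_linear[OF k]] by metis
    with has_derivative_compose[OF d k] show ?thesis by (simp add: has_vector_derivative_def)
  qed
  then show "((\<lambda>t. \<Sum>e\<in>Basis. Kop (t, y) e \<bullet> e) has_real_derivative (\<Sum>e\<in>Basis. dK (t, y) e \<bullet> e)) (at t)"
    by (intro DERIV_sum) (metis bounded_linear.has_vector_derivative[OF bounded_linear_inner_left]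
        has_real_derivative_iff_has_vector_derivative)
  show "(\<Sum>e\<in>Basis. Kop (t', y) e \<bullet> e) = trace (mat_K t')" if "t' \<in> {T<..}" for t'
    using trace_Kop(1)[of t' y] that assms by simp
qed (use assms in simp)

lemma raychaudhuri:
  assumes "t > T" "y \<in> N" and "ricci UNIV gp (t, y) (1, 0) (1, 0) = 0"
  shows "((\<lambda>t. trace (mat_K t)) has_real_derivative - trace (mat_K t ** mat_K t)) (at t)"
proof -
  have x: "(t, y) \<in> {T<..} \<times> N" using assms by auto
  have "(\<Sum>e\<in>Basis. dK (t, y) e \<bullet> e) = - trace (mat_K t ** mat_K t)"
    using ricci_tt[OF x] trace_Kop[OF assms(1,2)] assms(3) by simp
  with trace_mat_K_derivative[OF assms(1,2)] show ?thesis by simp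
qed

text \<open>\<open>scalar_curvature_slice\<close> still contains the trace of \<open>dK\<close>,
  which the time-time component of the vacuum equations turns into the trace of the square.\<close>

lemma hamiltonian_constraint:
  assumes "t > T" "y \<in> N" and "\<And>v w. ricci UNIV gp (t, y) v w = 0"
  shows "scalar_curvature UNIV (\<lambda>y. hh (t, y)) y = trace (mat_K t ** mat_K t) - (trace (mat_K t))\<^sup>2"
proof -
  have x: "(t, y) \<in> {T<..} \<times> N" using assms by auto
  have "(\<Sum>e\<in>Basis. dK (t, y) e \<bullet> e) = - trace (mat_K t ** mat_K t)"
    using ricci_tt[OF x] trace_Kop[OF assms(1,2)] assms(3) by simp
  then show ?thesis
    using scalar_curvature_slice[OF x assms(3)] trace_Kop[OF assms(1,2)] by simp
qed

lemma mean_curvature_eq: "t > T \<Longrightarrow> mean_curvature T gm t = - trace (mat_K t)"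
proof -
  assume t: "t > T"
  then have "at t within {T..} = at t" by (intro at_within_interior) simp
  then have "second_fundamental_form T gm t = - ((1/2) *\<^sub>R gm' t)"
    unfolding second_fundamental_form_def gm'_def by simp
  then have "matrix_inv (gm t) ** second_fundamental_form T gm t = (- (1/2)) *\<^sub>R (matrix_inv (gm t) ** gm' t)"
    by (metis matrix_scalar_ac scalar_matrix_assoc scaleR_minus_left)
  then show ?thesis
    unfolding mean_curvature_def mat_K_def by (simp add: trace_def sum_negf sum_distrib_left)
qed

text \<open>\<open>mat_K t\<close> is in general not a symmetric matrix, but it is self-adjoint for
  \<open>gm t\<close> since \<open>gm' t\<close> is symmetric. The second claim is
  \<open>trace_inequality\<close> for this operator.\<close>

lemma mat_K_square_nonneg: assumes t: "t > T" shows "0 \<le> trace (mat_K t ** mat_K t)"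
  and momentum_growth: "CARD('n) \<le> 9 \<Longrightarrow>
    - trace (mat_K t) * (w \<bullet> (gm' t *v w) / 2) \<le> trace (mat_K t ** mat_K t) * (w \<bullet> (gm t *v w))"
proof -
  interpret G: inner_product "\<lambda>u v. u \<bullet> (gm t *v v)" by (rule gm_form[OF t])
  have adj: "(mat_K t *v u) \<bullet> (gm t *v v) = u \<bullet> (gm t *v (mat_K t *v v))" for u v
    using G.sym[of "mat_K t *v u" v] gm'_sym[OF t, of u v] by (simp add: gm_mat_K[OF t])
  have tr: "(\<Sum>b\<in>Basis. (mat_K t *v (mat_K t *v b)) \<bullet> b) = trace (mat_K t ** mat_K t)"
    by (simp add: trace_eq_sum_Basis[symmetric] matrix_vector_mul_assoc)
  show "0 \<le> trace (mat_K t ** mat_K t)"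
    using G.trace_square_nonneg[of "(*v) (mat_K t)", OF matrix_vector_mul_linear adj] by (simp add: tr)
  assume "CARD('n) \<le> 9"
  then show "- trace (mat_K t) * (w \<bullet> (gm' t *v w) / 2) \<le> trace (mat_K t ** mat_K t) * (w \<bullet> (gm t *v w))"
    using G.trace_inequality[of "(*v) (mat_K t)" w, OF matrix_vector_mul_linear adj]
      G.sym[of "mat_K t *v w" w]
    by (simp add: tr trace_eq_sum_Basis gm_mat_K[OF t])
qed

end

section \<open>Curves\<close>

lemma bilinear_sum_Basis:
  fixes B :: "'e::euclidean_space \<Rightarrow> 'e \<Rightarrow> 'f::real_vector"
  assumes "bilinear B"
  shows "B u v = (\<Sum>i\<in>Basis. (u \<bullet> i) *\<^sub>R (\<Sum>j\<in>Basis. (v \<bullet> j) *\<^sub>R B i j))"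
proof -
  have "B u v = (\<Sum>i\<in>Basis. (u \<bullet> i) *\<^sub>R B i v)"
    using assms by (intro linear_sum_Basis) (simp add: bilinear_def)
  moreover have "B i v = (\<Sum>j\<in>Basis. (v \<bullet> j) *\<^sub>R B i j)" for i
    using assms by (intro linear_sum_Basis) (simp add: bilinear_def)
  ultimately show ?thesis by simp
qed

lemma continuous_on_linear_field:
  fixes A :: "'x::topological_space \<Rightarrow> 'e::euclidean_space \<Rightarrow> 'f::real_normed_vector"
  assumes "\<And>y. y \<in> K \<Longrightarrow> linear (A y)" "\<And>e. continuous_on K (\<lambda>y. A y e)"
  shows "continuous_on (K \<times> W) (\<lambda>z. A (fst z) (snd z))"
proof -
  have "continuous_on (K \<times> W) (\<lambda>z. \<Sum>e\<in>Basis. (snd z \<bullet> e) *\<^sub>R A (fst z) e)"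
    by (intro continuous_intros continuous_on_compose2[OF assms(2) continuous_on_fst]) auto
  moreover have "A (fst z) (snd z) = (\<Sum>e\<in>Basis. (snd z \<bullet> e) *\<^sub>R A (fst z) e)" if "z \<in> K \<times> W" for z
    using linear_sum_Basis[OF assms(1), of "fst z" "snd z"] that by auto
  ultimately show ?thesis by (simp cong: continuous_on_cong)
qed

lemma sphere_bound_below:
  fixes f :: "'x::topological_space \<times> 'e::euclidean_space \<Rightarrow> real"
  assumes K: "compact K" and f: "continuous_on (K \<times> sphere 0 1) f" and pos: "\<And>y w. y \<in> K \<Longrightarrow> norm w = 1 \<Longrightarrow> f (y, w) > 0"
  obtains c where "c > 0" "\<And>y w. y \<in> K \<Longrightarrow> norm w = 1 \<Longrightarrow> f (y, w) \<ge> c"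
proof (cases "K \<times> sphere (0 :: 'e) 1 = {}")
  case True
  then show ?thesis using that[of 1] by (auto simp: sphere_def dist_norm)
next
  case False
  have "compact (K \<times> sphere (0 :: 'e) 1)" by (intro compact_Times K compact_sphere)
  then obtain z where z: "z \<in> K \<times> sphere 0 1" "\<And>z'. z' \<in> K \<times> sphere 0 1 \<Longrightarrow> f z \<le> f z'"
    using continuous_attains_inf[OF _ False f] by auto
  show ?thesis
    by (rule that[of "f z"]) (use z pos in \<open>auto simp: dist_norm\<close>)
qed

text \<open>Minimum over the compact set of unit vectors above \<open>K\<close>, extended by
  homogeneity. It compares the norm of a vector in coordinates with that of its frame components,
  uniformly near a point.\<close>

lemma linear_field_bound_below:
  fixes A :: "'x::topological_space \<Rightarrow> 'e::euclidean_space \<Rightarrow> 'f::real_normed_vector"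
  assumes K: "compact K" and lin: "\<And>y. y \<in> K \<Longrightarrow> linear (A y)" and inj: "\<And>y. y \<in> K \<Longrightarrow> inj (A y)"
    and cont: "\<And>e. continuous_on K (\<lambda>y. A y e)"
  obtains C where "C > 0" "\<And>y w. y \<in> K \<Longrightarrow> norm w \<le> C * norm (A y w)"
proof -
  have "continuous_on (K \<times> sphere 0 1) (\<lambda>z. norm (A (fst z) (snd z)))"
    by (intro continuous_on_norm continuous_on_linear_field lin cont)
  moreover have "norm (A (fst (y, w)) (snd (y, w))) > 0" if "y \<in> K" "norm w = 1" for y w
    using linear_injective_0[OF lin[OF that(1)]] inj[OF that(1)] that(2) by auto
  ultimately obtain c where c: "c > 0" "\<And>y w. y \<in> K \<Longrightarrow> norm w = 1 \<Longrightarrow> norm (A (fst (y, w)) (snd (y, w))) \<ge> c"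
    using sphere_bound_below[OF K, of "\<lambda>z. norm (A (fst z) (snd z))"] by blast
  show ?thesis
  proof (rule that[of "1 / c"])
    show "1 / c > 0" using c by simp
    fix y w assume y: "y \<in> K"
    show "norm w \<le> 1 / c * norm (A y w)"
    proof (cases "w = 0")
      case False
      then have "c \<le> norm (A y ((1 / norm w) *\<^sub>R w))" using c(2)[OF y, of "(1 / norm w) *\<^sub>R w"] by simp
      also have "\<dots> = norm (A y w) / norm w" by (simp add: linear_scale[OF lin[OF y]])
      finally show ?thesis using c(1) False by (simp add: field_simps)
    qed (use c(1) in simp)
  qed
qed

lemma quadratic_form_bound_below:
  fixes B :: "'x::topological_space \<Rightarrow> 'e::euclidean_space \<Rightarrow> 'e \<Rightarrow> real"
  assumes K: "compact K" and bil: "\<And>y. y \<in> K \<Longrightarrow> bilinear (B y)" and pos: "\<And>y w. y \<in> K \<Longrightarrow> w \<noteq> 0 \<Longrightarrow> B y w w > 0"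
    and cont: "\<And>u v. continuous_on K (\<lambda>y. B y u v)"
  obtains c where "c > 0" "\<And>y w. y \<in> K \<Longrightarrow> c * (norm w)\<^sup>2 \<le> B y w w"
proof -
  have "continuous_on (K \<times> sphere 0 1) (\<lambda>z. \<Sum>e\<in>Basis. (snd z \<bullet> e) *\<^sub>R B (fst z) (snd z) e)"
    by (intro continuous_intros continuous_on_linear_field[where A = "\<lambda>y u. B y u _"] cont)
      (use bil in \<open>auto simp: bilinear_def\<close>)
  moreover have "B (fst z) (snd z) (snd z) = (\<Sum>e\<in>Basis. (snd z \<bullet> e) *\<^sub>R B (fst z) (snd z) e)"
    if "z \<in> K \<times> sphere 0 1" for z
    using linear_sum_Basis[of "B (fst z) (snd z)" "snd z"] bil[of "fst z"] that unfolding bilinear_def by auto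
  ultimately have "continuous_on (K \<times> sphere 0 1) (\<lambda>z. B (fst z) (snd z) (snd z))"
    by (simp cong: continuous_on_cong)
  moreover have "B (fst (y, w)) (snd (y, w)) (snd (y, w)) > 0" if "y \<in> K" "norm w = 1" for y w
  proof -
    have "w \<noteq> 0" using that(2) by force
    then show ?thesis using pos[OF that(1)] by simp
  qed
  ultimately obtain c where c: "c > 0" "\<And>y w. y \<in> K \<Longrightarrow> norm w = 1 \<Longrightarrow> B (fst (y, w)) (snd (y, w)) (snd (y, w)) \<ge> c"
    using sphere_bound_below[OF K, of "\<lambda>z. B (fst z) (snd z) (snd z)"] by blast
  show ?thesis
  proof (rule that[OF c(1)])
    fix y w assume y: "y \<in> K"
    show "c * (norm w)\<^sup>2 \<le> B y w w"
    proof (cases "w = 0")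
      case True
      then show ?thesis using bilinear_lzero[OF bil[OF y]] by simp
    next
      case False
      then have "c \<le> B y ((1 / norm w) *\<^sub>R w) ((1 / norm w) *\<^sub>R w)"
        using c(2)[OF y, of "(1 / norm w) *\<^sub>R w"] by simp
      also have "\<dots> = B y w w / (norm w)\<^sup>2"
        by (simp add: bilinear_lmul[OF bil[OF y]] bilinear_rmul[OF bil[OF y]] power2_eq_square)
      finally show ?thesis using False by (simp add: field_simps)
    qed
  qed
qed

lemma bilinear_field_bound:
  fixes B :: "'x::topological_space \<Rightarrow> 'e::euclidean_space \<Rightarrow> 'e \<Rightarrow> 'f::real_normed_vector"
  assumes K: "compact K" and bil: "\<And>y. y \<in> K \<Longrightarrow> bilinear (B y)" and cont: "\<And>u v. continuous_on K (\<lambda>y. B y u v)"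
  obtains C where "C \<ge> 0" "\<And>y u v. y \<in> K \<Longrightarrow> norm (B y u v) \<le> C * norm u * norm v"
proof -
  have "\<exists>c. \<forall>y\<in>K. norm (B y u v) \<le> c" for u v
    using compact_imp_bounded[OF compact_continuous_image[OF cont[of u v] K]] by (auto simp: bounded_iff)
  then obtain c where c: "\<And>u v y. y \<in> K \<Longrightarrow> norm (B y u v) \<le> c u v" by metis
  define C where "C = (\<Sum>i\<in>Basis. \<Sum>j\<in>Basis. \<bar>c i j\<bar>)"
  show ?thesis
  proof (rule that[of C])
    show "C \<ge> 0" unfolding C_def by (intro sum_nonneg) auto
    fix y u v assume y: "y \<in> K"
    have "B y u v = (\<Sum>i\<in>Basis. (u \<bullet> i) *\<^sub>R (\<Sum>j\<in>Basis. (v \<bullet> j) *\<^sub>R B y i j))"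
      by (rule bilinear_sum_Basis[OF bil[OF y]])
    also have "norm \<dots> \<le> (\<Sum>i\<in>Basis. norm u * (\<Sum>j\<in>Basis. norm v * \<bar>c i j\<bar>))"
    proof (intro sum_norm_le)
      fix i :: 'e assume i: "i \<in> Basis"
      have "norm (\<Sum>j\<in>Basis. (v \<bullet> j) *\<^sub>R B y i j) \<le> (\<Sum>j\<in>Basis. norm v * \<bar>c i j\<bar>)"
      proof (intro sum_norm_le)
        fix j :: 'e assume j: "j \<in> Basis"
        have "norm (B y i j) \<le> \<bar>c i j\<bar>" using c[OF y, of i j] by linarith
        then show "norm ((v \<bullet> j) *\<^sub>R B y i j) \<le> norm v * \<bar>c i j\<bar>"
          using Basis_le_norm[OF j, of v] by (simp add: mult_mono)
      qed
      then show "norm ((u \<bullet> i) *\<^sub>R (\<Sum>j\<in>Basis. (v \<bullet> j) *\<^sub>R B y i j)) \<le> norm u * (\<Sum>j\<in>Basis. norm v * \<bar>c i j\<bar>)"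
        using Basis_le_norm[OF i, of u] by (simp add: mult_mono)
    qed
    also have "\<dots> = C * norm u * norm v"
      by (simp add: C_def sum_distrib_left sum_distrib_right mult_ac)
    finally show "norm (B y u v) \<le> C * norm u * norm v" .
  qed
qed

subsection \<open>Derivatives of curves\<close>

lemma has_vector_derivative_iff_tendsto:
  "(f has_vector_derivative l) (at s within J) \<longleftrightarrow> ((\<lambda>r. (1 / (r - s)) *\<^sub>R (f r - f s)) \<longlongrightarrow> l) (at s within J)"
proof -
  have eq: "norm ((1 / norm (r - s)) *\<^sub>R (f r - (f s + (r - s) *\<^sub>R l))) = norm ((1 / (r - s)) *\<^sub>R (f r - f s) - l)"
    if "r \<noteq> s" for r
  proof -
    have "(1 / (r - s)) *\<^sub>R (f r - f s) - l = (1 / (r - s)) *\<^sub>R (f r - (f s + (r - s) *\<^sub>R l))"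
      using that by (simp add: scaleR_diff_right scaleR_add_right)
    then show ?thesis by simp
  qed
  have "(f has_vector_derivative l) (at s within J) \<longleftrightarrow>
     ((\<lambda>r. norm ((1 / norm (r - s)) *\<^sub>R (f r - (f s + (r - s) *\<^sub>R l)))) \<longlongrightarrow> 0) (at s within J)"
    unfolding has_vector_derivative_def has_derivative_within
    by (simp only: tendsto_norm_zero_iff bounded_linear_scaleR_left simp_thms)
  also have "\<dots> \<longleftrightarrow> ((\<lambda>r. norm ((1 / (r - s)) *\<^sub>R (f r - f s) - l)) \<longlongrightarrow> 0) (at s within J)"
    by (intro filterlim_cong refl, unfold eventually_at_filter, intro always_eventually allI impI, rule eq)
  also have "\<dots> \<longleftrightarrow> ((\<lambda>r. (1 / (r - s)) *\<^sub>R (f r - f s)) \<longlongrightarrow> l) (at s within J)"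
    unfolding tendsto_norm_zero_iff LIM_zero_iff ..
  finally show ?thesis .
qed

text \<open>The difference quotient of \<open>Y\<close> solves a linear system whose matrix tends to \<open>P\<close>.\<close>

lemma has_vector_derivative_cancel_immersion:
  fixes \<phi> :: "'e::euclidean_space \<Rightarrow> 'e"
  assumes \<phi>: "(\<phi> has_derivative P) (at (Y s) within S)" and inj: "inj P"
    and Y: "(Y \<longlongrightarrow> Y s) (at s within J)" and YS: "\<And>r. r \<in> J \<Longrightarrow> Y r \<in> S" and s: "s \<in> J"
    and w: "((\<lambda>r. \<phi> (Y r)) has_vector_derivative w) (at s within J)"
  obtains v where "P v = w" "(Y has_vector_derivative v) (at s within J)"
proof -
  have P: "linear P" using \<phi> has_derivative_linear by blast
  obtain v where v: "P v = w"
    using linear_injective_imp_surjective[OF P inj] by (metis surjD)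
  define R where "R x = \<phi> x - \<phi> (Y s) - P (x - Y s)" for x
  \<comment> \<open>The rank-one correction is chosen such that \<open>A r\<close> maps
    \<open>Y r - Y s\<close> exactly to the increment of \<open>\<phi>\<close>; if
    \<open>Y r = Y s\<close>, the fraction is 0 and \<open>A r\<close> is \<open>P\<close>. Its
    columns tend to those of \<open>P\<close> because \<open>R\<close> is of smaller order than its
    argument.\<close>
  define A where "A r e = P e + (((Y r - Y s) \<bullet> e) / (norm (Y r - Y s))\<^sup>2) *\<^sub>R R (Y r)" for r e
  have Alin: "linear (A r)" for r
    by (rule linearI) (simp_all add: A_def linear_add[OF P] linear_scale[OF P] inner_add_right
        add_divide_distrib scaleR_add_left scaleR_add_right)
  have AY: "A r (Y r - Y s) = \<phi> (Y r) - \<phi> (Y s)" for r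
    by (cases "Y r = Y s") (simp_all add: A_def R_def power2_norm_eq_inner[symmetric] linear_0[OF P])
  have Alim: "((\<lambda>r. A r e) \<longlongrightarrow> P e) (at s within J)" for e
  proof (rule tendstoI)
    fix \<epsilon> :: real assume \<epsilon>: "\<epsilon> > 0"
    define \<eta> where "\<eta> = \<epsilon> / (norm e + 1)"
    have \<eta>: "\<eta> > 0" unfolding \<eta>_def using \<epsilon> by (simp add: add_nonneg_pos)
    then obtain d where d: "d > 0" "\<And>x. x \<in> S \<Longrightarrow> norm (x - Y s) < d \<Longrightarrow> norm (R x) \<le> \<eta> * norm (x - Y s)"
      using \<phi> unfolding has_derivative_within_alt R_def by blast
    have "\<forall>\<^sub>F r in at s within J. dist (Y r) (Y s) < d" by (rule tendstoD[OF Y d(1)])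
    moreover have "\<forall>\<^sub>F r in at s within J. r \<in> J" by (simp add: eventually_at_filter)
    ultimately show "\<forall>\<^sub>F r in at s within J. dist (A r e) (P e) < \<epsilon>"
    proof eventually_elim
      case (elim r)
      have "dist (A r e) (P e) = \<bar>(Y r - Y s) \<bullet> e\<bar> / (norm (Y r - Y s))\<^sup>2 * norm (R (Y r))"
        by (simp add: A_def dist_norm)
      also have "\<dots> \<le> (norm (Y r - Y s) * norm e) / (norm (Y r - Y s))\<^sup>2 * (\<eta> * norm (Y r - Y s))"
        using d(2)[OF YS[OF elim(2)]] elim(1)
        by (intro mult_mono divide_right_mono Cauchy_Schwarz_ineq2) (auto simp: dist_norm)
      also have "\<dots> \<le> norm e * \<eta>"
        using \<eta> by (cases "Y r = Y s") (simp_all add: power2_eq_square)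
      also have "\<dots> < \<epsilon>"
      proof -
        have n: "0 < norm e + 1" by (rule add_nonneg_pos) auto
        show ?thesis
          unfolding \<eta>_def times_divide_eq_right pos_divide_less_eq[OF n] using \<epsilon> by (simp add: algebra_simps)
      qed
      finally show ?case .
    qed
  qed
  have "((\<lambda>r. (1 / (r - s)) *\<^sub>R (Y r - Y s)) \<longlongrightarrow> v) (at s within J)"
  proof (rule tendsto_linear_solve[OF _ P inj Alim w[unfolded has_vector_derivative_iff_tendsto] _ v])
    show "\<forall>\<^sub>F r in at s within J. linear (A r)" using Alin by simp
    show "\<forall>\<^sub>F r in at s within J. A r ((1 / (r - s)) *\<^sub>R (Y r - Y s)) = (1 / (r - s)) *\<^sub>R (\<phi> (Y r) - \<phi> (Y s))"
      by (simp add: linear_scale[OF Alin] AY)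
  qed
  with v show ?thesis using that has_vector_derivative_iff_tendsto by blast
qed

text \<open>A Lipschitz function is uniformly continuous and so extends to the closure of its
  domain.\<close>

lemma bounded_derivative_limit:
  fixes f :: "real \<Rightarrow> 'e::euclidean_space"
  assumes ab: "a < b" and f: "\<And>s. s \<in> {a..<b} \<Longrightarrow> (f has_vector_derivative f' s) (at s within {a..<b})"
    and C: "\<And>s. s \<in> {a..<b} \<Longrightarrow> norm (f' s) \<le> C"
  obtains l where "(f \<longlongrightarrow> l) (at b within {a..<b})"
proof -
  have "norm (f x - f y) \<le> C * norm (x - y)" if "x \<in> {a..<b}" "y \<in> {a..<b}" for x y
    by (rule differentiable_bound[OF _ f[unfolded has_vector_derivative_def] _ that])
      (use C in \<open>auto simp: onorm_scaleR_left[OF bounded_linear_ident, simplified] onorm_id\<close>)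
  moreover have "C \<ge> 0" using C[of a] ab norm_ge_zero[of "f' a"] by (simp del: norm_ge_zero)
  ultimately have "C-lipschitz_on {a..<b} f"
    by (intro lipschitz_onI) (auto simp: dist_norm)
  then have "uniformly_continuous_on {a..<b} f" by (rule lipschitz_on_uniformly_continuous)
  then show ?thesis
    by (rule uniformly_continuous_on_extension_at_closure[of _ _ b]) (use ab that in \<open>auto simp: closure_atLeastLessThan\<close>)
qed

text \<open>The mean value inequality for \<open>f x - x *\<^sub>R l\<close> on
  \<open>{s..r}\<close>, in the limit of \<open>r\<close> to \<open>b\<close>, estimates the
  difference quotient at the end point.\<close>

lemma has_vector_derivative_limit_right_end:
  fixes f :: "real \<Rightarrow> 'e::real_normed_vector"
  assumes ab: "a < b" and f: "\<And>s. s \<in> {a..<b} \<Longrightarrow> (f has_vector_derivative f' s) (at s within {a..<b})"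
    and f': "(f' \<longlongrightarrow> l) (at b within {a..<b})" and fb: "(f \<longlongrightarrow> f b) (at b within {a..<b})"
  shows "(f has_vector_derivative l) (at b within {a..b})"
  unfolding has_vector_derivative_def has_derivative_within_alt
proof (intro conjI allI impI bounded_linear_scaleR_left)
  fix e :: real assume e: "e > 0"
  have "\<forall>\<^sub>F s in at b within {a..<b}. dist (f' s) l < e / 2" using tendstoD[OF f' half_gt_zero[OF e]] .
  then obtain d where d: "d > 0" "\<And>s. s \<in> {a..<b} \<Longrightarrow> dist s b < d \<Longrightarrow> dist (f' s) l < e / 2"
    unfolding eventually_at by (metis atLeastLessThan_iff less_irrefl)
  have main: "norm (f b - f s - (b - s) *\<^sub>R l) \<le> e * (b - s)" if s: "s \<in> {a..<b}" "b - s < d" for s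
  proof -
    have nontriv: "at b within {s<..<b} \<noteq> bot"
      using s(1) by (simp add: at_within_eq_bot_iff)
    have near: "norm (f r - f s - (r - s) *\<^sub>R l) \<le> e * (r - s)" if r: "r \<in> {s<..<b}" for r
    proof -
      have "norm ((f r - r *\<^sub>R l) - (f s - s *\<^sub>R l)) \<le> e * norm (r - s)"
      proof (rule differentiable_bound[of "{s..<b}"])
        fix x assume x: "x \<in> {s..<b}"
        have "(f has_vector_derivative f' x) (at x within {s..<b})"
          using f[of x] x s(1) by (intro has_vector_derivative_within_subset[OF f]) auto
        then have "((\<lambda>x. f x - x *\<^sub>R l) has_vector_derivative f' x - l) (at x within {s..<b})"
          by (auto intro!: derivative_eq_intros)
        then show "((\<lambda>x. f x - x *\<^sub>R l) has_derivative (\<lambda>h. h *\<^sub>R (f' x - l))) (at x within {s..<b})"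
          by (simp add: has_vector_derivative_def)
        have "norm (f' x - l) \<le> e" using d(2)[of x] x s e by (auto simp: dist_norm)
        then show "onorm (\<lambda>h. h *\<^sub>R (f' x - l)) \<le> e"
          by (simp add: onorm_scaleR_left[OF bounded_linear_ident, simplified] onorm_id)
      qed (use r in auto)
      then show ?thesis using r by (simp add: algebra_simps)
    qed
    have sub: "(f \<longlongrightarrow> f b) (at b within {s<..<b})"
      by (rule tendsto_within_subset[OF fb]) (use s(1) in auto)
    show ?thesis
    proof (rule tendsto_le[OF nontriv])
      show "((\<lambda>r. e * (r - s)) \<longlongrightarrow> e * (b - s)) (at b within {s<..<b})" by (intro tendsto_intros)
      show "((\<lambda>r. norm (f r - f s - (r - s) *\<^sub>R l)) \<longlongrightarrow> norm (f b - f s - (b - s) *\<^sub>R l)) (at b within {s<..<b})"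
        by (intro tendsto_intros sub)
      show "\<forall>\<^sub>F r in at b within {s<..<b}. norm (f r - f s - (r - s) *\<^sub>R l) \<le> e * (r - s)"
        using near by (simp add: eventually_at_filter)
    qed
  qed
  show "\<exists>d>0. \<forall>y\<in>{a..b}. norm (y - b) < d \<longrightarrow> norm (f y - f b - (y - b) *\<^sub>R l) \<le> e * norm (y - b)"
  proof (intro exI[of _ d] conjI ballI impI d(1))
    fix y assume y: "y \<in> {a..b}" "norm (y - b) < d"
    show "norm (f y - f b - (y - b) *\<^sub>R l) \<le> e * norm (y - b)"
    proof (cases "y = b")
      case False
      have "norm (f y - f b - (y - b) *\<^sub>R l) = norm (f b - f y - (b - y) *\<^sub>R l)"
        by (subst norm_minus_cancel[symmetric]) (simp add: algebra_simps)
      then show ?thesis using main[of y] y False by simp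
    qed simp
  qed
qed

subsection \<open>Geodesics under local isometries\<close>

context local_isometry
begin

text \<open>The term with \<open>Q\<close> that arises from differentiating
  \<open>P (Y r) (V r)\<close> cancels the inhomogeneous term of
  \<open>christoffel_transform\<close>.\<close>

lemma geodesic_push:
  assumes s: "s \<in> J" and YU: "\<And>r. r \<in> J \<Longrightarrow> Y r \<in> U"
    and Y: "(Y has_vector_derivative V s) (at s within J)"
  shows "((\<lambda>r. \<phi> (Y r)) has_vector_derivative P (Y s) (V s)) (at s within J)"
    and "(V has_vector_derivative - dom.Gam (Y s) (V s) (V s)) (at s within J) \<Longrightarrow>
      ((\<lambda>r. P (Y r) (V r)) has_vector_derivative
        - cod.Gam (\<phi> (Y s)) (P (Y s) (V s)) (P (Y s) (V s))) (at s within J)"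
proof -
  note Y' = Y[unfolded has_vector_derivative_def]
  have U: "Y s \<in> U" by (rule YU[OF s])
  show "((\<lambda>r. \<phi> (Y r)) has_vector_derivative P (Y s) (V s)) (at s within J)"
    using has_derivative_compose[OF Y' smooth_on_has_derivative[OF smooth dom.U U]]
    by (simp add: has_vector_derivative_def linear_scale[OF P_linear[OF U]])
  assume V: "(V has_vector_derivative - dom.Gam (Y s) (V s) (V s)) (at s within J)"
  have "((\<lambda>r. P (Y r) (V r)) has_derivative
     (\<lambda>h. Q (Y s) (h *\<^sub>R V s) (V s) + P (Y s) (h *\<^sub>R (- dom.Gam (Y s) (V s) (V s))))) (at s within J)"
  proof (rule has_derivative_linear_field[OF s, where A = "\<lambda>r. P (Y r)" and A' = "\<lambda>e h. Q (Y s) (h *\<^sub>R V s) e"])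
    show "linear (P (Y r))" if "r \<in> J" for r by (rule P_linear[OF YU[OF that]])
    show "((\<lambda>r. P (Y r) e) has_derivative (\<lambda>h. Q (Y s) (h *\<^sub>R V s) e)) (at s within J)" for e
      by (rule has_derivative_compose[OF Y' smooth_on_has_derivative[OF P_smooth dom.U U]])
    show "linear (\<lambda>e. Q (Y s) (h *\<^sub>R V s) e)" for h
      using Q_bilinear[OF U] by (simp add: bilinear_def)
  qed (use V in \<open>simp add: has_vector_derivative_def\<close>)
  moreover have "Q (Y s) (h *\<^sub>R V s) (V s) + P (Y s) (h *\<^sub>R (- dom.Gam (Y s) (V s) (V s)))
     = h *\<^sub>R (- cod.Gam (\<phi> (Y s)) (P (Y s) (V s)) (P (Y s) (V s)))" for h
  proof -
    have 1: "P (Y s) (h *\<^sub>R (- dom.Gam (Y s) (V s) (V s))) = - (h *\<^sub>R P (Y s) (dom.Gam (Y s) (V s) (V s)))"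
      by (simp only: linear_scale[OF P_linear[OF U]] linear_neg[OF P_linear[OF U]] scaleR_minus_right)
    have 2: "Q (Y s) (h *\<^sub>R V s) (V s) = h *\<^sub>R Q (Y s) (V s) (V s)"
      by (rule bilinear_lmul[OF Q_bilinear[OF U]])
    show ?thesis
      unfolding 1 2 by (simp add: christoffel_transform[OF U] scaleR_add_right)
  qed
  ultimately show "((\<lambda>r. P (Y r) (V r)) has_vector_derivative
        - cod.Gam (\<phi> (Y s)) (P (Y s) (V s)) (P (Y s) (V s))) (at s within J)"
    by (simp add: has_vector_derivative_def)
qed

text \<open>The converse direction, where differentiability of \<open>V\<close> is itself to be
  shown: \<open>V\<close> solves the linear system \<open>P (Y r) (V r) = W r\<close>, and
  \<open>has_derivative_linear_solve\<close> differentiates the solution.\<close>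

lemma geodesic_pull:
  assumes s: "s \<in> J" and YU: "\<And>r. r \<in> J \<Longrightarrow> Y r \<in> U"
    and Y: "(Y has_vector_derivative V s) (at s within J)"
    and W: "\<And>r. r \<in> J \<Longrightarrow> W r = P (Y r) (V r)"
    and W': "(W has_vector_derivative - cod.Gam (\<phi> (Y s)) (W s) (W s)) (at s within J)"
  shows "(V has_vector_derivative - dom.Gam (Y s) (V s) (V s)) (at s within J)"
proof -
  note Y' = Y[unfolded has_vector_derivative_def]
  have U: "Y s \<in> U" by (rule YU[OF s])
  have "\<exists>z'. (V has_derivative z') (at s within J) \<and>
      (\<forall>h. P (Y s) (z' h) = h *\<^sub>R (- cod.Gam (\<phi> (Y s)) (W s) (W s))
         - (\<Sum>e\<in>Basis. (V s \<bullet> e) *\<^sub>R Q (Y s) (h *\<^sub>R V s) e))"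
  proof (rule has_derivative_linear_solve[OF s, where b = W])
    show "linear (P (Y r))" if "r \<in> J" for r by (rule P_linear[OF YU[OF that]])
    show "inj (P (Y s))" by (rule P_inj[OF U])
    show "((\<lambda>r. P (Y r) e) has_derivative (\<lambda>h. Q (Y s) (h *\<^sub>R V s) e)) (at s within J)" for e
      by (rule has_derivative_compose[OF Y' smooth_on_has_derivative[OF P_smooth dom.U U]])
  qed (use W W' in \<open>auto simp: has_vector_derivative_def\<close>)
  then obtain z' where z': "(V has_derivative z') (at s within J)"
    "\<And>h. P (Y s) (z' h) = h *\<^sub>R (- cod.Gam (\<phi> (Y s)) (W s) (W s))
         - (\<Sum>e\<in>Basis. (V s \<bullet> e) *\<^sub>R Q (Y s) (h *\<^sub>R V s) e)" by blast
  have "z' h = h *\<^sub>R (- dom.Gam (Y s) (V s) (V s))" for h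
  proof (rule injD[OF P_inj[OF U]])
    have "linear (Q (Y s) (h *\<^sub>R V s))" using Q_bilinear[OF U] by (simp add: bilinear_def)
    from linear_sum_Basis[OF this, of "V s"]
    have "(\<Sum>e\<in>Basis. (V s \<bullet> e) *\<^sub>R Q (Y s) (h *\<^sub>R V s) e) = h *\<^sub>R Q (Y s) (V s) (V s)"
      by (simp add: bilinear_lmul[OF Q_bilinear[OF U]])
    then have "P (Y s) (z' h) = - (h *\<^sub>R (cod.Gam (\<phi> (Y s)) (W s) (W s) + Q (Y s) (V s) (V s)))"
      by (simp add: z'(2) algebra_simps)
    also have "\<dots> = - (h *\<^sub>R P (Y s) (dom.Gam (Y s) (V s) (V s)))"
      by (simp add: christoffel_transform[OF U] W[OF s])
    also have "\<dots> = P (Y s) (h *\<^sub>R (- dom.Gam (Y s) (V s) (V s)))"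
      by (simp only: linear_scale[OF P_linear[OF U]] linear_neg[OF P_linear[OF U]] scaleR_minus_right)
    finally show "P (Y s) (z' h) = P (Y s) (h *\<^sub>R (- dom.Gam (Y s) (V s) (V s)))" .
  qed
  then have "z' = (\<lambda>h. h *\<^sub>R (- dom.Gam (Y s) (V s) (V s)))" by (rule ext)
  with z'(1) show ?thesis by (simp only: has_vector_derivative_def)
qed

end

lemma smooth_on_ident: "open U \<Longrightarrow> smooth_on U (\<lambda>x. x)"
proof -
  assume U: "open U"
  have "Ck_on k U (\<lambda>x. x)" for k
  proof (cases k)
    case (Suc k')
    show ?thesis unfolding Suc
      by (rule Ck_on_SucI[OF U, where f' = "\<lambda>x v. v"]) (simp_all add: Ck_on_const[OF U])
  qed simp
  then show ?thesis by (simp add: smooth_on_def)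
qed

subsection \<open>Local existence of solutions of ordinary differential equations\<close>

lemma smooth_on_lipschitz:
  fixes F :: "'a::euclidean_space \<Rightarrow> 'b::euclidean_space"
  assumes F: "smooth_on U F" and U: "open U" and K: "cball x r \<subseteq> U"
  obtains L where "L \<ge> 0" "\<And>y z. y \<in> cball x r \<Longrightarrow> z \<in> cball x r \<Longrightarrow> norm (F y - F z) \<le> L * norm (y - z)"
proof -
  have "\<exists>c. \<forall>y\<in>cball x r. norm (dir_deriv UNIV F y e) \<le> c" for e
    using compact_imp_bounded[OF compact_continuous_image[OF continuous_on_subset[OF
            smooth_on_imp_continuous_on[OF smooth_on_dir_deriv_UNIV[OF F U]] K] compact_cball], of e]
    by (auto simp: bounded_iff)
  then obtain c where c: "\<And>e y. y \<in> cball x r \<Longrightarrow> norm (dir_deriv UNIV F y e) \<le> c e" by metis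
  define L where "L = (\<Sum>e\<in>Basis. \<bar>c e\<bar>)"
  have D: "norm (dir_deriv UNIV F y v) \<le> L * norm v" if y: "y \<in> cball x r" for y v
  proof -
    have "y \<in> U" using y K by auto
    from linear_sum_Basis[OF dir_deriv_linear[OF F U this], of v]
    have "norm (dir_deriv UNIV F y v) = norm (\<Sum>e\<in>Basis. (v \<bullet> e) *\<^sub>R dir_deriv UNIV F y e)" by simp
    also have "\<dots> \<le> (\<Sum>e\<in>Basis. norm v * \<bar>c e\<bar>)"
    proof (intro sum_norm_le)
      fix e :: 'a assume e: "e \<in> Basis"
      have "norm (dir_deriv UNIV F y e) \<le> \<bar>c e\<bar>" using c[OF y, of e] by linarith
      then show "norm ((v \<bullet> e) *\<^sub>R dir_deriv UNIV F y e) \<le> norm v * \<bar>c e\<bar>"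
        using Basis_le_norm[OF e, of v] by (simp add: mult_mono)
    qed
    finally show ?thesis by (simp add: L_def sum_distrib_left mult.commute)
  qed
  show ?thesis
  proof (rule that[of L])
    show "L \<ge> 0" unfolding L_def by (intro sum_nonneg) auto
    fix y z assume yz: "y \<in> cball x r" "z \<in> cball x r"
    show "norm (F y - F z) \<le> L * norm (y - z)"
    proof (rule differentiable_bound[OF convex_cball _ _ yz])
      fix w assume w: "w \<in> cball x r"
      then show "(F has_derivative dir_deriv UNIV F w) (at w within cball x r)"
        using K smooth_on_has_derivative[OF F U] has_derivative_at_withinI by blast
      show "onorm (dir_deriv UNIV F w) \<le> L" by (rule onorm_le) (rule D[OF w])
    qed
  qed
qed

text \<open>Picard's map is a contraction with factor 1/2 on the complete space of bounded
  continuous functions once the interval is short against the Lipschitz constant.\<close>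

lemma picard_global:
  fixes G :: "'a::euclidean_space \<Rightarrow> 'a"
  assumes L: "L \<ge> 0" "\<And>y z. norm (G y - G z) \<le> L * norm (y - z)" and M: "\<And>y. norm (G y) \<le> M"
    and \<epsilon>: "\<epsilon> > 0" "\<epsilon> * L \<le> 1 / 2"
  obtains x where "x b = x0" "\<And>s. s \<in> {b..b + \<epsilon>} \<Longrightarrow> (x has_vector_derivative G (x s)) (at s within {b..b + \<epsilon>})"
    "\<And>s. s \<in> {b..b + \<epsilon>} \<Longrightarrow> norm (x s - x0) \<le> \<epsilon> * M"
proof -
  \<comment> \<open>Clamping time to the interval makes the Picard map act on functions defined on
    the whole line, as \<open>bcontfun\<close> demands.\<close>
  define cl where "cl s = max b (min s (b + \<epsilon>))" for s
  have cl: "cl s \<in> {b..b + \<epsilon>}" "s \<in> {b..b + \<epsilon>} \<Longrightarrow> cl s = s" for s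
    using \<epsilon> by (auto simp: cl_def)
  have G: "continuous_on UNIV G"
    by (rule lipschitz_on_continuous_on[of L]) (use L in \<open>auto intro!: lipschitz_onI simp: dist_norm\<close>)
  have Gf: "continuous_on S (\<lambda>s. G (apply_bcontfun f s))" for f and S :: "real set"
    by (rule continuous_on_compose2[OF G]) auto
  have int: "(\<lambda>s. G (apply_bcontfun f s)) integrable_on {b..c}" for f c
    by (rule integrable_continuous_real[OF Gf])
  have M0: "M \<ge> 0" using M[of 0] norm_ge_zero order_trans by blast
  define \<Phi> where "\<Phi> f s = x0 + integral {b..cl s} (\<lambda>s. G (apply_bcontfun f s))" for f s
  have bound: "norm (integral {b..c} (\<lambda>s. G (apply_bcontfun f s))) \<le> \<epsilon> * M" if "c \<in> {b..b + \<epsilon>}" for f c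
  proof -
    have "norm (integral {b..c} (\<lambda>s. G (apply_bcontfun f s))) \<le> M * (c - b)"
      by (rule integral_bound) (use that M Gf in auto)
    also have "\<dots> \<le> M * \<epsilon>" using that M0 by (intro mult_left_mono) auto
    finally show ?thesis by (simp add: mult.commute)
  qed
  have deriv: "((\<lambda>s. x0 + integral {b..s} (\<lambda>s. G (apply_bcontfun f s))) has_vector_derivative G (apply_bcontfun f s))
       (at s within {b..b + \<epsilon>})" if "s \<in> {b..b + \<epsilon>}" for f s
    using has_vector_derivative_add[OF has_vector_derivative_const integral_has_vector_derivative[OF Gf that]] by simp
  have "\<Phi> f \<in> bcontfun" for f
    unfolding bcontfun_def
  proof (intro CollectI conjI)
    have "continuous_on {b..b + \<epsilon>} (\<lambda>s. x0 + integral {b..s} (\<lambda>s. G (apply_bcontfun f s)))"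
      using deriv by (meson continuous_on_eq_continuous_within has_vector_derivative_continuous)
    moreover have "continuous_on UNIV cl" unfolding cl_def by (intro continuous_intros)
    ultimately show "continuous_on UNIV (\<Phi> f)"
      unfolding \<Phi>_def by (rule continuous_on_compose2) (use cl in auto)
    have "norm (\<Phi> f s) \<le> norm x0 + \<epsilon> * M" for s
      unfolding \<Phi>_def using bound[OF cl(1)] norm_triangle_ineq order_trans add_left_mono by metis
    then show "bounded (range (\<Phi> f))" by (auto simp: bounded_iff)
  qed
  then have app: "apply_bcontfun (Bcontfun (\<Phi> f)) = \<Phi> f" for f by (rule Bcontfun_inverse)
  have "dist (Bcontfun (\<Phi> f)) (Bcontfun (\<Phi> h)) \<le> 1 / 2 * dist f h" for f h
  proof (rule dist_bound)
    fix s
    have "dist (\<Phi> f s) (\<Phi> h s) = norm (integral {b..cl s} (\<lambda>s. G (apply_bcontfun f s) - G (apply_bcontfun h s)))"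
      by (simp add: \<Phi>_def dist_norm integral_diff[OF int int])
    also have "\<dots> \<le> (L * dist f h) * (cl s - b)"
    proof (rule integral_bound)
      show "b \<le> cl s" using cl(1)[of s] by simp
      show "continuous_on {b..cl s} (\<lambda>s. G (apply_bcontfun f s) - G (apply_bcontfun h s))"
        by (intro continuous_on_diff Gf)
      fix r
      have "norm (G (apply_bcontfun f r) - G (apply_bcontfun h r)) \<le> L * dist (apply_bcontfun f r) (apply_bcontfun h r)"
        using L(2) by (simp add: dist_norm)
      also have "\<dots> \<le> L * dist f h" by (intro mult_left_mono dist_bounded L)
      finally show "norm (G (apply_bcontfun f r) - G (apply_bcontfun h r)) \<le> L * dist f h" .
    qed
    also have "\<dots> \<le> (L * dist f h) * \<epsilon>"
      using cl(1)[of s] L by (intro mult_left_mono) auto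
    also have "\<dots> = (\<epsilon> * L) * dist f h" by simp
    also have "\<dots> \<le> 1 / 2 * dist f h" using \<epsilon> by (intro mult_right_mono) auto
    finally show "dist (apply_bcontfun (Bcontfun (\<Phi> f)) s) (apply_bcontfun (Bcontfun (\<Phi> h)) s) \<le> 1 / 2 * dist f h"
      by (simp add: app)
  qed
  then have "\<exists>!f. Bcontfun (\<Phi> f) = f"
    by (intro banach_fix_type[of "1/2"]) (simp, simp, blast)
  then obtain f where "Bcontfun (\<Phi> f) = f" by (rule ex1E)
  then have fp: "apply_bcontfun f = \<Phi> f" using app[of f] by simp
  have f: "apply_bcontfun f s = x0 + integral {b..s} (\<lambda>s. G (apply_bcontfun f s))" if "s \<in> {b..b + \<epsilon>}" for s
    using fun_cong[OF fp, of s] by (simp only: \<Phi>_def[of f s] cl(2)[OF that])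
  show ?thesis
  proof (rule that[of "apply_bcontfun f"])
    show "apply_bcontfun f b = x0" using f[of b] \<epsilon> by simp
    show "(apply_bcontfun f has_vector_derivative G (apply_bcontfun f s)) (at s within {b..b + \<epsilon>})"
      if "s \<in> {b..b + \<epsilon>}" for s
      using has_vector_derivative_transform[OF that f deriv[OF that]] by simp
    show "norm (apply_bcontfun f s - x0) \<le> \<epsilon> * M" if "s \<in> {b..b + \<epsilon>}" for s
      using f[OF that] bound[OF that] by simp
  qed
qed

text \<open>\<open>F\<close> is precomposed with the nearest-point projection to a ball, which does
  not increase distances; this yields a bounded global Lipschitz field. For the chosen time the
  solution stays in the ball, where the projection is the identity.\<close>

lemma picard_local:
  fixes F :: "'a::euclidean_space \<Rightarrow> 'a"
  assumes F: "smooth_on U F" and U: "open U" and x0: "x0 \<in> U"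
  obtains \<epsilon> x where "\<epsilon> > 0" "x b = x0" "\<And>s. s \<in> {b..b + \<epsilon>} \<Longrightarrow> x s \<in> U"
    "\<And>s. s \<in> {b..b + \<epsilon>} \<Longrightarrow> (x has_vector_derivative F (x s)) (at s within {b..b + \<epsilon>})"
proof -
  obtain r where r: "r > 0" "cball x0 r \<subseteq> U" using U x0 open_contains_cball by blast
  obtain L where L: "L \<ge> 0" "\<And>y z. y \<in> cball x0 r \<Longrightarrow> z \<in> cball x0 r \<Longrightarrow> norm (F y - F z) \<le> L * norm (y - z)"
    using smooth_on_lipschitz[OF F U r(2)] by blast
  have "\<exists>M. \<forall>y\<in>cball x0 r. norm (F y) \<le> M"
    using compact_imp_bounded[OF compact_continuous_image[OF continuous_on_subset[OF
            smooth_on_imp_continuous_on[OF F] r(2)] compact_cball]] unfolding bounded_iff by blast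
  then obtain M where M: "\<And>y. y \<in> cball x0 r \<Longrightarrow> norm (F y) \<le> M" by blast
  have M0: "M \<ge> 0" using M[of x0] r(1) norm_ge_zero[of "F x0"] by (simp del: norm_ge_zero)
  define c where "c = closest_point (cball x0 r)"
  have ne: "cball x0 r \<noteq> {}" using r(1) by auto
  have c: "c y \<in> cball x0 r" "y \<in> cball x0 r \<Longrightarrow> c y = y" "norm (c y - c z) \<le> norm (y - z)" for y z
    unfolding c_def
    by (rule closest_point_in_set[OF closed_cball ne], erule closest_point_self)
      (use closest_point_lipschitz[OF convex_cball closed_cball ne, of y z] in \<open>simp only: dist_norm\<close>)
  \<comment> \<open>The first bound keeps the solution within distance \<open>r\<close>, the second
    makes the Picard map contract; the summands 1 exclude zero denominators.\<close>
  define \<epsilon> where "\<epsilon> = min (r / (M + 1)) (1 / (2 * (L + 1)))"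
  have \<epsilon>: "\<epsilon> > 0" "\<epsilon> * L \<le> 1 / 2" "\<epsilon> * M \<le> r"
  proof -
    show "\<epsilon> > 0" using r(1) M0 L(1) by (simp add: \<epsilon>_def)
    have "\<epsilon> * L \<le> 1 / (2 * (L + 1)) * L" using L(1) by (intro mult_right_mono) (auto simp: \<epsilon>_def)
    also have "\<dots> \<le> 1 / 2" using L(1) by (simp add: divide_simps)
    finally show "\<epsilon> * L \<le> 1 / 2" .
    have "\<epsilon> * M \<le> r / (M + 1) * M" using M0 by (intro mult_right_mono) (auto simp: \<epsilon>_def)
    also have "\<dots> \<le> r" using M0 r(1) by (simp add: divide_simps)
    finally show "\<epsilon> * M \<le> r" .
  qed
  have lip: "norm (F (c y) - F (c z)) \<le> L * norm (y - z)" for y z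
    using L(2)[OF c(1) c(1), of y z] mult_left_mono[OF c(3) L(1), of y z] by linarith
  obtain x where x: "x b = x0"
    "\<And>s. s \<in> {b..b + \<epsilon>} \<Longrightarrow> (x has_vector_derivative F (c (x s))) (at s within {b..b + \<epsilon>})"
    "\<And>s. s \<in> {b..b + \<epsilon>} \<Longrightarrow> norm (x s - x0) \<le> \<epsilon> * M"
    using picard_global[OF L(1) lip M[OF c(1)] \<epsilon>(1,2), of b x0] by blast
  have in_ball: "x s \<in> cball x0 r" if "s \<in> {b..b + \<epsilon>}" for s
    using x(3)[OF that] \<epsilon>(3) by (simp add: dist_norm norm_minus_commute)
  show ?thesis
  proof (rule that[of \<epsilon> x])
    fix s assume s: "s \<in> {b..b + \<epsilon>}"
    show "x s \<in> U" using in_ball[OF s] r(2) by blast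
    show "(x has_vector_derivative F (x s)) (at s within {b..b + \<epsilon>})"
      using x(2)[OF s] c(2)[OF in_ball[OF s]] by simp
  qed (rule \<epsilon>(1), rule x(1))
qed

lemma (in metric_domain) spray_smooth:
  "smooth_on (U \<times> UNIV) (\<lambda>z. Gam (fst z) (snd z) (snd z))"
proof -
  let ?W = "U \<times> (UNIV :: 'e set)"
  have W: "open ?W" using U by (simp add: open_Times)
  have G: "smooth_on ?W (\<lambda>z. Gam (fst z) i j)" for i j
    by (rule smooth_on_compose_linear[OF bounded_linear_fst U W _ christoffel_smooth]) auto
  have snd: "smooth_on ?W snd"
    using smooth_on_compose_linear[OF bounded_linear_snd open_UNIV W, of "\<lambda>x. x"]
    by (simp add: smooth_on_ident)
  have exp: "Gam x v v = (\<Sum>i\<in>Basis. (v \<bullet> i) *\<^sub>R (\<Sum>j\<in>Basis. (v \<bullet> j) *\<^sub>R Gam x i j))" if "x \<in> U" for x v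
    by (rule bilinear_sum_Basis[OF christoffel_bilinear[OF that]])
  have "smooth_on ?W (\<lambda>z. (\<Sum>i\<in>Basis. (snd z \<bullet> i) *\<^sub>R (\<Sum>j\<in>Basis. (snd z \<bullet> j) *\<^sub>R Gam (fst z) i j)))"
    by (intro smooth_on_sum smooth_on_scaleR smooth_on_inner smooth_on_const W snd G)
  then show ?thesis
    by (subst smooth_on_cong) (rule exp, auto)
qed

lemma (in metric_domain) geodesic_exists:
  assumes "x0 \<in> U"
  obtains \<epsilon> Y V where "\<epsilon> > 0" "Y b = x0" "V b = v0" "\<And>s. s \<in> {b..b + \<epsilon>} \<Longrightarrow> Y s \<in> U"
    "\<And>s. s \<in> {b..b + \<epsilon>} \<Longrightarrow> (Y has_vector_derivative V s) (at s within {b..b + \<epsilon>})"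
    "\<And>s. s \<in> {b..b + \<epsilon>} \<Longrightarrow> (V has_vector_derivative - Gam (Y s) (V s) (V s)) (at s within {b..b + \<epsilon>})"
proof -
  let ?W = "U \<times> (UNIV :: 'e set)"
  define F where "F z = (snd z, - Gam (fst z) (snd z) (snd z))" for z :: "'e \<times> 'e"
  have W: "open ?W" using U by (simp add: open_Times)
  have snd: "smooth_on ?W snd"
    using smooth_on_compose_linear[OF bounded_linear_snd open_UNIV W, of "\<lambda>x. x"]
    by (simp add: smooth_on_ident)
  have "smooth_on ?W (\<lambda>z. (snd z, 0) + (0, - Gam (fst z) (snd z) (snd z)))"
    by (intro smooth_on_add W smooth_on_linear[OF _ W snd] smooth_on_linear[OF _ W spray_smooth, of "\<lambda>x. (0, - x)"]
        bounded_linear_Pair bounded_linear_ident bounded_linear_zero bounded_linear_minus)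
  then have F: "smooth_on ?W F" by (simp add: F_def[abs_def])
  obtain \<epsilon> z where z: "\<epsilon> > 0" "z b = (x0, v0)" "\<And>s. s \<in> {b..b + \<epsilon>} \<Longrightarrow> z s \<in> ?W"
    "\<And>s. s \<in> {b..b + \<epsilon>} \<Longrightarrow> (z has_vector_derivative F (z s)) (at s within {b..b + \<epsilon>})"
  proof -
    have "(x0, v0) \<in> ?W" using assms by simp
    from picard_local[OF F W this, of b] show ?thesis using that by metis
  qed
  show ?thesis
  proof (rule that[of \<epsilon> "\<lambda>s. fst (z s)" "\<lambda>s. snd (z s)"])
    fix s assume s: "s \<in> {b..b + \<epsilon>}"
    show "((\<lambda>s. fst (z s)) has_vector_derivative snd (z s)) (at s within {b..b + \<epsilon>})"
      using bounded_linear.has_vector_derivative[OF bounded_linear_fst z(4)[OF s]] by (simp add: F_def)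
    show "((\<lambda>s. snd (z s)) has_vector_derivative - Gam (fst (z s)) (snd (z s)) (snd (z s))) (at s within {b..b + \<epsilon>})"
      using bounded_linear.has_vector_derivative[OF bounded_linear_snd z(4)[OF s]] by (simp add: F_def)
    show "fst (z s) \<in> U" using z(3)[OF s] by auto
  qed (use z in auto)
qed

section \<open>Lifting curves through covering spaces\<close>

text \<open>Near \<open>r\<close> each lift stays in one sheet over an evenly covered set. Agreement
  at a single point there forces the two sheets to coincide, and \<open>p\<close> is injective on a
  sheet.\<close>

lemma covering_lift_unique_interval:
  fixes p :: "'a::topological_space \<Rightarrow> 'b::topological_space" and f1 f2 :: "real \<Rightarrow> 'a"
  assumes cov: "covering_space C p S" and I: "connected I" and aI: "a \<in> I" and sI: "s \<in> I"
    and f1: "continuous_on I f1" "f1 ` I \<subseteq> C" and f2: "continuous_on I f2" "f2 ` I \<subseteq> C"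
    and eq: "\<And>r. r \<in> I \<Longrightarrow> p (f1 r) = p (f2 r)" and start: "f1 a = f2 a"
  shows "f1 s = f2 s"
proof (rule connected_induction_simple[OF I aI sI, of "\<lambda>s. f1 s = f2 s", OF start])
  fix r assume r: "r \<in> I"
  have "p (f1 r) \<in> S" using cov f1(2) r by (auto simp: covering_space_def)
  then obtain T v where T: "p (f1 r) \<in> T" and v: "\<Union>v = C \<inter> p -` T" "\<And>u. u \<in> v \<Longrightarrow> openin (top_of_set C) u"
    "pairwise disjnt v" "\<And>u. u \<in> v \<Longrightarrow> \<exists>q. homeomorphism u T p q"
    using cov unfolding covering_space_def by metis
  have "f1 r \<in> \<Union>v" "f2 r \<in> \<Union>v" using v(1) T eq[OF r] f1(2) f2(2) r by auto
  then obtain u1 u2 where u: "u1 \<in> v" "f1 r \<in> u1" "u2 \<in> v" "f2 r \<in> u2" by blast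
  let ?W = "(I \<inter> f1 -` u1) \<inter> (I \<inter> f2 -` u2)"
  have "openin (top_of_set I) ?W"
    by (intro openin_Int continuous_openin_preimage[OF f1(1) _ v(2)[OF u(1)]]
        continuous_openin_preimage[OF f2(1) _ v(2)[OF u(3)]]) (use f1(2) f2(2) in auto)
  moreover have "f1 y = f2 y" if xy: "x \<in> ?W" "y \<in> ?W" and x: "f1 x = f2 x" for x y
  proof -
    have "u1 = u2"
      using v(3) u(1,3) xy(1) x by (auto simp: pairwise_def disjnt_iff)
    moreover obtain q where "homeomorphism u1 T p q" using v(4)[OF u(1)] by blast
    then have "inj_on p u1" by (metis homeomorphism_def inj_on_inverseI)
    ultimately show ?thesis using xy(2) eq[of y] by (auto dest: inj_onD)
  qed
  ultimately show "\<exists>T. openin (top_of_set I) T \<and> r \<in> T \<and> (\<forall>x\<in>T. \<forall>y\<in>T. f1 x = f2 x \<longrightarrow> f1 y = f2 y)"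
    using u r by (intro exI[of _ ?W]) blast
qed

text \<open>Connectedness replaces a subdivision of the interval: near each \<open>s\<close> the
  existence of a lift up to \<open>x\<close> passes to every nearby \<open>y\<close>, by restriction
  if \<open>y \<le> x\<close> and otherwise by appending the local section through
  \<open>f x\<close>.\<close>

lemma covering_lift_compact_interval:
  fixes p :: "'a::topological_space \<Rightarrow> 'b::topological_space" and \<gamma> :: "real \<Rightarrow> 'b"
  assumes cov: "covering_space C p S" and \<gamma>: "continuous_on {a..c} \<gamma>" "\<gamma> ` {a..c} \<subseteq> S"
    and z: "z \<in> C" "p z = \<gamma> a" and ac: "a \<le> c"
  shows "\<exists>f. continuous_on {a..c} f \<and> f ` {a..c} \<subseteq> C \<and> f a = z \<and> (\<forall>r\<in>{a..c}. p (f r) = \<gamma> r)"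
proof -
  let ?P = "\<lambda>s. \<exists>f. continuous_on {a..s} f \<and> f ` {a..s} \<subseteq> C \<and> f a = z \<and> (\<forall>r\<in>{a..s}. p (f r) = \<gamma> r)"
  show "?P c"
  proof (rule connected_induction_simple[of "{a..c}" a c ?P])
    show "?P a" using z by (intro exI[of _ "\<lambda>_. z"]) auto
    fix s assume s: "s \<in> {a..c}"
    then have "\<gamma> s \<in> S" using \<gamma>(2) by auto
    then obtain T v where T: "\<gamma> s \<in> T" "openin (top_of_set S) T" and v: "\<Union>v = C \<inter> p -` T"
      "\<And>u. u \<in> v \<Longrightarrow> \<exists>q. homeomorphism u T p q"
      using cov unfolding covering_space_def by metis
    have "openin (top_of_set {a..c}) ({a..c} \<inter> \<gamma> -` T)"
      using continuous_openin_preimage[OF \<gamma>(1) _ T(2)] \<gamma>(2) by auto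
    then obtain e where e: "e > 0" "ball s e \<inter> {a..c} \<subseteq> {a..c} \<inter> \<gamma> -` T"
      using s T(1) unfolding openin_contains_ball by blast
    have step: "?P y" if x: "x \<in> ball s e \<inter> {a..c}" and y: "y \<in> ball s e \<inter> {a..c}" and P: "?P x" for x y
    proof (cases "y \<le> x")
      case True
      from P obtain f where "continuous_on {a..x} f" "f ` {a..x} \<subseteq> C" "f a = z" "\<forall>r\<in>{a..x}. p (f r) = \<gamma> r" by blast
      with True show ?thesis
        by (intro exI[of _ f]) (auto intro: continuous_on_subset)
    next
      case False
      from P obtain f where f: "continuous_on {a..x} f" "f ` {a..x} \<subseteq> C" "f a = z" "\<And>r. r \<in> {a..x} \<Longrightarrow> p (f r) = \<gamma> r" by blast
      have xyT: "\<gamma> r \<in> T" if "r \<in> {x..y}" for r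
      proof -
        have "r \<in> ball s e \<inter> {a..c}"
          using x y that by (auto simp: dist_real_def abs_less_iff)
        then show ?thesis using e(2) by auto
      qed
      have "f x \<in> \<Union>v" using v(1) f(2) f(4)[of x] xyT[of x] x False by auto
      then obtain u q where u: "u \<in> v" "f x \<in> u" "homeomorphism u T p q" using v(2) by blast
      have q: "q (\<gamma> x) = f x" "continuous_on T q" "q ` T = u" "\<And>w. w \<in> T \<Longrightarrow> p (q w) = w"
        using u f(4)[of x] x by (auto simp: homeomorphism_def)
      have qc: "continuous_on {x..y} (\<lambda>r. q (\<gamma> r))"
        by (rule continuous_on_compose2[OF q(2) continuous_on_subset[OF \<gamma>(1)]]) (use x y xyT in auto)
      have uC: "u \<subseteq> C" using u(1) v(1) by blast
      have "continuous_on ({a..x} \<union> {x..y}) (\<lambda>r. if r \<le> x then f r else q (\<gamma> r))"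
        by (rule continuous_on_If) (use f(1) qc q(1) in auto)
      moreover have "{a..x} \<union> {x..y} = {a..y}" using x False by auto
      ultimately have "continuous_on {a..y} (\<lambda>r. if r \<le> x then f r else q (\<gamma> r))" by simp
      moreover have "(if r \<le> x then f r else q (\<gamma> r)) \<in> C \<and> p (if r \<le> x then f r else q (\<gamma> r)) = \<gamma> r"
        if "r \<in> {a..y}" for r
      proof (cases "r \<le> x")
        case True
        then show ?thesis using f(2) f(4)[of r] that by auto
      next
        case False
        then have "\<gamma> r \<in> T" using xyT[of r] that by simp
        then show ?thesis using q(3,4) uC False by auto
      qed
      ultimately show ?thesis
        using f(3) x by (intro exI[of _ "\<lambda>r. if r \<le> x then f r else q (\<gamma> r)"] conjI ballI image_subsetI) simp_all
    qed
    have "openin (top_of_set {a..c}) (ball s e \<inter> {a..c})"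
      by (metis Int_commute open_ball openin_open_Int)
    moreover have "s \<in> ball s e \<inter> {a..c}" using s e(1) by simp
    ultimately show "\<exists>T. openin (top_of_set {a..c}) T \<and> s \<in> T \<and> (\<forall>x\<in>T. \<forall>y\<in>T. ?P x \<longrightarrow> ?P y)"
      using step by blast
  qed (use ac in auto)
qed

text \<open>\<open>J\<close> need not contain its right end, so the lifts over the compact intervals
  \<open>{a..s}\<close> are patched; by uniqueness they are compatible.\<close>

lemma covering_lift_interval:
  fixes p :: "'a::topological_space \<Rightarrow> 'b::topological_space" and \<gamma> :: "real \<Rightarrow> 'b"
  assumes cov: "covering_space C p S" and J: "is_interval J" "a \<in> J" "\<And>s. s \<in> J \<Longrightarrow> a \<le> s"
    and \<gamma>: "continuous_on J \<gamma>" "\<gamma> ` J \<subseteq> S" and z: "z \<in> C" "p z = \<gamma> a"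
  obtains f where "continuous_on J f" "f ` J \<subseteq> C" "f a = z" "\<And>r. r \<in> J \<Longrightarrow> p (f r) = \<gamma> r"
proof -
  have sub: "{a..s} \<subseteq> J" if "s \<in> J" for s
    using J(1,2) that unfolding is_interval_1 by (meson atLeastAtMost_iff subsetI)
  have "\<exists>f. continuous_on {a..s} f \<and> f ` {a..s} \<subseteq> C \<and> f a = z \<and> (\<forall>r\<in>{a..s}. p (f r) = \<gamma> r)"
    if "s \<in> J" for s
  proof (rule covering_lift_compact_interval[OF cov, where \<gamma> = \<gamma>])
    show "continuous_on {a..s} \<gamma>" by (rule continuous_on_subset[OF \<gamma>(1) sub[OF that]])
    show "\<gamma> ` {a..s} \<subseteq> S" using \<gamma>(2) sub[OF that] by blast
  qed (use z J(3)[OF that] in auto)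
  then obtain L where L: "\<And>s. s \<in> J \<Longrightarrow> continuous_on {a..s} (L s)" "\<And>s. s \<in> J \<Longrightarrow> L s ` {a..s} \<subseteq> C"
    "\<And>s. s \<in> J \<Longrightarrow> L s a = z" "\<And>s r. s \<in> J \<Longrightarrow> r \<in> {a..s} \<Longrightarrow> p (L s r) = \<gamma> r" by metis
  have agree: "L r r = L s r" if s: "s \<in> J" and r: "r \<in> J" "r \<le> s" for r s
  proof (rule covering_lift_unique_interval[OF cov, of "{a..r}" a _ "L r" "L s"])
    have rs: "{a..r} \<subseteq> {a..s}" using r(2) by auto
    show "continuous_on {a..r} (L r)" "L r ` {a..r} \<subseteq> C" by (rule L[OF r(1)])+
    show "continuous_on {a..r} (L s)" by (rule continuous_on_subset[OF L(1)[OF s] rs])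
    show "L s ` {a..r} \<subseteq> C" using L(2)[OF s] rs by blast
    show "p (L r q) = p (L s q)" if "q \<in> {a..r}" for q
      using L(4)[OF r(1) that] L(4)[OF s] rs that by auto
    show "L r a = L s a" by (simp add: L(3)[OF r(1)] L(3)[OF s])
  qed (use J(3)[OF r(1)] in auto)
  define f where "f s = L s s" for s
  have "continuous (at s within J) f" if s: "s \<in> J" for s
  proof -
    \<comment> \<open>Continuity at \<open>s\<close> is read off from one lift that covers a
      neighbourhood of \<open>s\<close> in \<open>J\<close>: one reaching beyond \<open>s\<close>,
      or the lift up to \<open>s\<close> if \<open>s\<close> is the last point.\<close>
    obtain s' W where W: "s' \<in> J" "s \<le> s'" "open W" "s \<in> W" "J \<inter> W \<subseteq> {a..s'}"
    proof (cases "\<exists>s'\<in>J. s < s'")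
      case True
      then obtain s' where "s' \<in> J" "s < s'" by blast
      moreover have "J \<inter> {..<s'} \<subseteq> {a..s'}" using J(3) by auto
      ultimately show ?thesis using that[of s' "{..<s'}"] by simp
    next
      case False
      then show ?thesis using that[of s UNIV] J(3) s by force
    qed
    have eq: "f r = L s' r" if "r \<in> J \<inter> W" for r
      using agree[OF W(1), of r] that W(5) by (auto simp: f_def)
    have "continuous_on (J \<inter> W) (L s')" by (rule continuous_on_subset[OF L(1)[OF W(1)] W(5)])
    then have "continuous_on (J \<inter> W) f" by (rule continuous_on_eq) (simp add: eq)
    then have "continuous (at s within J \<inter> W) f" using s W(4) by (simp add: continuous_on_eq_continuous_within)
    moreover have "at s within J \<inter> W = at s within J"
      by (rule at_within_nhd[OF W(4,3)]) auto
    ultimately show ?thesis by simp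
  qed
  then have "continuous_on J f" by (simp add: continuous_on_eq_continuous_within)
  moreover have "f r \<in> C" "p (f r) = \<gamma> r" if "r \<in> J" for r
    using L(4)[OF that, of r] L(2)[OF that] J(3)[OF that] by (auto simp: f_def)
  ultimately show ?thesis
    by (intro that[of f]) (use L(3)[OF J(2)] in \<open>auto simp: f_def\<close>)
qed

section \<open>Curves with bounded velocity in a Lie group\<close>

lemma manifold_chart:
  assumes "smooth_manifold H M A" "c \<in> A"
  shows "openin (top_of_set M) (fst c)" "openin (top_of_set H) (snd c ` fst c)"
    "fst c \<subseteq> M" "continuous_on (fst c) (snd c)" "continuous_on (snd c ` fst c) (coord_inv c)"
    "\<And>p. p \<in> fst c \<Longrightarrow> coord_inv c (snd c p) = p"
    "\<And>y. y \<in> snd c ` fst c \<Longrightarrow> coord_inv c y \<in> fst c" "\<And>y. y \<in> snd c ` fst c \<Longrightarrow> snd c (coord_inv c y) = y"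
proof -
  from assms have *: "openin (top_of_set M) (fst c)" "openin (top_of_set H) (snd c ` fst c)"
    "homeomorphism (fst c) (snd c ` fst c) (snd c) (coord_inv c)" "(\<Union>c\<in>A. fst c) = M"
    unfolding smooth_manifold_def by blast+
  show "openin (top_of_set M) (fst c)" "openin (top_of_set H) (snd c ` fst c)" by fact+
  show "fst c \<subseteq> M" using *(4) assms(2) by blast
  show "continuous_on (fst c) (snd c)" "continuous_on (snd c ` fst c) (coord_inv c)"
    "\<And>p. p \<in> fst c \<Longrightarrow> coord_inv c (snd c p) = p"
    "\<And>y. y \<in> snd c ` fst c \<Longrightarrow> coord_inv c y \<in> fst c" "\<And>y. y \<in> snd c ` fst c \<Longrightarrow> snd c (coord_inv c y) = y"
    using *(3) unfolding homeomorphism_def by auto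
qed

lemma manifold_chart_at: "smooth_manifold H M A \<Longrightarrow> p \<in> M \<Longrightarrow> \<exists>c\<in>A. p \<in> fst c"
  unfolding smooth_manifold_def by blast

lemma eventually_in_chart:
  assumes M: "smooth_manifold H M A" and c: "c \<in> A" and f: "(f \<longlongrightarrow> l) F" "\<forall>\<^sub>F x in F. f x \<in> M" and l: "l \<in> fst c"
  shows "\<forall>\<^sub>F x in F. f x \<in> fst c"
proof -
  obtain W where W: "open W" "fst c = M \<inter> W"
    using manifold_chart(1)[OF M c] by (auto simp: openin_open)
  have "\<forall>\<^sub>F x in F. f x \<in> W" using topological_tendstoD[OF f(1) W(1)] l W(2) by auto
  with f(2) show ?thesis by eventually_elim (use W in auto)
qed

locale left_invariant_frame =
  fixes G :: "'g::topological_space monoid" and A :: "('g, real^'n::finite) chart set"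
    and \<theta> :: "'n \<Rightarrow> ('g, real^'n) one_form"
  assumes lie: "lie_group G A" and frame: "left_invariant_one_form_basis G A \<theta>"
begin

text \<open>The Maurer-Cartan form of the group in components: the vector of values of the coframe
  on a tangent vector.\<close>

definition TH :: "('g, real^'n) chart \<Rightarrow> 'g \<Rightarrow> real^'n \<Rightarrow> real^'n" where
  "TH c p u = (\<chi> a. \<theta> a c p u)"

lemma grp: "group G" and mfd: "smooth_manifold UNIV (carrier G) A"
  and mult_smooth: "smooth_map (carrier G \<times> carrier G) (prod_atlas A A) (carrier G) A (\<lambda>(x, y). x \<otimes>\<^bsub>G\<^esub> y)"
  using lie by (simp_all add: lie_group_def)

lemma form: "left_invariant_one_form G A (\<theta> a)"
  using frame by (simp add: left_invariant_one_form_basis_def)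

lemma TH_linear: "c \<in> A \<Longrightarrow> p \<in> fst c \<Longrightarrow> linear (TH c p)"
proof -
  assume "c \<in> A" "p \<in> fst c"
  then have l: "linear (\<theta> a c p)" for a
    using form[of a] by (simp add: left_invariant_one_form_def smooth_one_form_def)
  show ?thesis
    by (rule linearI) (simp_all add: TH_def vec_eq_iff linear_add[OF l] linear_scale[OF l])
qed

lemma TH_left_invariant:
  assumes "h \<in> carrier G" "c \<in> A" "d \<in> A" "p \<in> fst c" "h \<otimes>\<^bsub>G\<^esub> p \<in> fst d"
  shows "TH c p u = TH d (h \<otimes>\<^bsub>G\<^esub> p) (tangent_map c d (\<lambda>x. h \<otimes>\<^bsub>G\<^esub> x) p u)"
proof -
  have "\<theta> a c p u = \<theta> a d (h \<otimes>\<^bsub>G\<^esub> p) (tangent_map c d (\<lambda>x. h \<otimes>\<^bsub>G\<^esub> x) p u)" for a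
    using form[of a] assms unfolding left_invariant_one_form_def by blast
  then show ?thesis unfolding TH_def vec_eq_iff vec_lambda_beta by blast
qed

lemma TH_smooth: "c \<in> A \<Longrightarrow> smooth_on (snd c ` fst c) (\<lambda>y. TH c (coord_inv c y) u)"
proof -
  assume c: "c \<in> A"
  have o: "open (snd c ` fst c)" using manifold_chart(2)[OF mfd c] by simp
  have "smooth_on (snd c ` fst c) (\<lambda>y. \<Sum>a\<in>UNIV. \<theta> a c (coord_inv c y) u *\<^sub>R axis a 1)"
    using form c
    by (intro smooth_on_sum smooth_on_scaleR smooth_on_const o)
      (auto simp: left_invariant_one_form_def smooth_one_form_def)
  moreover have "TH c p u = (\<Sum>a\<in>UNIV. \<theta> a c p u *\<^sub>R axis a 1)" for p
    unfolding TH_def by (simp add: vec_eq_iff axis_def if_distrib cong: if_cong)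
  ultimately show ?thesis by simp
qed

text \<open>A linear relation between the forms at one point propagates by left translations.\<close>

lemma TH_inj: assumes c: "c \<in> A" and p: "p \<in> fst c" shows "inj (TH c p)"
proof (rule ccontr)
  assume ninj: "\<not> inj (TH c p)"
  note lin = TH_linear[OF c p]
  have "\<not> surj (TH c p)" using linear_surjective_imp_injective[OF lin] ninj by blast
  then have "span (range (TH c p)) \<noteq> UNIV"
    using linear_subspace_image[OF lin subspace_UNIV] span_eq_iff by blast
  then obtain x where x: "x \<noteq> 0" "\<And>y. y \<in> span (range (TH c p)) \<Longrightarrow> x \<bullet> y = 0"
    using span_not_UNIV_orthogonal[of "range (TH c p)"] by blast
  have x2: "x \<bullet> TH c p u = 0" for u by (rule x(2)[OF span_base[OF rangeI]])
  interpret group G by (rule grp)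
  have zero: "(\<Sum>a\<in>UNIV. x $ a * \<theta> a c' p' u) = 0" if c': "c' \<in> A" "p' \<in> fst c'" for c' p' u
  proof -
    have p': "p' \<in> carrier G" "p \<in> carrier G"
      using manifold_chart(3)[OF mfd c'(1)] manifold_chart(3)[OF mfd c] c'(2) p by auto
    define h where "h = p \<otimes>\<^bsub>G\<^esub> inv\<^bsub>G\<^esub> p'"
    have h: "h \<in> carrier G" "h \<otimes>\<^bsub>G\<^esub> p' = p" using p' by (auto simp: h_def m_assoc)
    have "x \<bullet> TH c' p' u = 0"
      using TH_left_invariant[OF h(1) c'(1) c c'(2)] h(2) p x2 by simp
    then show ?thesis by (simp add: inner_vec_def TH_def)
  qed
  \<comment> \<open>The zero form now has the two coefficient vectors \<open>x\<close> and 0,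
    against uniqueness in the basis property.\<close>
  have "left_invariant_one_form G A (\<lambda>c p u. 0)"
    unfolding left_invariant_one_form_def smooth_one_form_def
    using manifold_chart(2)[OF mfd] by (auto simp: linear_iff intro!: smooth_on_const)
  then have "\<exists>!x::real^'n. \<forall>c\<in>A. \<forall>p\<in>fst c. \<forall>u. 0 = (\<Sum>a\<in>UNIV. x $ a * \<theta> a c p u)"
    by (rule frame[unfolded left_invariant_one_form_basis_def, THEN conjunct2, rule_format])
  then obtain x' :: "real^'n" where x': "\<And>x. (\<forall>c\<in>A. \<forall>p\<in>fst c. \<forall>u. 0 = (\<Sum>a\<in>UNIV. x $ a * \<theta> a c p u)) \<Longrightarrow> x = x'"
    by blast
  have "x = x'" using zero by (intro x') simp
  moreover have "0 = x'" by (rule x') simp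
  ultimately have "x = 0" by simp
  with x(1) show False by simp
qed

lemma mult_tendsto:
  assumes "h \<in> carrier G" "(f \<longlongrightarrow> l) F" "l \<in> carrier G" "\<forall>\<^sub>F x in F. f x \<in> carrier G"
  shows "((\<lambda>x. h \<otimes>\<^bsub>G\<^esub> f x) \<longlongrightarrow> h \<otimes>\<^bsub>G\<^esub> l) F"
proof -
  have c: "continuous_on (carrier G \<times> carrier G) (\<lambda>(x, y). x \<otimes>\<^bsub>G\<^esub> y)"
    using mult_smooth by (simp add: smooth_map_def)
  have "((\<lambda>x. (\<lambda>(x, y). x \<otimes>\<^bsub>G\<^esub> y) (h, f x)) \<longlongrightarrow> (\<lambda>(x, y). x \<otimes>\<^bsub>G\<^esub> y) (h, l)) F"
    by (rule continuous_on_tendsto_compose[OF c]) (use assms in \<open>auto intro!: tendsto_Pair elim: eventually_mono\<close>)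
  then show ?thesis by simp
qed

text \<open>Left translation is the multiplication with its first argument frozen, so
  differentiability is inherited from the multiplication, read in a chart around
  \<open>h\<close>.\<close>

lemma left_translation_derivative:
  assumes h: "h \<in> carrier G" and c: "c \<in> A" "d \<in> A" and p: "p \<in> fst c" "h \<otimes>\<^bsub>G\<^esub> p \<in> fst d"
  shows "(coord_map c d (\<lambda>x. h \<otimes>\<^bsub>G\<^esub> x) has_derivative tangent_map c d (\<lambda>x. h \<otimes>\<^bsub>G\<^esub> x) p)
     (at (snd c p) within coord_dom c d (\<lambda>x. h \<otimes>\<^bsub>G\<^esub> x))"
proof -
  obtain c' where c': "c' \<in> A" "h \<in> fst c'" using manifold_chart_at[OF mfd h] by blast
  let ?m = "\<lambda>(x, y). x \<otimes>\<^bsub>G\<^esub> y"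
  let ?pc = "prod_chart c' c"
  have "?pc \<in> prod_atlas A A" using c' c unfolding prod_atlas_def by blast
  then have sm: "smooth_on (coord_dom ?pc d ?m) (coord_map ?pc d ?m)"
    using mult_smooth c(2) by (simp add: smooth_map_def)
  have in_dom: "(snd c' h, y) \<in> coord_dom ?pc d ?m" if y: "y \<in> coord_dom c d (\<lambda>x. h \<otimes>\<^bsub>G\<^esub> x)" for y
  proof -
    obtain q where "q \<in> fst c" "h \<otimes>\<^bsub>G\<^esub> q \<in> fst d" "y = snd c q" using y by (auto simp: coord_dom_def)
    then show ?thesis using c'(2) by (auto simp: coord_dom_def prod_chart_def image_iff intro!: bexI[of _ "(h, q)"])
  qed
  have inv: "coord_inv ?pc (snd c' h, snd c q) = (h, q)" if "q \<in> fst c" for q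
  proof -
    have "inj_on (snd c') (fst c')" "inj_on (snd c) (fst c)"
      using manifold_chart(6)[OF mfd] c'(1) c(1) by (metis inj_on_inverseI)+
    then have "inj_on (map_prod (snd c') (snd c)) (fst c' \<times> fst c)" by (rule map_prod_inj_on)
    from inv_into_f_f[OF this, of "(h, q)"] show ?thesis
      using that c'(2) by (simp add: coord_inv_def prod_chart_def)
  qed
  have eq: "coord_map c d (\<lambda>x. h \<otimes>\<^bsub>G\<^esub> x) y = coord_map ?pc d ?m (snd c' h, y)"
    if y: "y \<in> coord_dom c d (\<lambda>x. h \<otimes>\<^bsub>G\<^esub> x)" for y
  proof -
    obtain q where q: "q \<in> fst c" "y = snd c q" using y by (auto simp: coord_dom_def)
    show ?thesis by (simp add: coord_map_def q inv manifold_chart(6)[OF mfd c(1) q(1)])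
  qed
  have pS: "snd c p \<in> coord_dom c d (\<lambda>x. h \<otimes>\<^bsub>G\<^esub> x)" using p by (auto simp: coord_dom_def)
  have d1: "(coord_map ?pc d ?m has_derivative dir_deriv (coord_dom ?pc d ?m) (coord_map ?pc d ?m) (snd c' h, snd c p))
      (at (snd c' h, snd c p) within coord_dom ?pc d ?m)"
    by (rule smooth_on_has_derivative_within[OF sm in_dom[OF pS]])
  have d2: "((\<lambda>y. (snd c' h, y)) has_derivative (\<lambda>v. (0, v))) (at (snd c p) within coord_dom c d (\<lambda>x. h \<otimes>\<^bsub>G\<^esub> x))"
    by (auto intro!: derivative_eq_intros)
  have "((\<lambda>y. coord_map ?pc d ?m (snd c' h, y)) has_derivative
      (\<lambda>v. dir_deriv (coord_dom ?pc d ?m) (coord_map ?pc d ?m) (snd c' h, snd c p) (0, v)))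
      (at (snd c p) within coord_dom c d (\<lambda>x. h \<otimes>\<^bsub>G\<^esub> x))"
    by (rule has_derivative_in_compose[OF d2 has_derivative_subset[OF d1]]) (use in_dom in auto)
  then have "coord_map c d (\<lambda>x. h \<otimes>\<^bsub>G\<^esub> x) differentiable (at (snd c p) within coord_dom c d (\<lambda>x. h \<otimes>\<^bsub>G\<^esub> x))"
    unfolding differentiable_def
    by (intro exI) (rule has_derivative_transform[OF pS], erule eq)
  from dir_deriv_works[OF this] show ?thesis by (simp add: tangent_map_def[abs_def])
qed

text \<open>By left translation the curve may be assumed to pass through the identity; within a fixed time
  it cannot leave a compact coordinate ball around the identity.\<close>

lemma bounded_velocity_limit:
  assumes ab: "a < b" and x: "continuous_on {a<..<b} x" "x ` {a<..<b} \<subseteq> carrier G"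
    and vel: "\<And>s c. s \<in> {a<..<b} \<Longrightarrow> c \<in> A \<Longrightarrow> x s \<in> fst c \<Longrightarrow>
      \<exists>w. ((\<lambda>r. snd c (x r)) has_vector_derivative w) (at s) \<and> norm (TH c (x s) w) \<le> M"
  obtains l where "l \<in> carrier G" "(x \<longlongrightarrow> l) (at b within {a<..<b})"
proof -
  interpret group G by (rule grp)
  have xs: "(x \<longlongrightarrow> x s) (at s)" if "s \<in> {a<..<b}" for s
    using x(1) that by (simp add: continuous_on_eq_continuous_at isCont_def)
  have evab: "\<forall>\<^sub>F r in at s. r \<in> {a<..<b}" if "s \<in> {a<..<b}" for s
    by (rule eventually_at_in_open'[OF open_greaterThanLessThan that])
  obtain c where c: "c \<in> A" "\<one>\<^bsub>G\<^esub> \<in> fst c" using manifold_chart_at[OF mfd one_closed] by blast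
  let ?N = "snd c ` fst c"
  note ch = manifold_chart[OF mfd c(1)]
  define e0 where "e0 = snd c \<one>\<^bsub>G\<^esub>"
  have N: "open ?N" using ch(2) by simp
  then obtain R where R: "R > 0" "cball e0 R \<subseteq> ?N"
    using c(2) open_contains_cball[of ?N] unfolding e0_def by blast
  \<comment> \<open>On the coordinate ball around the identity, \<open>C\<close> bounds the
    coordinate speed by the speed measured in the frame.\<close>
  obtain C where C: "C > 0" "\<And>y w. y \<in> cball e0 R \<Longrightarrow> norm w \<le> C * norm (TH c (coord_inv c y) w)"
  proof (rule linear_field_bound_below[of "cball e0 R" "\<lambda>y. TH c (coord_inv c y)"])
    fix y assume "y \<in> cball e0 R"
    then have "coord_inv c y \<in> fst c" using R(2) ch(7) by blast
    then show "linear (TH c (coord_inv c y))" "inj (TH c (coord_inv c y))"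
      using TH_linear[OF c(1)] TH_inj[OF c(1)] by auto
  next
    show "continuous_on (cball e0 R) (\<lambda>y. TH c (coord_inv c y) e)" for e
      using continuous_on_subset[OF smooth_on_imp_continuous_on[OF TH_smooth[OF c(1)]] R(2)] .
  qed auto
  have "x ((a + b) / 2) \<in> carrier G" using x(2) ab by auto
  then obtain c1 where c1: "c1 \<in> A" "x ((a + b) / 2) \<in> fst c1" using manifold_chart_at[OF mfd] by blast
  have mid: "(a + b) / 2 \<in> {a<..<b}" using ab by simp
  obtain w1 where "norm (TH c1 (x ((a + b) / 2)) w1) \<le> M" using vel[OF mid c1] by blast
  then have M0: "M \<ge> 0" by (rule order_trans[OF norm_ge_zero])
  \<comment> \<open>Bound for the coordinate speed inside the ball; the summand 1 makes it
    positive.\<close>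
  define k where "k = C * (M + 1)"
  have k: "k > 0" using C(1) M0 by (simp add: k_def)
  \<comment> \<open>So late that a curve of speed \<open>k\<close> covers at most \<open>R/2\<close>
    between \<open>s2\<close> and \<open>b\<close>.\<close>
  define s2 where "s2 = max ((a + b) / 2) (b - R / (2 * k))"
  have s2: "a < s2" "s2 < b" using ab R(1) k by (simp_all add: s2_def less_max_iff_disj)
  have small: "k * (s - s2) < R" if "s < b" for s
  proof -
    have "s - s2 < R / (2 * k)" using that by (auto simp: s2_def)
    then have "k * (s - s2) < k * (R / (2 * k))" using k by (rule mult_strict_left_mono)
    also have "\<dots> = R / 2" using k by simp
    finally show ?thesis using R(1) by linarith
  qed
  define h where "h = inv\<^bsub>G\<^esub> (x s2)"
  have xs2: "x s2 \<in> carrier G" using x(2) s2 by auto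
  have h: "h \<in> carrier G" using xs2 by (simp add: h_def)
  define y where "y s = h \<otimes>\<^bsub>G\<^esub> x s" for s
  define \<eta> where "\<eta> s = snd c (y s)" for s
  have yG: "y s \<in> carrier G" if "s \<in> {a<..<b}" for s
    unfolding y_def using x(2) that by (intro m_closed h) auto
  have ys: "(y \<longlongrightarrow> y s) (at s)" if "s \<in> {a<..<b}" for s
    unfolding y_def
  proof (rule mult_tendsto[OF h xs[OF that]])
    show "x s \<in> carrier G" using x(2) that by auto
    show "\<forall>\<^sub>F r in at s. x r \<in> carrier G" using evab[OF that] by eventually_elim (use x(2) in auto)
  qed
  have ev_chart: "\<forall>\<^sub>F r in at s. y r \<in> fst c" if "s \<in> {a<..<b}" "y s \<in> fst c" for s
    by (rule eventually_in_chart[OF mfd c(1) ys[OF that(1)] _ that(2)]) (rule eventually_mono[OF evab[OF that(1)] yG])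
  have \<eta>s: "(\<eta> \<longlongrightarrow> \<eta> s) (at s)" if "s \<in> {a<..<b}" "y s \<in> fst c" for s
    unfolding \<eta>_def by (rule continuous_on_tendsto_compose[OF ch(4) ys[OF that(1)] that(2) ev_chart[OF that]])
  have \<eta>': "\<exists>w. (\<eta> has_vector_derivative w) (at s) \<and> norm (TH c (y s) w) \<le> M"
    \<comment> \<open>The velocity of \<open>x\<close> is known in a chart \<open>d\<close> around
      \<open>x s\<close>; it is carried to the chart \<open>c\<close> by the translation with
      \<open>h\<close>, under which the frame components do not change.\<close>
    if s: "s \<in> {a<..<b}" "y s \<in> fst c" for s
  proof -
    have "x s \<in> carrier G" using x(2) s by auto
    then obtain d where d: "d \<in> A" "x s \<in> fst d" using manifold_chart_at[OF mfd] by blast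
    obtain w where w: "((\<lambda>r. snd d (x r)) has_vector_derivative w) (at s)" "norm (TH d (x s) w) \<le> M"
      using vel[OF s(1) d] by blast
    let ?S = "coord_dom d c (\<lambda>z. h \<otimes>\<^bsub>G\<^esub> z)" and ?L = "coord_map d c (\<lambda>z. h \<otimes>\<^bsub>G\<^esub> z)"
    let ?D = "tangent_map d c (\<lambda>z. h \<otimes>\<^bsub>G\<^esub> z) (x s)"
    have ysc: "h \<otimes>\<^bsub>G\<^esub> x s \<in> fst c" using s(2) by (simp add: y_def)
    have "\<forall>\<^sub>F r in at s. x r \<in> carrier G" using evab[OF s(1)] by eventually_elim (use x(2) in auto)
    then have "\<forall>\<^sub>F r in at s. x r \<in> fst d \<and> y r \<in> fst c"
      by (intro eventually_conj eventually_in_chart[OF mfd d(1) xs[OF s(1)] _ d(2)] ev_chart[OF s])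
    then obtain W where W: "open W" "s \<in> W" "\<And>r. r \<in> W \<Longrightarrow> r \<noteq> s \<Longrightarrow> x r \<in> fst d \<and> y r \<in> fst c"
      unfolding eventually_at_topological by auto
    have W': "x r \<in> fst d" "y r \<in> fst c" if "r \<in> W" for r
      using W(3)[OF that] d(2) s(2) by (cases "r = s"; auto)+
    have dom: "snd d (x r) \<in> ?S" if "r \<in> W" for r using W'[OF that] by (auto simp: coord_dom_def y_def)
    have "((\<lambda>r. ?L (snd d (x r))) has_derivative (\<lambda>r. ?D (r *\<^sub>R w))) (at s within W)"
      by (rule has_derivative_in_compose[OF
            has_derivative_at_withinI[OF w(1)[unfolded has_vector_derivative_def]]
            has_derivative_subset[OF left_translation_derivative[OF h d(1) c(1) d(2) ysc]]])
        (use dom in auto)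
    moreover have lin: "linear ?D"
      using left_translation_derivative[OF h d(1) c(1) d(2) ysc] has_derivative_linear by blast
    ultimately have Lw: "((\<lambda>r. ?L (snd d (x r))) has_vector_derivative ?D w) (at s within W)"
      by (simp add: has_vector_derivative_def linear_scale[OF lin])
    have "\<eta> r = ?L (snd d (x r))" if "r \<in> W" for r
      using manifold_chart(6)[OF mfd d(1) W'(1)[OF that]] by (simp add: coord_map_def \<eta>_def y_def)
    from has_vector_derivative_transform[OF W(2) this Lw]
    have "(\<eta> has_vector_derivative ?D w) (at s)"
      by (simp only: at_within_open[OF W(2,1)])
    moreover have "TH c (y s) (?D w) = TH d (x s) w"
      using TH_left_invariant[OF h d(1) c(1) d(2) ysc] by (simp add: y_def)
    ultimately show ?thesis using w(2) by metis
  qed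
  define inK where "inK s \<longleftrightarrow> y s \<in> fst c \<and> \<eta> s \<in> cball e0 R" for s
  have \<eta>k: "\<exists>w. (\<eta> has_vector_derivative w) (at s) \<and> norm w \<le> k" if s: "s \<in> {a<..<b}" "inK s" for s
  proof -
    obtain w where w: "(\<eta> has_vector_derivative w) (at s)" "norm (TH c (y s) w) \<le> M"
      using \<eta>'[OF s(1)] s(2) by (auto simp: inK_def)
    have "norm w \<le> C * norm (TH c (coord_inv c (\<eta> s)) w)" using C(2) s(2) by (simp add: inK_def)
    also have "coord_inv c (\<eta> s) = y s" unfolding \<eta>_def using s(2) by (intro ch(6)) (simp add: inK_def)
    also have "C * norm (TH c (y s) w) \<le> k" unfolding k_def using w(2) C(1) by (intro mult_left_mono) auto
    finally show ?thesis using w(1) by blast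
  qed
  have mv: "norm (\<eta> s - \<eta> r) \<le> k * norm (s - r)" if K: "\<And>q. q \<in> {r..s} \<Longrightarrow> inK q" and rs: "s2 \<le> r" "r \<le> s" "s < b" for r s
  proof -
    obtain w where w: "\<And>q. q \<in> {r..s} \<Longrightarrow> (\<eta> has_vector_derivative w q) (at q)" "\<And>q. q \<in> {r..s} \<Longrightarrow> norm (w q) \<le> k"
    proof -
      have "\<exists>w. (\<eta> has_vector_derivative w) (at q) \<and> norm w \<le> k" if "q \<in> {r..s}" for q
        by (rule \<eta>k[OF _ K[OF that]]) (use that rs s2 in auto)
      then show ?thesis using that by metis
    qed
    show ?thesis
    proof (rule differentiable_bound[of "{r..s}" \<eta> "\<lambda>q v. v *\<^sub>R w q"])
      fix q assume q: "q \<in> {r..s}"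
      show "(\<eta> has_derivative (\<lambda>v. v *\<^sub>R w q)) (at q within {r..s})"
        using w(1)[OF q] has_derivative_at_withinI unfolding has_vector_derivative_def by blast
      show "onorm (\<lambda>v. v *\<^sub>R w q) \<le> k"
        using w(2)[OF q] by (simp add: onorm_scaleR_left[OF bounded_linear_ident, simplified] onorm_id)
    qed (use rs in auto)
  qed
  have start: "y s2 = \<one>\<^bsub>G\<^esub>" "\<eta> s2 = e0" "inK s2"
    using xs2 c(2) R(1) by (simp_all add: y_def h_def \<eta>_def e0_def inK_def)
  \<comment> \<open>Compact sets are closed in the Hausdorff space \<open>carrier G\<close>. Hence
    being outside the ball is an open condition on \<open>y\<close>, also at points outside the
    chart, where \<open>\<eta>\<close> has no meaning.\<close>
  have "compact (coord_inv c ` cball e0 R)"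
    by (rule compact_continuous_image[OF continuous_on_subset[OF ch(5) R(2)] compact_cball])
  moreover have sub: "coord_inv c ` cball e0 R \<subseteq> carrier G" using R(2) ch(3,7) by blast
  ultimately have "compactin (top_of_set (carrier G)) (coord_inv c ` cball e0 R)"
    by (simp add: compactin_subtopology compactin_euclidean_iff)
  then have "closedin (top_of_set (carrier G)) (coord_inv c ` cball e0 R)"
    using compactin_imp_closedin mfd unfolding smooth_manifold_def by blast
  then obtain Z where Z: "closed Z" "coord_inv c ` cball e0 R = carrier G \<inter> Z"
    by (auto simp: closedin_closed)
  have K_iff: "inK s \<longleftrightarrow> y s \<in> Z" if "s \<in> {a<..<b}" for s
  proof
    assume K: "inK s"
    then have "coord_inv c (\<eta> s) \<in> carrier G \<inter> Z" unfolding Z(2)[symmetric] by (auto simp: inK_def)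
    then show "y s \<in> Z" using ch(6)[of "y s"] K by (simp add: inK_def \<eta>_def)
  next
    assume "y s \<in> Z"
    then have "y s \<in> coord_inv c ` cball e0 R" using yG[OF that] Z(2) by auto
    then obtain v where v: "v \<in> cball e0 R" "y s = coord_inv c v" by auto
    then have "v \<in> ?N" using R(2) by blast
    then show "inK s" using v ch(7,8)[of v] by (simp add: inK_def \<eta>_def)
  qed
  define P where "P s \<longleftrightarrow> (\<forall>r\<in>{s2..s}. inK r)" for s
  have P: "P s" if "s \<in> {s2..<b}" for s
  proof (rule connected_induction_simple[of "{s2..<b}" s2 s P])
    show "P s2" using start(3) by (simp add: P_def)
    fix s assume s: "s \<in> {s2..<b}"
    then have sab: "s \<in> {a<..<b}" using s2 by auto
    have "\<exists>e>0. \<forall>r\<in>{s2..<b} \<inter> ball s e. \<forall>r'\<in>{s2..<b} \<inter> ball s e. P r \<longrightarrow> P r'"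
    proof (cases "y s \<in> fst c \<and> \<eta> s \<in> ball e0 R")
      case True
      have "\<forall>\<^sub>F r in at s. \<eta> r \<in> ball e0 R"
        by (rule topological_tendstoD[OF \<eta>s[OF sab]]) (use True in auto)
      with ev_chart[OF sab] True have "\<forall>\<^sub>F r in at s. y r \<in> fst c \<and> \<eta> r \<in> ball e0 R"
        by (auto intro: eventually_conj)
      then obtain e where e: "e > 0" "\<And>r. r \<noteq> s \<Longrightarrow> dist r s < e \<Longrightarrow> y r \<in> fst c \<and> \<eta> r \<in> ball e0 R"
        unfolding eventually_at by auto
      have inball: "inK r" if "dist r s < e" for r
        using e(2)[of r] that True by (cases "r = s") (auto simp: inK_def)
      have "P r'" if "r \<in> {s2..<b} \<inter> ball s e" "r' \<in> {s2..<b} \<inter> ball s e" "P r" for r r'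
        unfolding P_def
      proof
        fix q assume q: "q \<in> {s2..r'}"
        show "inK q"
        proof (cases "q \<le> r")
          case False
          then have "dist q s < e" using that q by (auto simp: dist_real_def abs_less_iff)
          then show ?thesis by (rule inball)
        qed (use that(3) q in \<open>auto simp: P_def\<close>)
      qed
      with e(1) show ?thesis by blast
    next
      \<comment> \<open>Near such an \<open>s\<close> the property \<open>P\<close> holds nowhere,
        so its propagation is vacuous: either \<open>y s\<close> is outside the closed ball, or
        \<open>\<eta> s\<close> is on its sphere, farther from \<open>e0\<close> than the speed
        bound allows.\<close>
      case False
      have "\<forall>\<^sub>F r in at s. r \<in> {s2..<b} \<longrightarrow> \<not> P r"
      proof (cases "inK s")
        case True
        then have n: "norm (\<eta> s - e0) \<ge> R" "y s \<in> fst c" using False by (auto simp: inK_def dist_norm norm_minus_commute)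
        have "((\<lambda>r. norm (\<eta> r - e0) - k * (r - s2)) \<longlongrightarrow> norm (\<eta> s - e0) - k * (s - s2)) (at s)"
          by (intro tendsto_intros \<eta>s[OF sab n(2)])
        moreover have "norm (\<eta> s - e0) - k * (s - s2) > 0" using n small[of s] s by auto
        ultimately have "\<forall>\<^sub>F r in at s. norm (\<eta> r - e0) - k * (r - s2) > 0" by (rule order_tendstoD)
        then show ?thesis
        proof eventually_elim
          case (elim r)
          show ?case
          proof (intro impI notI)
            assume r: "r \<in> {s2..<b}" and Pr: "P r"
            have "norm (\<eta> r - \<eta> s2) \<le> k * norm (r - s2)"
              by (rule mv) (use Pr r in \<open>auto simp: P_def\<close>)
            with elim r show False by (simp add: start)
          qed
        qed
      next
        case False
        then have "y s \<in> - Z" using K_iff[OF sab] by simp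
        then have "\<forall>\<^sub>F r in at s. y r \<in> - Z" using topological_tendstoD[OF ys[OF sab], of "- Z"] Z(1) by auto
        then show ?thesis
          by eventually_elim (use K_iff s2 in \<open>auto simp: P_def\<close>)
      qed
      moreover have "\<not> P s"
      proof
        assume Ps: "P s"
        then have "norm (\<eta> s - \<eta> s2) \<le> k * norm (s - s2)"
          by (intro mv) (use s in \<open>auto simp: P_def\<close>)
        then have "norm (\<eta> s - e0) < R" using small[of s] s by (auto simp: start)
        moreover have "inK s" using Ps s by (auto simp: P_def)
        ultimately show False using False by (auto simp: inK_def dist_norm norm_minus_commute)
      qed
      ultimately obtain e where "e > 0" "\<And>r. dist r s < e \<Longrightarrow> r \<in> {s2..<b} \<Longrightarrow> \<not> P r"
        unfolding eventually_at by (metis UNIV_I)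
      then show ?thesis by (auto simp: dist_commute)
    qed
    then obtain e where "e > 0" "\<forall>r\<in>{s2..<b} \<inter> ball s e. \<forall>r'\<in>{s2..<b} \<inter> ball s e. P r \<longrightarrow> P r'" by blast
    then show "\<exists>T. openin (top_of_set {s2..<b}) T \<and> s \<in> T \<and> (\<forall>x\<in>T. \<forall>y\<in>T. P x \<longrightarrow> P y)"
      using s by (intro exI[of _ "{s2..<b} \<inter> ball s e"]) (auto intro: openin_open_Int)
  qed (use that s2 in auto)
  have inK: "inK s" if "s \<in> {s2..<b}" for s using P[OF that] that by (auto simp: P_def)
  obtain w where w: "\<And>s. s \<in> {s2..<b} \<Longrightarrow> (\<eta> has_vector_derivative w s) (at s)" "\<And>s. s \<in> {s2..<b} \<Longrightarrow> norm (w s) \<le> k"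
    using \<eta>k inK s2 by (metis atLeastLessThan_iff greaterThanLessThan_iff less_le_trans)
  obtain v where v: "(\<eta> \<longlongrightarrow> v) (at b within {s2..<b})"
    by (rule bounded_derivative_limit[OF s2(2), of \<eta> w k])
      (use w has_vector_derivative_at_within in blast)+
  have nontriv: "at b within {s2..<b} \<noteq> bot" using s2 by (simp add: at_within_eq_bot_iff)
  have ev: "\<forall>\<^sub>F r in at b within {s2..<b}. r \<in> {s2..<b}" by (simp add: eventually_at_filter)
  have vK: "v \<in> cball e0 R"
    by (rule Lim_in_closed_set[OF closed_cball _ nontriv v]) (use ev inK in \<open>auto elim!: eventually_mono simp: inK_def\<close>)
  then have vN: "v \<in> ?N" using R(2) by blast
  have "((\<lambda>s. coord_inv c (\<eta> s)) \<longlongrightarrow> coord_inv c v) (at b within {s2..<b})"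
    by (rule continuous_on_tendsto_compose[OF ch(5) v vN])
      (use ev inK in \<open>auto elim!: eventually_mono simp: inK_def \<eta>_def\<close>)
  then have "((\<lambda>s. x s2 \<otimes>\<^bsub>G\<^esub> coord_inv c (\<eta> s)) \<longlongrightarrow> x s2 \<otimes>\<^bsub>G\<^esub> coord_inv c v) (at b within {s2..<b})"
  proof (rule mult_tendsto[OF xs2])
    show "coord_inv c v \<in> carrier G" using ch(3,7) vN by auto
    have "coord_inv c (\<eta> s) \<in> carrier G" if "s \<in> {s2..<b}" for s
    proof -
      have "\<eta> s \<in> ?N" using inK[OF that] R(2) by (auto simp: inK_def)
      then show ?thesis using ch(3,7) by blast
    qed
    then show "\<forall>\<^sub>F s in at b within {s2..<b}. coord_inv c (\<eta> s) \<in> carrier G"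
      by (rule eventually_mono[OF ev])
  qed
  moreover have "x s2 \<otimes>\<^bsub>G\<^esub> coord_inv c (\<eta> s) = x s" if "s \<in> {s2..<b}" for s
  proof -
    have "coord_inv c (\<eta> s) = y s" unfolding \<eta>_def using inK[OF that] by (intro ch(6)) (simp add: inK_def)
    moreover have "x s \<in> carrier G" using x(2) that s2 by auto
    ultimately show ?thesis using xs2 by (simp add: y_def h_def m_assoc[symmetric])
  qed
  ultimately have "(x \<longlongrightarrow> x s2 \<otimes>\<^bsub>G\<^esub> coord_inv c v) (at b within {s2..<b})"
    by (rule Lim_transform_eventually[OF _ eventually_mono[OF ev]]) auto
  moreover have "at b within {s2..<b} = at b within {a<..<b}"
    by (rule at_within_nhd[of b "{s2<..}"]) (use s2 in auto)
  moreover have "x s2 \<otimes>\<^bsub>G\<^esub> coord_inv c v \<in> carrier G" using xs2 ch(3,7) vN by auto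
  ultimately show ?thesis using that by simp
qed

end

section \<open>The spacetime in product coordinates\<close>

lemma has_vector_derivative_local_cong:
  assumes W: "open W" "x \<in> W" and x: "x \<in> S" and S: "S \<inter> W = S' \<inter> W" and f: "\<And>y. y \<in> S \<inter> W \<Longrightarrow> f y = f' y"
  shows "(f has_vector_derivative D) (at x within S) \<longleftrightarrow> (f' has_vector_derivative D) (at x within S')"
proof -
  have 1: "at x within S = at x within (S \<inter> W)" and 2: "at x within S' = at x within (S \<inter> W)"
    by (rule at_within_nhd[OF W(2,1)]; use S in auto)+
  have xs: "x \<in> S \<inter> W" using x W(2) by simp
  show ?thesis
    unfolding 1 2
    using has_vector_derivative_transform[OF xs, of f' f D] has_vector_derivative_transform[OF xs, of f f' D] f
    by metis
qed

lemma vector_derivative_local_cong: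
  assumes "open W" "x \<in> W" "x \<in> S" "S \<inter> W = S' \<inter> W" "\<And>y. y \<in> S \<inter> W \<Longrightarrow> f y = f' y"
  shows "vector_derivative f (at x within S) = vector_derivative f' (at x within S')"
  unfolding vector_derivative_def using has_vector_derivative_local_cong[OF assms] by simp

text \<open>An interval with interior points has no isolated points. This makes the vector
  derivative unique, so that \<open>velocity\<close> has the expected value.\<close>

lemma interval_nontrivial_limit:
  fixes J :: "real set"
  assumes "is_interval J" "interior J \<noteq> {}" "x \<in> J" "open W" "x \<in> W"
  shows "at x within (J \<inter> W) \<noteq> bot"
proof -
  have "infinite J" using assms(2) using empty_interior_finite by blast
  then have "\<nexists>a. J = {a}" by auto
  then have "x islimpt J"
    using connected_imp_perfect[of J x] assms(1,3) is_interval_connected by blast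
  moreover have "at x within J = at x within (J \<inter> W)"
    by (rule at_within_nhd[OF assms(5,4)]) auto
  ultimately show ?thesis by (metis trivial_limit_within)
qed

locale spacetime =
  fixes G :: "'g::topological_space monoid" and A :: "('g, real^'n::finite) chart set"
    and \<theta> :: "'n \<Rightarrow> ('g, real^'n) one_form" and T :: real and gm :: "real \<Rightarrow> real^'n^'n"
    and M :: "'m::topological_space set" and B :: "('m, real \<times> (real^'n)) chart set"
    and g :: "('m, real \<times> (real^'n)) bilinear_field" and \<pi> :: "real \<times> 'g \<Rightarrow> 'm"
  assumes lsh: "locally_spatially_homogeneous G A \<theta> T gm M B g \<pi>"
begin

sublocale left_invariant_frame G A \<theta>
  using lsh by unfold_locales (simp_all add: locally_spatially_homogeneous_def)

abbreviation "pc c \<equiv> prod_chart ({T..}, id) c"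
abbreviation "NN c \<equiv> snd c ` fst c"

definition pt :: "('g, real^'n) chart \<Rightarrow> real \<times> (real^'n) \<Rightarrow> real \<times> 'g" where
  "pt c x = (fst x, coord_inv c (snd x))"

definition th :: "('g, real^'n) chart \<Rightarrow> real^'n \<Rightarrow> real^'n \<Rightarrow> real^'n" where
  "th c y = TH c (coord_inv c y)"

abbreviation "\<phi> c d \<equiv> coord_map (pc c) d \<pi>"
abbreviation "cdom c d \<equiv> coord_dom (pc c) d \<pi>"

text \<open>The part \<open>t > T\<close> of the domain of the coordinate expression of
  \<open>\<pi>\<close>. It is open, while \<open>cdom c d\<close> may contain boundary
  points.\<close>

definition UU :: "('g, real^'n) chart \<Rightarrow> ('m, real \<times> (real^'n)) chart \<Rightarrow> (real \<times> (real^'n)) set" where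
  "UU c d = {x \<in> {T<..} \<times> NN c. \<pi> (pt c x) \<in> fst d}"

definition V' :: "('m, real \<times> (real^'n)) chart \<Rightarrow> (real \<times> (real^'n)) set" where
  "V' d = interior (snd d ` fst d)"

abbreviation "hhc c \<equiv> homogeneous_metric.hh (th c) gm"
abbreviation "gpc c \<equiv> gaussian_metric.gp (hhc c)"

lemma M_mfd: "smooth_manifold ({T..} \<times> UNIV) M B"
  and lorentz: "lorentzian_metric B g"
  and cover: "covering_space ({T..} \<times> carrier G) \<pi> M"
  and \<pi>_smooth: "smooth_map ({T..} \<times> carrier G) (time_atlas T A) M B \<pi>"
  and gm_smooth: "smooth_on {T..} gm"
  and gm_sym: "t \<ge> T \<Longrightarrow> transpose (gm t) = gm t"
  and gm_pos: "t \<ge> T \<Longrightarrow> v \<noteq> 0 \<Longrightarrow> v \<bullet> (gm t *v v) > 0"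
  using lsh by (simp_all add: locally_spatially_homogeneous_def)

lemma \<pi>_cont: "continuous_on ({T..} \<times> carrier G) \<pi>" and \<pi>_image: "z \<in> {T..} \<times> carrier G \<Longrightarrow> \<pi> z \<in> M"
  using \<pi>_smooth by (auto simp: smooth_map_def)

lemma pc_in: "c \<in> A \<Longrightarrow> pc c \<in> time_atlas T A"
  unfolding time_atlas_def prod_atlas_def by blast

lemma time_atlas_iff: "c' \<in> time_atlas T A \<longleftrightarrow> (\<exists>c\<in>A. c' = pc c)"
  unfolding time_atlas_def prod_atlas_def by blast

lemma N_open: "c \<in> A \<Longrightarrow> open (NN c)"
  using manifold_chart(2)[OF mfd] by simp

lemma in_carrier: "c \<in> A \<Longrightarrow> p \<in> fst c \<Longrightarrow> p \<in> carrier G"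
  using manifold_chart(3)[OF mfd] by blast

lemma pc_coord_inv:
  assumes c: "c \<in> A" and x: "fst x \<ge> T" "snd x \<in> NN c" shows "coord_inv (pc c) x = pt c x"
proof -
  have "inj_on (snd c) (fst c)"
    using manifold_chart(6)[OF mfd c] by (metis inj_on_inverseI)
  then have inj: "inj_on (map_prod id (snd c)) ({T..} \<times> fst c)" by (intro map_prod_inj_on) auto
  note ci = manifold_chart(7,8)[OF mfd c x(2)]
  have "(fst x, coord_inv c (snd x)) \<in> {T..} \<times> fst c" using x ci by auto
  from inv_into_f_f[OF inj this] have "inv_into ({T..} \<times> fst c) (map_prod id (snd c)) x = pt c x"
    using ci by (simp add: pt_def)
  then show ?thesis by (simp add: coord_inv_def prod_chart_def)
qed

lemma \<phi>_eq: "c \<in> A \<Longrightarrow> fst x \<ge> T \<Longrightarrow> snd x \<in> NN c \<Longrightarrow> \<phi> c d x = snd d (\<pi> (pt c x))"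
  by (simp add: coord_map_def pc_coord_inv)

lemma pt_coord: "c \<in> A \<Longrightarrow> p \<in> fst c \<Longrightarrow> pt c (t, snd c p) = (t, p)"
  using manifold_chart(6)[OF mfd] by (simp add: pt_def)

lemma pt_in: "c \<in> A \<Longrightarrow> fst x \<ge> T \<Longrightarrow> snd x \<in> NN c \<Longrightarrow> pt c x \<in> {T..} \<times> carrier G"
  using manifold_chart(7)[OF mfd] in_carrier by (auto simp: pt_def)

lemma dom_iff:
  assumes c: "c \<in> A" shows "x \<in> cdom c d \<longleftrightarrow> fst x \<ge> T \<and> snd x \<in> NN c \<and> \<pi> (pt c x) \<in> fst d"
proof
  assume "x \<in> cdom c d"
  then show "fst x \<ge> T \<and> snd x \<in> NN c \<and> \<pi> (pt c x) \<in> fst d"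
    using pt_coord[OF c] by (auto simp: coord_dom_def prod_chart_def)
next
  assume x: "fst x \<ge> T \<and> snd x \<in> NN c \<and> \<pi> (pt c x) \<in> fst d"
  then have "pt c x \<in> fst (pc c) \<inter> \<pi> -` fst d" "x = snd (pc c) (pt c x)"
    using manifold_chart(7,8)[OF mfd c] by (auto simp: prod_chart_def pt_def prod_eq_iff)
  then show "x \<in> cdom c d" unfolding coord_dom_def by blast
qed

lemma pt_cont: "c \<in> A \<Longrightarrow> continuous_on ({T..} \<times> NN c) (\<lambda>x. \<pi> (pt c x))"
proof -
  assume c: "c \<in> A"
  have "continuous_on ({T..} \<times> NN c) (pt c)"
    unfolding pt_def[abs_def]
    by (intro continuous_intros continuous_on_compose2[OF manifold_chart(5)[OF mfd c] continuous_on_snd]) auto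
  then show ?thesis
  proof (rule continuous_on_compose2[OF \<pi>_cont])
    show "pt c ` ({T..} \<times> NN c) \<subseteq> {T..} \<times> carrier G"
      by (rule image_subsetI, rule pt_in[OF c]) auto
  qed
qed

lemma UU_open: assumes c: "c \<in> A" and d: "d \<in> B" shows "open (UU c d)"
proof -
  have o: "open ({T<..} \<times> NN c)" by (intro open_Times N_open c open_greaterThan)
  have cont: "continuous_on ({T<..} \<times> NN c) (\<lambda>x. \<pi> (pt c x))"
    by (rule continuous_on_subset[OF pt_cont[OF c]]) auto
  have "openin (top_of_set ({T<..} \<times> NN c)) (({T<..} \<times> NN c) \<inter> (\<lambda>x. \<pi> (pt c x)) -` fst d)"
  proof (rule continuous_openin_preimage[OF cont _ manifold_chart(1)[OF M_mfd d]])
    have "\<pi> (pt c x) \<in> M" if "x \<in> {T<..} \<times> NN c" for x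
      by (rule \<pi>_image, rule pt_in[OF c]) (use that in auto)
    then show "(\<lambda>x. \<pi> (pt c x)) \<in> {T<..} \<times> NN c \<rightarrow> M" by blast
  qed
  moreover have "({T<..} \<times> NN c) \<inter> (\<lambda>x. \<pi> (pt c x)) -` fst d = UU c d" by (auto simp: UU_def)
  ultimately show ?thesis using o openin_open_trans by metis
qed

lemma UU_dom: "c \<in> A \<Longrightarrow> UU c d \<subseteq> cdom c d"
  by (auto simp: UU_def dom_iff)

lemma UU_D:
  assumes "c \<in> A" "x \<in> UU c d"
  shows "x \<in> cdom c d" "T < fst x" "T \<le> fst x" "snd x \<in> NN c" "\<pi> (pt c x) \<in> fst d"
  using assms(2) subsetD[OF UU_dom[OF assms(1)] assms(2)] by (auto simp: UU_def)

lemma UU_interior: "c \<in> A \<Longrightarrow> d \<in> B \<Longrightarrow> x \<in> UU c d \<Longrightarrow> x \<in> interior (cdom c d)"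
  using interior_maximal[OF UU_dom UU_open] by blast

lemma hom:
  assumes c: "c \<in> A" shows "homogeneous_metric T (NN c) (th c) gm"
proof (rule homogeneous_metric.intro)
  show "open (NN c)" by (rule N_open[OF c])
  fix y assume "y \<in> NN c"
  note p = manifold_chart(7)[OF mfd c this]
  show "linear (th c y)" unfolding th_def[abs_def] by (rule TH_linear[OF c p])
  show "inj (th c y)" unfolding th_def[abs_def] by (rule TH_inj[OF c p])
next
  show "smooth_on (NN c) (\<lambda>y. th c y u)" for u
    using TH_smooth[OF c] by (simp add: th_def)
  show "smooth_on {T<..} gm"
    by (rule smooth_on_open_subset[OF gm_smooth]) auto
qed (use gm_sym gm_pos in auto)

lemma gpc_eq:
  "c \<in> A \<Longrightarrow> gpc c x a b = - (fst a * fst b) + th c (snd x) (snd a) \<bullet> (gm (fst x) *v th c (snd x) (snd b))"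
proof -
  assume c: "c \<in> A"
  interpret H: homogeneous_metric T "NN c" "th c" gm by (rule hom[OF c])
  show ?thesis by (simp add: H.gp_def H.hh_def)
qed

lemma \<phi>_smooth: "c \<in> A \<Longrightarrow> d \<in> B \<Longrightarrow> smooth_on (cdom c d) (\<phi> c d)"
  using \<pi>_smooth pc_in by (simp add: smooth_map_def)

lemma \<phi>_derivative:
  "c \<in> A \<Longrightarrow> d \<in> B \<Longrightarrow> x \<in> cdom c d \<Longrightarrow> (\<phi> c d has_derivative dir_deriv (cdom c d) (\<phi> c d) x) (at x within cdom c d)"
  by (rule smooth_on_has_derivative_within[OF \<phi>_smooth])

lemma pullback:
  assumes c: "c \<in> A" and d: "d \<in> B" and x: "x \<in> cdom c d"
  shows "g d (\<pi> (pt c x)) (dir_deriv (cdom c d) (\<phi> c d) x a) (dir_deriv (cdom c d) (\<phi> c d) x b) = gpc c x a b"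
proof -
  obtain t y where ty: "x = (t, y)" by (cases x)
  obtain r u where a: "a = (r, u)" by (cases a)
  obtain s v where b: "b = (s, v)" by (cases b)
  have *: "t \<ge> T" "y \<in> NN c" "\<pi> (pt c x) \<in> fst d" using x dom_iff[OF c, of x d] ty by auto
  define p where "p = coord_inv c y"
  have p: "p \<in> fst c" "snd c p = y" "pt c x = (t, p)"
    using manifold_chart(7,8)[OF mfd c *(2)] by (auto simp: p_def pt_def ty)
  have "\<forall>c\<in>A. \<forall>d\<in>B. \<forall>t\<ge>T. \<forall>x\<in>fst c. \<pi> (t, x) \<in> fst d \<longrightarrow>
      (\<forall>r u s v. g d (\<pi> (t, x)) (tangent_map (pc c) d \<pi> (t, x) (r, u)) (tangent_map (pc c) d \<pi> (t, x) (s, v))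
         = - r * s + (\<Sum>a\<in>UNIV. \<Sum>b\<in>UNIV. gm t $ a $ b * \<theta> a c x u * \<theta> b c x v))"
    using lsh unfolding locally_spatially_homogeneous_def by (elim conjE)
  from this[rule_format, OF c d *(1) p(1)]
  have "g d (\<pi> (t, p)) (tangent_map (pc c) d \<pi> (t, p) (r, u)) (tangent_map (pc c) d \<pi> (t, p) (s, v))
      = - r * s + (\<Sum>a\<in>UNIV. \<Sum>b\<in>UNIV. gm t $ a $ b * \<theta> a c p u * \<theta> b c p v)"
    using *(3) p(3) by simp
  moreover have "snd (pc c) (t, p) = x" using p by (simp add: prod_chart_def ty)
  moreover have "(\<Sum>a\<in>UNIV. \<Sum>b\<in>UNIV. gm t $ a $ b * \<theta> a c p u * \<theta> b c p v) = TH c p u \<bullet> (gm t *v TH c p v)"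
    by (simp add: inner_vec_def matrix_vector_mult_def TH_def sum_distrib_left mult_ac)
  ultimately show ?thesis
    by (simp add: gpc_eq[OF c] tangent_map_def a b pt_def ty th_def p_def)
qed

lemma gpc_causal:
  assumes c: "c \<in> A" and x: "fst x \<ge> T" "snd x \<in> NN c" and v: "gpc c x v v \<le> 0" "v \<noteq> 0"
  shows "fst v \<noteq> 0"
proof
  assume "fst v = 0"
  then have le: "th c (snd x) (snd v) \<bullet> (gm (fst x) *v th c (snd x) (snd v)) \<le> 0"
    using v(1) by (simp add: gpc_eq[OF c])
  have "th c (snd x) (snd v) = 0"
    using gm_pos[OF x(1), of "th c (snd x) (snd v)"] le by (cases "th c (snd x) (snd v) = 0") auto
  then have "snd v = 0"
    using homogeneous_metric.th_zero[OF hom[OF c] x(2)] by blast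
  with \<open>fst v = 0\<close> v(2) show False by (simp add: prod_eq_iff)
qed

text \<open>A vector in the kernel is orthogonal to all others for the pulled-back metric. Pairing
  it with the time direction kills its time component, and positive definiteness of
  \<open>gm\<close> the rest. This includes the boundary \<open>t = T\<close>, where a lifted
  geodesic may start.\<close>

lemma d\<phi>_inj:
  assumes c: "c \<in> A" and d: "d \<in> B" and x: "x \<in> cdom c d" shows "inj (dir_deriv (cdom c d) (\<phi> c d) x)"
proof -
  have lin: "linear (dir_deriv (cdom c d) (\<phi> c d) x)"
    using \<phi>_derivative[OF c d x] has_derivative_linear by blast
  have xx: "fst x \<ge> T" "snd x \<in> NN c" "\<pi> (pt c x) \<in> fst d" using dom_iff[OF c, of x d] x by auto
  have bil: "bilinear (g d (\<pi> (pt c x)))"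
    using lorentz d xx(3) unfolding lorentzian_metric_def smooth_bilinear_field_def by blast
  show ?thesis
    unfolding linear_injective_0[OF lin]
  proof (intro allI impI)
    fix v assume "dir_deriv (cdom c d) (\<phi> c d) x v = 0"
    then have z: "gpc c x v b = 0" for b
      using pullback[OF c d x, of v b] bilinear_lzero[OF bil] by simp
    have "fst v = 0"
      using z[of "(1, 0)"] linear_0[OF TH_linear[OF c manifold_chart(7)[OF mfd c xx(2)]]]
      by (simp add: gpc_eq[OF c] th_def)
    then show "v = 0" using gpc_causal[OF c xx(1,2), of v] z[of v] by auto
  qed
qed

lemma V'_metric: assumes d: "d \<in> B" shows "metric_on (V' d) (in_coords d g)"
  unfolding metric_on_def
proof (intro conjI ballI allI)
  fix u v
  have "smooth_on (snd d ` fst d) (\<lambda>x. g d (coord_inv d x) u v)"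
    using lorentz d unfolding lorentzian_metric_def smooth_bilinear_field_def by blast
  then show "smooth_on (V' d) (\<lambda>x. in_coords d g x u v)"
    unfolding in_coords_def V'_def by (rule smooth_on_open_subset) (rule open_interior, rule interior_subset)
next
  fix x assume "x \<in> V' d"
  then have "coord_inv d x \<in> fst d" using manifold_chart(7)[OF M_mfd d] subsetD[OF interior_subset] unfolding V'_def by blast
  then have *: "bilinear (g d (coord_inv d x))" "\<And>u v. g d (coord_inv d x) u v = g d (coord_inv d x) v u"
    "\<exists>K. g d (coord_inv d x) K K < 0 \<and> (\<forall>u. u \<noteq> 0 \<and> g d (coord_inv d x) K u = 0 \<longrightarrow> g d (coord_inv d x) u u > 0)"
    using lorentz d unfolding lorentzian_metric_def smooth_bilinear_field_def by blast+
  show "nondeg_form (in_coords d g x)"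
    unfolding nondeg_form_def in_coords_def
  proof (intro conjI allI impI *(1,2))
    fix z assume z: "\<forall>w. g d (coord_inv d x) z w = 0"
    show "z = 0" using *(3) z *(2) by (metis less_irrefl)
  qed
qed

text \<open>If a point with \<open>t > T\<close> went to the boundary of the half-space, the first
  coordinate of \<open>\<phi>\<close> would have a minimum there and a vanishing differential,
  although the differential of \<open>\<phi>\<close> is onto.\<close>

lemma \<phi>_interior:
  assumes c: "c \<in> A" and d: "d \<in> B" and x: "x \<in> UU c d" shows "\<phi> c d x \<in> V' d"
proof -
  note xd = UU_D(1)[OF c x] and xx = UU_D(3,4)[OF c x]
  have range: "\<phi> c d y \<in> snd d ` fst d" if "y \<in> UU c d" for y
    using that \<phi>_eq[OF c, of y d] by (auto simp: UU_def)
  obtain W where W: "open W" "snd d ` fst d = ({T..} \<times> UNIV) \<inter> W"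
    using manifold_chart(2)[OF M_mfd d] by (auto simp: openin_open)
  have ge: "T \<le> fst (\<phi> c d y)" if "y \<in> UU c d" for y using range[OF that] W(2) by auto
  have der: "(\<phi> c d has_derivative dir_deriv (cdom c d) (\<phi> c d) x) (at x)"
    using \<phi>_derivative[OF c d xd] at_within_interior[OF UU_interior[OF c d x]] by metis
  have "fst (\<phi> c d x) \<noteq> T"
  proof
    assume eq: "fst (\<phi> c d x) = T"
    have "(\<lambda>v. fst (dir_deriv (cdom c d) (\<phi> c d) x v)) = (\<lambda>v. 0)"
      by (rule differential_zero_maxmin[OF x UU_open[OF c d] has_derivative_fst[OF der]]) (use ge eq in auto)
    moreover have "linear (dir_deriv (cdom c d) (\<phi> c d) x)" using der has_derivative_linear by blast
    from linear_injective_imp_surjective[OF this d\<phi>_inj[OF c d xd]]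
    obtain v where "dir_deriv (cdom c d) (\<phi> c d) x v = (1, 0)" by (metis surjD)
    ultimately show False by (metis fst_conv zero_neq_one)
  qed
  then have "\<phi> c d x \<in> ({T<..} \<times> UNIV) \<inter> W" using ge[OF x] range[OF x] W(2) by (cases "\<phi> c d x") auto
  moreover have "open (({T<..} \<times> UNIV) \<inter> W)" by (intro open_Int open_Times W(1)) auto
  moreover have "({T<..} \<times> UNIV) \<inter> W \<subseteq> snd d ` fst d" using W(2) by auto
  ultimately show ?thesis unfolding V'_def by (metis interiorI)
qed

lemma d\<phi>_eq: "c \<in> A \<Longrightarrow> d \<in> B \<Longrightarrow> x \<in> UU c d \<Longrightarrow> dir_deriv UNIV (\<phi> c d) x = dir_deriv (cdom c d) (\<phi> c d) x"
  by (rule dir_deriv_interior[OF UU_interior, symmetric])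

lemma iso: assumes c: "c \<in> A" and d: "d \<in> B" shows "local_isometry (UU c d) (gpc c) (V' d) (in_coords d g) (\<phi> c d)"
proof -
  interpret H: homogeneous_metric T "NN c" "th c" gm by (rule hom[OF c])
  show ?thesis
  proof
    show "open (UU c d)" by (rule UU_open[OF c d])
    show "metric_on (UU c d) (gpc c)"
      by (rule metric_on_subset[OF H.prod.metric UU_open[OF c d]]) (auto simp: UU_def)
    show "open (V' d)" by (simp add: V'_def)
    show "metric_on (V' d) (in_coords d g)" by (rule V'_metric[OF d])
    show "smooth_on (UU c d) (\<phi> c d)"
      by (rule smooth_on_open_subset[OF \<phi>_smooth[OF c d] UU_open[OF c d] UU_dom[OF c]])
    fix x assume x: "x \<in> UU c d"
    show "\<phi> c d x \<in> V' d" by (rule \<phi>_interior[OF c d x])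
    note xd = UU_D(1)[OF c x] and xx = UU_D(3,4,5)[OF c x]
    show "gpc c x u v = in_coords d g (\<phi> c d x) (dir_deriv UNIV (\<phi> c d) x u) (dir_deriv UNIV (\<phi> c d) x v)" for u v
      using pullback[OF c d xd, of u v] \<phi>_eq[OF c xx(1,2), of d] manifold_chart(6)[OF M_mfd d xx(3)]
      by (simp add: d\<phi>_eq[OF c d x] in_coords_def)
  qed
qed

lemma ricci_zero:
  assumes flat: "ricci_flat B g" and c: "c \<in> A" and x: "fst x > T" "snd x \<in> NN c"
  shows "ricci UNIV (gpc c) x v w = 0"
proof -
  have "\<pi> (pt c x) \<in> M" using pt_in[OF c] x \<pi>_image by (simp add: less_imp_le)
  then obtain d where d: "d \<in> B" "\<pi> (pt c x) \<in> fst d" using manifold_chart_at[OF M_mfd] by blast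
  have xU: "x \<in> UU c d" using x d by (cases x) (simp add: UU_def)
  interpret I: local_isometry "UU c d" "gpc c" "V' d" "in_coords d g" "\<phi> c d" by (rule iso[OF c d(1)])
  have e: "\<phi> c d x = snd d (\<pi> (pt c x))" by (rule \<phi>_eq[OF c less_imp_le[OF x(1)] x(2)])
  have int: "\<phi> c d x \<in> interior (snd d ` fst d)" using \<phi>_interior[OF c d(1) xU] by (simp add: V'_def)
  have "ricci UNIV (gpc c) x v w = ricci UNIV (in_coords d g) (\<phi> c d x) (I.P x v) (I.P x w)"
    by (rule I.ricci_transform[OF xU, symmetric])
  also have "\<dots> = ricci (snd d ` fst d) (in_coords d g) (\<phi> c d x) (I.P x v) (I.P x w)"
    by (simp add: ricci_interior[OF int])
  also have "\<dots> = 0" using flat d unfolding ricci_flat_def e by blast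
  finally show ?thesis .
qed

text \<open>The metric of the slice at time \<open>t\<close> as a tensor field on \<open>G\<close>,
  to be compared with the assumption on left-invariant metrics.\<close>

definition slice_metric :: "real \<Rightarrow> ('g, real^'n) bilinear_field" where
  "slice_metric t c p u v = TH c p u \<bullet> (gm t *v TH c p v)"

lemma TH_transform:
  "c \<in> A \<Longrightarrow> d \<in> A \<Longrightarrow> p \<in> fst c \<inter> fst d \<Longrightarrow> TH c p u = TH d p (tangent_map c d id p u)"
proof -
  assume *: "c \<in> A" "d \<in> A" "p \<in> fst c \<inter> fst d"
  have "\<theta> a c p u = \<theta> a d p (tangent_map c d id p u)" for a
    using form[of a] * unfolding left_invariant_one_form_def smooth_one_form_def by blast
  then show ?thesis unfolding TH_def vec_eq_iff vec_lambda_beta by blast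
qed

lemma slice_metric_left_invariant:
  assumes t: "t > T" shows "left_invariant_metric G A (slice_metric t)"
  unfolding left_invariant_metric_def riemannian_metric_def smooth_bilinear_field_def
proof (intro conjI ballI allI impI)
  have form: "inner_product (\<lambda>u v. u \<bullet> (gm t *v v))"
    if "c \<in> A" for c using homogeneous_metric.gm_form[OF hom[OF that] t] .
  fix c assume c: "c \<in> A"
  interpret H: homogeneous_metric T "NN c" "th c" gm by (rule hom[OF c])
  interpret F: inner_product "\<lambda>u v. u \<bullet> (gm t *v v)" by (rule form[OF c])
  {
    fix p assume p: "p \<in> fst c"
    note l = TH_linear[OF c p]
    show "bilinear (slice_metric t c p)"
      unfolding bilinear_def by (intro conjI allI linearI)
        (simp_all add: slice_metric_def linear_add[OF l] linear_scale[OF l] F.lin)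
    show "slice_metric t c p u v = slice_metric t c p v u" for u v
      unfolding slice_metric_def by (rule F.sym)
    show "0 < slice_metric t c p u u" if "u \<noteq> 0" for u
      unfolding slice_metric_def
      using that linear_injective_0[OF l] TH_inj[OF c p] by (intro F.pos) blast
  }
  show "smooth_on (snd c ` fst c) (\<lambda>x. slice_metric t c (coord_inv c x) u v)" for u v
    unfolding slice_metric_def
    by (intro smooth_on_inner N_open[OF c] TH_smooth[OF c] smooth_on_linear[OF matrix_vector_mul_bounded_linear])
next
  fix c d p u v assume "c \<in> A" "d \<in> A" "p \<in> fst c \<inter> fst d"
  then show "slice_metric t c p u v = slice_metric t d p (tangent_map c d id p u) (tangent_map c d id p v)"
    unfolding slice_metric_def using TH_transform[of c d p] by metis
next
  fix h c d p u v assume "h \<in> carrier G" "c \<in> A" "d \<in> A" "p \<in> fst c" "h \<otimes>\<^bsub>G\<^esub> p \<in> fst d"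
  then show "slice_metric t c p u v = slice_metric t d (h \<otimes>\<^bsub>G\<^esub> p) (tangent_map c d ((\<otimes>\<^bsub>G\<^esub>) h) p u)
      (tangent_map c d ((\<otimes>\<^bsub>G\<^esub>) h) p v)"
    unfolding slice_metric_def using TH_left_invariant[of h c d p] by metis
qed

section \<open>Evolution of the mean curvature\<close>

definition H :: "real \<Rightarrow> real" where
  "H t = trace (homogeneous_metric.mat_K gm t)"

definition S :: "real \<Rightarrow> real" where
  "S t = trace (homogeneous_metric.mat_K gm t ** homogeneous_metric.mat_K gm t)"

text \<open>\<open>H\<close> and \<open>S\<close> involve no chart; a chart at the identity serves
  to instantiate the local formulas.\<close>

lemma chart_exists: obtains c where "c \<in> A" "\<one>\<^bsub>G\<^esub> \<in> fst c"
  using manifold_chart_at[OF mfd group.is_monoid[OF grp, THEN monoid.one_closed]] by blast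

lemma H_pos: "expanding T gm \<Longrightarrow> t > T \<Longrightarrow> H t > 0"
proof -
  assume e: "expanding T gm" and t: "t > T"
  obtain c where c: "c \<in> A" "\<one>\<^bsub>G\<^esub> \<in> fst c" by (rule chart_exists)
  have "mean_curvature T gm t = - H t"
    unfolding H_def by (rule homogeneous_metric.mean_curvature_eq[OF hom[OF c(1)] t])
  then show ?thesis using e[unfolded expanding_def, rule_format, of t] t by simp
qed

lemma H_derivative: "ricci_flat B g \<Longrightarrow> t > T \<Longrightarrow> (H has_real_derivative - S t) (at t)"
proof -
  assume flat: "ricci_flat B g" and t: "t > T"
  obtain c where c: "c \<in> A" "\<one>\<^bsub>G\<^esub> \<in> fst c" by (rule chart_exists)
  have y: "snd c \<one>\<^bsub>G\<^esub> \<in> NN c" using c by simp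
  show ?thesis
    unfolding H_def[abs_def] S_def
    by (rule homogeneous_metric.raychaudhuri[OF hom[OF c(1)] t y ricci_zero[OF flat c(1)]]) (use t y in auto)
qed

lemma S_nonneg: "t > T \<Longrightarrow> 0 \<le> S t"
  using chart_exists homogeneous_metric.mat_K_square_nonneg[OF hom] unfolding S_def by metis

text \<open>Failure of positivity provides just one point of nonpositive scalar curvature. By the
  constraint the value there is \<open>S t - (H t)\<^sup>2\<close>, in which the point no longer
  occurs.\<close>

lemma S_le:
  assumes flat: "ricci_flat B g" and no_psc: "\<not> (\<exists>b. left_invariant_metric G A b \<and> positive_scalar_curvature A b)"
    and t: "t > T"
  shows "S t \<le> (H t)\<^sup>2"
proof -
  obtain c p where c: "c \<in> A" "p \<in> fst c"
    and R: "\<not> 0 < scalar_curvature (NN c) (in_coords c (slice_metric t)) (snd c p)"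
    using no_psc slice_metric_left_invariant[OF t] unfolding positive_scalar_curvature_def by blast
  interpret H: homogeneous_metric T "NN c" "th c" gm by (rule hom[OF c(1)])
  have y: "snd c p \<in> NN c" using c by simp
  have "in_coords c (slice_metric t) = (\<lambda>y. hhc c (t, y))"
    by (intro ext) (simp add: in_coords_def slice_metric_def H.hh_def th_def)
  then have "scalar_curvature (NN c) (in_coords c (slice_metric t)) (snd c p) = scalar_curvature UNIV (\<lambda>y. hhc c (t, y)) (snd c p)"
    using scalar_curvature_interior[of "snd c p" "NN c"] interior_open[OF N_open[OF c(1)]] y by metis
  also have "\<dots> = S t - (H t)\<^sup>2"
    unfolding S_def H_def by (rule H.hamiltonian_constraint[OF t y ricci_zero[OF flat c(1)]]) (use t y in auto)
  finally show ?thesis using R by simp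
qed

subsection \<open>Extension of geodesics\<close>

text \<open>Every parameter is below \<open>a2\<close>, where the new curve is
  \<open>\<gamma>\<close>, or above \<open>a\<close>, where it is the image of a solution in product
  coordinates. Both conditions are open and the geodesic equation is local, so it can be checked
  separately.\<close>

lemma geodesic_extend:
  assumes geo: "geodesic_on M B g J \<gamma>" and c: "c \<in> A" and J': "is_interval J'" "J \<subseteq> J'"
    and a: "a < a2" "J \<inter> {..<a2} = J' \<inter> {..<a2}"
    and Y: "\<And>r. r \<in> J' \<inter> {a<..} \<Longrightarrow> Y r \<in> {T<..} \<times> NN c"
    and Y': "\<And>r. r \<in> J' \<inter> {a<..} \<Longrightarrow> (Y has_vector_derivative V r) (at r within J' \<inter> {a<..})"
    and V': "\<And>r. r \<in> J' \<inter> {a<..} \<Longrightarrow>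
      (V has_vector_derivative - christoffel UNIV (gpc c) (Y r) (V r) (V r)) (at r within J' \<inter> {a<..})"
    and \<gamma>: "\<And>r. r \<in> J \<inter> {a<..} \<Longrightarrow> \<gamma> r = \<pi> (pt c (Y r))"
  shows "geodesic_on M B g J' (\<lambda>r. if r \<in> J then \<gamma> r else \<pi> (pt c (Y r)))"
proof -
  define \<gamma>' where "\<gamma>' = (\<lambda>r. if r \<in> J then \<gamma> r else \<pi> (pt c (Y r)))"
  note geo = geo[unfolded geodesic_on_def]
  have late: "\<gamma>' r = \<pi> (pt c (Y r))" if "r \<in> J' \<inter> {a<..}" for r
    using \<gamma> that by (auto simp: \<gamma>'_def)
  have early: "\<gamma>' r = \<gamma> r" if "r \<in> J' \<inter> {..<a2}" for r
    using that a(2) by (auto simp: \<gamma>'_def)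
  have split: "r < a2 \<or> a < r" for r using a(1) by linarith
  have \<pi>c: "continuous_on (J' \<inter> {a<..}) (\<lambda>r. \<pi> (pt c (Y r)))"
  proof (rule continuous_on_compose2[OF pt_cont[OF c]])
    show "continuous_on (J' \<inter> {a<..}) Y"
      using Y' by (meson continuous_on_eq_continuous_within has_vector_derivative_continuous)
  qed (use Y in force)
  have int': "interior J' \<noteq> {}" using geo interior_mono[OF J'(2)] by blast
  have cont: "continuous_on J' \<gamma>'"
    unfolding continuous_on_eq_continuous_within
  proof
    fix r assume r: "r \<in> J'"
    have *: "continuous (at r within J') \<gamma>'" if W: "open W" "r \<in> W" "continuous_on (J' \<inter> W) \<gamma>'" for W
    proof -
      have "continuous (at r within (J' \<inter> W)) \<gamma>'" using W r by (simp add: continuous_on_eq_continuous_within)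
      moreover have "at r within (J' \<inter> W) = at r within J'" by (rule at_within_nhd[OF W(2,1)]) auto
      ultimately show ?thesis by simp
    qed
    show "continuous (at r within J') \<gamma>'"
    proof (cases "r < a2")
      case True
      have "continuous_on (J \<inter> {..<a2}) \<gamma>"
        by (rule continuous_on_subset[OF geo[THEN conjunct2, THEN conjunct2, THEN conjunct1]]) auto
      then have "continuous_on (J' \<inter> {..<a2}) \<gamma>'" unfolding a(2) by (rule continuous_on_eq) (simp add: early)
      then show ?thesis by (rule *[rotated 2]) (use True in auto)
    next
      case False
      have "continuous_on (J' \<inter> {a<..}) \<gamma>'" using \<pi>c by (rule continuous_on_eq) (simp add: late)
      then show ?thesis by (rule *[rotated 2]) (use False split[of r] in auto)
    qed
  qed
  have img: "\<gamma>' r \<in> M" if r: "r \<in> J'" for r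
  proof (cases "r < a2")
    case True
    then show ?thesis using early[of r] r geo a(2) by auto
  next
    case False
    then have r': "r \<in> J' \<inter> {a<..}" using r split[of r] by auto
    from Y[OF r'] have "pt c (Y r) \<in> {T..} \<times> carrier G" by (intro pt_in[OF c]) auto
    then show ?thesis using late[OF r'] \<pi>_image by simp
  qed
  have "(snd d \<circ> \<gamma>' has_vector_derivative velocity d \<gamma>' J' s) (at s within J' \<inter> \<gamma>' -` fst d) \<and>
      (velocity d \<gamma>' J' has_vector_derivative
         - christoffel (snd d ` fst d) (in_coords d g) (snd d (\<gamma>' s)) (velocity d \<gamma>' J' s) (velocity d \<gamma>' J' s))
      (at s within J' \<inter> \<gamma>' -` fst d)"
    if d: "d \<in> B" and s: "s \<in> J' \<inter> \<gamma>' -` fst d" for d s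
  proof (cases "s < a2")
    case True
    have sets: "(J \<inter> \<gamma> -` fst d) \<inter> {..<a2} = (J' \<inter> \<gamma>' -` fst d) \<inter> {..<a2}"
      using early a(2) J'(2) by auto
    have s2: "s \<in> J \<inter> \<gamma> -` fst d" using s sets True by blast
    have vel: "velocity d \<gamma> J r = velocity d \<gamma>' J' r" if "r \<in> (J \<inter> \<gamma> -` fst d) \<inter> {..<a2}" for r
      unfolding velocity_def
      by (rule vector_derivative_local_cong[OF open_lessThan _ _ sets]) (use that early J'(2) in auto)
    have c1: "(snd d \<circ> \<gamma>) r = (snd d \<circ> \<gamma>') r" if "r \<in> (J \<inter> \<gamma> -` fst d) \<inter> {..<a2}" for r
      using that early J'(2) by auto
    have s3: "s \<in> {..<a2}" "s \<in> (J \<inter> \<gamma> -` fst d) \<inter> {..<a2}" using True s2 by auto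
    note g = geo[THEN conjunct2, THEN conjunct2, THEN conjunct2, THEN conjunct2, rule_format, OF d s2]
    show ?thesis
    proof
      show "(snd d \<circ> \<gamma>' has_vector_derivative velocity d \<gamma>' J' s) (at s within J' \<inter> \<gamma>' -` fst d)"
        using iffD1[OF has_vector_derivative_local_cong[OF open_lessThan s3(1) s2 sets c1] conjunct1[OF g]]
          vel[OF s3(2)] by (simp add: comp_def)
      have "(velocity d \<gamma>' J' has_vector_derivative
         - christoffel (snd d ` fst d) (in_coords d g) (snd d (\<gamma> s)) (velocity d \<gamma> J s) (velocity d \<gamma> J s))
        (at s within J' \<inter> \<gamma>' -` fst d)"
        by (rule iffD1[OF has_vector_derivative_local_cong[OF open_lessThan s3(1) s2 sets vel] conjunct2[OF g]])
      then show "(velocity d \<gamma>' J' has_vector_derivative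
         - christoffel (snd d ` fst d) (in_coords d g) (snd d (\<gamma>' s)) (velocity d \<gamma>' J' s) (velocity d \<gamma>' J' s))
        (at s within J' \<inter> \<gamma>' -` fst d)"
        using vel[OF s3(2)] early[of s] True s by simp
    qed
  next
    case False
    interpret I: local_isometry "UU c d" "gpc c" "V' d" "in_coords d g" "\<phi> c d" by (rule iso[OF c d])
    let ?K = "J' \<inter> \<gamma>' -` fst d \<inter> {a<..}"
    have sK: "s \<in> ?K" using s False split[of s] by auto
    have YU: "Y r \<in> UU c d" if "r \<in> ?K" for r using that Y late by (auto simp: UU_def)
    have eq: "snd d (\<gamma>' r) = \<phi> c d (Y r)" if "r \<in> ?K" for r
      using \<phi>_eq[OF c, of "Y r" d] Y[of r] late[of r] that by auto
    have Yd: "(Y has_vector_derivative V r) (at r within ?K)" if "r \<in> ?K" for r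
      by (rule has_vector_derivative_within_subset[OF Y']) (use that in auto)
    have Vd: "(V has_vector_derivative - christoffel UNIV (gpc c) (Y r) (V r) (V r)) (at r within ?K)" if "r \<in> ?K" for r
      by (rule has_vector_derivative_within_subset[OF V']) (use that in auto)
    have sets: "?K \<inter> {a<..} = (J' \<inter> \<gamma>' -` fst d) \<inter> {a<..}" by auto
    have push1: "(snd d \<circ> \<gamma>' has_vector_derivative I.P (Y r) (V r)) (at r within J' \<inter> \<gamma>' -` fst d)" if r: "r \<in> ?K" for r
    proof -
      have "(\<lambda>r. \<phi> c d (Y r)) q = (snd d \<circ> \<gamma>') q" if "q \<in> ?K \<inter> {a<..}" for q using eq that by auto
      moreover have "r \<in> {a<..}" using r by simp
      ultimately show ?thesis
        using iffD1[OF has_vector_derivative_local_cong[OF open_greaterThan _ r sets] I.geodesic_push(1)[where Y = Y and V = V, OF r YU Yd[OF r]]]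
        by blast
    qed
    \<comment> \<open>The parameters seen by the chart \<open>d\<close> form a relatively open part
      of \<open>J'\<close>; hence none is isolated, and the velocity is determined by the derivative
      just computed.\<close>
    obtain W where W: "open W" "J' \<inter> \<gamma>' -` fst d = J' \<inter> W"
    proof -
      have "openin (top_of_set J') (J' \<inter> \<gamma>' -` fst d)"
        by (rule continuous_openin_preimage[OF cont _ manifold_chart(1)[OF M_mfd d]]) (use img in auto)
      then show ?thesis using that by (auto simp: openin_open)
    qed
    have vel: "velocity d \<gamma>' J' r = I.P (Y r) (V r)" if r: "r \<in> ?K" for r
      unfolding velocity_def
    proof (rule vector_derivative_within[OF _ push1[OF r]])
      have "r \<in> J'" "r \<in> W" using r W(2) by auto
      then show "at r within J' \<inter> \<gamma>' -` fst d \<noteq> bot"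
        unfolding W(2) by (intro interval_nontrivial_limit J'(1) int' W(1))
    qed
    have int: "\<phi> c d (Y s) \<in> interior (snd d ` fst d)"
      using \<phi>_interior[OF c d YU[OF sK]] by (simp add: V'_def)
    have "((\<lambda>r. I.P (Y r) (V r)) has_vector_derivative
        - christoffel UNIV (in_coords d g) (\<phi> c d (Y s)) (I.P (Y s) (V s)) (I.P (Y s) (V s))) (at s within ?K)"
      by (rule I.geodesic_push(2)[where Y = Y and V = V, OF sK YU Yd[OF sK] Vd[OF sK]])
    then have "(velocity d \<gamma>' J' has_vector_derivative
        - christoffel UNIV (in_coords d g) (\<phi> c d (Y s)) (I.P (Y s) (V s)) (I.P (Y s) (V s))) (at s within J' \<inter> \<gamma>' -` fst d)"
    proof (rule iffD1[OF has_vector_derivative_local_cong[OF open_greaterThan _ sK sets], rotated 2])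
      show "s \<in> {a<..}" using sK by simp
      show "I.P (Y r) (V r) = velocity d \<gamma>' J' r" if "r \<in> ?K \<inter> {a<..}" for r using vel[of r] that by simp
    qed
    then show ?thesis
      using push1[OF sK] vel[OF sK] eq[OF sK] by (simp add: christoffel_interior[OF int])
  qed
  then show ?thesis
    unfolding geodesic_on_def \<gamma>'_def[symmetric] using J'(1) int' cont img by blast
qed

end

section \<open>Lifted geodesics\<close>

lemma has_vector_derivative_Un:
  assumes "(f has_vector_derivative D) (at x within S)" "(f has_vector_derivative D) (at x within S')"
  shows "(f has_vector_derivative D) (at x within S \<union> S')"
  using assms unfolding has_vector_derivative_iff_tendsto unfolding at_within_union by (rule filterlim_sup)

text \<open>The geodesic is lifted from \<open>a0\<close> on, as a merely continuous curve.
  \<open>start\<close> fixes the time direction at \<open>a0\<close>, with the preimage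
  \<open>\<sigma> a0\<close> that witnesses it; \<open>E_pos\<close> propagates the sign. The lift
  may start at \<open>t = T\<close>, so second-order statements are made for later
  parameters.\<close>

locale lifted_geodesic = spacetime G A \<theta> T gm M B g \<pi>
  for G :: "'g::topological_space monoid" and A :: "('g, real^'n::finite) chart set"
    and \<theta> :: "'n \<Rightarrow> ('g, real^'n) one_form" and T :: real and gm :: "real \<Rightarrow> real^'n^'n"
    and M :: "'m::topological_space set" and B :: "('m, real \<times> (real^'n)) chart set"
    and g :: "('m, real \<times> (real^'n)) bilinear_field" and \<pi> :: "real \<times> 'g \<Rightarrow> 'm" +
  fixes J0 :: "real set" and a0 :: real and J :: "real set" and \<gamma> :: "real \<Rightarrow> 'm" and \<sigma> :: "real \<Rightarrow> real \<times> 'g"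
  assumes geo: "geodesic_on M B g J \<gamma>"
    and causal: "\<And>d s. d \<in> B \<Longrightarrow> s \<in> J \<Longrightarrow> \<gamma> s \<in> fst d \<Longrightarrow>
      velocity d \<gamma> J s \<noteq> 0 \<and> g d (\<gamma> s) (velocity d \<gamma> J s) (velocity d \<gamma> J s) \<le> 0"
    and J0: "J0 = J \<inter> {a0..}" and a0: "a0 \<in> J" and later: "\<exists>s\<in>J. a0 < s"
    and lift_cont: "continuous_on J0 \<sigma>" and lift_in: "\<And>s. s \<in> J0 \<Longrightarrow> \<sigma> s \<in> {T..} \<times> carrier G"
    and lift: "\<And>s. s \<in> J0 \<Longrightarrow> \<pi> (\<sigma> s) = \<gamma> s"
    and start: "\<exists>c\<in>A. \<exists>d\<in>B. snd (\<sigma> a0) \<in> fst c \<and> \<gamma> a0 \<in> fst d \<and>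
      g d (\<gamma> a0) (velocity d \<gamma> J a0) (tangent_map (pc c) d \<pi> (\<sigma> a0) (1, 0)) < 0"
begin

section \<open>The lifted curve in product coordinates\<close>

definition tt :: "real \<Rightarrow> real" where "tt s = fst (\<sigma> s)"
definition xx :: "real \<Rightarrow> 'g" where "xx s = snd (\<sigma> s)"

definition Y :: "('g, real^'n) chart \<Rightarrow> real \<Rightarrow> real \<times> (real^'n)" where
  "Y c s = (tt s, snd c (xx s))"

definition V :: "('g, real^'n) chart \<Rightarrow> real \<Rightarrow> real \<times> (real^'n)" where
  "V c s = vector_derivative (Y c) (at s within J0)"

definition E :: "real \<Rightarrow> real" where
  "E s = vector_derivative tt (at s within J0)"

lemma J_interval: "is_interval J" and M_image: "s \<in> J \<Longrightarrow> \<gamma> s \<in> M" and \<gamma>_cont: "continuous_on J \<gamma>"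
  using geo unfolding geodesic_on_def by auto

lemma J0_interval: "is_interval J0"
  unfolding J0 by (intro is_interval_Int J_interval) (simp add: is_interval_ci)

lemma J0_sub: "s \<in> J0 \<Longrightarrow> s \<in> J" "s \<in> J0 \<Longrightarrow> a0 \<le> s"
  by (auto simp: J0)

lemma a0_in: "a0 \<in> J0" using a0 by (simp add: J0)

lemma J0_mem: "a0 \<le> r \<Longrightarrow> r \<le> s \<Longrightarrow> s \<in> J0 \<Longrightarrow> r \<in> J0"
  using J0_interval a0_in unfolding is_interval_1 by blast

lemma J0_interior: "interior J0 \<noteq> {}"
proof -
  obtain s where s: "s \<in> J" "a0 < s" using later by blast
  have "{a0<..<s} \<subseteq> J0"
    using J0_mem[of _ s] s by (auto simp: J0)
  then have "{a0<..<s} \<subseteq> interior J0" by (rule interior_maximal) simp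
  then show ?thesis using s(2) dense by fastforce
qed

lemma J0_limit: "s \<in> J0 \<Longrightarrow> at s within J0 \<noteq> bot"
  using interval_nontrivial_limit[OF J0_interval J0_interior _ open_UNIV] by simp

lemma xx_carrier: "s \<in> J0 \<Longrightarrow> xx s \<in> carrier G" and tt_ge: "s \<in> J0 \<Longrightarrow> tt s \<ge> T"
  using lift_in[of s] by (auto simp: xx_def tt_def mem_Times_iff)

lemma xx_cont: "continuous_on J0 xx" and tt_cont: "continuous_on J0 tt"
  unfolding xx_def[abs_def] tt_def[abs_def] by (intro continuous_intros lift_cont)+

lemma chart_at: "s \<in> J0 \<Longrightarrow> \<exists>c\<in>A. xx s \<in> fst c"
  by (rule manifold_chart_at[OF mfd xx_carrier])

lemma chart_at_M: "s \<in> J0 \<Longrightarrow> \<exists>d\<in>B. \<gamma> s \<in> fst d"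
  by (rule manifold_chart_at[OF M_mfd M_image[OF J0_sub(1)]])

lemma chart_neighbourhood:
  assumes c: "c \<in> A" obtains W where "open W" "{r \<in> J0. xx r \<in> fst c} = J0 \<inter> W"
proof -
  have "openin (top_of_set J0) (J0 \<inter> xx -` fst c)"
    by (rule continuous_openin_preimage[OF xx_cont _ manifold_chart(1)[OF mfd c]]) (use xx_carrier in auto)
  then obtain W where "open W" "J0 \<inter> xx -` fst c = J0 \<inter> W" by (auto simp: openin_open)
  then show ?thesis using that[of W] by blast
qed

lemma chart_neighbourhood_M:
  assumes d: "d \<in> B" obtains W where "open W" "{r \<in> J0. \<gamma> r \<in> fst d} = J0 \<inter> W"
proof -
  have "openin (top_of_set J0) (J0 \<inter> \<gamma> -` fst d)"
    by (rule continuous_openin_preimage[OF continuous_on_subset[OF \<gamma>_cont] _ manifold_chart(1)[OF M_mfd d]])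
      (use M_image J0_sub in auto)
  then obtain W where "open W" "J0 \<inter> \<gamma> -` fst d = J0 \<inter> W" by (auto simp: openin_open)
  then show ?thesis using that[of W] by blast
qed

definition R :: "('g, real^'n) chart \<Rightarrow> ('m, real \<times> (real^'n)) chart \<Rightarrow> real set" where
  "R c d = {r \<in> J0. xx r \<in> fst c \<and> \<gamma> r \<in> fst d}"

lemma R_sub: "R c d \<subseteq> J \<inter> \<gamma> -` fst d"
  using J0_sub by (auto simp: R_def)

lemma at_R:
  assumes "c \<in> A" "d \<in> B" "s \<in> R c d" shows "at s within J0 = at s within R c d"
proof -
  obtain W where W: "open W" "{r \<in> J0. xx r \<in> fst c} = J0 \<inter> W" using chart_neighbourhood[OF assms(1)] by blast
  obtain W' where W': "open W'" "{r \<in> J0. \<gamma> r \<in> fst d} = J0 \<inter> W'" using chart_neighbourhood_M[OF assms(2)] by blast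
  have eq: "R c d = J0 \<inter> (W \<inter> W')" using W(2) W'(2) unfolding R_def by blast
  then have "s \<in> W \<inter> W'" using assms(3) by blast
  then show ?thesis by (rule at_within_nhd[OF _ open_Int[OF W(1) W'(1)]]) (use eq in auto)
qed

lemma Y_in: "c \<in> A \<Longrightarrow> s \<in> J0 \<Longrightarrow> xx s \<in> fst c \<Longrightarrow> fst (Y c s) \<ge> T \<and> snd (Y c s) \<in> NN c \<and> pt c (Y c s) = \<sigma> s"
  using tt_ge[of s] pt_coord[of c "xx s" "tt s"] by (simp add: Y_def) (simp add: tt_def xx_def)

lemma Y_dom: assumes "c \<in> A" "s \<in> R c d" shows "Y c s \<in> cdom c d"
  using dom_iff[OF assms(1), of "Y c s" d] Y_in[of c s] lift[of s] assms unfolding R_def by auto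

lemma \<phi>_Y: assumes "c \<in> A" "s \<in> R c d" shows "\<phi> c d (Y c s) = snd d (\<gamma> s)"
  using \<phi>_eq[of c "Y c s" d] Y_in[of c s] lift[of s] assms unfolding R_def by auto

text \<open>Only \<open>\<gamma>\<close>, in charts of \<open>M\<close>, is known to be
  differentiable. The derivative of the lift is obtained by cancelling the immersion
  \<open>\<phi>\<close> in the identity \<open>\<phi>_Y\<close>.\<close>

lemma velocity_lift:
  assumes c: "c \<in> A" and d: "d \<in> B" and s: "s \<in> R c d"
  shows "(Y c has_vector_derivative V c s) (at s within J0)"
    and "dir_deriv (cdom c d) (\<phi> c d) (Y c s) (V c s) = velocity d \<gamma> J s"
proof -
  have sJ: "s \<in> J0" "xx s \<in> fst c" "\<gamma> s \<in> fst d" using s by (auto simp: R_def)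
  have xs: "(xx \<longlongrightarrow> xx s) (at s within R c d)" and ts: "(tt \<longlongrightarrow> tt s) (at s within R c d)"
    using xx_cont tt_cont sJ(1) at_R[OF c d s] by (auto simp: continuous_on_def)
  have ev: "\<forall>\<^sub>F r in at s within R c d. r \<in> R c d" by (simp add: eventually_at_filter)
  have "((\<lambda>r. snd c (xx r)) \<longlongrightarrow> snd c (xx s)) (at s within R c d)"
    by (rule continuous_on_tendsto_compose[OF manifold_chart(4)[OF mfd c] xs sJ(2)])
      (use ev in \<open>auto elim!: eventually_mono simp: R_def\<close>)
  then have Ys: "(Y c \<longlongrightarrow> Y c s) (at s within R c d)"
    unfolding Y_def by (intro tendsto_Pair ts)
  have "((\<lambda>r. snd d (\<gamma> r)) has_vector_derivative velocity d \<gamma> J s) (at s within J \<inter> \<gamma> -` fst d)"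
    using geo d sJ J0_sub unfolding geodesic_on_def comp_def by blast
  then have "((\<lambda>r. snd d (\<gamma> r)) has_vector_derivative velocity d \<gamma> J s) (at s within R c d)"
    by (rule has_vector_derivative_within_subset[OF _ R_sub])
  then have w: "((\<lambda>r. \<phi> c d (Y c r)) has_vector_derivative velocity d \<gamma> J s) (at s within R c d)"
    by (rule has_vector_derivative_transform[OF s, rotated]) (rule \<phi>_Y[OF c])
  obtain v where v: "dir_deriv (cdom c d) (\<phi> c d) (Y c s) v = velocity d \<gamma> J s"
    "(Y c has_vector_derivative v) (at s within R c d)"
    using has_vector_derivative_cancel_immersion[OF \<phi>_derivative[OF c d Y_dom[OF c s]] d\<phi>_inj[OF c d Y_dom[OF c s]] Ys Y_dom[OF c] s w]
    by blast
  then have "(Y c has_vector_derivative v) (at s within J0)" by (simp only: at_R[OF c d s])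
  moreover from this have "V c s = v" unfolding V_def by (rule vector_derivative_within[OF J0_limit[OF sJ(1)]])
  ultimately show "(Y c has_vector_derivative V c s) (at s within J0)"
    "dir_deriv (cdom c d) (\<phi> c d) (Y c s) (V c s) = velocity d \<gamma> J s"
    using v(1) by simp_all
qed

lemma first_order:
  assumes c: "c \<in> A" and s: "s \<in> J0" "xx s \<in> fst c"
  shows "(Y c has_vector_derivative V c s) (at s within J0)" "fst (V c s) = E s" "E s \<noteq> 0"
    "(tt has_vector_derivative E s) (at s within J0)" "gpc c (Y c s) (V c s) (V c s) \<le> 0"
proof -
  obtain d where d: "d \<in> B" "\<gamma> s \<in> fst d" using chart_at_M[OF s(1)] by blast
  have sR: "s \<in> R c d" using s d by (simp add: R_def)
  note vl = velocity_lift[OF c d(1) sR]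
  show Y': "(Y c has_vector_derivative V c s) (at s within J0)" by (rule vl(1))
  have t': "(tt has_vector_derivative fst (V c s)) (at s within J0)"
    using bounded_linear.has_vector_derivative[OF bounded_linear_fst Y'] by (simp add: Y_def)
  then show e: "fst (V c s) = E s"
    unfolding E_def using vector_derivative_within[OF J0_limit[OF s(1)] t'] by simp
  show "(tt has_vector_derivative E s) (at s within J0)" using t' e by simp
  have caus: "velocity d \<gamma> J s \<noteq> 0" "g d (\<gamma> s) (velocity d \<gamma> J s) (velocity d \<gamma> J s) \<le> 0"
    using causal[OF d(1) J0_sub(1)[OF s(1)] d(2)] by auto
  have pY: "\<pi> (pt c (Y c s)) = \<gamma> s" using Y_in[OF c s] lift[OF s(1)] by simp
  show le: "gpc c (Y c s) (V c s) (V c s) \<le> 0"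
    using pullback[OF c d(1) Y_dom[OF c sR], of "V c s" "V c s"] caus(2) by (simp add: vl(2) pY)
  have "linear (dir_deriv (cdom c d) (\<phi> c d) (Y c s))"
    using \<phi>_derivative[OF c d(1) Y_dom[OF c sR]] has_derivative_linear by blast
  then have "V c s \<noteq> 0" using vl(2) caus(1) linear_0 by metis
  then show "E s \<noteq> 0"
    using gpc_causal[OF c _ _ le] Y_in[OF c s] e by simp
qed

lemma tt_derivative: "s \<in> J0 \<Longrightarrow> (tt has_real_derivative E s) (at s within J0)" and E_nonzero: "s \<in> J0 \<Longrightarrow> E s \<noteq> 0"
  using chart_at[of s] first_order(3,4)[of _ s] by (auto simp: has_real_derivative_iff_has_vector_derivative)

lemma E_start: "E a0 > 0"
proof -
  obtain c d where c: "c \<in> A" "d \<in> B" "xx a0 \<in> fst c" "\<gamma> a0 \<in> fst d"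
    and neg: "g d (\<gamma> a0) (velocity d \<gamma> J a0) (tangent_map (pc c) d \<pi> (\<sigma> a0) (1, 0)) < 0"
    using start by (auto simp: xx_def)
  have aR: "a0 \<in> R c d" using c a0_in by (simp add: R_def)
  have pY: "\<pi> (pt c (Y c a0)) = \<gamma> a0" using Y_in[OF c(1) a0_in c(3)] lift[OF a0_in] by simp
  have "snd (pc c) (\<sigma> a0) = Y c a0" by (simp add: prod_chart_def Y_def tt_def xx_def prod_eq_iff)
  then have "tangent_map (pc c) d \<pi> (\<sigma> a0) (1, 0) = dir_deriv (cdom c d) (\<phi> c d) (Y c a0) (1, 0)"
    by (simp add: tangent_map_def)
  then have "gpc c (Y c a0) (V c a0) (1, 0) < 0"
    using neg pullback[OF c(1,2) Y_dom[OF c(1) aR], of "V c a0" "(1, 0)"]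
    by (simp add: velocity_lift(2)[OF c(1,2) aR] pY)
  moreover have "th c (snd (Y c a0)) 0 = 0"
    using linear_0[OF homogeneous_metric.th_linear[OF hom[OF c(1)]]] Y_in[OF c(1) a0_in c(3)] by blast
  ultimately show ?thesis
    using first_order(2)[OF c(1) a0_in c(3)] by (simp add: gpc_eq[OF c(1)])
qed

text \<open>Darboux's argument, since continuity of \<open>E\<close> at \<open>a0\<close> is not at
  hand: if \<open>E\<close> were positive at \<open>a0\<close> and negative at \<open>s\<close>, a
  maximum of \<open>tt\<close> in between would be a zero of \<open>E\<close>, and a causal velocity
  excludes zeros.\<close>

lemma E_pos: assumes s: "s \<in> J0" shows "E s > 0"
proof (rule ccontr)
  assume "\<not> E s > 0"
  then have neg: "E s < 0" using E_nonzero[OF s] by linarith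
  have as: "a0 < s" using neg E_start J0_sub(2)[OF s] by (cases "s = a0") auto
  have sub: "{a0..s} \<subseteq> J0" using J0_mem[OF _ _ s] by auto
  obtain m where m: "m \<in> {a0..s}" "\<And>r. r \<in> {a0..s} \<Longrightarrow> tt r \<le> tt m"
    using continuous_attains_sup[of "{a0..s}" tt] as continuous_on_subset[OF tt_cont sub] by auto
  have mJ: "m \<in> J0" using m(1) sub by blast
  show False
  proof (cases "E m > 0")
    case True
    obtain e where e: "e > 0" "\<And>h. h > 0 \<Longrightarrow> m + h \<in> J0 \<Longrightarrow> h < e \<Longrightarrow> tt m < tt (m + h)"
      using has_real_derivative_pos_inc_right[OF tt_derivative[OF mJ] True] by blast
    have "m \<noteq> s" using True neg by auto
    then have ms: "m < s" using m(1) by auto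
    define h where "h = min (e / 2) (s - m)"
    have h: "h > 0" "h < e" "m + h \<in> {a0..s}" using e(1) ms m(1) by (auto simp: h_def)
    then show False using e(2)[of h] m(2)[of "m + h"] sub by auto
  next
    case False
    then have "E m < 0" using E_nonzero[OF mJ] by linarith
    then obtain e where e: "e > 0" "\<And>h. h > 0 \<Longrightarrow> m - h \<in> J0 \<Longrightarrow> h < e \<Longrightarrow> tt m < tt (m - h)"
      using has_real_derivative_neg_dec_left[OF tt_derivative[OF mJ]] by blast
    have "m \<noteq> a0" using False E_start by auto
    then have ms: "a0 < m" using m(1) by auto
    define h where "h = min (e / 2) (m - a0)"
    have h: "h > 0" "h < e" "m - h \<in> {a0..s}" using e(1) ms m(1) by (auto simp: h_def)
    then show False using e(2)[of h] m(2)[of "m - h"] sub by auto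
  qed
qed

lemma J0_at: "a0 < r \<Longrightarrow> r < s \<Longrightarrow> s \<in> J0 \<Longrightarrow> at r within J0 = at r"
proof -
  assume *: "a0 < r" "r < s" "s \<in> J0"
  have "{a0<..<s} \<subseteq> J0" using J0_mem[OF _ _ *(3)] by auto
  then have "r \<in> interior J0" using * interior_maximal[of "{a0<..<s}" J0] by auto
  then show ?thesis by (rule at_within_interior)
qed

lemma tt_strict: assumes "r \<in> J0" "s \<in> J0" "r < s" shows "tt r < tt s"
proof (rule DERIV_pos_imp_increasing_open[OF assms(3)])
  show "\<exists>y. (tt has_real_derivative y) (at q) \<and> 0 < y" if "r < q" "q < s" for q
  proof -
    have q: "q \<in> J0" using J0_mem[of q s] that assms J0_sub(2)[OF assms(1)] by simp
    have "at q within J0 = at q"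
      using J0_at[of q s] that assms J0_sub(2)[OF assms(1)] by simp
    then show ?thesis using tt_derivative[OF q] E_pos[OF q] by auto
  qed
  have "{r..s} \<subseteq> J0" using J0_mem[OF _ _ assms(2)] J0_sub(2)[OF assms(1)] by auto
  then show "continuous_on {r..s} tt" by (rule continuous_on_subset[OF tt_cont])
qed

lemma tt_gt: "s \<in> J0 \<Longrightarrow> a0 < s \<Longrightarrow> tt s > T"
  using tt_strict[OF a0_in, of s] tt_ge[OF a0_in] by linarith

lemma Y_interior: "c \<in> A \<Longrightarrow> s \<in> J0 \<Longrightarrow> a0 < s \<Longrightarrow> xx s \<in> fst c \<Longrightarrow> Y c s \<in> {T<..} \<times> NN c"
  using tt_gt[of s] by (simp add: Y_def)

text \<open>The geodesic equation in charts of \<open>M\<close> is carried back by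
  \<open>geodesic_pull\<close>. After \<open>a0\<close> the curve has \<open>t > T\<close>, so
  \<open>\<phi>\<close> is a local isometry of open sets around it.\<close>

lemma second_order:
  assumes c: "c \<in> A" and s: "s \<in> J0" "a0 < s" "xx s \<in> fst c"
  shows "(V c has_vector_derivative - christoffel UNIV (gpc c) (Y c s) (V c s) (V c s)) (at s within J0)"
proof -
  obtain d where d: "d \<in> B" "\<gamma> s \<in> fst d" using chart_at_M[OF s(1)] by blast
  interpret I: local_isometry "UU c d" "gpc c" "V' d" "in_coords d g" "\<phi> c d" by (rule iso[OF c d(1)])
  let ?K = "R c d \<inter> {a0<..}"
  have sK: "s \<in> ?K" and sR: "s \<in> R c d" using s d by (auto simp: R_def)
  have YU: "Y c r \<in> UU c d" if "r \<in> ?K" for r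
    using that Y_interior[OF c, of r] Y_in[OF c, of r] lift[of r] by (auto simp: UU_def R_def)
  have int: "snd d (\<gamma> s) \<in> interior (snd d ` fst d)"
    using \<phi>_interior[OF c d(1) YU[OF sK]] \<phi>_Y[OF c sR] by (simp add: V'_def)
  have "(velocity d \<gamma> J has_vector_derivative
     - christoffel (snd d ` fst d) (in_coords d g) (snd d (\<gamma> s)) (velocity d \<gamma> J s) (velocity d \<gamma> J s))
     (at s within J \<inter> \<gamma> -` fst d)"
    using geo d s J0_sub unfolding geodesic_on_def by blast
  then have W': "(velocity d \<gamma> J has_vector_derivative
     - christoffel UNIV (in_coords d g) (\<phi> c d (Y c s)) (velocity d \<gamma> J s) (velocity d \<gamma> J s)) (at s within ?K)"
    unfolding \<phi>_Y[OF c sR] christoffel_interior[OF int]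
    by (rule has_vector_derivative_within_subset) (use R_sub in blast)
  have vel: "velocity d \<gamma> J r = I.P (Y c r) (V c r)" if "r \<in> ?K" for r
    using velocity_lift(2)[OF c d(1), of r] d\<phi>_eq[OF c d(1) YU[OF that]] that by auto
  have Yd: "(Y c has_vector_derivative V c s) (at s within ?K)"
    by (rule has_vector_derivative_within_subset[OF velocity_lift(1)[OF c d(1) sR]]) (auto simp: R_def)
  have "(V c has_vector_derivative - christoffel UNIV (gpc c) (Y c s) (V c s) (V c s)) (at s within ?K)"
    by (rule I.geodesic_pull[OF sK YU Yd vel W'])
  moreover have "at s within R c d = at s within ?K"
    by (rule at_within_nhd[of s "{a0<..}"]) (use s in auto)
  ultimately show ?thesis by (simp only: at_R[OF c d(1) sR])
qed

lemma frame_velocity_bound: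
  assumes c: "c \<in> A" and s: "s \<in> J0" "xx s \<in> fst c"
  shows "TH c (xx s) (snd (V c s)) \<bullet> (gm (tt s) *v TH c (xx s) (snd (V c s))) \<le> (E s)\<^sup>2"
  using first_order(2,5)[OF c s] manifold_chart(6)[OF mfd c s(2)]
  by (simp add: gpc_eq[OF c] Y_def th_def power2_eq_square)

text \<open>The time component of the geodesic equation gives E' in terms of \<open>gm'\<close> by
  \<open>fst_Gam\<close>. \<open>momentum_growth\<close> bounds it by \<open>S\<close> times the
  squared spatial length, which causality bounds by \<open>E\<close>, using that \<open>S\<close> is
  nonnegative.\<close>

lemma energy:
  assumes exp: "expanding T gm" and card: "CARD('n) \<le> 9" and s: "s \<in> J0" "a0 < s"
  shows "\<exists>E'. (E has_real_derivative E') (at s within J0) \<and> E' * H (tt s) \<le> S (tt s) * (E s)\<^sup>2"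
proof -
  obtain c where c: "c \<in> A" "xx s \<in> fst c" using chart_at[OF s(1)] by blast
  interpret H: homogeneous_metric T "NN c" "th c" gm by (rule hom[OF c(1)])
  have x: "Y c s \<in> {T<..} \<times> NN c" by (rule Y_interior[OF c(1) s c(2)])
  let ?w = "TH c (xx s) (snd (V c s))"
  have t: "tt s > T" by (rule tt_gt[OF s])
  have w: "th c (snd (Y c s)) (snd (V c s)) = ?w"
    using manifold_chart(6)[OF mfd c] by (simp add: th_def Y_def)
  have "fst (christoffel UNIV (gpc c) (Y c s) (V c s) (V c s)) = H.ht (Y c s) (snd (V c s)) (snd (V c s)) / 2"
    using H.fst_Gam[OF x, of "fst (V c s)" "snd (V c s)"] by simp
  also have "\<dots> = (?w \<bullet> (H.gm' (tt s) *v ?w)) / 2"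
    using H.ht_eq[OF t, of "snd (Y c s)"] x w by (simp add: Y_def)
  finally have fG: "fst (christoffel UNIV (gpc c) (Y c s) (V c s) (V c s)) = (?w \<bullet> (H.gm' (tt s) *v ?w)) / 2" .
  have "((\<lambda>r. fst (V c r)) has_vector_derivative - (?w \<bullet> (H.gm' (tt s) *v ?w) / 2)) (at s within J0)"
    using bounded_linear.has_vector_derivative[OF bounded_linear_fst second_order[OF c(1) s c(2)]]
    by (simp only: fst_uminus fG)
  note V' = this
  obtain W where W: "open W" "{r \<in> J0. xx r \<in> fst c} = J0 \<inter> W" using chart_neighbourhood[OF c(1)] by blast
  have sW: "s \<in> W" using W(2) s c by blast
  have "fst (V c r) = E r" if "r \<in> J0 \<inter> W" for r
    using first_order(2)[OF c(1), of r] that W(2) by blast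
  note fV = this
  have "(E has_vector_derivative - (?w \<bullet> (H.gm' (tt s) *v ?w) / 2)) (at s within J0)"
    by (rule iffD1[OF has_vector_derivative_local_cong[OF W(1) sW s(1) refl fV] V'])
  moreover have "- (?w \<bullet> (H.gm' (tt s) *v ?w) / 2) * H (tt s) \<le> S (tt s) * (E s)\<^sup>2"
  proof -
    have "- H (tt s) * (?w \<bullet> (H.gm' (tt s) *v ?w) / 2) \<le> S (tt s) * (?w \<bullet> (gm (tt s) *v ?w))"
      using H.momentum_growth[OF t card] by (simp add: H_def S_def)
    also have "\<dots> \<le> S (tt s) * (E s)\<^sup>2"
      by (intro mult_left_mono frame_velocity_bound[OF c(1) s(1) c(2)] S_nonneg[OF t])
    finally show ?thesis by (simp add: mult.commute)
  qed
  ultimately show ?thesis by (auto simp: has_real_derivative_iff_has_vector_derivative)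
qed

subsection \<open>Bounds on a bounded parameter interval\<close>

text \<open>\<open>b'\<close> is a parameter beyond \<open>s\<close>; it makes derivatives within
  \<open>J0\<close> two-sided up to and including \<open>s\<close>.\<close>

lemma EH_decreasing:
  assumes exp: "expanding T gm" and card: "CARD('n) \<le> 9" and flat: "ricci_flat B g"
    and s: "a0 < s1" "s1 \<le> s" "s < b" "b' \<in> J0" "s < b'"
  shows "E s * H (tt s) \<le> E s1 * H (tt s1)"
proof (rule DERIV_nonpos_imp_nonincreasing[OF s(2)])
  fix r assume r: "s1 \<le> r" "r \<le> s"
  have rJ: "r \<in> J0" using J0_mem[of r b'] r s by simp
  have ar: "a0 < r" using r s by simp
  have at: "at r within J0 = at r" using J0_at[OF ar _ s(4)] r s by simp
  obtain E' where E': "(E has_real_derivative E') (at r)" "E' * H (tt r) \<le> S (tt r) * (E r)\<^sup>2"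
    using energy[OF exp card rJ ar] at by auto
  have "((\<lambda>r. H (tt r)) has_real_derivative - S (tt r) * E r) (at r)"
    by (rule DERIV_chain2[where f = H and g = tt, OF H_derivative[OF flat tt_gt[OF rJ ar]] tt_derivative[OF rJ, unfolded at]])
  from DERIV_mult[OF E'(1) this]
  have "((\<lambda>r. E r * H (tt r)) has_real_derivative E' * H (tt r) + - S (tt r) * E r * E r) (at r)" .
  moreover have "E' * H (tt r) + - S (tt r) * E r * E r \<le> 0"
    using E'(2) by (simp add: power2_eq_square mult.assoc)
  ultimately show "\<exists>y. ((\<lambda>r. E r * H (tt r)) has_real_derivative y) (at r) \<and> y \<le> 0" by blast
qed

end

context spacetime
begin

lemma inverse_H_growth:
  assumes exp: "expanding T gm" and flat: "ricci_flat B g"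
    and no_psc: "\<not> (\<exists>b. left_invariant_metric G A b \<and> positive_scalar_curvature A b)"
    and t: "T < t1" "t1 \<le> t"
  shows "1 / H t \<le> 1 / H t1 + (t - t1)"
proof -
  have "1 / H t - t \<le> 1 / H t1 - t1"
  proof (rule DERIV_nonpos_imp_nonincreasing[OF t(2)])
    fix r assume r: "t1 \<le> r" "r \<le> t"
    then have rT: "T < r" using t by simp
    have pos: "H r > 0" by (rule H_pos[OF exp rT])
    have "((\<lambda>r. 1 / H r - r) has_real_derivative (S r / (H r)\<^sup>2 - 1)) (at r)"
      using pos by (auto intro!: derivative_eq_intros H_derivative[OF flat rT] simp: power2_eq_square)
    moreover have "S r / (H r)\<^sup>2 - 1 \<le> 0"
      using S_le[OF flat no_psc rT] pos by (simp add: divide_le_eq)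
    ultimately show "\<exists>y. ((\<lambda>r. 1 / H r - r) has_real_derivative y) (at r) \<and> y \<le> 0" by blast
  qed
  then show ?thesis by simp
qed

end

context lifted_geodesic
begin

text \<open>The affine majorant \<open>D\<close> of 1/H has derivative \<open>E\<close> along the
  geodesic, and \<open>E \<le> C0 * D\<close> by monotonicity of \<open>E H\<close>. So
  \<open>ln D\<close> grows at most linearly, a form of Gronwall's inequality.\<close>

lemma bounded_parameter:
  assumes exp: "expanding T gm" and card: "CARD('n) \<le> 9" and flat: "ricci_flat B g"
    and no_psc: "\<not> (\<exists>b. left_invariant_metric G A b \<and> positive_scalar_curvature A b)"
    and Jb: "J0 = {a0..<b}" and s1: "a0 < s1" "s1 < b"
  obtains Em tm where "\<And>s. s \<in> {s1..<b} \<Longrightarrow> E s \<le> Em" "\<And>s. s \<in> {s1..<b} \<Longrightarrow> tt s \<le> tm"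
proof -
  have mem: "s \<in> J0" "a0 < s" "T < tt s" if "s \<in> {s1..<b}" for s using that s1 tt_gt[of s] by (auto simp: Jb)
  have s1m: "s1 \<in> {s1..<b}" using s1 by simp
  define C0 where "C0 = E s1 * H (tt s1)"
  have C0: "C0 > 0" unfolding C0_def by (intro mult_pos_pos E_pos mem(1)[OF s1m] H_pos[OF exp] mem(3)[OF s1m])
  define D where "D s = 1 / H (tt s1) + (tt s - tt s1)" for s
  have tmono: "tt s1 \<le> tt s" if "s \<in> {s1..<b}" for s
    using tt_strict[OF mem(1)[OF s1m] mem(1)[OF that]] that by (cases "s = s1") auto
  have Hs1: "1 / H (tt s1) > 0" using H_pos[OF exp mem(3)[OF s1m]] by simp
  have Dpos: "D s > 0" if "s \<in> {s1..<b}" for s using tmono[OF that] Hs1 by (simp add: D_def add_pos_nonneg)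
  have ED: "E s \<le> C0 * D s" if s: "s \<in> {s1..<b}" for s
  proof -
    obtain b' where b': "s < b'" "b' < b" using s dense by auto
    have "E s * H (tt s) \<le> C0"
      unfolding C0_def by (rule EH_decreasing[OF exp card flat s1(1), of s b b']) (use s b' s1 in \<open>auto simp: Jb\<close>)
    then have "E s \<le> C0 * (1 / H (tt s))"
      using H_pos[OF exp mem(3)[OF s]] by (simp add: pos_le_divide_eq)
    also have "\<dots> \<le> C0 * D s"
      unfolding D_def using C0 inverse_H_growth[OF exp flat no_psc mem(3)[OF s1m] tmono[OF s]] by (intro mult_left_mono) auto
    finally show ?thesis .
  qed
  define Lm where "Lm = ln (D s1) + C0 * (b - s1)"
  have "D s \<le> exp Lm" if s: "s \<in> {s1..<b}" for s
  proof -
    have "ln (D s) - C0 * s \<le> ln (D s1) - C0 * s1"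
    proof (rule DERIV_nonpos_imp_nonincreasing[of s1 s])
      fix r assume r: "s1 \<le> r" "r \<le> s"
      then have rm: "r \<in> {s1..<b}" using s by simp
      obtain b' where b': "r < b'" "b' < b" using rm dense by auto
      have "at r within J0 = at r" by (rule J0_at[of r b']) (use rm b' s1 in \<open>auto simp: Jb\<close>)
      then have t': "(tt has_real_derivative E r) (at r)" using tt_derivative[OF mem(1)[OF rm]] by simp
      have "((\<lambda>r. ln (D r) - C0 * r) has_real_derivative (E r / D r - C0)) (at r)"
        using Dpos[OF rm] unfolding D_def by (auto intro!: derivative_eq_intros t')
      moreover have "E r / D r - C0 \<le> 0" using ED[OF rm] Dpos[OF rm] by (simp add: pos_divide_le_eq)
      ultimately show "\<exists>y. ((\<lambda>r. ln (D r) - C0 * r) has_real_derivative y) (at r) \<and> y \<le> 0" by blast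
    qed (use s in simp)
    then have "ln (D s) \<le> ln (D s1) + C0 * (s - s1)" by (simp add: algebra_simps)
    also have "\<dots> \<le> Lm" unfolding Lm_def using s C0 by (intro add_left_mono mult_left_mono) auto
    finally show ?thesis using Dpos[OF s] by (metis exp_le_cancel_iff exp_ln)
  qed
  note Dm = this
  show ?thesis
  proof (rule that[of "C0 * exp Lm" "tt s1 + exp Lm"])
    fix s assume s: "s \<in> {s1..<b}"
    show "E s \<le> C0 * exp Lm" using ED[OF s] mult_left_mono[OF Dm[OF s], of C0] C0 by linarith
    show "tt s \<le> tt s1 + exp Lm" using Dm[OF s] Hs1 unfolding D_def by linarith
  qed
qed

lemma at_open_end: "J0 = {a0..<b} \<Longrightarrow> a0 < s \<Longrightarrow> s < b \<Longrightarrow> at s within J0 = at s"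
proof -
  assume *: "J0 = {a0..<b}" "a0 < s" "s < b"
  obtain b' where "s < b'" "b' < b" using *(3) dense by auto
  then show ?thesis using J0_at[of s b'] * by auto
qed

text \<open>Times between \<open>tt s1\<close> and \<open>tm\<close> form a compact set, on which
  \<open>gm\<close> is uniformly positive definite; together with causality this turns the bound on
  \<open>E\<close> into one on the frame components.\<close>

lemma frame_bound:
  assumes Em: "\<And>s. s \<in> {s1..<b} \<Longrightarrow> E s \<le> Em" and tm: "\<And>s. s \<in> {s1..<b} \<Longrightarrow> tt s \<le> tm"
    and Jb: "J0 = {a0..<b}" and s1: "a0 < s1" "s1 < b"
  obtains Mw where "\<And>s c. s \<in> {s1..<b} \<Longrightarrow> c \<in> A \<Longrightarrow> xx s \<in> fst c \<Longrightarrow> norm (TH c (xx s) (snd (V c s))) \<le> Mw"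
proof -
  have mem: "s \<in> J0" "a0 < s" "T < tt s" if "s \<in> {s1..<b}" for s using that s1 tt_gt[of s] by (auto simp: Jb)
  have s1m: "s1 \<in> {s1..<b}" using s1 by simp
  have tmono: "tt s1 \<le> tt s" if "s \<in> {s1..<b}" for s
    using tt_strict[OF mem(1)[OF s1m] mem(1)[OF that]] that by (cases "s = s1") auto
  obtain c0 where c0: "c0 \<in> A" "\<one>\<^bsub>G\<^esub> \<in> fst c0" by (rule chart_exists)
  interpret H: homogeneous_metric T "NN c0" "th c0" gm by (rule hom[OF c0(1)])
  have gt: "T < t" if "t \<in> {tt s1..tm}" for t using that mem(3)[OF s1m] by auto
  obtain q where q: "q > 0" "\<And>t w. t \<in> {tt s1..tm} \<Longrightarrow> q * (norm w)\<^sup>2 \<le> w \<bullet> (gm t *v w)"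
  proof (rule quadratic_form_bound_below[of "{tt s1..tm}" "\<lambda>t u v. u \<bullet> (gm t *v v)"])
    show "continuous_on {tt s1..tm} (\<lambda>t. u \<bullet> (gm t *v v))" for u v
      by (rule continuous_on_subset[OF smooth_on_imp_continuous_on[OF H.gm_entry_smooth]]) (use gt in auto)
    fix t assume "t \<in> {tt s1..tm}"
    then interpret F: inner_product "\<lambda>u v. u \<bullet> (gm t *v v)" using H.gm_form gt by blast
    show "bilinear (\<lambda>u v. u \<bullet> (gm t *v v))" by (rule F.bil)
    show "0 < w \<bullet> (gm t *v w)" if "w \<noteq> 0" for w by (rule F.pos[OF that])
  qed auto
  show ?thesis
  proof (rule that[of "sqrt (Em\<^sup>2 / q)"])
    fix s c assume s: "s \<in> {s1..<b}" and c: "c \<in> A" "xx s \<in> fst c"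
    let ?w = "TH c (xx s) (snd (V c s))"
    have "q * (norm ?w)\<^sup>2 \<le> (E s)\<^sup>2"
      using q(2)[of "tt s" ?w] tmono[OF s] tm[OF s] frame_velocity_bound[OF c(1) mem(1)[OF s] c(2)] by simp
    also have "\<dots> \<le> Em\<^sup>2" using Em[OF s] E_pos[OF mem(1)[OF s]] by (intro power_mono) auto
    finally have "(norm ?w)\<^sup>2 \<le> Em\<^sup>2 / q" using q(1) by (simp add: field_simps)
    then show "norm ?w \<le> sqrt (Em\<^sup>2 / q)" by (rule real_le_rsqrt)
  qed
qed

lemma lift_converges:
  assumes Em: "\<And>s. s \<in> {s1..<b} \<Longrightarrow> E s \<le> Em"
    and Mw: "\<And>s c. s \<in> {s1..<b} \<Longrightarrow> c \<in> A \<Longrightarrow> xx s \<in> fst c \<Longrightarrow> norm (TH c (xx s) (snd (V c s))) \<le> Mw"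
    and Jb: "J0 = {a0..<b}" and s1: "a0 < s1" "s1 < b"
  obtains tb xb where "tb > T" "(tt \<longlongrightarrow> tb) (at b within {s1..<b})" "xb \<in> carrier G" "(xx \<longlongrightarrow> xb) (at b within {s1..<b})"
proof -
  have mem: "s \<in> J0" "a0 < s" "T < tt s" if "s \<in> {s1..<b}" for s using that s1 tt_gt[of s] by (auto simp: Jb)
  have nontriv: "at b within {s1..<b} \<noteq> bot" using s1 by (simp add: at_within_eq_bot_iff)
  have "(tt has_vector_derivative E s) (at s within {s1..<b})" if "s \<in> {s1..<b}" for s
    by (rule has_vector_derivative_within_subset[OF tt_derivative[OF mem(1)[OF that],
          unfolded has_real_derivative_iff_has_vector_derivative]]) (use s1 in \<open>auto simp: Jb\<close>)
  then obtain tb where tb: "(tt \<longlongrightarrow> tb) (at b within {s1..<b})"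
  proof (rule bounded_derivative_limit[OF s1(2)])
    show "norm (E s) \<le> Em" if "s \<in> {s1..<b}" for s using Em[OF that] E_pos[OF mem(1)[OF that]] by simp
  qed auto
  have s1m: "s1 \<in> {s1..<b}" using s1 by simp
  have "tt s1 \<le> tt s" if "s \<in> {s1..<b}" for s
    using tt_strict[OF mem(1)[OF s1m] mem(1)[OF that]] that by (cases "s = s1") auto
  then have "\<forall>\<^sub>F s in at b within {s1..<b}. tt s1 \<le> tt s" by (auto simp: eventually_at_filter)
  then have "tt s1 \<le> tb" by (rule tendsto_lowerbound[OF tb _ nontriv])
  then have tbT: "tb > T" using mem(3)[OF s1m] by linarith
  obtain xb where xb: "xb \<in> carrier G" "(xx \<longlongrightarrow> xb) (at b within {s1<..<b})"
  proof (rule bounded_velocity_limit[OF s1(2), of xx Mw])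
    show "continuous_on {s1<..<b} xx" by (rule continuous_on_subset[OF xx_cont]) (use s1 in \<open>auto simp: Jb\<close>)
    show "xx ` {s1<..<b} \<subseteq> carrier G" using xx_carrier mem(1) by auto
    fix s c assume s: "s \<in> {s1<..<b}" and c: "c \<in> A" "xx s \<in> fst c"
    then have sm: "s \<in> {s1..<b}" by simp
    have "((\<lambda>r. snd (Y c r)) has_vector_derivative snd (V c s)) (at s)"
      using bounded_linear.has_vector_derivative[OF bounded_linear_snd first_order(1)[OF c(1) mem(1)[OF sm] c(2)]]
        at_open_end[OF Jb mem(2)[OF sm]] sm by simp
    then show "\<exists>w. ((\<lambda>r. snd c (xx r)) has_vector_derivative w) (at s) \<and> norm (TH c (xx s) w) \<le> Mw"
      using Mw[OF sm c] by (auto simp: Y_def)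
  qed auto
  moreover have "at b within {s1..<b} = at b within {s1<..<b}"
    by (rule at_within_nhd[of b "{s1<..}"]) (use s1 in auto)
  ultimately show ?thesis using that tbT tb by simp
qed

text \<open>If the end point is not attained, bounded velocities and the geodesic equation make position and
  velocity converge, so that the geodesic extends to the closed interval.\<close>

lemma open_end:
  assumes exp: "expanding T gm" and card: "CARD('n) \<le> 9" and flat: "ricci_flat B g"
    and no_psc: "\<not> (\<exists>b. left_invariant_metric G A b \<and> positive_scalar_curvature A b)"
    and Jb: "J0 = {a0..<b}" and ab: "a0 < b"
  obtains c a Z U where "c \<in> A" "a0 \<le> a" "a < b" "\<And>r. r \<in> {a<..b} \<Longrightarrow> Z r \<in> {T<..} \<times> NN c"
    "\<And>r. r \<in> {a<..b} \<Longrightarrow> (Z has_vector_derivative U r) (at r within {a<..b})"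
    "\<And>r. r \<in> {a<..b} \<Longrightarrow> (U has_vector_derivative - christoffel UNIV (gpc c) (Z r) (U r) (U r)) (at r within {a<..b})"
    "\<And>r. r \<in> {a<..<b} \<Longrightarrow> \<pi> (pt c (Z r)) = \<gamma> r"
proof -
  \<comment> \<open>Starting strictly after \<open>a0\<close> keeps the time coordinate above
    \<open>tt s1 > T\<close>, at a distance from the boundary.\<close>
  define s1 where "s1 = (a0 + b) / 2"
  have s1: "a0 < s1" "s1 < b" using ab by (auto simp: s1_def)
  obtain Em tm where Em: "\<And>s. s \<in> {s1..<b} \<Longrightarrow> E s \<le> Em" and tm: "\<And>s. s \<in> {s1..<b} \<Longrightarrow> tt s \<le> tm"
    using bounded_parameter[OF exp card flat no_psc Jb s1] by blast
  obtain Mw where Mw: "\<And>s c. s \<in> {s1..<b} \<Longrightarrow> c \<in> A \<Longrightarrow> xx s \<in> fst c \<Longrightarrow> norm (TH c (xx s) (snd (V c s))) \<le> Mw"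
    using frame_bound[OF Em tm Jb s1] by blast
  obtain tb xb where tb: "tb > T" "(tt \<longlongrightarrow> tb) (at b within {s1..<b})"
    and xb: "xb \<in> carrier G" "(xx \<longlongrightarrow> xb) (at b within {s1..<b})"
    using lift_converges[OF Em Mw Jb s1] by blast
  have mem: "s \<in> J0" "a0 < s" "T < tt s" if "s \<in> {s1..<b}" for s using that s1 tt_gt[of s] by (auto simp: Jb)
  obtain c where c: "c \<in> A" "xb \<in> fst c" using manifold_chart_at[OF mfd xb(1)] by blast
  note ch = manifold_chart[OF mfd c(1)]
  interpret H: homogeneous_metric T "NN c" "th c" gm by (rule hom[OF c(1)])
  define yb where "yb = snd c xb"
  have ybN: "yb \<in> NN c" using c(2) by (simp add: yb_def)
  obtain \<rho> where \<rho>: "\<rho> > 0" "cball yb \<rho> \<subseteq> NN c" using open_contains_cball N_open[OF c(1)] ybN by blast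
  have ev: "\<forall>\<^sub>F r in at b within {s1..<b}. r \<in> {s1..<b}" by (simp add: eventually_at_filter)
  have evG: "\<forall>\<^sub>F r in at b within {s1..<b}. xx r \<in> carrier G"
    using ev by eventually_elim (use mem(1) xx_carrier in blast)
  have evc: "\<forall>\<^sub>F r in at b within {s1..<b}. xx r \<in> fst c"
    by (rule eventually_in_chart[OF mfd c(1) xb(2) evG c(2)])
  have ylim: "((\<lambda>r. snd c (xx r)) \<longlongrightarrow> yb) (at b within {s1..<b})"
    unfolding yb_def by (rule continuous_on_tendsto_compose[OF ch(4) xb(2) c(2) evc])
  have "\<forall>\<^sub>F r in at b within {s1..<b}. dist (snd c (xx r)) yb < \<rho>" by (rule tendstoD[OF ylim \<rho>(1)])
  with evc have "\<forall>\<^sub>F r in at b within {s1..<b}. xx r \<in> fst c \<and> snd c (xx r) \<in> cball yb \<rho>"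
    by eventually_elim (simp add: dist_commute)
  then obtain e where e: "e > 0" "\<And>r. r \<in> {s1..<b} \<Longrightarrow> dist r b < e \<Longrightarrow> xx r \<in> fst c \<and> snd c (xx r) \<in> cball yb \<rho>"
    unfolding eventually_at by (metis atLeastLessThan_iff less_irrefl)
  \<comment> \<open>From here on the curve stays in a compact ball of one chart around the limit, so
    that the bounds on the coframe and on the Christoffel symbols are uniform.\<close>
  define a where "a = max s1 (b - e / 2)"
  have a: "s1 \<le> a" "a < b" "a0 < a" using s1 e(1) by (auto simp: a_def)
  have am: "r \<in> {s1..<b}" "xx r \<in> fst c" "snd c (xx r) \<in> cball yb \<rho>" if "r \<in> {a..<b}" for r
  proof -
    show r: "r \<in> {s1..<b}" using that a by auto
    have "dist r b < e" using that e(1) by (auto simp: a_def dist_real_def)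
    from e(2)[OF r this] show "xx r \<in> fst c" "snd c (xx r) \<in> cball yb \<rho>" by auto
  qed
  have atb: "at b within {s1..<b} = at b within {a..<b}"
    by (rule at_within_nhd[of b "{a<..}"]) (use a in auto)
  have Ylim: "(Y c \<longlongrightarrow> (tb, yb)) (at b within {a..<b})"
    unfolding Y_def using tb(2) ylim by (intro tendsto_Pair) (simp_all add: atb)
  obtain C where C: "C > 0" "\<And>y w. y \<in> cball yb \<rho> \<Longrightarrow> norm w \<le> C * norm (th c y w)"
  proof (rule linear_field_bound_below[of "cball yb \<rho>" "th c"])
    show "continuous_on (cball yb \<rho>) (\<lambda>y. th c y w)" for w
      by (rule continuous_on_subset[OF smooth_on_imp_continuous_on[OF H.th_smooth] \<rho>(2)])
  qed (use \<rho>(2) H.th_linear H.th_inj in auto)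
  have Vb: "norm (V c r) \<le> Em + C * Mw" if r: "r \<in> {a..<b}" for r
  proof -
    have "norm (snd (V c r)) \<le> C * norm (th c (snd c (xx r)) (snd (V c r)))" by (rule C(2)[OF am(3)[OF r]])
    also have "th c (snd c (xx r)) = TH c (xx r)" using ch(6)[OF am(2)[OF r]] by (simp add: th_def[abs_def])
    also have "C * norm (TH c (xx r) (snd (V c r))) \<le> C * Mw"
      using C(1) Mw[OF am(1)[OF r] c(1) am(2)[OF r]] by (intro mult_left_mono) auto
    finally have "norm (snd (V c r)) \<le> C * Mw" .
    moreover have "norm (fst (V c r)) \<le> Em"
      using first_order(2)[OF c(1) mem(1)[OF am(1)[OF r]] am(2)[OF r]] Em[OF am(1)[OF r]] E_pos[OF mem(1)[OF am(1)[OF r]]]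
      by simp
    ultimately show ?thesis using norm_Pair_le[of "fst (V c r)" "snd (V c r)"] by simp
  qed
  let ?Gam = "christoffel UNIV (gpc c)"
  have s1m: "s1 \<in> {s1..<b}" using s1 by simp
  have tmono: "tt s1 \<le> tt s" if "s \<in> {s1..<b}" for s
    using tt_strict[OF mem(1)[OF s1m] mem(1)[OF that]] that by (cases "s = s1") auto
  let ?K = "{tt s1..tm} \<times> cball yb \<rho>"
  have Ksub: "?K \<subseteq> {T<..} \<times> NN c" using mem(3)[OF s1m] \<rho>(2) by auto
  have YK: "Y c r \<in> ?K" if "r \<in> {a..<b}" for r
    using am[OF that] tmono[OF am(1)[OF that]] tm[OF am(1)[OF that]] by (simp add: Y_def)
  obtain CG where CG: "CG \<ge> 0" "\<And>x u v. x \<in> ?K \<Longrightarrow> norm (?Gam x u v) \<le> CG * norm u * norm v"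
  proof (rule bilinear_field_bound[of ?K ?Gam])
    show "compact ?K" by (intro compact_Times) auto
    show "bilinear (?Gam x)" if "x \<in> ?K" for x by (rule H.prod.christoffel_bilinear) (use that Ksub in blast)
    show "continuous_on ?K (\<lambda>x. ?Gam x u v)" for u v
      by (rule continuous_on_subset[OF smooth_on_imp_continuous_on[OF H.prod.christoffel_smooth] Ksub])
  qed auto
  have sub: "{a..<b} \<subseteq> J0" using am(1) mem(1) by blast
  have Yd: "(Y c has_vector_derivative V c r) (at r within {a..<b})" if "r \<in> {a..<b}" for r
    by (rule has_vector_derivative_within_subset[OF first_order(1)[OF c(1) mem(1)[OF am(1)[OF that]] am(2)[OF that]] sub])
  have Vd: "(V c has_vector_derivative - ?Gam (Y c r) (V c r) (V c r)) (at r within {a..<b})" if "r \<in> {a..<b}" for r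
    by (rule has_vector_derivative_within_subset[OF second_order[OF c(1) mem(1,2)[OF am(1)[OF that]] am(2)[OF that]] sub])
  \<comment> \<open>Position and velocity range over bounded sets, so the geodesic equation bounds
    the acceleration and the velocity has a limit.\<close>
  obtain vb where vb: "(V c \<longlongrightarrow> vb) (at b within {a..<b})"
  proof (rule bounded_derivative_limit[OF a(2) Vd])
    show "norm (- ?Gam (Y c r) (V c r) (V c r)) \<le> CG * (Em + C * Mw) * (Em + C * Mw)" if r: "r \<in> {a..<b}" for r
    proof -
      have "norm (?Gam (Y c r) (V c r) (V c r)) \<le> CG * norm (V c r) * norm (V c r)" by (rule CG(2)[OF YK[OF r]])
      also have "\<dots> \<le> CG * (Em + C * Mw) * (Em + C * Mw)"
        using CG(1) Vb[OF r] order_trans[OF norm_ge_zero Vb[OF r]] by (intro mult_mono mult_left_mono mult_nonneg_nonneg) auto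
      finally show ?thesis by simp
    qed
  qed auto
  define Z where "Z r = (if r < b then Y c r else (tb, yb))" for r
  define U where "U r = (if r < b then V c r else vb)" for r
  have evab: "\<forall>\<^sub>F r in at b within {a..<b}. r < b" by (simp add: eventually_at_filter)
  have Zlim: "(Z \<longlongrightarrow> Z b) (at b within {a..<b})" and Ulim: "(U \<longlongrightarrow> U b) (at b within {a..<b})"
  proof -
    have "\<forall>\<^sub>F r in at b within {a..<b}. Y c r = Z r" "\<forall>\<^sub>F r in at b within {a..<b}. V c r = U r"
      using evab by (eventually_elim, simp add: Z_def U_def)+
    from Lim_transform_eventually[OF Ylim this(1)] Lim_transform_eventually[OF vb this(2)]
    show "(Z \<longlongrightarrow> Z b) (at b within {a..<b})" "(U \<longlongrightarrow> U b) (at b within {a..<b})"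
      unfolding Z_def[of b] U_def[of b] by simp_all
  qed
  have Zd: "(Z has_vector_derivative U r) (at r within {a..<b})"
    and Ud: "(U has_vector_derivative - ?Gam (Z r) (U r) (U r)) (at r within {a..<b})" if r: "r \<in> {a..<b}" for r
    using has_vector_derivative_transform[OF r _ Yd[OF r], of Z] has_vector_derivative_transform[OF r _ Vd[OF r], of U] r
    by (auto simp: Z_def U_def)
  have Zb: "Z b \<in> {T<..} \<times> NN c" using tb(1) ybN by (simp add: Z_def)
  have Zin: "Z r \<in> {T<..} \<times> NN c" if "r \<in> {a..b}" for r
  proof (cases "r < b")
    case True
    then show ?thesis using YK[of r] that Ksub unfolding Z_def by auto
  next
    case False
    then show ?thesis using Zb that by auto
  qed
  have Glim: "((\<lambda>r. - ?Gam (Z r) (U r) (U r)) \<longlongrightarrow> - ?Gam (Z b) (U b) (U b)) (at b within {a..<b})"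
  proof (rule tendsto_minus)
    have "\<forall>\<^sub>F r in at b within {a..<b}. r \<in> {a..<b}" by (simp add: eventually_at_filter)
    then have "\<forall>\<^sub>F r in at b within {a..<b}. (Z r, U r) \<in> ({T<..} \<times> NN c) \<times> UNIV"
      by eventually_elim (use Zin in auto)
    then have "((\<lambda>r. (\<lambda>z. ?Gam (fst z) (snd z) (snd z)) (Z r, U r)) \<longlongrightarrow> (\<lambda>z. ?Gam (fst z) (snd z) (snd z)) (Z b, U b)) (at b within {a..<b})"
      using Zb by (intro continuous_on_tendsto_compose[OF smooth_on_imp_continuous_on[OF H.prod.spray_smooth] tendsto_Pair[OF Zlim Ulim]]) auto
    then show "((\<lambda>r. ?Gam (Z r) (U r) (U r)) \<longlongrightarrow> ?Gam (Z b) (U b) (U b)) (at b within {a..<b})" by simp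
  qed
  \<comment> \<open>Limits of the derivatives are one-sided derivatives at \<open>b\<close>, so the
    geodesic equation persists at the added point.\<close>
  have Zd_b: "(Z has_vector_derivative U b) (at b within {a..b})"
    by (rule has_vector_derivative_limit_right_end[OF a(2) Zd Ulim Zlim])
  have Ud_b: "(U has_vector_derivative - ?Gam (Z b) (U b) (U b)) (at b within {a..b})"
    by (rule has_vector_derivative_limit_right_end[OF a(2) Ud Glim Ulim])
  have all: "(f has_vector_derivative f' r) (at r within {a<..b})"
    if r: "r \<in> {a<..b}" and f: "\<And>r. r \<in> {a..<b} \<Longrightarrow> (f has_vector_derivative f' r) (at r within {a..<b})"
      and fb: "(f has_vector_derivative f' b) (at b within {a..b})" for f f' :: "real \<Rightarrow> real \<times> (real^'n)" and r
  proof (cases "r < b")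
    case True
    have "(f has_vector_derivative f' r) (at r within {a..<b})" by (rule f) (use r True in auto)
    moreover have "at r within {a..<b} = at r within {a<..b}"
      by (rule at_within_nhd[of r "{a<..<b}"]) (use r True in auto)
    ultimately show ?thesis by simp
  next
    case False
    then have "r = b" using r by simp
    moreover have "{a<..b} \<subseteq> {a..b}" by auto
    ultimately show ?thesis using has_vector_derivative_within_subset[OF fb] by blast
  qed
  show ?thesis
  proof (rule that[of c a Z U])
    show "c \<in> A" "a0 \<le> a" "a < b" using c a by auto
    fix r assume r: "r \<in> {a<..b}"
    show "Z r \<in> {T<..} \<times> NN c" using Zin[of r] r by simp
    show "(Z has_vector_derivative U r) (at r within {a<..b})" by (rule all[OF r Zd Zd_b])
    show "(U has_vector_derivative - ?Gam (Z r) (U r) (U r)) (at r within {a<..b})"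
      using all[OF r Ud Ud_b] .
  next
    fix r assume r: "r \<in> {a<..<b}"
    then have "r \<in> {a..<b}" by simp
    then show "\<pi> (pt c (Z r)) = \<gamma> r"
      using Y_in[OF c(1) mem(1)[OF am(1)] am(2)] lift[OF mem(1)[OF am(1)]] r by (simp add: Z_def)
  qed
qed

text \<open>When the last parameter is attained, no estimate is involved: local existence restarts
  the geodesic from its last position and velocity. As \<open>b\<close> lies after
  \<open>a0\<close>, this position has \<open>t > T\<close> and is interior.\<close>

lemma closed_end:
  assumes Jb: "J0 = {a0..b}" and ab: "a0 < b"
  obtains c a e Z U where "c \<in> A" "a0 \<le> a" "a < b" "e > 0" "\<And>r. r \<in> {a<..b + e} \<Longrightarrow> Z r \<in> {T<..} \<times> NN c"
    "\<And>r. r \<in> {a<..b + e} \<Longrightarrow> (Z has_vector_derivative U r) (at r within {a<..b + e})"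
    "\<And>r. r \<in> {a<..b + e} \<Longrightarrow> (U has_vector_derivative - christoffel UNIV (gpc c) (Z r) (U r) (U r)) (at r within {a<..b + e})"
    "\<And>r. r \<in> {a<..b} \<Longrightarrow> \<pi> (pt c (Z r)) = \<gamma> r"
proof -
  have bJ: "b \<in> J0" using ab by (simp add: Jb)
  obtain c where c: "c \<in> A" "xx b \<in> fst c" using chart_at[OF bJ] by blast
  interpret H: homogeneous_metric T "NN c" "th c" gm by (rule hom[OF c(1)])
  let ?Gam = "christoffel UNIV (gpc c)"
  obtain W where W: "open W" "{r \<in> J0. xx r \<in> fst c} = J0 \<inter> W" using chart_neighbourhood[OF c(1)] by blast
  have "b \<in> W" using W(2) bJ c by blast
  then obtain \<delta> where \<delta>: "\<delta> > 0" "ball b \<delta> \<subseteq> W" using W(1) open_contains_ball by blast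
  define a where "a = max a0 (b - \<delta>)"
  have a: "a0 \<le> a" "a < b" using ab \<delta>(1) by (auto simp: a_def)
  have am: "r \<in> J0" "a0 < r" "xx r \<in> fst c" if "r \<in> {a<..b}" for r
  proof -
    show r: "r \<in> J0" "a0 < r" using that a by (auto simp: Jb)
    have "r \<in> ball b \<delta>" using that \<delta>(1) by (auto simp: a_def dist_real_def)
    then show "xx r \<in> fst c" using \<delta>(2) W(2) r by blast
  qed
  have bm: "b \<in> {a<..b}" using a by simp
  obtain e Ys Vs where e: "e > 0" and Ys: "Ys b = Y c b" "Vs b = V c b" "\<And>s. s \<in> {b..b + e} \<Longrightarrow> Ys s \<in> {T<..} \<times> NN c"
    "\<And>s. s \<in> {b..b + e} \<Longrightarrow> (Ys has_vector_derivative Vs s) (at s within {b..b + e})"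
    "\<And>s. s \<in> {b..b + e} \<Longrightarrow> (Vs has_vector_derivative - ?Gam (Ys s) (Vs s) (Vs s)) (at s within {b..b + e})"
    using H.prod.geodesic_exists[OF Y_interior[OF c(1) am[OF bm]], of b "V c b"] by blast
  define Z where "Z r = (if r \<le> b then Y c r else Ys r)" for r
  define U where "U r = (if r \<le> b then V c r else Vs r)" for r
  have ZY: "Z r = Y c r" "U r = V c r" if "r \<le> b" for r using that by (auto simp: Z_def U_def)
  have ZYs: "Z r = Ys r" "U r = Vs r" if "b \<le> r" for r using that Ys(1,2) by (auto simp: Z_def U_def)
  have sub: "{a<..b} \<subseteq> J0" using am(1) by blast
  have left: "(Z has_vector_derivative U r) (at r within {a<..b})"
    "(U has_vector_derivative - ?Gam (Z r) (U r) (U r)) (at r within {a<..b})" if r: "r \<in> {a<..b}" for r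
  proof -
    have rb: "r \<le> b" using r by simp
    show "(Z has_vector_derivative U r) (at r within {a<..b})"
      unfolding ZY(2)[OF rb]
      by (rule has_vector_derivative_transform[OF r _ has_vector_derivative_within_subset[OF first_order(1)[OF c(1) am(1,3)[OF r]] sub]])
        (simp add: ZY)
    show "(U has_vector_derivative - ?Gam (Z r) (U r) (U r)) (at r within {a<..b})"
      unfolding ZY(1)[OF rb] ZY(2)[OF rb]
      by (rule has_vector_derivative_transform[OF r _ has_vector_derivative_within_subset[OF second_order[OF c(1) am[OF r]] sub]])
        (simp add: ZY)
  qed
  have right: "(Z has_vector_derivative U r) (at r within {b..b + e})"
    "(U has_vector_derivative - ?Gam (Z r) (U r) (U r)) (at r within {b..b + e})" if r: "r \<in> {b..b + e}" for r
  proof -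
    have rb: "b \<le> r" using r by simp
    show "(Z has_vector_derivative U r) (at r within {b..b + e})"
      unfolding ZYs(2)[OF rb] by (rule has_vector_derivative_transform[OF r _ Ys(4)[OF r]]) (simp add: ZYs)
    show "(U has_vector_derivative - ?Gam (Z r) (U r) (U r)) (at r within {b..b + e})"
      unfolding ZYs(1)[OF rb] ZYs(2)[OF rb] by (rule has_vector_derivative_transform[OF r _ Ys(5)[OF r]]) (simp add: ZYs)
  qed
  have all: "(f has_vector_derivative f' r) (at r within {a<..b + e})"
    if r: "r \<in> {a<..b + e}" and l: "\<And>r. r \<in> {a<..b} \<Longrightarrow> (f has_vector_derivative f' r) (at r within {a<..b})"
      and rt: "\<And>r. r \<in> {b..b + e} \<Longrightarrow> (f has_vector_derivative f' r) (at r within {b..b + e})"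
    for f f' :: "real \<Rightarrow> real \<times> (real^'n)" and r
  proof -
    have un: "{a<..b + e} = {a<..b} \<union> {b..b + e}" using a e by auto
    consider "r < b" | "r = b" | "b < r" by linarith
    then show ?thesis
    proof cases
      case 1
      have "at r within {a<..b} = at r within {a<..b + e}"
        by (rule at_within_nhd[of r "{..<b}"]) (use 1 e in auto)
      then show ?thesis using l[of r] 1 r by simp
    next
      case 2
      show ?thesis unfolding un
        by (rule has_vector_derivative_Un[OF l rt]) (use 2 a e in auto)
    next
      case 3
      have "at r within {b..b + e} = at r within {a<..b + e}"
        by (rule at_within_nhd[of r "{b<..}"]) (use 3 a in auto)
      then show ?thesis using rt[of r] 3 r by simp
    qed
  qed
  show ?thesis
  proof (rule that[of c a e Z U])
    fix r assume r: "r \<in> {a<..b + e}"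
    show "Z r \<in> {T<..} \<times> NN c"
    proof (cases "r \<le> b")
      case True
      then have "r \<in> {a<..b}" using r by simp
      then show ?thesis using Y_interior[OF c(1) am] ZY(1)[OF True] by simp
    next
      case False
      then show ?thesis using Ys(3)[of r] ZYs(1)[of r] r by simp
    qed
    show "(Z has_vector_derivative U r) (at r within {a<..b + e})" by (rule all[OF r left(1) right(1)])
    show "(U has_vector_derivative - ?Gam (Z r) (U r) (U r)) (at r within {a<..b + e})"
      using all[OF r left(2) right(2)] .
  next
    fix r assume r: "r \<in> {a<..b}"
    then show "\<pi> (pt c (Z r)) = \<gamma> r"
      using Y_in[OF c(1) am(1,3)[OF r]] lift[OF am(1)[OF r]] ZY(1)[of r] by simp
  qed (use c a e in auto)
qed

lemma bounded_geodesic_extends: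
  assumes exp: "expanding T gm" and card: "CARD('n) \<le> 9" and flat: "ricci_flat B g"
    and no_psc: "\<not> (\<exists>b. left_invariant_metric G A b \<and> positive_scalar_curvature A b)"
    and bdd: "\<And>s. s \<in> J \<Longrightarrow> s \<le> r0"
  shows "\<exists>J' \<gamma>'. geodesic_on M B g J' \<gamma>' \<and> J \<subseteq> J' \<and> (\<forall>s\<in>J. \<gamma>' s = \<gamma> s) \<and> (\<exists>s'\<in>J'. \<forall>s\<in>J. s < s')"
proof -
  \<comment> \<open>If \<open>b\<close> belongs to \<open>J\<close>, the domain is prolonged beyond
    it by \<open>closed_end\<close>; otherwise \<open>b\<close> itself is added by
    \<open>open_end\<close>, which already contradicts inextendibility.\<close>
  define b where "b = Sup J"
  have bdd': "bdd_above J" using bdd by (auto simp: bdd_above_def)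
  have ub: "s \<le> b" if "s \<in> J" for s unfolding b_def by (rule cSup_upper[OF that bdd'])
  obtain s2 where s2: "s2 \<in> J" "a0 < s2" using later by blast
  have ab: "a0 < b" using s2 ub[OF s2(1)] by linarith
  have mem: "r \<in> J" if r: "a0 \<le> r" "r < b" for r
  proof -
    have "J \<noteq> {}" using a0 by auto
    then obtain s where "s \<in> J" "r < s" using less_cSup_iff[OF _ bdd', of r] r(2) unfolding b_def by blast
    then show ?thesis using J_interval a0 r(1) unfolding is_interval_1 by (meson less_imp_le)
  qed
  show ?thesis
  proof (cases "b \<in> J")
    case True
    have Jb: "J0 = {a0..b}" using mem ub True by (force simp: J0)
    obtain c a e Z U where *: "c \<in> A" "a0 \<le> a" "a < b" "e > 0" "\<And>r. r \<in> {a<..b + e} \<Longrightarrow> Z r \<in> {T<..} \<times> NN c"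
      "\<And>r. r \<in> {a<..b + e} \<Longrightarrow> (Z has_vector_derivative U r) (at r within {a<..b + e})"
      "\<And>r. r \<in> {a<..b + e} \<Longrightarrow> (U has_vector_derivative - christoffel UNIV (gpc c) (Z r) (U r) (U r)) (at r within {a<..b + e})"
      "\<And>r. r \<in> {a<..b} \<Longrightarrow> \<pi> (pt c (Z r)) = \<gamma> r"
      using closed_end[OF Jb ab] by blast
    let ?J' = "J \<union> {b..b + e}"
    have K: "?J' \<inter> {a<..} = {a<..b + e}"
    proof
      show "?J' \<inter> {a<..} \<subseteq> {a<..b + e}" using ub *(4) by force
      show "{a<..b + e} \<subseteq> ?J' \<inter> {a<..}"
      proof
        fix r assume r: "r \<in> {a<..b + e}"
        then show "r \<in> ?J' \<inter> {a<..}" using mem[of r] *(2) by (cases "r < b") auto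
      qed
    qed
    have iJ: "is_interval ?J'"
      using J_interval True *(4) unfolding is_interval_connected_1
      by (intro connected_Un) auto
    have "geodesic_on M B g ?J' (\<lambda>r. if r \<in> J then \<gamma> r else \<pi> (pt c (Z r)))"
      by (rule geodesic_extend[OF geo *(1) iJ _ *(3), where V = U]) (use *(5-8) K ub in auto)
    moreover have "\<forall>s\<in>J. s < b + e" using ub *(4) by force
    ultimately show ?thesis using *(4)
      by (intro exI[of _ ?J'] exI[of _ "\<lambda>r. if r \<in> J then \<gamma> r else \<pi> (pt c (Z r))"]) auto
  next
    case False
    have Jb: "J0 = {a0..<b}" using mem ub False by (force simp: J0 order.order_iff_strict)
    obtain c a Z U where *: "c \<in> A" "a0 \<le> a" "a < b" "\<And>r. r \<in> {a<..b} \<Longrightarrow> Z r \<in> {T<..} \<times> NN c"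
      "\<And>r. r \<in> {a<..b} \<Longrightarrow> (Z has_vector_derivative U r) (at r within {a<..b})"
      "\<And>r. r \<in> {a<..b} \<Longrightarrow> (U has_vector_derivative - christoffel UNIV (gpc c) (Z r) (U r) (U r)) (at r within {a<..b})"
      "\<And>r. r \<in> {a<..<b} \<Longrightarrow> \<pi> (pt c (Z r)) = \<gamma> r"
      using open_end[OF exp card flat no_psc Jb ab] by blast
    let ?J' = "insert b J"
    have lt: "s < b" if "s \<in> J" for s using ub[OF that] False that by (cases "s = b") auto
    have K: "?J' \<inter> {a<..} = {a<..b}"
    proof
      show "?J' \<inter> {a<..} \<subseteq> {a<..b}" using ub by auto
      show "{a<..b} \<subseteq> ?J' \<inter> {a<..}"
      proof
        fix r assume r: "r \<in> {a<..b}"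
        then show "r \<in> ?J' \<inter> {a<..}" using mem[of r] *(2) by (cases "r = b") auto
      qed
    qed
    have iJ: "is_interval ?J'"
      unfolding is_interval_1
    proof (intro ballI allI impI)
      fix p q x assume pq: "p \<in> ?J'" "q \<in> ?J'" "p \<le> x \<and> x \<le> q"
      show "x \<in> ?J'"
      proof (cases "x < b")
        case True
        show ?thesis
        proof (cases "a0 \<le> x")
          case True
          then show ?thesis using mem \<open>x < b\<close> by simp
        next
          case False
          then have "p \<in> J" using pq ab by auto
          then show ?thesis using J_interval a0 pq(3) False unfolding is_interval_1 by (meson insertI2 less_imp_le not_le)
        qed
      next
        case False
        then have "x = b" using pq ub by fastforce
        then show ?thesis by simp
      qed
    qed
    have "geodesic_on M B g ?J' (\<lambda>r. if r \<in> J then \<gamma> r else \<pi> (pt c (Z r)))"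
    proof (rule geodesic_extend[OF geo *(1) iJ _ *(3), where V = U, unfolded K])
      show "J \<inter> {..<b} = ?J' \<inter> {..<b}" by auto
      show "\<gamma> r = \<pi> (pt c (Z r))" if "r \<in> J \<inter> {a<..}" for r using *(7)[of r] that lt by simp
    qed (use *(4-6) in auto)
    then show ?thesis using lt
      by (intro exI[of _ ?J'] exI[of _ "\<lambda>r. if r \<in> J then \<gamma> r else \<pi> (pt c (Z r))"]) auto
  qed
qed

end

theorem theorem3:
  fixes G :: "'g::topological_space monoid"
    and A :: "('g, real^'n::finite) chart set"
    and \<theta> :: "'n \<Rightarrow> ('g, real^'n) one_form"
    and T t0 :: real
    and gm :: "real \<Rightarrow> real^'n^'n"
    and M :: "'m::topological_space set"
    and B :: "('m, real \<times> (real^'n)) chart set"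
    and g :: "('m, real \<times> (real^'n)) bilinear_field"
    and \<pi> :: "real \<times> 'g \<Rightarrow> 'm"
  assumes "CARD('n) + 1 < 10"
    and "locally_spatially_homogeneous G A \<theta> T gm M B g \<pi>"
    and "\<not> (\<exists>b. left_invariant_metric G A b \<and> positive_scalar_curvature A b)"
    and "ricci_flat B g"
    and "expanding T gm"
    and "T \<le> t0"
    and "(SUP t\<in>{t0..}. ereal (Min (kasner_exponents T gm t)))
         - (INF t\<in>{t0..}. ereal (Min (kasner_exponents T gm t)))
         \<le> ereal ((9 - real CARD('n)) / (4 * real CARD('n)))"
  shows "future_geodesically_complete M B g (future_directed T A g \<pi>)"
  unfolding future_geodesically_complete_def
proof (intro allI impI)
  interpret spacetime G A \<theta> T gm M B g \<pi> by unfold_locales (rule assms(2))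
  fix J :: "real set" and \<gamma> :: "real \<Rightarrow> 'm" and r :: real
  assume *: "future_inextendible_geodesic M B g J \<gamma> \<and>
    (\<forall>c\<in>B. \<forall>s\<in>J \<inter> \<gamma> -` fst c. velocity c \<gamma> J s \<noteq> 0 \<and> g c (\<gamma> s) (velocity c \<gamma> J s) (velocity c \<gamma> J s) \<le> 0 \<and>
       future_directed T A g \<pi> c (\<gamma> s) (velocity c \<gamma> J s))"
  then have geo: "geodesic_on M B g J \<gamma>" unfolding future_inextendible_geodesic_def by blast
  then have J: "is_interval J" "interior J \<noteq> {}" "continuous_on J \<gamma>" "\<gamma> ` J \<subseteq> M"
    unfolding geodesic_on_def by auto
  \<comment> \<open>An interior parameter guarantees that the domain continues after
    \<open>a0\<close>.\<close>
  obtain a0 where a0: "a0 \<in> interior J" using J(2) by blast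
  then have a0J: "a0 \<in> J" using interior_subset by blast
  obtain e where e: "e > 0" "ball a0 e \<subseteq> J" using a0 by (meson mem_interior)
  then have "a0 + e / 2 \<in> J" by (auto simp: subset_iff dist_real_def)
  with e(1) have later: "\<exists>s\<in>J. a0 < s" by (intro bexI[of _ "a0 + e / 2"]) auto
  obtain d where d: "d \<in> B" "\<gamma> a0 \<in> fst d" using manifold_chart_at[OF M_mfd] a0J J(4) by blast
  then have "future_directed T A g \<pi> d (\<gamma> a0) (velocity d \<gamma> J a0)" using * a0J by blast
  \<comment> \<open>The preimage \<open>z\<close> provided by future-directedness becomes the
    initial point of the lift, so the sign condition refers to the lifted curve.\<close>
  then obtain c z where c: "c \<in> A" and z: "z \<in> fst (pc c)" "\<pi> z = \<gamma> a0"
    and neg: "g d (\<gamma> a0) (velocity d \<gamma> J a0) (tangent_map (pc c) d \<pi> z (1, 0)) < 0"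
    unfolding future_directed_def Bex_def time_atlas_iff by blast
  have zc: "snd z \<in> fst c" "z \<in> {T..} \<times> carrier G"
    using z(1) in_carrier[OF c] by (auto simp: prod_chart_def)
  define J0 where "J0 = J \<inter> {a0..}"
  obtain \<sigma> where \<sigma>: "continuous_on J0 \<sigma>" "\<sigma> ` J0 \<subseteq> {T..} \<times> carrier G" "\<sigma> a0 = z" "\<And>s. s \<in> J0 \<Longrightarrow> \<pi> (\<sigma> s) = \<gamma> s"
  proof (rule covering_lift_interval[OF cover])
    show "is_interval J0" unfolding J0_def by (intro is_interval_Int J(1)) (simp add: is_interval_ci)
    show "continuous_on J0 \<gamma>" unfolding J0_def by (rule continuous_on_subset[OF J(3)]) auto
  qed (use a0J J(4) zc z in \<open>auto simp: J0_def\<close>)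
  interpret lifted_geodesic G A \<theta> T gm M B g \<pi> J0 a0 J \<gamma> \<sigma>
  proof
    show "\<exists>c\<in>A. \<exists>d\<in>B. snd (\<sigma> a0) \<in> fst c \<and> \<gamma> a0 \<in> fst d \<and>
      g d (\<gamma> a0) (velocity d \<gamma> J a0) (tangent_map (pc c) d \<pi> (\<sigma> a0) (1, 0)) < 0"
      using c d zc(1) neg \<sigma>(3) by blast
  qed (use * geo a0J later \<sigma> in \<open>auto simp: J0_def\<close>)
  show "\<exists>s\<in>J. r < s"
  proof (rule ccontr)
    assume "\<not> (\<exists>s\<in>J. r < s)"
    then have "s \<le> r" if "s \<in> J" for s using that by (meson not_le)
    from bounded_geodesic_extends[OF assms(5) _ assms(4,3) this]
    show False using * assms(1) unfolding future_inextendible_geodesic_def by auto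
  qed
qed

end
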